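(* Let $X$ be a smooth projective curve over $\mathbb{C}$ and let $\mathcal{L}$ be an ample line bundle on $X$. Then $(X,\mathcal{L})$ satisfies the Alexander-Hirschowitz property. That is, there exists an integer $d_0$, depending only on $X$ and $\mathcal{L}$, such that for all integers $d\ge d_0$ and all positive integers $k$, for a general collection of points $p_1,\ldots,p_k\in X$, the linear system of divisors in $|\mathcal{L}^{\otimes d}|$ singular at all of the points $p_1,\ldots,p_k$ has the expected dimension $$\max\bigl(0,\chi(X,\mathcal{L}^{\otimes d})-2k\bigr)-1.$$
   Context: The ground field is $\mathbb{C}$. For a smooth projective variety $X$ and a line bundle $\mathcal{L}$ on $X$, the pair $(X,\mathcal{L})$ satisfies the Alexander-Hirschowitz property (AH) if, for all sufficiently large $d$ (with the bound on $d$ independent of $k$) and all positive integers $k$, double points at a general collection $p_1,\ldots,p_k\in X$ impose independent (i.e. the expected number of) conditions on the linear system $|\mathcal{L}^{\otimes d}|$; equivalently, the linear system of divisors in $|\mathcal{L}^{\otimes d}|$ singular at all of the $p_i$ has dimension $\max(0,\chi(X,\mathcal{L}^{\otimes d})-k(\dim(X)+1))-1$. A divisor is singular at $p$ if a section defining it lies in $H^0(X,\mathcal{L}^{\otimes d}\otimes \mathfrak{m}_p^2)$, where $\mathfrak{m}_p$ is the ideal sheaf of $p$ (on a curve: the divisor contains $p$ with multiplicity at least $2$). The linear system in question is the projectivization of the vector space $H^0(X,\mathcal{L}^{\otimes d}(-2(p_1+\cdots+p_k)))$, so its dimension is the dimension of this vector space minus $1$ (the empty linear system has dimension $-1$). "A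 general collection" means $(p_1,\ldots,p_k)$ in a nonempty Zariski open subset of $X^k$, which may depend on $d$ and $k$. *)

theory Defs
  imports
    "HOL-Analysis.Analysis"
    "HOL-Library.Function_Algebras"
    "HOL-Library.Extended_Nat"
begin

section \<open>Complex vector spaces of functions\<close>

definition cscale :: "complex \<Rightarrow> ('a \<Rightarrow> complex) \<Rightarrow> 'a \<Rightarrow> complex" where
  "cscale c f = (\<lambda>x. c * f x)"

interpretation cfun: vector_space "cscale :: complex \<Rightarrow> ('a \<Rightarrow> complex) \<Rightarrow> 'a \<Rightarrow> complex"
  by unfold_locales (auto simp: cscale_def algebra_simps fun_eq_iff)

text \<open>
  Dimension of \<open>V / W\<close> for subspaces \<open>W \<subseteq> V\<close>: the least number of vectors whose classes span
  the quotient.  Only meaningful when the quotient is finite-dimensional, which holds in every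
  use below.
\<close>

definition quot_dim :: "('a \<Rightarrow> complex) set \<Rightarrow> ('a \<Rightarrow> complex) set \<Rightarrow> nat" where
  "quot_dim V W = (LEAST m. \<exists>B. B \<subseteq> V \<and> finite B \<and> card B = m \<and> cfun.span (W \<union> B) = V)"


section \<open>Projective space and its Zariski topology\<close>

text \<open>
  A vector of \<open>\<complex>\<^sup>n\<^sup>+\<^sup>1\<close> is a function \<open>nat \<Rightarrow> complex\<close> vanishing beyond \<open>n\<close>; a point of
  \<open>\<P>\<^sup>n\<close> is a line through the origin, represented as the set of all its vectors (0 included).
\<close>

type_synonym cvec = "nat \<Rightarrow> complex"
type_synonym ppoint = "cvec set"

definition line :: "cvec \<Rightarrow> ppoint" where
  "line v = range (\<lambda>c. cscale c v)"

definition proj_space :: "nat \<Rightarrow> ppoint set" where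
  "proj_space n = {line v | v. (\<forall>i>n. v i = 0) \<and> v \<noteq> 0}"

text \<open>
  Homogeneous polynomials in \<open>x\<^sub>0, \<dots>, x\<^sub>n\<close> of the given degree, as functions; over the
  infinite field \<open>\<complex>\<close> nothing is lost by this.
\<close>

inductive hom_poly :: "nat \<Rightarrow> nat \<Rightarrow> (cvec \<Rightarrow> complex) \<Rightarrow> bool" for n where
  const: "hom_poly n 0 (\<lambda>_. c)"
| var: "i \<le> n \<Longrightarrow> hom_poly n 1 (\<lambda>v. v i)"
| add: "hom_poly n d F \<Longrightarrow> hom_poly n d G \<Longrightarrow> hom_poly n d (\<lambda>v. F v + G v)"
| mult: "hom_poly n d F \<Longrightarrow> hom_poly n e G \<Longrightarrow> hom_poly n (d + e) (\<lambda>v. F v * G v)"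

definition zariski_open :: "nat \<Rightarrow> ppoint set \<Rightarrow> bool" where
  "zariski_open n U \<longleftrightarrow>
     (\<exists>S. (\<forall>F\<in>S. \<exists>d. hom_poly n d F) \<and> U = {p \<in> proj_space n. \<exists>F\<in>S. \<exists>v\<in>p. F v \<noteq> 0})"

definition zariski :: "nat \<Rightarrow> ppoint topology" where
  "zariski n = topology (zariski_open n)"

text \<open>
  The Zariski topology of \<open>(\<P>\<^sup>n)\<^sup>k\<close> is finer than the product topology: its closed sets are cut
  out by multihomogeneous polynomials in \<open>k\<close> groups of variables.  In
  \<open>multihom_poly k n d F\<close>, \<open>d j\<close> is the degree of \<open>F\<close> in the \<open>j\<close>-th group.
\<close>

inductive multihom_poly ::
    "nat \<Rightarrow> nat \<Rightarrow> (nat \<Rightarrow> nat) \<Rightarrow> ((nat \<Rightarrow> cvec) \<Rightarrow> complex) \<Rightarrow> bool" for k n where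
  const: "multihom_poly k n (\<lambda>_. 0) (\<lambda>_. c)"
| var: "j < k \<Longrightarrow> i \<le> n \<Longrightarrow> multihom_poly k n (\<lambda>l. if l = j then 1 else 0) (\<lambda>v. v j i)"
| add: "multihom_poly k n d F \<Longrightarrow> multihom_poly k n d G \<Longrightarrow> multihom_poly k n d (\<lambda>v. F v + G v)"
| mult: "multihom_poly k n d F \<Longrightarrow> multihom_poly k n e G \<Longrightarrow>
         multihom_poly k n (\<lambda>l. d l + e l) (\<lambda>v. F v * G v)"

definition zariski_power_open :: "nat \<Rightarrow> nat \<Rightarrow> (nat \<Rightarrow> ppoint) set \<Rightarrow> bool" where
  "zariski_power_open k n U \<longleftrightarrow>
     (\<exists>S. (\<forall>F\<in>S. \<exists>d. multihom_poly k n d F) \<and>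
          U = {p \<in> {..<k} \<rightarrow>\<^sub>E proj_space n. \<exists>F\<in>S. \<exists>v. (\<forall>j<k. v j \<in> p j) \<and> F v \<noteq> 0})"

definition zariski_power :: "nat \<Rightarrow> nat \<Rightarrow> (nat \<Rightarrow> ppoint) topology" where
  "zariski_power k n = topology (zariski_power_open k n)"

lemma hom_poly_scale: "hom_poly n d F \<Longrightarrow> F (cscale c v) = c ^ d * F v"
  by (induction rule: hom_poly.induct) (auto simp: cscale_def algebra_simps power_add)

lemma hom_poly_line_nz:
  assumes "hom_poly n d F" "v \<in> line u" "F v \<noteq> 0"
  shows "F u \<noteq> 0"
  using assms by (auto simp: line_def hom_poly_scale)

lemma multihom_poly_cong:
  assumes "multihom_poly k n d F" "\<And>j. j < k \<Longrightarrow> v j = w j"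
  shows "F v = F w"
  using assms by (induction rule: multihom_poly.induct) auto

lemma multihom_poly_scale:
  assumes "multihom_poly k n d F"
  shows "F (\<lambda>j. cscale (c j) (v j)) = (\<Prod>j<k. c j ^ d j) * F v"
  using assms
proof (induction rule: multihom_poly.induct)
  case (var j i)
  have "(\<Prod>l<k. c l ^ (if l = j then 1 else 0)) = (\<Prod>l<k. if l = j then c l else 1)"
    by (rule prod.cong) auto
  also have "\<dots> = c j"
    using var by (simp add: prod.delta)
  finally show ?case
    by (simp add: cscale_def)
qed (auto simp: algebra_simps power_add prod.distrib)

lemma multihom_poly_line_nz:
  assumes F: "multihom_poly k n d F" and v: "\<And>j. j < k \<Longrightarrow> v j \<in> line (u j)" and "F v \<noteq> 0"
  shows "F u \<noteq> 0"
proof -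
  from v have "\<forall>j. \<exists>c. j < k \<longrightarrow> v j = cscale c (u j)"
    by (auto simp: line_def)
  then obtain c where c: "\<And>j. j < k \<Longrightarrow> v j = cscale (c j) (u j)"
    by metis
  have "F v = F (\<lambda>j. cscale (c j) (u j))"
    by (rule multihom_poly_cong[OF F]) (simp add: c)
  with assms(3) show ?thesis
    by (simp add: multihom_poly_scale[OF F])
qed

lemma istopology_zariski_open: "istopology (zariski_open n)"
  unfolding istopology_def
proof (intro conjI allI impI)
  fix U U' assume "zariski_open n U" "zariski_open n U'"
  then obtain S S' where S: "\<forall>F\<in>S. \<exists>d. hom_poly n d F" "\<forall>F\<in>S'. \<exists>d. hom_poly n d F"
      and U: "U = {p \<in> proj_space n. \<exists>F\<in>S. \<exists>v\<in>p. F v \<noteq> 0}"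
      and U': "U' = {p \<in> proj_space n. \<exists>F\<in>S'. \<exists>v\<in>p. F v \<noteq> 0}"
    unfolding zariski_open_def by (elim exE conjE) rule
  let ?T = "{(\<lambda>v. F v * G v) | F G. F \<in> S \<and> G \<in> S'}"
  have 1: "\<forall>H\<in>?T. \<exists>d. hom_poly n d H"
    using S hom_poly.mult by fast
  have 2: "U \<inter> U' = {p \<in> proj_space n. \<exists>H\<in>?T. \<exists>v\<in>p. H v \<noteq> 0}" (is "_ = ?R")
  proof (intro set_eqI iffI)
    fix p assume p: "p \<in> U \<inter> U'"
    then obtain F G v w where *: "p \<in> proj_space n" "F \<in> S" "v \<in> p" "F v \<noteq> 0"
        "G \<in> S'" "w \<in> p" "G w \<noteq> 0"
      unfolding U U' by blast
    from *(1) obtain u where u: "p = line u"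
      unfolding proj_space_def by blast
    have "u = cscale 1 u"
      by (simp add: cscale_def)
    then have up: "u \<in> p"
      unfolding u line_def by blast
    have "F u \<noteq> 0" "G u \<noteq> 0"
      using * S hom_poly_line_nz unfolding u by blast+
    then have "\<exists>H\<in>?T. \<exists>v\<in>p. H v \<noteq> 0"
      using *(2,5) up by (intro bexI[of _ "\<lambda>v. F v * G v"] bexI[of _ u]) auto
    with *(1) show "p \<in> ?R"
      by blast
  next
    fix p assume "p \<in> ?R"
    then obtain F G v where *: "p \<in> proj_space n" "F \<in> S" "G \<in> S'" "v \<in> p" "F v * G v \<noteq> 0"
      by blast
    then have "F v \<noteq> 0" "G v \<noteq> 0"
      by auto
    with * show "p \<in> U \<inter> U'"
      unfolding U U' by blast
  qed
  show "zariski_open n (U \<inter> U')"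
    unfolding zariski_open_def using 1 2 by (intro exI[of _ ?T] conjI)
next
  fix K assume K: "\<forall>U\<in>K. zariski_open n U"
  let ?D = "\<lambda>F. {p \<in> proj_space n. \<exists>v\<in>p. F v \<noteq> 0}"
  let ?S = "{F. (\<exists>d. hom_poly n d F) \<and> ?D F \<subseteq> \<Union>K}"
  have "\<Union>K = (\<Union>F\<in>?S. ?D F)"
  proof
    show "\<Union>K \<subseteq> (\<Union>F\<in>?S. ?D F)"
    proof
      fix p assume "p \<in> \<Union>K"
      then obtain U where U: "U \<in> K" "p \<in> U"
        by blast
      with K have "zariski_open n U"
        by blast
      then obtain S where S: "\<forall>F\<in>S. \<exists>d. hom_poly n d F"
          and US: "U = {p \<in> proj_space n. \<exists>F\<in>S. \<exists>v\<in>p. F v \<noteq> 0}"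
        unfolding zariski_open_def by (elim exE conjE) rule
      from U(2) obtain F where F: "F \<in> S" "p \<in> ?D F"
        unfolding US by blast
      have "?D F \<subseteq> U"
        unfolding US using F(1) by blast
      with U(1) have "?D F \<subseteq> \<Union>K"
        by (meson Union_upper order_trans)
      with F(1) S have "F \<in> ?S"
        by simp
      then show "p \<in> (\<Union>F\<in>?S. ?D F)"
        using F(2) by (rule UN_I[where a = F and A = ?S and B = ?D])
    qed
  qed blast
  also have "\<dots> = {p \<in> proj_space n. \<exists>F\<in>?S. \<exists>v\<in>p. F v \<noteq> 0}"
    by blast
  finally show "zariski_open n (\<Union>K)"
    unfolding zariski_open_def by (intro exI[of _ ?S] conjI) auto
qed

lemma openin_zariski: "openin (zariski n) = zariski_open n"
  by (simp add: zariski_def istopology_zariski_open topology_inverse')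

lemma topspace_zariski: "topspace (zariski n) = proj_space n"
proof -
  have "v \<in> line v" for v
    unfolding line_def by (rule range_eqI[of _ _ 1]) (simp add: cscale_def)
  then have "zariski_open n (proj_space n)"
    unfolding zariski_open_def
    by (intro exI[of _ "{\<lambda>_. 1}"]) (auto simp: proj_space_def intro: hom_poly.const)
  moreover have "U \<subseteq> proj_space n" if "zariski_open n U" for U
    using that unfolding zariski_open_def by auto
  ultimately show ?thesis
    unfolding topspace_def openin_zariski by auto
qed

lemma istopology_zariski_power_open: "istopology (zariski_power_open k n)"
  unfolding istopology_def
proof (intro conjI allI impI)
  fix U U' assume "zariski_power_open k n U" "zariski_power_open k n U'"
  then obtain S S' where S: "\<forall>F\<in>S. \<exists>d. multihom_poly k n d F" "\<forall>F\<in>S'. \<exists>d. multihom_poly k n d F"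
      and U: "U = {p \<in> {..<k} \<rightarrow>\<^sub>E proj_space n. \<exists>F\<in>S. \<exists>v. (\<forall>j<k. v j \<in> p j) \<and> F v \<noteq> 0}"
      and U': "U' = {p \<in> {..<k} \<rightarrow>\<^sub>E proj_space n. \<exists>F\<in>S'. \<exists>v. (\<forall>j<k. v j \<in> p j) \<and> F v \<noteq> 0}"
    unfolding zariski_power_open_def by (elim exE conjE) rule
  let ?T = "{(\<lambda>v. F v * G v) | F G. F \<in> S \<and> G \<in> S'}"
  have 1: "\<forall>H\<in>?T. \<exists>d. multihom_poly k n d H"
    using S multihom_poly.mult by fast
  have 2: "U \<inter> U' = {p \<in> {..<k} \<rightarrow>\<^sub>E proj_space n. \<exists>H\<in>?T. \<exists>v. (\<forall>j<k. v j \<in> p j) \<and> H v \<noteq> 0}"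
    (is "_ = ?R")
  proof (intro set_eqI iffI)
    fix p assume p: "p \<in> U \<inter> U'"
    then obtain F G v w where *: "p \<in> {..<k} \<rightarrow>\<^sub>E proj_space n" "F \<in> S" "\<forall>j<k. v j \<in> p j" "F v \<noteq> 0"
        "G \<in> S'" "\<forall>j<k. w j \<in> p j" "G w \<noteq> 0"
      unfolding U U' by blast
    have "\<forall>j. \<exists>u. j < k \<longrightarrow> p j = line u"
      using *(1) unfolding proj_space_def by (fastforce simp: PiE_iff)
    then obtain u where u: "\<And>j. j < k \<Longrightarrow> p j = line (u j)"
      by metis
    have "cscale 1 (u j) = u j" for j
      by (simp add: cscale_def)
    then have up: "\<forall>j<k. u j \<in> p j"
      using u unfolding line_def by (metis rangeI)
    obtain d e where FG: "multihom_poly k n d F" "multihom_poly k n e G"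
      using * S by blast
    have "F u \<noteq> 0"
      by (rule multihom_poly_line_nz[OF FG(1) _ *(4)]) (use *(3) u in blast)
    have "G u \<noteq> 0"
      by (rule multihom_poly_line_nz[OF FG(2) _ *(7)]) (use *(6) u in blast)
    then have "\<exists>H\<in>?T. \<exists>v. (\<forall>j<k. v j \<in> p j) \<and> H v \<noteq> 0"
      using *(2,5) up \<open>F u \<noteq> 0\<close> by (intro bexI[of _ "\<lambda>v. F v * G v"] exI[of _ u]) auto
    with *(1) show "p \<in> ?R"
      by blast
  next
    fix p assume "p \<in> ?R"
    then obtain F G v where *: "p \<in> {..<k} \<rightarrow>\<^sub>E proj_space n" "F \<in> S" "G \<in> S'"
        "\<forall>j<k. v j \<in> p j" "F v * G v \<noteq> 0"
      by blast
    then have "F v \<noteq> 0" "G v \<noteq> 0"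
      by auto
    with * show "p \<in> U \<inter> U'"
      unfolding U U' by blast
  qed
  show "zariski_power_open k n (U \<inter> U')"
    unfolding zariski_power_open_def using 1 2 by (intro exI[of _ ?T] conjI)
next
  fix K assume K: "\<forall>U\<in>K. zariski_power_open k n U"
  let ?D = "\<lambda>F. {p \<in> {..<k} \<rightarrow>\<^sub>E proj_space n. \<exists>v. (\<forall>j<k. v j \<in> p j) \<and> F v \<noteq> 0}"
  let ?S = "{F. (\<exists>d. multihom_poly k n d F) \<and> ?D F \<subseteq> \<Union>K}"
  have "\<Union>K = (\<Union>F\<in>?S. ?D F)"
  proof
    show "\<Union>K \<subseteq> (\<Union>F\<in>?S. ?D F)"
    proof
      fix p assume "p \<in> \<Union>K"
      then obtain U where U: "U \<in> K" "p \<in> U"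
        by blast
      with K have "zariski_power_open k n U"
        by blast
      then obtain S where S: "\<forall>F\<in>S. \<exists>d. multihom_poly k n d F"
          and US: "U = {p \<in> {..<k} \<rightarrow>\<^sub>E proj_space n. \<exists>F\<in>S. \<exists>v. (\<forall>j<k. v j \<in> p j) \<and> F v \<noteq> 0}"
        unfolding zariski_power_open_def by (elim exE conjE) rule
      from U(2) obtain F where F: "F \<in> S" "p \<in> ?D F"
        unfolding US by blast
      have "?D F \<subseteq> U"
        unfolding US using F(1) by blast
      with U(1) have "?D F \<subseteq> \<Union>K"
        by (meson Union_upper order_trans)
      with F(1) S have "F \<in> ?S"
        by simp
      then show "p \<in> (\<Union>F\<in>?S. ?D F)"
        using F(2) by (rule UN_I[where a = F and A = ?S and B = ?D])
    qed
  qed blast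
  also have "\<dots> = {p \<in> {..<k} \<rightarrow>\<^sub>E proj_space n. \<exists>F\<in>?S. \<exists>v. (\<forall>j<k. v j \<in> p j) \<and> F v \<noteq> 0}"
    by blast
  finally show "zariski_power_open k n (\<Union>K)"
    unfolding zariski_power_open_def by (intro exI[of _ ?S] conjI) auto
qed

lemma openin_zariski_power: "openin (zariski_power k n) = zariski_power_open k n"
  by (simp add: zariski_power_def istopology_zariski_power_open topology_inverse')


section \<open>Subvarieties of projective space\<close>

definition irreducible_in :: "'a topology \<Rightarrow> 'a set \<Rightarrow> bool" where
  "irreducible_in T Z \<longleftrightarrow> Z \<noteq> {} \<and> Z \<subseteq> topspace T \<and>
     (\<forall>A B. closedin T A \<and> closedin T B \<and> Z \<subseteq> A \<union> B \<longrightarrow> Z \<subseteq> A \<or> Z \<subseteq> B)"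

definition irreducible_chain :: "'a topology \<Rightarrow> nat \<Rightarrow> bool" where
  "irreducible_chain T l \<longleftrightarrow>
     (\<exists>Z. (\<forall>i\<le>l. closedin T (Z i) \<and> irreducible_in T (Z i)) \<and> (\<forall>i<l. Z i \<subset> Z (Suc i)))"

definition krull_dim :: "'a topology \<Rightarrow> enat" where
  "krull_dim T = (SUP l \<in> {l. irreducible_chain T l}. enat l)"

abbreviation zariski_on :: "nat \<Rightarrow> ppoint set \<Rightarrow> ppoint topology" where
  "zariski_on n X \<equiv> subtopology (zariski n) X"

definition projective_variety :: "nat \<Rightarrow> ppoint set \<Rightarrow> bool" where
  "projective_variety n X \<longleftrightarrow> closedin (zariski n) X \<and> irreducible_in (zariski n) X"

definition regular_on :: "nat \<Rightarrow> ppoint set \<Rightarrow> ppoint set \<Rightarrow> (ppoint \<Rightarrow> complex) \<Rightarrow> bool" where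
  "regular_on n X U f \<longleftrightarrow>
     (\<forall>p\<in>U. \<exists>V d F G. openin (zariski_on n X) V \<and> p \<in> V \<and> V \<subseteq> U \<and> hom_poly n d F \<and> hom_poly n d G \<and>
        (\<forall>q\<in>V. \<forall>v\<in>q. v \<noteq> 0 \<longrightarrow> G v \<noteq> 0 \<and> f q = F v / G v))"

text \<open>
  Germs at \<open>p\<close> are handled through representatives: \<open>max_ideal n X p\<close> and \<open>max_ideal_sq n X p\<close>
  are the preimages of \<open>\<mm>\<^sub>p\<close> and \<open>\<mm>\<^sub>p\<^sup>2\<close> among the functions that are regular near \<open>p\<close> (and
  arbitrary elsewhere).  Functions with zero germ lie in both, so the quotient of the two
  preimages is the cotangent space.
\<close>

definition max_ideal :: "nat \<Rightarrow> ppoint set \<Rightarrow> ppoint \<Rightarrow> (ppoint \<Rightarrow> complex) set" where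
  "max_ideal n X p =
     {f. (\<exists>U. openin (zariski_on n X) U \<and> p \<in> U \<and> regular_on n X U f) \<and> f p = 0}"

definition max_ideal_sq :: "nat \<Rightarrow> ppoint set \<Rightarrow> ppoint \<Rightarrow> (ppoint \<Rightarrow> complex) set" where
  "max_ideal_sq n X p =
     {f. \<exists>U (m::nat) a b. openin (zariski_on n X) U \<and> p \<in> U \<and>
           (\<forall>j<m. a j \<in> max_ideal n X p \<and> b j \<in> max_ideal n X p) \<and>
           (\<forall>q\<in>U. f q = (\<Sum>j<m. a j q * b j q))}"

definition smooth_variety :: "nat \<Rightarrow> ppoint set \<Rightarrow> bool" where
  "smooth_variety n X \<longleftrightarrow>
     (\<forall>p\<in>X. enat (quot_dim (max_ideal n X p) (max_ideal_sq n X p)) = krull_dim (zariski_on n X))"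

definition smooth_projective_curve :: "nat \<Rightarrow> ppoint set \<Rightarrow> bool" where
  "smooth_projective_curve n X \<longleftrightarrow>
     projective_variety n X \<and> krull_dim (zariski_on n X) = 1 \<and> smooth_variety n X"

definition variety_morphism ::
    "nat \<Rightarrow> ppoint set \<Rightarrow> nat \<Rightarrow> ppoint set \<Rightarrow> (ppoint \<Rightarrow> ppoint) \<Rightarrow> bool" where
  "variety_morphism n X N Y \<phi> \<longleftrightarrow>
     continuous_map (zariski_on n X) (zariski_on N Y) \<phi> \<and>
     (\<forall>V f. openin (zariski_on N Y) V \<and> regular_on N Y V f \<longrightarrow>
        regular_on n X {x \<in> X. \<phi> x \<in> V} (f \<circ> \<phi>))"

definition closed_embedding :: "nat \<Rightarrow> ppoint set \<Rightarrow> nat \<Rightarrow> (ppoint \<Rightarrow> ppoint) \<Rightarrow> bool" where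
  "closed_embedding n X N \<phi> \<longleftrightarrow>
     closedin (zariski N) (\<phi> ` X) \<and> variety_morphism n X N (\<phi> ` X) \<phi> \<and>
     (\<exists>\<psi>. variety_morphism N (\<phi> ` X) n X \<psi> \<and> (\<forall>x\<in>X. \<psi> (\<phi> x) = x))"


section \<open>Line bundles\<close>

text \<open>
  A line bundle is given by an open cover \<open>U\<^sub>i\<close> over which it is trivialised, together with its
  transition functions \<open>g\<^sub>i\<^sub>j\<close> on \<open>U\<^sub>i \<inter> U\<^sub>j\<close>; a section is a family of regular functions \<open>s\<^sub>i\<close>
  with \<open>s\<^sub>i = g\<^sub>i\<^sub>j s\<^sub>j\<close>.  The cocycle identities below force the \<open>g\<^sub>i\<^sub>j\<close> to be units.
\<close>

record 'i line_bundle =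
  index :: "'i set"
  chart :: "'i \<Rightarrow> ppoint set"
  trans_fun :: "'i \<Rightarrow> 'i \<Rightarrow> ppoint \<Rightarrow> complex"

definition is_line_bundle :: "nat \<Rightarrow> ppoint set \<Rightarrow> 'i line_bundle \<Rightarrow> bool" where
  "is_line_bundle n X L \<longleftrightarrow>
     (\<forall>i\<in>index L. openin (zariski_on n X) (chart L i)) \<and> (\<Union>i\<in>index L. chart L i) = X \<and>
     (\<forall>i\<in>index L. \<forall>j\<in>index L. regular_on n X (chart L i \<inter> chart L j) (trans_fun L i j)) \<and>
     (\<forall>i\<in>index L. \<forall>x\<in>chart L i. trans_fun L i i x = 1) \<and>
     (\<forall>i\<in>index L. \<forall>j\<in>index L. \<forall>k\<in>index L. \<forall>x\<in>chart L i \<inter> chart L j \<inter> chart L k.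
        trans_fun L i j x * trans_fun L j k x = trans_fun L i k x)"

definition tensor_power :: "'i line_bundle \<Rightarrow> int \<Rightarrow> 'i line_bundle" where
  "tensor_power L d = L\<lparr>trans_fun := \<lambda>i j x. trans_fun L i j x powi d\<rparr>"

text \<open>
  Sections over \<open>W\<close> are extended by 0 to the pairs \<open>(i, x)\<close> without \<open>x \<in> W \<inter> U\<^sub>i\<close>, so that
  equality of sections is equality of functions.
\<close>

definition sections ::
    "nat \<Rightarrow> ppoint set \<Rightarrow> 'i line_bundle \<Rightarrow> ppoint set \<Rightarrow> ('i \<times> ppoint \<Rightarrow> complex) set" where
  "sections n X L W =
     {s. (\<forall>i\<in>index L. regular_on n X (W \<inter> chart L i) (\<lambda>x. s (i, x))) \<and>
         (\<forall>i\<in>index L. \<forall>j\<in>index L. \<forall>x\<in>W \<inter> chart L i \<inter> chart L j.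
            s (i, x) = trans_fun L i j x * s (j, x)) \<and>
         (\<forall>i x. \<not> (i \<in> index L \<and> x \<in> W \<inter> chart L i) \<longrightarrow> s (i, x) = 0)}"

text \<open>
  \<open>L\<close> is very ample if global sections \<open>\<sigma>\<^sub>0, \<dots>, \<sigma>\<^sub>N\<close> without common zero define a closed embedding
  \<open>x \<mapsto> [\<sigma>\<^sub>0(x) : \<dots> : \<sigma>\<^sub>N(x)]\<close>, i.e. \<open>L\<close> is the pullback of \<open>\<O>(1)\<close> under it.
\<close>

definition very_ample :: "nat \<Rightarrow> ppoint set \<Rightarrow> 'i line_bundle \<Rightarrow> bool" where
  "very_ample n X L \<longleftrightarrow>
     (\<exists>N \<sigma> \<phi>. (\<forall>a\<le>N. \<sigma> a \<in> sections n X L X) \<and>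
        (\<forall>i\<in>index L. \<forall>x\<in>chart L i.
           (\<exists>a\<le>N. \<sigma> a (i, x) \<noteq> 0) \<and> \<phi> x = line (\<lambda>a. if a \<le> N then \<sigma> a (i, x) else 0)) \<and>
        closed_embedding n X N \<phi>)"

definition ample :: "nat \<Rightarrow> ppoint set \<Rightarrow> 'i line_bundle \<Rightarrow> bool" where
  "ample n X L \<longleftrightarrow> (\<exists>m>0. very_ample n X (tensor_power L m))"


section \<open>Cohomology and the Euler characteristic on a curve\<close>

text \<open>
  \<open>H\<^sup>1\<close> is the first Cech cohomology group with respect to the cover of \<open>X\<close> by the affine open
  sets \<open>X \<inter> {x\<^sub>a \<noteq> 0}\<close>, \<open>a = 0, \<dots>, n\<close>.
\<close>

definition std_chart :: "nat \<Rightarrow> ppoint set \<Rightarrow> nat \<Rightarrow> ppoint set" where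
  "std_chart n X a = {p \<in> X. \<exists>v\<in>p. v a \<noteq> 0}"

definition cech_Z1 ::
    "nat \<Rightarrow> ppoint set \<Rightarrow> 'i line_bundle \<Rightarrow> (nat \<times> nat \<times> 'i \<times> ppoint \<Rightarrow> complex) set" where
  "cech_Z1 n X L =
     {c. (\<forall>a\<le>n. \<forall>b\<le>n. (\<lambda>y. c (a, b, y)) \<in> sections n X L (std_chart n X a \<inter> std_chart n X b)) \<and>
         (\<forall>a\<le>n. \<forall>b\<le>n. \<forall>e\<le>n. \<forall>i\<in>index L.
            \<forall>x\<in>std_chart n X a \<inter> std_chart n X b \<inter> std_chart n X e \<inter> chart L i.
              c (b, e, i, x) - c (a, e, i, x) + c (a, b, i, x) = 0) \<and>
         (\<forall>a b y. \<not> (a \<le> n \<and> b \<le> n) \<longrightarrow> c (a, b, y) = 0)}"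

definition cech_B1 ::
    "nat \<Rightarrow> ppoint set \<Rightarrow> 'i line_bundle \<Rightarrow> (nat \<times> nat \<times> 'i \<times> ppoint \<Rightarrow> complex) set" where
  "cech_B1 n X L =
     {c. \<exists>h. (\<forall>a\<le>n. h a \<in> sections n X L (std_chart n X a)) \<and>
         c = (\<lambda>(a, b, i, x). if a \<le> n \<and> b \<le> n \<and> x \<in> std_chart n X a \<inter> std_chart n X b
                             then h b (i, x) - h a (i, x) else 0)}"

definition h0 :: "nat \<Rightarrow> ppoint set \<Rightarrow> 'i line_bundle \<Rightarrow> nat" where
  "h0 n X L = cfun.dim (sections n X L X)"

definition h1 :: "nat \<Rightarrow> ppoint set \<Rightarrow> 'i line_bundle \<Rightarrow> nat" where
  "h1 n X L = quot_dim (cech_Z1 n X L) (cech_B1 n X L)"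

text \<open>On a curve the higher cohomology groups vanish.\<close>

definition curve_euler_char :: "nat \<Rightarrow> ppoint set \<Rightarrow> 'i line_bundle \<Rightarrow> int" where
  "curve_euler_char n X L = int (h0 n X L) - int (h1 n X L)"


section \<open>Divisors singular at general points\<close>

definition singular_at ::
    "nat \<Rightarrow> ppoint set \<Rightarrow> 'i line_bundle \<Rightarrow> ('i \<times> ppoint \<Rightarrow> complex) \<Rightarrow> ppoint \<Rightarrow> bool" where
  "singular_at n X L s p \<longleftrightarrow>
     (\<forall>i\<in>index L. p \<in> chart L i \<longrightarrow> (\<lambda>x. s (i, x)) \<in> max_ideal_sq n X p)"

definition singular_sections ::
    "nat \<Rightarrow> ppoint set \<Rightarrow> 'i line_bundle \<Rightarrow> ppoint set \<Rightarrow> ('i \<times> ppoint \<Rightarrow> complex) set" where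
  "singular_sections n X L P = {s \<in> sections n X L X. \<forall>p\<in>P. singular_at n X L s p}"

text \<open>
  The divisors of \<open>|L|\<close> singular along \<open>P\<close> form the projectivisation of \<open>singular_sections\<close>; the
  empty linear system has dimension -1.
\<close>

definition singular_system_dim :: "nat \<Rightarrow> ppoint set \<Rightarrow> 'i line_bundle \<Rightarrow> ppoint set \<Rightarrow> int" where
  "singular_system_dim n X L P = int (cfun.dim (singular_sections n X L P)) - 1"

definition for_general_points ::
    "nat \<Rightarrow> ppoint set \<Rightarrow> nat \<Rightarrow> ((nat \<Rightarrow> ppoint) \<Rightarrow> bool) \<Rightarrow> bool" where
  "for_general_points n X k Q \<longleftrightarrow>
     (\<exists>W. openin (subtopology (zariski_power k n) ({..<k} \<rightarrow>\<^sub>E X)) W \<and> W \<noteq> {} \<and> (\<forall>p\<in>W. Q p))"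

end

theory Submission
  imports Defs "HOL-Computational_Algebra.Fundamental_Theorem_Algebra"
begin

text \<open>
  For general points the conditions imposed by double points are as independent as possible on any
  finite-dimensional space of sections: each point lowers its dimension by 2, because the Wronskian
  of two linearly independent sections does not vanish identically in characteristic 0.  Hence the
  dimension is \<open>max 0 (h0 - 2 * k)\<close>, and it remains to prove Serre vanishing, \<open>h1 = 0\<close> for large \<open>d\<close>.

  Let \<open>Z\<close> be the zero set on the curve of a coordinate \<open>x\<^sub>0\<close>.  A Cech cocycle is a coboundary as soon as
  its principal parts at \<open>Z\<close> are those of a section regular outside \<open>Z\<close>.  Forms of every degree \<open>\<ge> r\<close>
  interpolate arbitrary values modulo \<open>x\<^sub>0\<close> at \<open>Z\<close>, so the products \<open>s A / x\<^sub>0\<^sup>j\<close> of a fixed section \<open>s\<close>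
  divisible by \<open>x\<^sub>0\<^sup>r\<close> at \<open>Z\<close> with forms \<open>A\<close> of degree \<open>j\<close> realise all principal parts.  Such an \<open>s\<close> exists for
  large \<open>d\<close> by a dimension count, since \<open>h0\<close> is unbounded.
\<close>

section \<open>Homogeneous polynomials and points\<close>

text \<open>The bound on \<open>d\<close> must not depend on \<open>k\<close>. The double points are
  no obstacle to this: the Wronskian argument works for every line bundle and every number of
  points, so \<open>d\<close> has to be large only to make \<open>h1\<close> vanish. One tuple of
  points with the right dimension is built greedily. Elimination on the matrix of values and
  derivatives spreads the upper bound to an open set of tuples; the lower bound holds for all
  tuples. Regular functions are given only as local quotients of forms, so the commutative algebra
  has to be recovered from them. Noetherianity enters twice, for finite orders of vanishing and for
  finite zero sets. The Nullstellensatz makes global regular functions constant, hence spaces of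
  sections finite-dimensional. Unboundedness of \<open>h0\<close> comes from a pencil: two
  independent sections of \<open>L\<^sup>m\<close> give \<open>j + 1\<close> independent sections of
  its \<open>j\<close>-th power. The degree \<open>r\<close> must serve all pole orders at once,
  because the order to which \<open>s\<close> vanishes is fixed before the cocycle is known.\<close>

lemma hom_poly_mult':
  "hom_poly n d F \<Longrightarrow> hom_poly n e G \<Longrightarrow> k = d + e \<Longrightarrow> hom_poly n k (\<lambda>v. F v * G v)"
  using hom_poly.mult by blast

lemma hom_poly_cmult: "hom_poly n d F \<Longrightarrow> hom_poly n d (\<lambda>v. c * F v)"
  using hom_poly_mult'[OF hom_poly.const[of n c]] by simp

lemma hom_poly_zero: "hom_poly n d (\<lambda>_. 0)"
proof (induction d)
  case (Suc d)
  from hom_poly_mult'[OF this hom_poly.var[of 0 n]] show ?case by simp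
qed (rule hom_poly.const)

lemma hom_poly_diff: "hom_poly n d F \<Longrightarrow> hom_poly n d G \<Longrightarrow> hom_poly n d (\<lambda>v. F v - G v)"
  using hom_poly.add[OF _ hom_poly_cmult[of n d G "-1"]] by simp

lemma hom_poly_sum:
  "(\<And>i. i \<in> I \<Longrightarrow> hom_poly n d (F i)) \<Longrightarrow> hom_poly n d (\<lambda>v. \<Sum>i\<in>I. F i v)"
  by (induction I rule: infinite_finite_induct) (auto intro: hom_poly_zero hom_poly.add)

lemma hom_poly_power: "hom_poly n d F \<Longrightarrow> hom_poly n (k * d) (\<lambda>v. F v ^ k)"
  by (induction k) (auto intro: hom_poly.const hom_poly.mult)

lemma hom_poly_var_power: "i \<le> n \<Longrightarrow> hom_poly n k (\<lambda>v. v i ^ k)"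
  using hom_poly_power[OF hom_poly.var, of i n k] by simp

text \<open>One fixed nonzero vector per point turns the value of a form at a point into a number.
  The choice is harmless: zeros of forms and quotients of forms of equal degree do not depend on
  it.\<close>

definition rep :: "ppoint \<Rightarrow> cvec" where
  "rep q = (SOME v. v \<in> q \<and> v \<noteq> 0)"

lemma line_self: "v \<in> line v"
  unfolding line_def by (rule range_eqI[of _ _ 1]) (simp add: cscale_def)

lemma line_cscale:
  assumes "c \<noteq> 0" shows "line (cscale c v) = line v"
  unfolding line_def
proof (intro set_eqI iffI; elim rangeE)
  fix x d assume "x = cscale d v"
  then have "x = cscale (d / c) (cscale c v)" using assms by (simp add: cscale_def)
  then show "x \<in> range (\<lambda>d. cscale d (cscale c v))" by blast
next
  fix x d assume "x = cscale d (cscale c v)"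
  then have "x = cscale (d * c) v" by (simp add: cscale_def mult.assoc)
  then show "x \<in> range (\<lambda>d. cscale d v)" by blast
qed

lemma rep:
  assumes "q \<in> proj_space n"
  shows "rep q \<in> q" "rep q \<noteq> 0" "q = line (rep q)" "\<And>i. i > n \<Longrightarrow> rep q i = 0"
proof -
  from assms obtain u where u: "q = line u" "\<forall>i>n. u i = 0" "u \<noteq> 0"
    by (auto simp: proj_space_def)
  then have "\<exists>v. v \<in> q \<and> v \<noteq> 0" using line_self by blast
  from someI_ex[OF this] show *: "rep q \<in> q" "rep q \<noteq> 0" by (auto simp: rep_def)
  then obtain c where c: "rep q = cscale c u" by (auto simp: u line_def)
  then have c0: "c \<noteq> 0" using * by (auto simp: cscale_def fun_eq_iff)
  have "line u = line (rep q)"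
    using line_cscale[OF c0] unfolding c by simp
  then show "q = line (rep q)" using u(1) by simp
  show "\<And>i. i > n \<Longrightarrow> rep q i = 0" using u(2) by (simp add: c cscale_def)
qed

lemma rep_coord_nonzero:
  assumes "q \<in> proj_space n" obtains i where "i \<le> n" "rep q i \<noteq> 0"
  using rep(2,4)[OF assms] by (metis ext le_less_linear zero_fun_apply)

lemma in_point_scale:
  assumes "q \<in> proj_space n" "v \<in> q"
  obtains c where "v = cscale c (rep q)"
  using assms rep(3)[OF assms(1)] by (auto simp: line_def)

lemma in_point_scale':
  assumes "q \<in> proj_space n" "v \<in> q" "v \<noteq> 0"
  obtains c where "v = cscale c (rep q)" "c \<noteq> 0"
  using in_point_scale[OF assms(1,2)] assms(3) by (metis cfun.scale_zero_left)

lemma hom_poly_rep_eq_0: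
  assumes "hom_poly n d F" "q \<in> proj_space n" "v \<in> q" "v \<noteq> 0"
  shows "F v = 0 \<longleftrightarrow> F (rep q) = 0"
  using in_point_scale'[OF assms(2-4)] hom_poly_scale[OF assms(1)] by (metis mult_eq_0_iff power_eq_0_iff)

lemma hom_poly_rep_divide:
  assumes "hom_poly n d F" "hom_poly n d G" "q \<in> proj_space n" "v \<in> q" "v \<noteq> 0"
  shows "F v / G v = F (rep q) / G (rep q)"
proof -
  obtain c where c: "v = cscale c (rep q)" "c \<noteq> 0" using in_point_scale'[OF assms(3-5)] .
  show ?thesis using c(2) unfolding c(1) hom_poly_scale[OF assms(1)] hom_poly_scale[OF assms(2)] by simp
qed

lemma point_eqI:
  assumes "p \<in> proj_space n" "q \<in> proj_space n"
    and "rep p b \<noteq> 0" "rep q b \<noteq> 0" "\<And>i. i \<le> n \<Longrightarrow> rep q i / rep q b = rep p i / rep p b"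
  shows "p = q"
proof -
  let ?c = "rep q b / rep p b"
  have "rep q i = ?c * rep p i" for i
  proof (cases "i \<le> n")
    case True
    then show ?thesis using assms(5)[OF True] assms(3,4) by (simp add: field_simps)
  next
    case False
    then show ?thesis using rep(4)[OF assms(1)] rep(4)[OF assms(2)] by simp
  qed
  then have "rep q = cscale ?c (rep p)" unfolding cscale_def by blast
  then have "rep q \<in> line (rep p)" unfolding line_def by (rule range_eqI)
  with rep(3)[OF assms(1)] have "rep q \<in> p" by simp
  from in_point_scale'[OF assms(1) this rep(2)[OF assms(2)]]
  obtain c where c: "rep q = cscale c (rep p)" "c \<noteq> 0" .
  have "line (rep q) = line (rep p)"
    using line_cscale[OF c(2)] unfolding c(1) .
  then show ?thesis using rep(3)[OF assms(1)] rep(3)[OF assms(2)] by simp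
qed

section \<open>Germs of regular functions\<close>

locale curve =
  fixes n :: nat and X :: "ppoint set"
  assumes curve: "smooth_projective_curve n X"
begin

section \<open>Zariski topology of the curve, with its neighbourhood and generic filters\<close>

abbreviation zar :: "ppoint topology" where "zar \<equiv> zariski_on n X"

abbreviation near :: "ppoint \<Rightarrow> ppoint filter" where "near p \<equiv> nhdsin zar p"

lemma closed_X: "closedin (zariski n) X" and irred_X: "irreducible_in (zariski n) X"
  using curve by (auto simp: smooth_projective_curve_def projective_variety_def)

lemma X_proj: "q \<in> X \<Longrightarrow> q \<in> proj_space n"
  using closedin_subset[OF closed_X] by (auto simp: topspace_zariski)

lemma topspace_zar [simp]: "topspace zar = X"
  using X_proj by (auto simp: topspace_zariski)

lemma topspace_zariski_inter_X [simp]: "topspace (zariski n) \<inter> X = X"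
  using topspace_zar by simp

lemma openin_X: "openin zar X"
  using openin_topspace[of zar] unfolding topspace_zar .

lemma X_nonempty: "X \<noteq> {}"
  using irred_X by (simp add: irreducible_in_def)

lemma openin_zariski_basic: "hom_poly n d H \<Longrightarrow> openin (zariski n) {q \<in> proj_space n. H (rep q) \<noteq> 0}"
  unfolding openin_zariski zariski_open_def
  apply (rule exI[of _ "{H}"])
  apply (auto simp: Bex_def)
  using rep(1) apply blast
  by (metis hom_poly_line_nz rep(3))

lemma openin_basic: "hom_poly n d H \<Longrightarrow> openin zar {q \<in> X. H (rep q) \<noteq> 0}"
  unfolding openin_subtopology
  by (rule exI[of _ "{q \<in> proj_space n. H (rep q) \<noteq> 0}"]) (auto simp: openin_zariski_basic X_proj)

lemma openin_zar_obtain_basic: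
  assumes "openin zar U" "p \<in> U"
  obtains d H where "hom_poly n d H" "H (rep p) \<noteq> 0" "\<And>q. q \<in> X \<Longrightarrow> H (rep q) \<noteq> 0 \<Longrightarrow> q \<in> U"
proof -
  from assms obtain T where T: "openin (zariski n) T" "U = T \<inter> X" by (auto simp: openin_subtopology)
  then obtain S where S: "\<forall>F\<in>S. \<exists>d. hom_poly n d F" "T = {p \<in> proj_space n. \<exists>F\<in>S. \<exists>v\<in>p. F v \<noteq> 0}"
    unfolding openin_zariski zariski_open_def by (elim exE conjE) rule
  with assms(2) T obtain H v where H: "H \<in> S" "v \<in> p" "H v \<noteq> 0" "p \<in> X" by blast
  then obtain d where d: "hom_poly n d H" using S by blast
  have "H (rep p) \<noteq> 0" using hom_poly_line_nz[OF d, of v "rep p"] H rep(3) X_proj by metis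
  moreover have "q \<in> U" if "q \<in> X" "H (rep q) \<noteq> 0" for q
    using that S(2) T(2) rep(1) X_proj H(1) by blast
  ultimately show thesis using that d by blast
qed

lemma openin_subset_X: "openin zar U \<Longrightarrow> U \<subseteq> X"
  using openin_subset by fastforce

lemma irred_closed:
  "closedin (zariski n) A \<Longrightarrow> closedin (zariski n) B \<Longrightarrow> X \<subseteq> A \<union> B \<Longrightarrow> X \<subseteq> A \<or> X \<subseteq> B"
  using irred_X by (simp add: irreducible_in_def)

text \<open>The complements of two disjoint nonempty open sets would be proper closed sets covering
  an irreducible space. This is what makes \<open>gen\<close> a filter.\<close>

lemma open_inter_nonempty:
  assumes "openin zar U" "openin zar V" "U \<noteq> {}" "V \<noteq> {}"
  shows "U \<inter> V \<noteq> {}"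
proof
  assume 0: "U \<inter> V = {}"
  obtain S T where ST: "openin (zariski n) S" "U = S \<inter> X" "openin (zariski n) T" "V = T \<inter> X"
    using assms(1,2) unfolding openin_subtopology by blast
  let ?c = "\<lambda>A. topspace (zariski n) - A"
  have "closedin (zariski n) (?c S)" "closedin (zariski n) (?c T)" using ST(1,3) by blast+
  moreover have "X \<subseteq> ?c S \<union> ?c T" using 0 ST(2,4) X_proj unfolding topspace_zariski by blast
  ultimately have "X \<subseteq> ?c S \<or> X \<subseteq> ?c T" by (intro irred_closed)
  then have "X \<inter> S = {} \<or> X \<inter> T = {}" by blast
  then show False using assms(3,4) unfolding ST(2,4) by blast
qed

lemma eventually_near: "p \<in> X \<Longrightarrow> eventually P (near p) \<longleftrightarrow> (\<exists>S. openin zar S \<and> p \<in> S \<and> (\<forall>x\<in>S. P x))"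
  unfolding eventually_nhdsin topspace_zar by blast

lemma eventually_near_self: "p \<in> X \<Longrightarrow> eventually P (near p) \<Longrightarrow> P p"
  by (auto simp: eventually_near)

lemma eventually_near_open: "openin zar U \<Longrightarrow> p \<in> U \<Longrightarrow> eventually (\<lambda>q. q \<in> U) (near p)"
  using openin_subset_X by (subst eventually_near) auto

lemma eventually_near_in_X: "p \<in> X \<Longrightarrow> eventually (\<lambda>q. q \<in> X) (near p)"
  using eventually_near_open[OF openin_X] by blast

lemma eventually_near_basic:
  "hom_poly n d H \<Longrightarrow> p \<in> X \<Longrightarrow> H (rep p) \<noteq> 0 \<Longrightarrow> eventually (\<lambda>q. H (rep q) \<noteq> 0) (near p)"
  by (rule eventually_mono[OF eventually_near_open[OF openin_basic]]) auto

text \<open>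
  Rational functions are represented by functions on all points, with \<open>eventually (\<lambda>q. f q = g q) gen\<close>
  as equality.
\<close>

definition gen :: "ppoint filter" where
  "gen = Abs_filter (\<lambda>P. \<exists>U. openin zar U \<and> U \<noteq> {} \<and> (\<forall>q\<in>U. P q))"

lemma eventually_gen: "eventually P gen \<longleftrightarrow> (\<exists>U. openin zar U \<and> U \<noteq> {} \<and> (\<forall>q\<in>U. P q))"
  unfolding gen_def
proof (rule eventually_Abs_filter, standard, goal_cases)
  case 1
  show ?case using X_nonempty openin_X by blast
next
  case (2 P Q)
  then obtain U V where "openin zar U" "U \<noteq> {}" "\<forall>q\<in>U. P q" "openin zar V" "V \<noteq> {}" "\<forall>q\<in>V. Q q" by blast
  then show ?case using open_inter_nonempty[of U V] by (intro exI[of _ "U \<inter> V"]) auto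
qed blast

lemma gen_not_bot: "gen \<noteq> bot"
  unfolding trivial_limit_def eventually_gen by blast

lemma near_gen: "p \<in> X \<Longrightarrow> eventually P (near p) \<Longrightarrow> eventually P gen"
  by (auto simp: eventually_near eventually_gen)

lemma gen_open: "openin zar U \<Longrightarrow> U \<noteq> {} \<Longrightarrow> eventually (\<lambda>q. q \<in> U) gen"
  by (auto simp: eventually_gen)

lemma gen_in_X: "eventually (\<lambda>q. q \<in> X) gen"
  using gen_open[OF openin_X X_nonempty] .

lemma gen_ex: "eventually P gen \<Longrightarrow> \<exists>q\<in>X. P q"
  using openin_subset_X by (fastforce simp: eventually_gen)

lemma hom_poly_gen_nonzero:
  "hom_poly n d F \<Longrightarrow> q \<in> X \<Longrightarrow> F (rep q) \<noteq> 0 \<Longrightarrow> eventually (\<lambda>q. F (rep q) \<noteq> 0) gen"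
  using near_gen eventually_near_basic by blast

text \<open>Being nonzero at one point of the curve is an open condition, hence would hold
  generically, against the generic vanishing.\<close>

lemma hom_poly_gen_zero:
  assumes "hom_poly n d F" "eventually (\<lambda>q. F (rep q) = 0) gen" "q \<in> X"
  shows "F (rep q) = 0"
proof (rule ccontr)
  assume "F (rep q) \<noteq> 0"
  from eventually_conj[OF hom_poly_gen_nonzero[OF assms(1,3) this] assms(2)] gen_not_bot show False
    by (auto simp: trivial_limit_def elim: eventually_mono)
qed

text \<open>The local ring at \<open>p\<close>, as the set of all functions whose germ lies in it.
  Values far from \<open>p\<close> are arbitrary, so no quotient has to be formed and germs are
  compared with \<open>near p\<close>.\<close>

definition loc :: "ppoint \<Rightarrow> (ppoint \<Rightarrow> complex) set" where
  "loc p = {f. \<exists>d F G. hom_poly n d F \<and> hom_poly n d G \<and> G (rep p) \<noteq> 0 \<and>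
                 eventually (\<lambda>q. f q = F (rep q) / G (rep q)) (near p)}"

lemma locI:
  "hom_poly n d F \<Longrightarrow> hom_poly n d G \<Longrightarrow> G (rep p) \<noteq> 0 \<Longrightarrow>
   eventually (\<lambda>q. f q = F (rep q) / G (rep q)) (near p) \<Longrightarrow> f \<in> loc p"
  unfolding loc_def by blast

lemma locE:
  assumes "f \<in> loc p"
  obtains d F G where "hom_poly n d F" "hom_poly n d G" "G (rep p) \<noteq> 0"
     "eventually (\<lambda>q. f q = F (rep q) / G (rep q)) (near p)"
  using assms unfolding loc_def by blast

lemma regular_on_iff:
  assumes "openin zar U"
  shows "regular_on n X U f \<longleftrightarrow> (\<forall>p\<in>U. f \<in> loc p)"
proof
  assume f: "regular_on n X U f"
  show "\<forall>p\<in>U. f \<in> loc p"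
  proof
    fix p assume p: "p \<in> U"
    then obtain V d F G where V: "openin zar V" "p \<in> V" "hom_poly n d F" "hom_poly n d G"
       and FG: "\<forall>q\<in>V. \<forall>v\<in>q. v \<noteq> 0 \<longrightarrow> G v \<noteq> 0 \<and> f q = F v / G v"
      using f[unfolded regular_on_def] by meson
    have *: "G (rep q) \<noteq> 0 \<and> f q = F (rep q) / G (rep q)" if "q \<in> V" for q
      using FG that rep(1,2)[OF X_proj[OF subsetD[OF openin_subset_X[OF V(1)] that]]] by blast
    show "f \<in> loc p"
      using * V(2) by (intro locI[OF V(3,4)] eventually_mono[OF eventually_near_open[OF V(1,2)]]) auto
  qed
next
  assume f: "\<forall>p\<in>U. f \<in> loc p"
  show "regular_on n X U f"
    unfolding regular_on_def
  proof
    fix p assume p: "p \<in> U"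
    with f have "f \<in> loc p" by blast
    then obtain d F G where F: "hom_poly n d F" "hom_poly n d G" "G (rep p) \<noteq> 0"
      and ev: "eventually (\<lambda>q. f q = F (rep q) / G (rep q)) (near p)"
      by (rule locE)
    have pX: "p \<in> X" using p assms openin_subset_X by blast
    then obtain S where S: "openin zar S" "p \<in> S" "\<forall>q\<in>S. f q = F (rep q) / G (rep q)"
      using ev by (auto simp: eventually_near)
    let ?V = "S \<inter> U \<inter> {q\<in>X. G (rep q) \<noteq> 0}"
    have "openin zar ?V" using S assms openin_basic[OF F(2)] by blast
    moreover have "\<forall>q\<in>?V. \<forall>v\<in>q. v \<noteq> 0 \<longrightarrow> G v \<noteq> 0 \<and> f q = F v / G v"
    proof (intro ballI impI)
      fix q v assume q: "q \<in> ?V" "v \<in> q" "v \<noteq> 0"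
      then have "q \<in> proj_space n" using X_proj by blast
      then show "G v \<noteq> 0 \<and> f q = F v / G v"
        using hom_poly_rep_divide[OF F(1,2) _ q(2,3)] hom_poly_rep_eq_0[OF F(2) _ q(2,3)] S(3) q(1) by simp
    qed
    moreover have "p \<in> ?V" "?V \<subseteq> U" using S(2) p pX F(3) by blast+
    ultimately show "\<exists>V d F G. openin zar V \<and> p \<in> V \<and> V \<subseteq> U \<and> hom_poly n d F \<and> hom_poly n d G \<and>
        (\<forall>q\<in>V. \<forall>v\<in>q. v \<noteq> 0 \<longrightarrow> G v \<noteq> 0 \<and> f q = F v / G v)"
      using F(1,2) by (intro exI[of _ ?V] exI[of _ d] exI[of _ F] exI[of _ G] conjI)
  qed
qed

lemma loc_cong:
  assumes "eventually (\<lambda>q. f q = g q) (near p)"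
  shows "f \<in> loc p \<longleftrightarrow> g \<in> loc p"
proof -
  have "g \<in> loc p" if "f \<in> loc p" "eventually (\<lambda>q. f q = g q) (near p)" for f g
    using that(1)
  proof (rule locE)
    fix d F G assume *: "hom_poly n d F" "hom_poly n d G" "G (rep p) \<noteq> 0"
      "eventually (\<lambda>q. f q = F (rep q) / G (rep q)) (near p)"
    show "g \<in> loc p"
      using *(4) that(2) by (intro locI[OF *(1-3)], eventually_elim) simp
  qed
  from this[of f g] this[of g f] assms show ?thesis by (auto simp: eq_commute)
qed

lemma loc_iff_regular:
  assumes "p \<in> X"
  shows "f \<in> loc p \<longleftrightarrow> (\<exists>U. openin zar U \<and> p \<in> U \<and> regular_on n X U f)"
proof
  assume "f \<in> loc p"
  then obtain d F G where F: "hom_poly n d F" "hom_poly n d G" "G (rep p) \<noteq> 0"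
      and ev: "eventually (\<lambda>q. f q = F (rep q) / G (rep q)) (near p)"
    by (rule locE)
  from ev assms obtain S where S: "openin zar S" "p \<in> S" "\<forall>q\<in>S. f q = F (rep q) / G (rep q)"
    by (auto simp: eventually_near)
  let ?V = "S \<inter> {q\<in>X. G (rep q) \<noteq> 0}"
  have o: "openin zar ?V" using S openin_basic[OF F(2)] by blast
  have "f \<in> loc q" if "q \<in> ?V" for q
    using that S(3) by (intro locI[OF F(1,2)] eventually_mono[OF eventually_near_open[OF S(1)]]) auto
  then show "\<exists>U. openin zar U \<and> p \<in> U \<and> regular_on n X U f"
    using S(2) F(3) assms o by (intro exI[of _ ?V]) (simp add: regular_on_iff)
qed (auto simp: regular_on_iff)

lemma loc_near: "p \<in> X \<Longrightarrow> f \<in> loc p \<Longrightarrow> eventually (\<lambda>q. f \<in> loc q) (near p)"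
  unfolding eventually_near loc_iff_regular[of p] using regular_on_iff by blast

lemma loc_frac:
  "p \<in> X \<Longrightarrow> hom_poly n d F \<Longrightarrow> hom_poly n d G \<Longrightarrow> G (rep p) \<noteq> 0 \<Longrightarrow> (\<lambda>q. F (rep q) / G (rep q)) \<in> loc p"
  by (rule locI) auto

lemma loc_const [intro!]: "(\<lambda>_. c) \<in> loc p"
  by (rule locI[OF hom_poly.const[of n c] hom_poly.const[of n 1]]) auto

lemma loc_add [intro]:
  assumes "p \<in> X" "f \<in> loc p" "g \<in> loc p" shows "(\<lambda>q. f q + g q) \<in> loc p"
  using assms(2)
proof (rule locE)
  fix d F G assume 1: "hom_poly n d F" "hom_poly n d G" "G (rep p) \<noteq> 0"
      "eventually (\<lambda>q. f q = F (rep q) / G (rep q)) (near p)"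
  show ?thesis using assms(3)
  proof (rule locE)
    fix e A B assume 2: "hom_poly n e A" "hom_poly n e B" "B (rep p) \<noteq> 0"
      "eventually (\<lambda>q. g q = A (rep q) / B (rep q)) (near p)"
    show ?thesis
    proof (rule locI)
      show "hom_poly n (d+e) (\<lambda>v. F v * B v + A v * G v)" "hom_poly n (d+e) (\<lambda>v. G v * B v)"
        using 1 2 by (auto intro!: hom_poly.add hom_poly_mult' simp: add.commute)
      show "eventually (\<lambda>q. f q + g q =
          (F (rep q) * B (rep q) + A (rep q) * G (rep q)) / (G (rep q) * B (rep q))) (near p)"
        using 1(4) 2(4) eventually_near_basic[OF 1(2) assms(1) 1(3)] eventually_near_basic[OF 2(2) assms(1) 2(3)]
        by eventually_elim (simp add: field_simps)
    qed (use 1 2 in auto)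
  qed
qed

lemma loc_mult [intro]:
  assumes "p \<in> X" "f \<in> loc p" "g \<in> loc p" shows "(\<lambda>q. f q * g q) \<in> loc p"
  using assms(2)
proof (rule locE)
  fix d F G assume 1: "hom_poly n d F" "hom_poly n d G" "G (rep p) \<noteq> 0"
      "eventually (\<lambda>q. f q = F (rep q) / G (rep q)) (near p)"
  show ?thesis using assms(3)
  proof (rule locE)
    fix e A B assume 2: "hom_poly n e A" "hom_poly n e B" "B (rep p) \<noteq> 0"
      "eventually (\<lambda>q. g q = A (rep q) / B (rep q)) (near p)"
    show ?thesis
    proof (rule locI)
      show "hom_poly n (d+e) (\<lambda>v. F v * A v)" "hom_poly n (d+e) (\<lambda>v. G v * B v)"
        using 1 2 by (auto intro!: hom_poly.mult)
      show "eventually (\<lambda>q. f q * g q = (F (rep q) * A (rep q)) / (G (rep q) * B (rep q))) (near p)"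
        using 1(4) 2(4) by eventually_elim simp
    qed (use 1 2 in auto)
  qed
qed

lemma loc_uminus [intro]: "p \<in> X \<Longrightarrow> f \<in> loc p \<Longrightarrow> (\<lambda>q. - f q) \<in> loc p"
  using loc_mult[OF _ loc_const[of "-1"], of p f] by simp

lemma loc_diff [intro]: "p \<in> X \<Longrightarrow> f \<in> loc p \<Longrightarrow> g \<in> loc p \<Longrightarrow> (\<lambda>q. f q - g q) \<in> loc p"
  using loc_add[OF _ _ loc_uminus, of p f g] by simp

lemma loc_power [intro]: "p \<in> X \<Longrightarrow> f \<in> loc p \<Longrightarrow> (\<lambda>q. f q ^ k) \<in> loc p"
  by (induction k) auto

lemma loc_sum [intro]:
  "p \<in> X \<Longrightarrow> (\<And>i. i \<in> I \<Longrightarrow> f i \<in> loc p) \<Longrightarrow> (\<lambda>q. \<Sum>i\<in>I. f i q) \<in> loc p"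
  by (induction I rule: infinite_finite_induct) auto

lemma loc_nonzero_near:
  assumes "p \<in> X" "f \<in> loc p" "f p \<noteq> 0"
  shows "eventually (\<lambda>q. f q \<noteq> 0) (near p)"
  using assms(2)
proof (rule locE)
  fix d F G assume 1: "hom_poly n d F" "hom_poly n d G" "G (rep p) \<noteq> 0"
      "eventually (\<lambda>q. f q = F (rep q) / G (rep q)) (near p)"
  then have "F (rep p) \<noteq> 0" using eventually_near_self[OF assms(1) 1(4)] assms(3) by auto
  from 1(4) eventually_near_basic[OF 1(1) assms(1) this] eventually_near_basic[OF 1(2) assms(1) 1(3)]
  show ?thesis by eventually_elim auto
qed

lemma loc_inverse [intro]:
  assumes "p \<in> X" "f \<in> loc p" "f p \<noteq> 0"
  shows "(\<lambda>q. inverse (f q)) \<in> loc p"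
  using assms(2)
proof (rule locE)
  fix d F G assume 1: "hom_poly n d F" "hom_poly n d G" "G (rep p) \<noteq> 0"
      "eventually (\<lambda>q. f q = F (rep q) / G (rep q)) (near p)"
  then have "F (rep p) \<noteq> 0" using eventually_near_self[OF assms(1) 1(4)] assms(3) by auto
  then show ?thesis
    using 1(4) by (intro locI[OF 1(2,1)]) (auto elim!: eventually_mono)
qed

lemma loc_divide [intro]:
  "p \<in> X \<Longrightarrow> f \<in> loc p \<Longrightarrow> g \<in> loc p \<Longrightarrow> g p \<noteq> 0 \<Longrightarrow> (\<lambda>q. f q / g q) \<in> loc p"
  unfolding divide_inverse by (intro loc_mult loc_inverse)

text \<open>Identity principle: the numerator vanishes on a dense open set, hence on the whole
  irreducible curve. It allows identities between rational functions to be checked generically and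
  then read off at a point.\<close>

lemma loc_gen_zero:
  assumes "p \<in> X" "f \<in> loc p" "eventually (\<lambda>q. f q = 0) gen"
  shows "eventually (\<lambda>q. f q = 0) (near p)"
  using assms(2)
proof (rule locE)
  fix d F G assume 1: "hom_poly n d F" "hom_poly n d G" "G (rep p) \<noteq> 0"
      "eventually (\<lambda>q. f q = F (rep q) / G (rep q)) (near p)"
  have "eventually (\<lambda>q. F (rep q) = 0) gen"
    using assms(3) near_gen[OF assms(1) 1(4)] near_gen[OF assms(1) eventually_near_basic[OF 1(2) assms(1) 1(3)]]
    by eventually_elim auto
  from hom_poly_gen_zero[OF 1(1) this] have "q \<in> X \<Longrightarrow> F (rep q) = 0" for q .
  then show ?thesis using 1(4) eventually_near_in_X[OF assms(1)] by (auto elim: eventually_elim2)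
qed

text \<open>A numerator either vanishes on all of the curve or is nonzero on a dense open set. This
  dichotomy replaces the statement that the local rings are domains.\<close>

lemma loc_zero_or_gen_nonzero:
  assumes "p \<in> X" "f \<in> loc p"
  shows "eventually (\<lambda>q. f q = 0) (near p) \<or> eventually (\<lambda>q. f q \<noteq> 0) gen"
  using assms(2)
proof (rule locE)
  fix d F G assume 1: "hom_poly n d F" "hom_poly n d G" "G (rep p) \<noteq> 0"
      "eventually (\<lambda>q. f q = F (rep q) / G (rep q)) (near p)"
  show ?thesis
  proof (cases "\<forall>q\<in>X. F (rep q) = 0")
    case True
    then show ?thesis using 1(4) eventually_near_in_X[OF assms(1)] by (auto elim: eventually_elim2)
  next
    case False
    then have "eventually (\<lambda>q. F (rep q) \<noteq> 0) gen" using hom_poly_gen_nonzero[OF 1(1)] by blast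
    with near_gen[OF assms(1) 1(4)] near_gen[OF assms(1) eventually_near_basic[OF 1(2) assms(1) 1(3)]]
    have "eventually (\<lambda>q. f q \<noteq> 0) gen" by eventually_elim auto
    then show ?thesis ..
  qed
qed

lemma loc_gen_eq:
  assumes "p \<in> X" "f \<in> loc p" "g \<in> loc p" "eventually (\<lambda>q. f q = g q) gen"
  shows "eventually (\<lambda>q. f q = g q) (near p)" "f p = g p"
proof -
  have "eventually (\<lambda>q. f q - g q = 0) (near p)"
    by (rule loc_gen_zero[OF assms(1)]) (use assms in auto)
  then show "eventually (\<lambda>q. f q = g q) (near p)" by simp
  then show "f p = g p" using eventually_near_self[OF assms(1)] by fast
qed

lemma max_ideal_iff: "p \<in> X \<Longrightarrow> max_ideal n X p = {f \<in> loc p. f p = 0}"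
  unfolding max_ideal_def by (auto simp: loc_iff_regular)

lemma max_ideal_sq_iff:
  assumes "p \<in> X"
  shows "max_ideal_sq n X p = {f. \<exists>(m::nat) a b. (\<forall>j<m. a j \<in> loc p \<and> a j p = 0 \<and> b j \<in> loc p \<and> b j p = 0) \<and>
           eventually (\<lambda>q. f q = (\<Sum>j<m. a j q * b j q)) (near p)}"
  unfolding max_ideal_sq_def max_ideal_iff[OF assms] eventually_near[OF assms]
  by (rule Collect_cong) blast

end

section \<open>Hilbert's basis theorem\<close>

text \<open>Rings are subsets of a ring type, since the polynomial ring will be a set of functions
  on \<open>cvec\<close>, built by adjoining one coordinate at a time.\<close>

definition subring_of :: "'a::comm_ring_1 set \<Rightarrow> bool" where
  "subring_of R \<longleftrightarrow> 1 \<in> R \<and> (\<forall>a\<in>R. \<forall>b\<in>R. a - b \<in> R \<and> a * b \<in> R)"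

lemma subring_ofD:
  assumes "subring_of R"
  shows "1 \<in> R" "0 \<in> R" "a \<in> R \<Longrightarrow> b \<in> R \<Longrightarrow> a - b \<in> R" "a \<in> R \<Longrightarrow> - a \<in> R"
    "a \<in> R \<Longrightarrow> b \<in> R \<Longrightarrow> a + b \<in> R" "a \<in> R \<Longrightarrow> b \<in> R \<Longrightarrow> a * b \<in> R"
proof -
  show *: "1 \<in> R" "a \<in> R \<Longrightarrow> b \<in> R \<Longrightarrow> a - b \<in> R" "a \<in> R \<Longrightarrow> b \<in> R \<Longrightarrow> a * b \<in> R" for a b
    using assms by (auto simp: subring_of_def)
  show 0: "0 \<in> R" using *(2)[OF *(1) *(1)] by simp
  show m: "- a \<in> R" if "a \<in> R" for a using *(2)[OF 0 that] by simp
  show "a \<in> R \<Longrightarrow> b \<in> R \<Longrightarrow> a + b \<in> R" using *(2)[OF _ m, of a b] by simp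
qed

inductive_set rspan :: "'a::comm_ring_1 set \<Rightarrow> 'a set \<Rightarrow> 'a set" for R B where
  zero: "0 \<in> rspan R B"
| step: "r \<in> R \<Longrightarrow> b \<in> B \<Longrightarrow> x \<in> rspan R B \<Longrightarrow> r * b + x \<in> rspan R B"

lemma rspan_add: "x \<in> rspan R B \<Longrightarrow> y \<in> rspan R B \<Longrightarrow> x + y \<in> rspan R B"
  by (induction rule: rspan.induct) (auto simp: add.assoc intro: rspan.intros)

lemma rspan_mult:
  assumes "subring_of R" shows "x \<in> rspan R B \<Longrightarrow> r \<in> R \<Longrightarrow> r * x \<in> rspan R B"
proof (induction rule: rspan.induct)
  case (step s b x)
  then have "(r * s) * b + r * x \<in> rspan R B" using subring_ofD(6)[OF assms] by (intro rspan.step) auto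
  then show ?case by (simp add: algebra_simps)
qed (auto intro: rspan.intros)

lemma rspan_base: "subring_of R \<Longrightarrow> b \<in> B \<Longrightarrow> b \<in> rspan R B"
  using rspan.step[OF subring_ofD(1) _ rspan.zero, of R b B] by simp

lemma rspan_trans:
  assumes "subring_of R" "B \<subseteq> rspan R C" shows "rspan R B \<subseteq> rspan R C"
proof
  fix x assume "x \<in> rspan R B"
  then show "x \<in> rspan R C"
    by induction (use assms in \<open>auto intro!: rspan_add rspan_mult rspan.zero\<close>)
qed

lemma rspan_mono:
  assumes "B \<subseteq> C" shows "rspan R B \<subseteq> rspan R C"
proof
  fix x assume "x \<in> rspan R B"
  then show "x \<in> rspan R C" by induction (use assms in \<open>auto intro: rspan.intros\<close>)
qed

lemma rspan_finite: "x \<in> rspan R B \<Longrightarrow> \<exists>T. finite T \<and> T \<subseteq> B \<and> x \<in> rspan R T"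
proof (induction rule: rspan.induct)
  case zero
  show ?case by (rule exI[of _ "{}"]) (auto intro: rspan.zero)
next
  case (step r b x)
  then obtain T where T: "finite T" "T \<subseteq> B" "x \<in> rspan R T" by blast
  then have "r * b + x \<in> rspan R (insert b T)"
    using step rspan_mono[of T "insert b T" R] by (intro rspan.step) auto
  then show ?case using T step by (intro exI[of _ "insert b T"]) auto
qed

definition is_ideal :: "'a::comm_ring_1 set \<Rightarrow> 'a set \<Rightarrow> bool" where
  "is_ideal R I \<longleftrightarrow> I \<subseteq> R \<and> rspan R I \<subseteq> I"

definition noetherian :: "'a::comm_ring_1 set \<Rightarrow> bool" where
  "noetherian R \<longleftrightarrow> (\<forall>I. is_ideal R I \<longrightarrow> (\<exists>B. finite B \<and> B \<subseteq> I \<and> I \<subseteq> rspan R B))"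

lemma is_idealD:
  assumes "is_ideal R I" "subring_of R"
  shows "0 \<in> I" "x \<in> I \<Longrightarrow> y \<in> I \<Longrightarrow> x + y \<in> I" "r \<in> R \<Longrightarrow> x \<in> I \<Longrightarrow> r * x \<in> I"
    "x \<in> I \<Longrightarrow> y \<in> I \<Longrightarrow> x - y \<in> I"
proof -
  have I: "rspan R I \<subseteq> I" using assms by (simp add: is_ideal_def)
  show "0 \<in> I" using I rspan.zero by blast
  show a: "x \<in> I \<Longrightarrow> y \<in> I \<Longrightarrow> x + y \<in> I" for x y
    using I rspan_add rspan_base[OF assms(2)] by blast
  show m: "r \<in> R \<Longrightarrow> x \<in> I \<Longrightarrow> r * x \<in> I" for r x
    using I rspan_mult[OF assms(2)] rspan_base[OF assms(2)] by blast
  show "x \<in> I \<Longrightarrow> y \<in> I \<Longrightarrow> x - y \<in> I"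
    using a[of x "- y"] m[of "- 1" y] subring_ofD(4)[OF assms(2) subring_ofD(1)[OF assms(2)]] by simp
qed

definition poly_over :: "'a::comm_ring_1 set \<Rightarrow> 'a poly set" where
  "poly_over R = {p. \<forall>i. coeff p i \<in> R}"

text \<open>Evaluation at \<open>x\<close> need not be injective, so arguments by degree have to
  speak about the polynomials and not about their values.\<close>

definition adjoin :: "'a::comm_ring_1 set \<Rightarrow> 'a \<Rightarrow> 'a set" where
  "adjoin R x = (\<lambda>p. poly p x) ` poly_over R"

lemma poly_over_closed:
  assumes "subring_of R"
  shows "0 \<in> poly_over R" "r \<in> R \<Longrightarrow> [:r:] \<in> poly_over R"
    "p \<in> poly_over R \<Longrightarrow> q \<in> poly_over R \<Longrightarrow> p + q \<in> poly_over R"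
    "p \<in> poly_over R \<Longrightarrow> q \<in> poly_over R \<Longrightarrow> p - q \<in> poly_over R"
    "r \<in> R \<Longrightarrow> p \<in> poly_over R \<Longrightarrow> smult r p \<in> poly_over R"
    "p \<in> poly_over R \<Longrightarrow> monom 1 k * p \<in> poly_over R"
    "p \<in> poly_over R \<Longrightarrow> q \<in> poly_over R \<Longrightarrow> p * q \<in> poly_over R"
  using subring_ofD[OF assms]
proof -
  note R = subring_ofD[OF assms]
  show "p \<in> poly_over R \<Longrightarrow> q \<in> poly_over R \<Longrightarrow> p * q \<in> poly_over R"
  proof -
    assume pq: "p \<in> poly_over R" "q \<in> poly_over R"
    have "(\<Sum>i\<in>I. coeff p i * coeff q (k - i)) \<in> R" for k I
      by (induction I rule: infinite_finite_induct) (use pq R in \<open>auto simp: poly_over_def\<close>)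
    then show ?thesis by (simp add: poly_over_def coeff_mult)
  qed
qed (auto simp: poly_over_def coeff_pCons coeff_monom_mult split: nat.split)

lemma subring_adjoin:
  assumes "subring_of R" shows "subring_of (adjoin R x)"
  unfolding subring_of_def
proof (intro conjI ballI)
  show "1 \<in> adjoin R x" unfolding adjoin_def
    using poly_over_closed(2)[OF assms subring_ofD(1)[OF assms]] by (intro image_eqI[of _ _ "[:1:]"]) auto
  fix a b assume "a \<in> adjoin R x" "b \<in> adjoin R x"
  then obtain p q where pq: "a = poly p x" "b = poly q x" "p \<in> poly_over R" "q \<in> poly_over R"
    by (auto simp: adjoin_def)
  show "a - b \<in> adjoin R x" unfolding adjoin_def
    using pq poly_over_closed(4)[OF assms] by (intro image_eqI[of _ _ "p - q"]) auto
  show "a * b \<in> adjoin R x" unfolding adjoin_def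
    using pq poly_over_closed(7)[OF assms] by (intro image_eqI[of _ _ "p * q"]) auto
qed

lemma subset_adjoin: "subring_of R \<Longrightarrow> R \<subseteq> adjoin R x"
proof
  fix r assume "subring_of R" "r \<in> R"
  then show "r \<in> adjoin R x" unfolding adjoin_def
    using poly_over_closed(2)[of R r] by (intro image_eqI[of _ _ "[:r:]"]) auto
qed

lemma self_in_adjoin:
  assumes "subring_of R" shows "x \<in> adjoin R x"
  unfolding adjoin_def
  using poly_over_closed(6)[OF assms poly_over_closed(2)[OF assms subring_ofD(1)[OF assms]], of 1]
  by (intro image_eqI[of _ _ "monom 1 1 * [:1:]"]) (auto simp: poly_monom)

lemma adjoin_least:
  assumes "R \<subseteq> T" "x \<in> T" "0 \<in> T" "\<And>a b. a \<in> T \<Longrightarrow> b \<in> T \<Longrightarrow> a + b \<in> T" "\<And>a b. a \<in> T \<Longrightarrow> b \<in> T \<Longrightarrow> a * b \<in> T"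
  shows "adjoin R x \<subseteq> T"
proof -
  have "poly p x \<in> T" if "p \<in> poly_over R" for p
    using that
  proof (induction p)
    case (pCons a p)
    have "coeff (pCons a p) 0 \<in> R" "\<And>i. coeff (pCons a p) (Suc i) \<in> R"
      using pCons.prems unfolding poly_over_def by blast+
    then have "a \<in> R" "p \<in> poly_over R" by (auto simp: poly_over_def)
    then show ?case using assms pCons.IH by auto
  qed (use assms in auto)
  then show ?thesis by (auto simp: adjoin_def)
qed

lemma hilbert_basis:
  assumes R: "subring_of R" and N: "noetherian R"
  shows "noetherian (adjoin R x)"
  unfolding noetherian_def
proof (intro allI impI)
  fix I assume I: "is_ideal (adjoin R x) I"
  note S = subring_adjoin[OF R, of x]
  note Id = is_idealD[OF I S]
  \<comment> \<open>Leading coefficients in degree \<open>d\<close> of polynomials whose value lies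
    in \<open>I\<close>. The coefficient may be 0, which makes each \<open>L d\<close> an ideal of
    \<open>R\<close>; multiplying by powers of \<open>x\<close> makes the sequence increase.\<close>
  define L where "L d = {a. \<exists>p\<in>poly_over R. (\<forall>i>d. coeff p i = 0) \<and> coeff p d = a \<and> poly p x \<in> I}" for d
  have Lspan: "rspan R (L d) \<subseteq> L d" for d
  proof
    fix a assume "a \<in> rspan R (L d)"
    then show "a \<in> L d"
    proof induction
      case zero
      show ?case unfolding L_def using Id(1) poly_over_closed(1)[OF R] by (auto intro!: bexI[of _ 0])
    next
      case (step r b a)
      then obtain p q where p: "p \<in> poly_over R" "\<forall>i>d. coeff p i = 0" "coeff p d = b" "poly p x \<in> I"
        and q: "q \<in> poly_over R" "\<forall>i>d. coeff q i = 0" "coeff q d = a" "poly q x \<in> I"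
        by (auto simp: L_def)
      have "r * poly p x + poly q x \<in> I"
        using step(1) subset_adjoin[OF R] p(4) q(4) Id(2,3) by blast
      then show ?case unfolding L_def
        using p q step(1) poly_over_closed(3,5)[OF R] by (intro CollectI bexI[of _ "smult r p + q"]) auto
    qed
  qed
  have LR: "L d \<subseteq> R" for d by (auto simp: L_def poly_over_def)
  have idL: "is_ideal R (L d)" for d using Lspan LR by (simp add: is_ideal_def)
  have Lmono: "L d \<subseteq> L (d + k)" for d k
  proof
    fix a assume "a \<in> L d"
    then obtain p where p: "p \<in> poly_over R" "\<forall>i>d. coeff p i = 0" "coeff p d = a" "poly p x \<in> I"
      by (auto simp: L_def)
    have "x ^ k \<in> adjoin R x"
      by (induction k) (use subring_ofD[OF S] self_in_adjoin[OF R] in auto)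
    then have "poly (monom 1 k * p) x \<in> I" using Id(3) p(4) by (simp add: poly_monom)
    then show "a \<in> L (d + k)" unfolding L_def
      using p poly_over_closed(6)[OF R p(1)] by (intro CollectI bexI[of _ "monom 1 k * p"]) (auto simp: coeff_monom_mult)
  qed
  have Lmono': "L d \<subseteq> L e" if "d \<le> e" for d e using Lmono[of d "e - d"] that by simp
  have idLU: "is_ideal R (\<Union>d. L d)"
    unfolding is_ideal_def
  proof
    show "rspan R (\<Union>d. L d) \<subseteq> (\<Union>d. L d)"
    proof
      fix a assume "a \<in> rspan R (\<Union>d. L d)"
      then show "a \<in> (\<Union>d. L d)"
      proof induction
        case zero
        then show ?case using Lspan[of 0] rspan.zero by blast
      next
        case (step r b a)
        then obtain d e where "b \<in> L d" "a \<in> L e" by blast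
        then have "b \<in> L (max d e)" "a \<in> L (max d e)"
          using Lmono'[of d "max d e"] Lmono'[of e "max d e"] by auto
        then have "r * b + a \<in> L (max d e)"
          using is_idealD(2,3)[OF idL R] step(1) by blast
        then show ?case by blast
      qed
    qed
  qed (use LR in blast)
  then obtain B where B: "finite B" "B \<subseteq> (\<Union>d. L d)" "(\<Union>d. L d) \<subseteq> rspan R B"
    using N unfolding noetherian_def by blast
  have "\<exists>D. B \<subseteq> L D" using B(1,2)
  proof (induction B)
    case (insert b B)
    then obtain D d where "B \<subseteq> L D" "b \<in> L d" by auto
    then have "insert b B \<subseteq> L (max D d)" using Lmono'[of D "max D d"] Lmono'[of d "max D d"] by auto
    then show ?case ..
  qed auto
  then obtain D where D: "B \<subseteq> L D" ..
  \<comment> \<open>Finite generation of the union makes the chain of the \<open>L d\<close>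
    stationary from \<open>D\<close> on.\<close>
  have LD: "L d \<subseteq> L D" for d
    using B(3) rspan_mono[OF D, of R] Lspan[of D] by blast
  have "\<forall>d. \<exists>B. finite B \<and> B \<subseteq> L d \<and> L d \<subseteq> rspan R B"
    using N idL unfolding noetherian_def by blast
  then obtain C where C: "\<And>d. finite (C d)" "\<And>d. C d \<subseteq> L d" "\<And>d. L d \<subseteq> rspan R (C d)" by metis
  have "\<forall>d b. \<exists>p. b \<in> L d \<longrightarrow> p \<in> poly_over R \<and> (\<forall>i>d. coeff p i = 0) \<and> coeff p d = b \<and> poly p x \<in> I"
    by (auto simp: L_def)
  then obtain P where P: "\<And>d b. b \<in> L d \<Longrightarrow>
      P d b \<in> poly_over R \<and> (\<forall>i>d. coeff (P d b) i = 0) \<and> coeff (P d b) d = b \<and> poly (P d b) x \<in> I" by metis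
  \<comment> \<open>Lifts of generators of \<open>L 0\<close> up to \<open>L D\<close>; these
    finitely many values will generate \<open>I\<close>.\<close>
  define G where "G = (\<Union>d\<le>D. (\<lambda>b. poly (P d b) x) ` C d)"
  have GI: "G \<subseteq> I" using P C(2) by (fastforce simp: G_def)
  have GspanI: "rspan (adjoin R x) G \<subseteq> I"
    using rspan_mono[OF GI, of "adjoin R x"] I by (auto simp: is_ideal_def)
  have lift: "\<exists>q\<in>poly_over R. (\<forall>i>d. coeff q i = 0) \<and> coeff q d = a \<and> poly q x \<in> rspan (adjoin R x) G"
    if "a \<in> rspan R (C d)" "d \<le> D" for a d
    using that(1)
  proof induction
    case zero
    show ?case using poly_over_closed(1)[OF R] by (auto intro!: bexI[of _ 0] rspan.zero)
  next
    case (step r b a)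
    then obtain q where q: "q \<in> poly_over R" "\<forall>i>d. coeff q i = 0" "coeff q d = a" "poly q x \<in> rspan (adjoin R x) G"
      by blast
    note Pb = P[of b d, OF subsetD[OF C(2) step(2)]]
    have "r * poly (P d b) x + poly q x \<in> rspan (adjoin R x) G"
      using step(1,2) subset_adjoin[OF R] q(4) that(2) by (intro rspan.step) (auto simp: G_def)
    then show ?case
      using q Pb step(1) poly_over_closed(3,5)[OF R]
      by (intro bexI[of _ "smult r (P d b) + q"]) auto
  qed
  \<comment> \<open>Induction on a bound for the degree: subtract a polynomial with value in the
    span and the same top coefficient. Above \<open>D\<close> it is found in degree \<open>D\<close>
    and multiplied by a power of \<open>x\<close>.\<close>
  have main: "poly p x \<in> rspan (adjoin R x) G" if "p \<in> poly_over R" "\<forall>i\<ge>d. coeff p i = 0" "poly p x \<in> I" for p d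
    using that
  proof (induction d arbitrary: p)
    case 0
    then have "p = 0" by (simp add: poly_eq_iff)
    then show ?case by (simp add: rspan.zero)
  next
    case (Suc d)
    have a: "coeff p d \<in> L d" unfolding L_def using Suc.prems by (intro CollectI bexI[of _ p]) auto
    have "\<exists>q\<in>poly_over R. (\<forall>i>d. coeff q i = 0) \<and> coeff q d = coeff p d \<and> poly q x \<in> rspan (adjoin R x) G"
    proof (cases "d \<le> D")
      case True
      then show ?thesis using lift a C(3) by blast
    next
      case False
      then obtain q where q: "q \<in> poly_over R" "\<forall>i>D. coeff q i = 0" "coeff q D = coeff p d"
          "poly q x \<in> rspan (adjoin R x) G"
        using lift[of "coeff p d" D] a LD C(3)[of D] by blast
      have "x ^ k \<in> adjoin R x" for k
        by (induction k) (use subring_ofD[OF S] self_in_adjoin[OF R] in auto)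
      then have "poly (monom 1 (d - D) * q) x \<in> rspan (adjoin R x) G"
        using rspan_mult[OF S q(4)] by (simp add: poly_monom)
      then show ?thesis
        using q False poly_over_closed(6)[OF R q(1)]
        by (intro bexI[of _ "monom 1 (d - D) * q"]) (auto simp: coeff_monom_mult)
    qed
    then obtain q where q: "q \<in> poly_over R" "\<forall>i>d. coeff q i = 0" "coeff q d = coeff p d"
        "poly q x \<in> rspan (adjoin R x) G" by blast
    have "poly (p - q) x \<in> rspan (adjoin R x) G"
    proof (rule Suc.IH)
      show "p - q \<in> poly_over R" using Suc.prems(1) q(1) poly_over_closed(4)[OF R] by blast
      show "\<forall>i\<ge>d. coeff (p - q) i = 0"
      proof (intro allI impI)
        fix i assume "d \<le> i"
        then show "coeff (p - q) i = 0" using Suc.prems(2) q(2,3) by (cases "i = d") auto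
      qed
      show "poly (p - q) x \<in> I" using Id(4) Suc.prems(3) q(4) GspanI by auto
    qed
    then show ?case using rspan_add[OF _ q(4)] by fastforce
  qed
  have "I \<subseteq> rspan (adjoin R x) G"
  proof
    fix y assume y: "y \<in> I"
    then obtain p where p: "p \<in> poly_over R" "y = poly p x" using I by (auto simp: is_ideal_def adjoin_def)
    show "y \<in> rspan (adjoin R x) G"
      using main[of p "Suc (degree p)"] p y by (auto simp: coeff_eq_0)
  qed
  moreover have "finite G" using C(1) by (auto simp: G_def)
  ultimately show "\<exists>B. finite B \<and> B \<subseteq> I \<and> I \<subseteq> rspan (adjoin R x) B" using GI by blast
qed

text \<open>Finitely many generators of the ideal of all \<open>A k\<close> involve only finitely
  many of the \<open>A k\<close>, so the next one is a combination of its predecessors. This is the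
  shape in which Noetherianity is applied.\<close>

lemma noetherian_seq:
  assumes R: "subring_of R" and N: "noetherian R" and A: "\<And>k::nat. A k \<in> R"
  shows "\<exists>K. A K \<in> rspan R (A ` {..<K})"
proof -
  have "rspan R (range A) \<subseteq> R"
  proof
    fix x assume "x \<in> rspan R (range A)"
    then show "x \<in> R" by induction (use subring_ofD[OF R] A in auto)
  qed
  then have "is_ideal R (rspan R (range A))"
    unfolding is_ideal_def using rspan_trans[OF R order_refl] by blast
  then obtain B where B: "finite B" "B \<subseteq> rspan R (range A)" "rspan R (range A) \<subseteq> rspan R B"
    using N unfolding noetherian_def by blast
  have "\<exists>K. B \<subseteq> rspan R (A ` {..<K})" using B(1,2)
  proof (induction B)
    case (insert b B)
    then obtain K where K: "B \<subseteq> rspan R (A ` {..<K})" by blast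
    from insert.prems have "b \<in> rspan R (range A)" by blast
    from rspan_finite[OF this] obtain T where KT: "finite T" "T \<subseteq> range A" "b \<in> rspan R T" by blast
    from finite_subset_image[OF KT(1,2)] obtain J where J: "finite J" "T = A ` J" by blast
    then obtain M where M: "J \<subseteq> {..<M}" using finite_nat_bounded by blast
    have "T \<subseteq> A ` {..<max K M}" "A ` {..<K} \<subseteq> A ` {..<max K M}" using J(2) M by auto
    from rspan_mono[OF this(1), of R] rspan_mono[OF this(2), of R] K KT(3)
    have "insert b B \<subseteq> rspan R (A ` {..<max K M})" by blast
    then show ?case ..
  qed auto
  then obtain K where "B \<subseteq> rspan R (A ` {..<K})" ..
  from rspan_trans[OF R this] B(3) rspan_base[OF R, of "A K" "range A"]
  show ?thesis by blast
qed

text \<open>Polynomial functions in the coordinates below the index, adjoined one by one so that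
  Hilbert's theorem applies at each stage.\<close>

fun polys :: "nat \<Rightarrow> (cvec \<Rightarrow> complex) set" where
  "polys 0 = range (\<lambda>c _. c)"
| "polys (Suc i) = adjoin (polys i) (\<lambda>v. v i)"

lemma subring_polys: "subring_of (polys m)"
proof (induction m)
  case 0
  show ?case by (auto simp: subring_of_def fun_eq_iff image_iff)
qed (auto intro: subring_adjoin)

lemma noetherian_polys: "noetherian (polys m)"
proof (induction m)
  case 0
  show ?case unfolding noetherian_def
  proof (intro allI impI)
    fix I assume I: "is_ideal (polys 0) I"
    show "\<exists>B. finite B \<and> B \<subseteq> I \<and> I \<subseteq> rspan (polys 0) B"
    proof (cases "I \<subseteq> {0}")
      case True
      then have "I \<subseteq> rspan (polys 0) {}" using rspan.zero by auto
      then show ?thesis by blast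
    next
      case False
      then obtain f where f: "f \<in> I" "f \<noteq> 0" by blast
      with I obtain c where c: "f = (\<lambda>_. c)" by (auto simp: is_ideal_def)
      with f have "c \<noteq> 0" by auto
      have "I \<subseteq> rspan (polys 0) {f}"
      proof
        fix g assume "g \<in> I"
        with I obtain d where d: "g = (\<lambda>_. d)" by (auto simp: is_ideal_def)
        have "(\<lambda>_. d / c) * f + 0 \<in> rspan (polys 0) {f}" by (intro rspan.intros) auto
        moreover have "(\<lambda>_. d / c) * f + 0 = g" using \<open>c \<noteq> 0\<close> by (simp add: c d fun_eq_iff)
        ultimately show "g \<in> rspan (polys 0) {f}" by simp
      qed
      then show ?thesis using f(1) by blast
    qed
  qed
next
  case (Suc m)
  then show ?case using hilbert_basis[OF subring_polys] by simp
qed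

lemma polys_mono: "i \<le> j \<Longrightarrow> polys i \<subseteq> polys j"
  by (induction j rule: dec_induct) (use subset_adjoin[OF subring_polys] in auto)

lemma hom_poly_in_polys: "hom_poly n d F \<Longrightarrow> F \<in> polys (Suc n)"
proof (induction rule: hom_poly.induct)
  case (const c)
  then show ?case using polys_mono[of 0 "Suc n"] by (auto simp del: polys.simps(2))
next
  case (var i)
  then show ?case using polys_mono[of "Suc i" "Suc n"] self_in_adjoin[OF subring_polys, of "\<lambda>v. v i" i] by auto
next
  case (add d F G)
  from subring_ofD(5)[OF subring_polys this(3,4)] show ?case by (simp add: plus_fun_def)
next
  case (mult d F e G)
  from subring_ofD(6)[OF subring_polys this(3,4)] show ?case by (simp add: times_fun_def)
qed

lemma hom_poly_noetherian_seq:
  assumes "\<And>k::nat. \<exists>d. hom_poly n d (A k)"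
  obtains K where "A K \<in> rspan (polys (Suc n)) (A ` {..<K})"
proof -
  have "A k \<in> polys (Suc n)" for k using assms[of k] hom_poly_in_polys by blast
  from noetherian_seq[OF subring_polys noetherian_polys, of A, OF this] that show thesis by blast
qed

section \<open>The local rings are discrete valuation rings\<close>

text \<open>Coordinates in the affine chart where coordinate \<open>b\<close> is 1. On these vectors
  a single form of any degree becomes a function of points, so that it has a germ.\<close>

definition nrm :: "nat \<Rightarrow> ppoint \<Rightarrow> cvec" where
  "nrm b q = (\<lambda>i. rep q i / rep q b)"

lemma hom_poly_nrm: "hom_poly n d F \<Longrightarrow> F (nrm b q) = F (rep q) / rep q b ^ d"
  using hom_poly_scale[of n d F "inverse (rep q b)" "rep q"]
  by (simp add: nrm_def cscale_def divide_inverse mult.commute power_inverse)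

lemma nrm_self: "rep q b \<noteq> 0 \<Longrightarrow> nrm b q b = 1"
  by (simp add: nrm_def)

text \<open>The 2 x 2 minors against a nonzero coordinate of \<open>p\<close> have no common zero
  besides \<open>p\<close>.\<close>

lemma separating_form:
  assumes "p \<in> proj_space n" "q \<in> proj_space n" "p \<noteq> q"
  obtains F where "hom_poly n 1 F" "F (rep p) = 0" "F (rep q) \<noteq> 0"
proof -
  obtain b where b: "b \<le> n" "rep p b \<noteq> 0" using rep_coord_nonzero[OF assms(1)] .
  have hp: "hom_poly n 1 (\<lambda>v. rep p b * v i - rep p i * v b)" if "i \<le> n" for i
    using that b by (intro hom_poly_diff hom_poly_cmult hom_poly.var) auto
  show thesis
  proof (cases "rep q b = 0")
    case True
    obtain i where "i \<le> n" "rep q i \<noteq> 0" using rep_coord_nonzero[OF assms(2)] .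
    with True b that[OF hp[of i]] show thesis by auto
  next
    case False
    then obtain i where "i \<le> n" "rep q i / rep q b \<noteq> rep p i / rep p b"
      using point_eqI[OF assms(1,2) b(2)] assms(3) by blast
    with False b that[OF hp[of i]] show thesis by (auto simp: field_simps)
  qed
qed

context curve
begin

lemma eventually_near_neq:
  assumes "p \<in> X" "q \<in> X" "p \<noteq> q"
  shows "eventually (\<lambda>x. x \<noteq> q) (near p)"
proof -
  obtain F where F: "hom_poly n 1 F" "F (rep q) = 0" "F (rep p) \<noteq> 0"
    using separating_form[OF X_proj[OF assms(2)] X_proj[OF assms(1)] assms(3)[symmetric]] .
  from eventually_near_basic[OF F(1) assms(1) F(3)] show ?thesis
    by eventually_elim (use F(2) in auto)
qed

lemma eventually_near_finite:
  assumes "finite S" "p \<in> X"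
  shows "eventually (\<lambda>q. q \<in> S \<longrightarrow> q = p) (near p)"
  using assms(1)
proof (induction S)
  case (insert x S)
  show ?case
  proof (cases "x \<in> X \<and> x \<noteq> p")
    case True
    then have "eventually (\<lambda>y. y \<noteq> x) (near p)" by (intro eventually_near_neq[OF assms(2)]) auto
    with insert(3) show ?thesis by eventually_elim auto
  next
    case False
    from insert(3) eventually_near_in_X[OF assms(2)] show ?thesis
      by eventually_elim (use False in auto)
  qed
qed simp

section \<open>The maximal ideal and its square in affine coordinates\<close>

lemma loc_hom_nrm:
  assumes "p \<in> X" "hom_poly n d F" "b \<le> n" "rep p b \<noteq> 0"
  shows "(\<lambda>q. F (nrm b q)) \<in> loc p"
  unfolding hom_poly_nrm[OF assms(2)]
  by (rule loc_frac[OF assms(1,2) hom_poly_var_power[OF assms(3)]]) (use assms in auto)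

lemma loc_nrm: "p \<in> X \<Longrightarrow> i \<le> n \<Longrightarrow> b \<le> n \<Longrightarrow> rep p b \<noteq> 0 \<Longrightarrow> (\<lambda>q. nrm b q i) \<in> loc p"
  using loc_hom_nrm[OF _ hom_poly.var] by blast

text \<open>The coefficients supplied by Hilbert's theorem are inhomogeneous polynomials; in an
  affine chart they are regular all the same.\<close>

lemma loc_polys_nrm:
  assumes "p \<in> X" "b \<le> n" "rep p b \<noteq> 0" "m \<le> Suc n"
  shows "f \<in> polys m \<Longrightarrow> (\<lambda>q. f (nrm b q)) \<in> loc p"
  using assms(4)
proof (induction m arbitrary: f)
  case (Suc m)
  have "adjoin (polys m) (\<lambda>v. v m) \<subseteq> {f. (\<lambda>q. f (nrm b q)) \<in> loc p}"
    by (rule adjoin_least) (use Suc assms(1) loc_nrm[OF assms(1) _ assms(2,3)] in auto)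
  then show ?case using Suc.prems by auto
qed auto

definition dif :: "nat \<Rightarrow> ppoint \<Rightarrow> nat \<Rightarrow> ppoint \<Rightarrow> complex" where
  "dif b p i q = nrm b q i - nrm b p i"

lemma loc_dif: "p \<in> X \<Longrightarrow> i \<le> n \<Longrightarrow> b \<le> n \<Longrightarrow> rep p b \<noteq> 0 \<Longrightarrow> dif b p i \<in> loc p"
  unfolding dif_def by (intro loc_diff loc_nrm loc_const)

lemma dif_self [simp]: "dif b p i p = 0"
  by (simp add: dif_def)

text \<open>Hadamard's lemma by induction over forms, with the Leibniz splitting in the product
  case. It shows that the coordinate differences generate the maximal ideal.\<close>

lemma hom_poly_dif_expand:
  assumes "p \<in> X" "b \<le> n" "rep p b \<noteq> 0" "hom_poly n d F"
  shows "\<exists>a. (\<forall>i\<le>n. a i \<in> loc p) \<and> (\<forall>q. F (nrm b q) - F (nrm b p) = (\<Sum>i\<le>n. dif b p i q * a i q))"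
  using assms(4)
proof (induction rule: hom_poly.induct)
  case (const c)
  show ?case by (rule exI[of _ "\<lambda>_ _. 0"]) auto
next
  case (var i)
  have "(\<Sum>j\<le>n. dif b p j q * (if j = i then 1 else 0)) = dif b p i q" for q
    using var by (simp add: if_distrib sum.delta cong: if_cong)
  then show ?case by (intro exI[of _ "\<lambda>j _. if j = i then 1 else 0"]) (auto simp: dif_def)
next
  case (add d F G)
  then obtain a a' where a: "\<forall>i\<le>n. a i \<in> loc p" "\<And>q. F (nrm b q) - F (nrm b p) = (\<Sum>i\<le>n. dif b p i q * a i q)"
    "\<forall>i\<le>n. a' i \<in> loc p" "\<And>q. G (nrm b q) - G (nrm b p) = (\<Sum>i\<le>n. dif b p i q * a' i q)" by blast
  show ?case
  proof (intro exI[of _ "\<lambda>i q. a i q + a' i q"] conjI allI impI)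
    show "(\<lambda>q. a i q + a' i q) \<in> loc p" if "i \<le> n" for i using a(1,3) that assms(1) by auto
    fix q
    have "F (nrm b q) + G (nrm b q) - (F (nrm b p) + G (nrm b p)) =
      (F (nrm b q) - F (nrm b p)) + (G (nrm b q) - G (nrm b p))" by simp
    also have "\<dots> = (\<Sum>i\<le>n. dif b p i q * (a i q + a' i q))"
      unfolding a(2,4) by (simp add: distrib_left sum.distrib)
    finally show "F (nrm b q) + G (nrm b q) - (F (nrm b p) + G (nrm b p)) = (\<Sum>i\<le>n. dif b p i q * (a i q + a' i q))" .
  qed
next
  case (mult d F e G)
  then obtain a a' where a: "\<forall>i\<le>n. a i \<in> loc p" "\<And>q. F (nrm b q) - F (nrm b p) = (\<Sum>i\<le>n. dif b p i q * a i q)"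
    "\<forall>i\<le>n. a' i \<in> loc p" "\<And>q. G (nrm b q) - G (nrm b p) = (\<Sum>i\<le>n. dif b p i q * a' i q)" by blast
  have "F (nrm b q) * G (nrm b q) - F (nrm b p) * G (nrm b p) =
        (\<Sum>i\<le>n. dif b p i q * (a i q * G (nrm b q) + F (nrm b p) * a' i q))" for q
  proof -
    have "F (nrm b q) * G (nrm b q) - F (nrm b p) * G (nrm b p) =
       (F (nrm b q) - F (nrm b p)) * G (nrm b q) + F (nrm b p) * (G (nrm b q) - G (nrm b p))"
      by (simp add: algebra_simps)
    also have "\<dots> = (\<Sum>i\<le>n. dif b p i q * (a i q * G (nrm b q) + F (nrm b p) * a' i q))"
      unfolding a(2,4) by (simp add: sum_distrib_left sum_distrib_right sum.distrib algebra_simps)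
    finally show ?thesis .
  qed
  moreover have "(\<lambda>q. a i q * G (nrm b q) + F (nrm b p) * a' i q) \<in> loc p" if "i \<le> n" for i
    using a(1,3) that
    by (intro loc_add loc_mult loc_const loc_hom_nrm[OF assms(1) mult(2) assms(2,3)] assms(1)) auto
  ultimately show ?case by (intro exI[of _ "\<lambda>i q. a i q * G (nrm b q) + F (nrm b p) * a' i q"]) auto
qed

lemma max_ideal_expand:
  assumes "p \<in> X" "b \<le> n" "rep p b \<noteq> 0" "f \<in> loc p" "f p = 0"
  shows "\<exists>a. (\<forall>i\<le>n. a i \<in> loc p) \<and> eventually (\<lambda>q. f q = (\<Sum>i\<le>n. dif b p i q * a i q)) (near p)"
proof -
  obtain d F G where F: "hom_poly n d F" "hom_poly n d G" "G (rep p) \<noteq> 0"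
    and ev: "eventually (\<lambda>q. f q = F (rep q) / G (rep q)) (near p)" using assms(4) by (rule locE)
  have "F (rep p) = 0" using eventually_near_self[OF assms(1) ev] assms(5) F(3) by simp
  then have F0: "F (nrm b p) = 0" by (simp add: hom_poly_nrm[OF F(1)])
  obtain a where a: "\<forall>i\<le>n. a i \<in> loc p" "\<And>q. F (nrm b q) = (\<Sum>i\<le>n. dif b p i q * a i q)"
    using hom_poly_dif_expand[OF assms(1-3) F(1)] unfolding F0 by auto
  have G0: "G (nrm b p) \<noteq> 0" using F(3) assms(3) by (simp add: hom_poly_nrm[OF F(2)])
  show ?thesis
  proof (intro exI[of _ "\<lambda>i q. a i q / G (nrm b q)"] conjI allI impI)
    fix i assume "i \<le> n"
    then show "(\<lambda>q. a i q / G (nrm b q)) \<in> loc p"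
      using a(1) loc_hom_nrm[OF assms(1) F(2) assms(2,3)] G0 assms(1) by (intro loc_divide) auto
  next
    from eventually_near_basic[OF hom_poly.var[OF assms(2)] assms(1,3)] ev
    show "eventually (\<lambda>q. f q = (\<Sum>i\<le>n. dif b p i q * (a i q / G (nrm b q)))) (near p)"
    proof eventually_elim
      case (elim q)
      have "f q = F (nrm b q) / G (nrm b q)"
        using elim by (simp add: hom_poly_nrm[OF F(1)] hom_poly_nrm[OF F(2)])
      then show ?case unfolding a(2) by (simp add: sum_divide_distrib)
    qed
  qed
qed

text \<open>Expanding one factor of each product collects an arbitrary sum of products into
  \<open>n + 1\<close> terms with fixed first factors. In this shape closure under sums and
  multiples is immediate.\<close>

lemma max_ideal_sq_expand:
  assumes "p \<in> X" "b \<le> n" "rep p b \<noteq> 0"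
  shows "f \<in> max_ideal_sq n X p \<longleftrightarrow>
    (\<exists>a. (\<forall>i\<le>n. a i \<in> loc p \<and> a i p = 0) \<and> eventually (\<lambda>q. f q = (\<Sum>i\<le>n. dif b p i q * a i q)) (near p))"
    (is "_ \<longleftrightarrow> ?R")
proof
  assume "f \<in> max_ideal_sq n X p"
  then obtain m :: nat and u w where uw': "\<forall>j<m. u j \<in> loc p \<and> u j p = 0 \<and> w j \<in> loc p \<and> w j p = 0"
    and ev: "eventually (\<lambda>q. f q = (\<Sum>j<m. u j q * w j q)) (near p)"
    unfolding max_ideal_sq_iff[OF assms(1)] mem_Collect_eq by (elim exE conjE)
  then have uw: "u j \<in> loc p \<and> u j p = 0 \<and> w j \<in> loc p \<and> w j p = 0" if "j < m" for j
    using that by simp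
  have "\<exists>a. (\<forall>i\<le>n. a i \<in> loc p) \<and> eventually (\<lambda>q. u j q = (\<Sum>i\<le>n. dif b p i q * a i q)) (near p)"
    if "j < m" for j using max_ideal_expand[OF assms, of "u j"] uw[OF that] by simp
  then have "\<forall>j. \<exists>a. j < m \<longrightarrow> (\<forall>i\<le>n. a i \<in> loc p) \<and> eventually (\<lambda>q. u j q = (\<Sum>i\<le>n. dif b p i q * a i q)) (near p)"
    by simp
  from choice[OF this] obtain a where a: "\<forall>j. j < m \<longrightarrow> (\<forall>i\<le>n. a j i \<in> loc p) \<and>
      eventually (\<lambda>q. u j q = (\<Sum>i\<le>n. dif b p i q * a j i q)) (near p)" ..
  have ev': "eventually (\<lambda>q. \<forall>j\<in>{..<m}. u j q = (\<Sum>i\<le>n. dif b p i q * a j i q)) (near p)"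
    using a by (subst eventually_ball_finite_distrib) auto
  show ?R
  proof (intro exI[of _ "\<lambda>i q. \<Sum>j<m. a j i q * w j q"] conjI allI impI)
    show "(\<lambda>q. \<Sum>j<m. a j i q * w j q) \<in> loc p" if "i \<le> n" for i
      using a uw assms(1) that by (intro loc_sum loc_mult) auto
    show "eventually (\<lambda>q. f q = (\<Sum>i\<le>n. dif b p i q * (\<Sum>j<m. a j i q * w j q))) (near p)"
      using ev ev'
    proof eventually_elim
      case (elim q)
      have "f q = (\<Sum>j<m. (\<Sum>i\<le>n. dif b p i q * a j i q) * w j q)"
        using elim by simp
      also have "\<dots> = (\<Sum>i\<le>n. dif b p i q * (\<Sum>j<m. a j i q * w j q))"
        by (simp add: sum_distrib_left sum_distrib_right mult.assoc) (rule sum.swap)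
      finally show ?case .
    qed
  qed (use uw in auto)
next
  assume ?R
  then obtain a where a: "\<forall>i\<le>n. a i \<in> loc p \<and> a i p = 0"
    "eventually (\<lambda>q. f q = (\<Sum>i\<le>n. dif b p i q * a i q)) (near p)" by blast
  then show "f \<in> max_ideal_sq n X p"
    unfolding max_ideal_sq_iff[OF assms(1)]
    using loc_dif[OF assms(1) _ assms(2,3)]
    by (intro CollectI exI[of _ "Suc n"] exI[of _ "dif b p"] exI[of _ a])
       (auto simp: less_Suc_eq_le lessThan_Suc_atMost)
qed

lemma subspace_max_ideal: "p \<in> X \<Longrightarrow> cfun.subspace (max_ideal n X p)"
  unfolding max_ideal_iff cfun.subspace_def
  by (auto simp: cscale_def zero_fun_def plus_fun_def)

lemma subspace_max_ideal_sq:
  assumes p: "p \<in> X" shows "cfun.subspace (max_ideal_sq n X p)"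
proof -
  obtain b where b: "b \<le> n" "rep p b \<noteq> 0" using rep_coord_nonzero[OF X_proj[OF p]] .
  note W = max_ideal_sq_expand[OF p b]
  show ?thesis
    unfolding cfun.subspace_def
  proof (intro conjI ballI allI)
    show "0 \<in> max_ideal_sq n X p" unfolding W by (rule exI[of _ "\<lambda>_ _. 0"]) auto
    fix f assume "f \<in> max_ideal_sq n X p"
    then obtain a where a: "\<forall>i\<le>n. a i \<in> loc p \<and> a i p = 0"
      "eventually (\<lambda>q. f q = (\<Sum>i\<le>n. dif b p i q * a i q)) (near p)" unfolding W by blast
    fix c show "cscale c f \<in> max_ideal_sq n X p"
      unfolding W using a p
      by (intro exI[of _ "\<lambda>i q. c * a i q"])
         (auto simp: cscale_def sum_distrib_left mult.left_commute elim!: eventually_mono)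
    fix g assume "g \<in> max_ideal_sq n X p"
    then obtain a' where a': "\<forall>i\<le>n. a' i \<in> loc p \<and> a' i p = 0"
      "eventually (\<lambda>q. g q = (\<Sum>i\<le>n. dif b p i q * a' i q)) (near p)" unfolding W by blast
    show "f + g \<in> max_ideal_sq n X p"
      unfolding W using a(1) a'(1) p
      by (intro exI[of _ "\<lambda>i q. a i q + a' i q"] conjI eventually_elim2[OF a(2) a'(2)])
         (auto simp: distrib_left sum.distrib)
  qed
qed

text \<open>Smoothness is used only here: the cotangent spaces have dimension 1.\<close>

lemma cotangent_generator:
  assumes p: "p \<in> X" and b: "b \<le> n" "rep p b \<noteq> 0"
  obtains k where "k \<le> n" "dif b p k \<notin> max_ideal_sq n X p"
    "\<And>f. f \<in> loc p \<Longrightarrow> f p = 0 \<Longrightarrow> \<exists>c. (\<lambda>q. f q - c * dif b p k q) \<in> max_ideal_sq n X p"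
proof -
  let ?V = "max_ideal n X p" and ?W = "max_ideal_sq n X p"
  note W = max_ideal_sq_expand[OF p b]
  note sV = subspace_max_ideal[OF p] and sW = subspace_max_ideal_sq[OF p]
  have V: "?V = {f \<in> loc p. f p = 0}" using max_ideal_iff[OF p] .
  have WV: "?W \<subseteq> ?V"
  proof
    fix f assume "f \<in> ?W"
    then obtain a where a: "\<forall>i\<le>n. a i \<in> loc p \<and> a i p = 0"
      "eventually (\<lambda>q. f q = (\<Sum>i\<le>n. dif b p i q * a i q)) (near p)" unfolding W by blast
    have "(\<lambda>q. \<Sum>i\<le>n. dif b p i q * a i q) \<in> loc p"
      using a(1) loc_dif[OF p _ b] p by (intro loc_sum loc_mult) auto
    then show "f \<in> ?V" unfolding V
      using loc_cong[OF a(2)] eventually_near_self[OF p a(2)] by simp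
  qed
  \<comment> \<open>Replacing the coefficients by their values at \<open>p\<close> changes
    \<open>f\<close> only by an element of the square.\<close>
  have split: "\<exists>a. (\<lambda>q. f q - (\<Sum>i\<le>n. a i * dif b p i q)) \<in> ?W" if f: "f \<in> loc p" "f p = 0" for f
  proof -
    obtain a where a: "\<forall>i\<le>n. a i \<in> loc p"
        "eventually (\<lambda>q. f q = (\<Sum>i\<le>n. dif b p i q * a i q)) (near p)"
      using max_ideal_expand[OF p b f] by blast
    have "(\<lambda>q. f q - (\<Sum>i\<le>n. a i p * dif b p i q)) \<in> ?W"
      unfolding W using a p
      by (intro exI[of _ "\<lambda>i q. a i q - a i p"] conjI eventually_mono[OF a(2)])
         (auto simp: sum_subtractf algebra_simps)
    then show ?thesis by (rule exI[of _ "\<lambda>i. a i p"])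
  qed
  have one: "quot_dim ?V ?W = 1"
    using curve p by (auto simp: smooth_projective_curve_def smooth_variety_def one_enat_def)
  let ?P = "\<lambda>m. \<exists>B. B \<subseteq> ?V \<and> finite B \<and> card B = m \<and> cfun.span (?W \<union> B) = ?V"
  let ?B = "dif b p ` {..n}"
  have BV: "?B \<subseteq> ?V" unfolding V using loc_dif[OF p _ b] by auto
  have "cfun.span (?W \<union> ?B) = ?V"
  proof
    show "cfun.span (?W \<union> ?B) \<subseteq> ?V" using WV BV sV by (intro cfun.span_minimal) auto
    show "?V \<subseteq> cfun.span (?W \<union> ?B)"
    proof
      fix f assume "f \<in> ?V"
      then obtain a where a: "(\<lambda>q. f q - (\<Sum>i\<le>n. a i * dif b p i q)) \<in> ?W" using split V by blast
      have "(\<Sum>i\<le>n. cscale (a i) (dif b p i)) \<in> cfun.span (?W \<union> ?B)"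
        by (intro cfun.span_sum cfun.span_scale cfun.span_base) auto
      moreover have "(\<lambda>q. f q - (\<Sum>i\<le>n. a i * dif b p i q)) \<in> cfun.span (?W \<union> ?B)"
        using a by (intro cfun.span_base) auto
      ultimately have "(\<lambda>q. f q - (\<Sum>i\<le>n. a i * dif b p i q)) + (\<Sum>i\<le>n. cscale (a i) (dif b p i)) \<in> cfun.span (?W \<union> ?B)"
        using cfun.span_add by blast
      moreover have "(\<Sum>i\<le>n. cscale (a i) (dif b p i)) q = (\<Sum>i\<le>n. a i * dif b p i q)" for q
        by (induction n) (auto simp: cscale_def)
      ultimately show "f \<in> cfun.span (?W \<union> ?B)" by (simp add: plus_fun_def)
    qed
  qed
  \<comment> \<open>A finite spanning set has to be exhibited first: only then is the least number
    in \<open>quot_dim\<close> attained, so that the value 1 yields a single generator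
    \<open>t\<close>.\<close>
  then have P: "?P (card ?B)" using BV by blast
  have P1: "?P 1" using LeastI[of ?P, OF P] one unfolding quot_dim_def by simp
  then obtain B where B: "B \<subseteq> ?V" "card B = 1" "cfun.span (?W \<union> B) = ?V" by blast
  then obtain t where "B = {t}" by (meson card_1_singletonE)
  with B have t: "cfun.span (insert t ?W) = ?V" by simp
  have tdec: "\<exists>c. f - cscale c t \<in> ?W" if "f \<in> ?V" for f
  proof -
    have sp: "cfun.span ?W = ?W" using cfun.span_eq_iff[of ?W] sW by blast
    have "\<exists>k. f - cscale k t \<in> cfun.span ?W" using that t cfun.span_breakdown_eq[of f t ?W] by simp
    then show ?thesis unfolding sp .
  qed
  have "\<not> ?V \<subseteq> ?W"
  proof
    assume "?V \<subseteq> ?W"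
    then have "cfun.span ?W = ?V" using WV cfun.span_eq_iff[of ?W] sW by blast
    then have "?P 0" by (intro exI[of _ "{}"]) auto
    then have "quot_dim ?V ?W \<le> 0" unfolding quot_dim_def by (rule Least_le)
    then show False using one by simp
  qed
  then obtain f where f: "f \<in> ?V" "f \<notin> ?W" by blast
  have "\<exists>k\<le>n. dif b p k \<notin> ?W"
  proof (rule ccontr)
    assume *: "\<not> (\<exists>k\<le>n. dif b p k \<notin> ?W)"
    obtain a where a: "(\<lambda>q. f q - (\<Sum>i\<le>n. a i * dif b p i q)) \<in> ?W" using split V f(1) by blast
    have "(\<Sum>i\<le>n. cscale (a i) (dif b p i)) \<in> ?W"
      using * sW by (intro cfun.subspace_sum cfun.subspace_scale) auto
    with a have "(\<lambda>q. f q - (\<Sum>i\<le>n. a i * dif b p i q)) + (\<Sum>i\<le>n. cscale (a i) (dif b p i)) \<in> ?W"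
      using cfun.subspace_add[OF sW] by blast
    moreover have "(\<Sum>i\<le>n. cscale (a i) (dif b p i)) q = (\<Sum>i\<le>n. a i * dif b p i q)" for q
      by (induction n) (auto simp: cscale_def)
    ultimately show False using f(2) by (simp add: plus_fun_def)
  qed
  then obtain k where k: "k \<le> n" "dif b p k \<notin> ?W" by blast
  have "dif b p k \<in> ?V" using BV k by auto
  then obtain c where c: "dif b p k - cscale c t \<in> ?W" using tdec by blast
  \<comment> \<open>Since \<open>dif b p k\<close> is outside the square, it is a nonzero multiple
    of \<open>t\<close> modulo the square and may replace \<open>t\<close> as generator.\<close>
  have "c \<noteq> 0" using c k(2) by (intro notI) simp
  show thesis
  proof (rule that[OF k])
    fix g assume "g \<in> loc p" "g p = 0"
    then obtain e where e: "g - cscale e t \<in> ?W" using tdec V by blast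
    have "(g - cscale e t) - cscale (e / c) (dif b p k - cscale c t) \<in> ?W"
      using cfun.subspace_diff[OF sW e cfun.subspace_scale[OF sW c]] .
    moreover have "(g - cscale e t) - cscale (e / c) (dif b p k - cscale c t) = (\<lambda>q. g q - e / c * dif b p k q)"
      using \<open>c \<noteq> 0\<close> by (auto simp: fun_eq_iff cscale_def algebra_simps)
    ultimately show "\<exists>c. (\<lambda>q. g q - c * dif b p k q) \<in> ?W" by (intro exI[of _ "e / c"]) simp
  qed
qed

text \<open>A generator of the maximal ideal. Lying outside the square keeps its germ from being
  zero, as the zero germ lies in the square.\<close>

definition uniformizer :: "ppoint \<Rightarrow> (ppoint \<Rightarrow> complex) \<Rightarrow> bool" where
  "uniformizer p t \<longleftrightarrow> t \<in> loc p \<and> t p = 0 \<and> t \<notin> max_ideal_sq n X p \<and>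
     (\<forall>f\<in>loc p. f p = 0 \<longrightarrow> (\<exists>a\<in>loc p. eventually (\<lambda>q. f q = t q * a q) (near p)))"

text \<open>Nakayama's lemma, removing the generators \<open>dif b p j\<close> of the maximal ideal one at a time.\<close>

lemma uniformizer_exists:
  assumes p: "p \<in> X" and b: "b \<le> n" "rep p b \<noteq> 0"
  obtains k where "k \<le> n" "uniformizer p (dif b p k)"
proof -
  obtain k where k: "k \<le> n" "dif b p k \<notin> max_ideal_sq n X p"
    and gen: "\<And>f. f \<in> loc p \<Longrightarrow> f p = 0 \<Longrightarrow> \<exists>c. (\<lambda>q. f q - c * dif b p k q) \<in> max_ideal_sq n X p"
    using cotangent_generator[OF p b] by blast
  let ?t = "dif b p k"
  have tl: "?t \<in> loc p" using loc_dif[OF p k(1) b] .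
  \<comment> \<open>\<open>J'\<close> collects the removed indices; once \<open>J\<close> is empty,
    \<open>t\<close> alone generates.\<close>
  have step: "\<exists>a c. a \<in> loc p \<and> (\<forall>j\<in>J. c j \<in> loc p) \<and>
       eventually (\<lambda>q. f q = ?t q * a q + (\<Sum>j\<in>J. dif b p j q * c j q)) (near p)"
    if "finite J'" "J' \<subseteq> {..n}" "J = {..n} - J'" "f \<in> loc p" "f p = 0" for J' J f
    using that
  proof (induction J' arbitrary: J f)
    case empty
    obtain a where a: "\<forall>i\<le>n. a i \<in> loc p" "eventually (\<lambda>q. f q = (\<Sum>i\<le>n. dif b p i q * a i q)) (near p)"
      using max_ideal_expand[OF p b empty.prems(3,4)] by blast
    then show ?case using empty by (intro exI[of _ "\<lambda>_. 0"] exI[of _ a]) auto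
  next
    case (insert m J')
    then have m: "m \<le> n" "m \<notin> J" "finite J" and J: "insert m J = {..n} - J'" by auto
    have IH: "\<exists>a c c'. a \<in> loc p \<and> c' \<in> loc p \<and> (\<forall>j\<in>J. c j \<in> loc p) \<and>
       eventually (\<lambda>q. f q = ?t q * a q + dif b p m q * c' q + (\<Sum>j\<in>J. dif b p j q * c j q)) (near p)"
      if f: "f \<in> loc p" "f p = 0" for f
    proof -
      from insert.IH[OF _ J f] insert.prems obtain a c where ac: "a \<in> loc p" "\<forall>j\<in>insert m J. c j \<in> loc p"
         "eventually (\<lambda>q. f q = ?t q * a q + (\<Sum>j\<in>insert m J. dif b p j q * c j q)) (near p)" by auto
      then show ?thesis using m
        by (intro exI[of _ a] exI[of _ c] exI[of _ "c m"]) (auto elim!: eventually_mono)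
    qed
    have difl: "dif b p i \<in> loc p" if "i \<le> n" for i using loc_dif[OF p that b] .
    have "\<exists>a c c'. a \<in> loc p \<and> c' \<in> loc p \<and> (\<forall>j\<in>J. c j \<in> loc p) \<and>
       eventually (\<lambda>q. dif b p i q = ?t q * a q + dif b p m q * c' q + (\<Sum>j\<in>J. dif b p j q * c j q)) (near p)"
      if "i \<le> n" for i using IH[OF difl[OF that]] by simp
    then have "\<forall>i. \<exists>x. i \<le> n \<longrightarrow> fst x \<in> loc p \<and> snd (snd x) \<in> loc p \<and> (\<forall>j\<in>J. fst (snd x) j \<in> loc p) \<and>
       eventually (\<lambda>q. dif b p i q = ?t q * fst x q + dif b p m q * snd (snd x) q + (\<Sum>j\<in>J. dif b p j q * fst (snd x) j q)) (near p)"
      by simp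
    from choice[OF this] obtain x where x: "\<forall>i. i \<le> n \<longrightarrow> fst (x i) \<in> loc p \<and> snd (snd (x i)) \<in> loc p \<and> (\<forall>j\<in>J. fst (snd (x i)) j \<in> loc p) \<and>
       eventually (\<lambda>q. dif b p i q = ?t q * fst (x i) q + dif b p m q * snd (snd (x i)) q + (\<Sum>j\<in>J. dif b p j q * fst (snd (x i)) j q)) (near p)" ..
    define a where "a i = fst (x i)" for i
    define c where "c i = fst (snd (x i))" for i
    define c' where "c' i = snd (snd (x i))" for i
    have ac: "a i \<in> loc p \<and> c' i \<in> loc p \<and> (\<forall>j\<in>J. c i j \<in> loc p) \<and>
       eventually (\<lambda>q. dif b p i q = ?t q * a i q + dif b p m q * c' i q + (\<Sum>j\<in>J. dif b p j q * c i j q)) (near p)"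
      if "i \<le> n" for i
      using x that unfolding a_def c_def c'_def by blast
    have ev1: "eventually (\<lambda>q. \<forall>i\<in>{..n}. dif b p i q = ?t q * a i q + dif b p m q * c' i q + (\<Sum>j\<in>J. dif b p j q * c i j q)) (near p)"
      using ac by (subst eventually_ball_finite_distrib) auto
    obtain e where "(\<lambda>q. dif b p m q - e * ?t q) \<in> max_ideal_sq n X p" using gen[OF difl[OF m(1)]] by auto
    then obtain r where r: "\<forall>i\<le>n. r i \<in> loc p \<and> r i p = 0"
      "eventually (\<lambda>q. dif b p m q - e * ?t q = (\<Sum>i\<le>n. dif b p i q * r i q)) (near p)"
      unfolding max_ideal_sq_expand[OF p b] by blast
    \<comment> \<open>Substituting the expansions of all \<open>dif b p i\<close> into the relation
      for \<open>dif b p m\<close> makes \<open>dif b p m\<close> appear on both sides. Collected,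
      its coefficient is \<open>u\<close>, a unit because every \<open>r i\<close> vanishes at
      \<open>p\<close>, so the relation can be solved for \<open>dif b p m\<close>.\<close>
    define u where "u = (\<lambda>q. 1 - (\<Sum>i\<le>n. c' i q * r i q))"
    define A where "A = (\<lambda>q. e + (\<Sum>i\<le>n. a i q * r i q))"
    define C where "C = (\<lambda>j q. \<Sum>i\<le>n. c i j q * r i q)"
    have u: "u \<in> loc p" "u p \<noteq> 0" unfolding u_def
      using ac r p by (intro loc_diff loc_const loc_sum loc_mult; auto) (use r in auto)
    have A: "A \<in> loc p" unfolding A_def using ac r p by (intro loc_add loc_const loc_sum loc_mult) auto
    have C: "C j \<in> loc p" if "j \<in> J" for j
      unfolding C_def using ac r p that by (intro loc_sum loc_mult) auto
    have evm: "eventually (\<lambda>q. dif b p m q * u q = ?t q * A q + (\<Sum>j\<in>J. dif b p j q * C j q)) (near p)"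
      using ev1 r(2)
    proof eventually_elim
      case (elim q)
      have "(\<Sum>i\<le>n. dif b p i q * r i q) =
          (\<Sum>i\<le>n. (?t q * a i q + dif b p m q * c' i q + (\<Sum>j\<in>J. dif b p j q * c i j q)) * r i q)"
        by (rule sum.cong[OF refl]) (use elim(1) in simp)
      also have "\<dots> = ?t q * (\<Sum>i\<le>n. a i q * r i q) + dif b p m q * (\<Sum>i\<le>n. c' i q * r i q)
         + (\<Sum>i\<le>n. \<Sum>j\<in>J. dif b p j q * (c i j q * r i q))"
        by (simp add: sum.distrib sum_distrib_left sum_distrib_right distrib_right mult.assoc)
      also have "(\<Sum>i\<le>n. \<Sum>j\<in>J. dif b p j q * (c i j q * r i q)) = (\<Sum>j\<in>J. dif b p j q * C j q)"
        by (subst sum.swap) (simp add: C_def sum_distrib_left)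
      finally show ?case using elim(2) by (simp add: u_def A_def algebra_simps)
    qed
    obtain a0 c0 c1 where f: "a0 \<in> loc p" "c1 \<in> loc p" "\<forall>j\<in>J. c0 j \<in> loc p"
       "eventually (\<lambda>q. f q = ?t q * a0 q + dif b p m q * c1 q + (\<Sum>j\<in>J. dif b p j q * c0 j q)) (near p)"
      using IH[OF insert.prems(3,4)] by blast
    show ?case
    proof (intro exI conjI ballI)
      show "(\<lambda>q. a0 q + A q * (c1 q / u q)) \<in> loc p"
        by (intro loc_add loc_mult loc_divide f A u p)
      show "(\<lambda>q. c0 j q + C j q * (c1 q / u q)) \<in> loc p" if "j \<in> J" for j
        using f(3) C that by (intro loc_add loc_mult loc_divide f(1,2) u p) auto
      show "eventually (\<lambda>q. f q = ?t q * (a0 q + A q * (c1 q / u q)) +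
          (\<Sum>j\<in>J. dif b p j q * (c0 j q + C j q * (c1 q / u q)))) (near p)"
        using f(4) evm loc_nonzero_near[OF p u]
      proof eventually_elim
        case (elim q)
        then have "dif b p m q = (?t q * A q + (\<Sum>j\<in>J. dif b p j q * C j q)) / u q"
          by (simp add: field_simps)
        with elim(1) show ?case
          by (simp add: distrib_left sum.distrib sum_distrib_left sum_distrib_right sum_divide_distrib
              add_divide_distrib distrib_right mult.assoc)
      qed
    qed
  qed
  have "uniformizer p ?t"
    unfolding uniformizer_def
  proof (intro conjI ballI impI tl k(2))
    fix f assume "f \<in> loc p" "f p = 0"
    from step[OF finite_atMost order_refl _ this, of "{}"] obtain a where
      "a \<in> loc p" "eventually (\<lambda>q. f q = ?t q * a q) (near p)" by auto
    then show "\<exists>a\<in>loc p. eventually (\<lambda>q. f q = ?t q * a q) (near p)" by blast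
  qed simp
  with k(1) show thesis by (rule that)
qed


lemma uniformizerD:
  assumes "uniformizer p t"
  shows "t \<in> loc p" "t p = 0" "t \<notin> max_ideal_sq n X p"
    "f \<in> loc p \<Longrightarrow> f p = 0 \<Longrightarrow> \<exists>a\<in>loc p. eventually (\<lambda>q. f q = t q * a q) (near p)"
  using assms unfolding uniformizer_def by blast+

lemma max_ideal_sq_uniformizer:
  assumes p: "p \<in> X" and t: "uniformizer p t"
  shows "f \<in> max_ideal_sq n X p \<longleftrightarrow> (\<exists>a\<in>loc p. eventually (\<lambda>q. f q = t q ^ 2 * a q) (near p))"
proof
  assume "f \<in> max_ideal_sq n X p"
  then obtain m :: nat and u w where uw: "\<forall>j<m. u j \<in> loc p \<and> u j p = 0 \<and> w j \<in> loc p \<and> w j p = 0"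
    and ev: "eventually (\<lambda>q. f q = (\<Sum>j<m. u j q * w j q)) (near p)"
    unfolding max_ideal_sq_iff[OF p] mem_Collect_eq by (elim exE conjE)
  have "\<forall>j. \<exists>a. j < m \<longrightarrow> a \<in> loc p \<and> eventually (\<lambda>q. u j q = t q * a q) (near p)"
    using uw uniformizerD(4)[OF t] by blast
  from choice[OF this] obtain a where
    a: "\<forall>j. j < m \<longrightarrow> a j \<in> loc p \<and> eventually (\<lambda>q. u j q = t q * a j q) (near p)" ..
  have "\<forall>j. \<exists>a. j < m \<longrightarrow> a \<in> loc p \<and> eventually (\<lambda>q. w j q = t q * a q) (near p)"
    using uw uniformizerD(4)[OF t] by blast
  from choice[OF this] obtain c where
    c: "\<forall>j. j < m \<longrightarrow> c j \<in> loc p \<and> eventually (\<lambda>q. w j q = t q * c j q) (near p)" ..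
  have "eventually (\<lambda>q. \<forall>j\<in>{..<m}. u j q = t q * a j q \<and> w j q = t q * c j q) (near p)"
    using a c by (subst eventually_ball_finite_distrib) (auto intro: eventually_conj)
  with ev have "eventually (\<lambda>q. f q = t q ^ 2 * (\<Sum>j<m. a j q * c j q)) (near p)"
    by eventually_elim (auto simp: sum_distrib_left power2_eq_square intro!: sum.cong)
  moreover have "(\<lambda>q. \<Sum>j<m. a j q * c j q) \<in> loc p" using a c p by (intro loc_sum loc_mult) auto
  ultimately show "\<exists>a\<in>loc p. eventually (\<lambda>q. f q = t q ^ 2 * a q) (near p)"
    by (intro bexI[of _ "\<lambda>q. \<Sum>j<m. a j q * c j q"])
next
  assume "\<exists>a\<in>loc p. eventually (\<lambda>q. f q = t q ^ 2 * a q) (near p)"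
  then obtain a where a: "a \<in> loc p" "eventually (\<lambda>q. f q = t q ^ 2 * a q) (near p)" by (elim bexE)
  have "(\<lambda>q. t q * a q) \<in> loc p" using a(1) uniformizerD(1)[OF t] p by (intro loc_mult)
  moreover have "eventually (\<lambda>q. f q = (\<Sum>j<Suc 0. t q * (t q * a q))) (near p)"
    using a(2) by (rule eventually_mono) (simp add: power2_eq_square)
  ultimately show "f \<in> max_ideal_sq n X p"
    unfolding max_ideal_sq_iff[OF p] mem_Collect_eq using uniformizerD(1,2)[OF t]
    by (intro exI[of _ "Suc 0"] exI[of _ "\<lambda>_. t"] exI[of _ "\<lambda>_ q. t q * a q"]) simp
qed

lemma uniformizer_gen_nonzero:
  assumes p: "p \<in> X" and t: "uniformizer p t"
  shows "eventually (\<lambda>q. t q \<noteq> 0) gen"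
proof -
  have "\<not> eventually (\<lambda>q. t q = 0) (near p)"
  proof
    assume "eventually (\<lambda>q. t q = 0) (near p)"
    then have "t \<in> max_ideal_sq n X p"
      unfolding max_ideal_sq_uniformizer[OF p t] by (intro bexI[of _ "\<lambda>_. 0"]) auto
    with uniformizerD(3)[OF t] show False ..
  qed
  with loc_zero_or_gen_nonzero[OF p uniformizerD(1)[OF t]] show ?thesis by blast
qed

text \<open>All coordinate differences are multiples of \<open>t\<close> near \<open>p\<close>, so a
  zero of \<open>t\<close> there has the affine coordinates of \<open>p\<close>.\<close>

lemma uniformizer_near_nonzero:
  assumes p: "p \<in> X" and t: "uniformizer p t"
  shows "eventually (\<lambda>q. q \<noteq> p \<longrightarrow> t q \<noteq> 0) (near p)"
proof -
  obtain b where b: "b \<le> n" "rep p b \<noteq> 0" using rep_coord_nonzero[OF X_proj[OF p]] .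
  have "eventually (\<lambda>q. t q = 0 \<longrightarrow> dif b p i q = 0) (near p)" if i: "i \<le> n" for i
  proof -
    have "\<exists>a\<in>loc p. eventually (\<lambda>q. dif b p i q = t q * a q) (near p)"
      using uniformizerD(4)[OF t loc_dif[OF p i b]] by simp
    then obtain a where "eventually (\<lambda>q. dif b p i q = t q * a q) (near p)" by (elim bexE)
    then show ?thesis by (rule eventually_mono) simp
  qed
  then have "eventually (\<lambda>q. \<forall>i\<in>{..n}. t q = 0 \<longrightarrow> dif b p i q = 0) (near p)"
    by (subst eventually_ball_finite_distrib) auto
  with eventually_near_basic[OF hom_poly.var[OF b(1)] p b(2)] eventually_near_in_X[OF p]
  show ?thesis
  proof eventually_elim
    case (elim q)
    have "p = q" if "t q = 0"
    proof (rule point_eqI[OF X_proj[OF p] X_proj[OF elim(2)] b(2) elim(1)])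
      fix i assume "i \<le> n"
      with elim(3) that show "rep q i / rep q b = rep p i / rep p b" by (simp add: dif_def nrm_def)
    qed
    then show ?case by blast
  qed
qed

text \<open>Some coordinate difference is a uniformizer: it vanishes at \<open>p\<close> but not
  generically. In particular the curve has more than one point.\<close>

lemma gen_neq: "p \<in> X \<Longrightarrow> eventually (\<lambda>q. q \<noteq> p) gen"
proof -
  assume p: "p \<in> X"
  obtain b where b: "b \<le> n" "rep p b \<noteq> 0" using rep_coord_nonzero[OF X_proj[OF p]] .
  obtain k where "uniformizer p (dif b p k)" using uniformizer_exists[OF p b] .
  from uniformizer_gen_nonzero[OF p this] show ?thesis by (rule eventually_mono) auto
qed

lemma gen_not_finite: "finite S \<Longrightarrow> eventually (\<lambda>q. q \<notin> S) gen"
proof (induction S rule: finite_induct)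
  case (insert x S)
  have "eventually (\<lambda>q. q \<noteq> x) gen"
  proof (cases "x \<in> X")
    case False
    from gen_in_X show ?thesis by (rule eventually_mono) (use False in auto)
  qed (rule gen_neq)
  with insert.IH show ?case by eventually_elim auto
qed simp

text \<open>If \<open>f\<close> were divisible by every power of \<open>t\<close>, the successive quotients \<open>u 0, u 1, \<dots>\<close> would
  generate an ideal which is not finitely generated.\<close>

lemma local_factorization:
  assumes p: "p \<in> X" and t: "uniformizer p t" and f: "f \<in> loc p" "\<not> eventually (\<lambda>q. f q = 0) (near p)"
  obtains e u where "u \<in> loc p" "u p \<noteq> 0" "eventually (\<lambda>q. f q = t q ^ e * u q) (near p)"
proof (rule ccontr)
  assume "\<not> thesis"
  with that have no: "u p = 0" if "u \<in> loc p" "eventually (\<lambda>q. f q = t q ^ e * u q) (near p)" for e u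
    using that by blast
  note tl = uniformizerD(1)[OF t]
  let ?P = "\<lambda>k u. u \<in> loc p \<and> eventually (\<lambda>q. f q = t q ^ k * u q) (near p)"
  \<comment> \<open>No quotient is a unit, so division by \<open>t\<close> never stops; dependent
    choice records the whole sequence of quotients.\<close>
  have "\<exists>u. \<forall>k. ?P k (u k) \<and> eventually (\<lambda>q. u k q = t q * u (Suc k) q) (near p)"
  proof (rule dependent_nat_choice)
    show "\<exists>u. ?P 0 u" using f(1) by (intro exI[of _ f]) simp
    fix u k assume u: "?P k u"
    then obtain a where a: "a \<in> loc p" "eventually (\<lambda>q. u q = t q * a q) (near p)"
      using uniformizerD(4)[OF t] no by blast
    from u a(2) have "eventually (\<lambda>q. f q = t q ^ Suc k * a q) (near p)"
      by (auto elim: eventually_elim2)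
    with a show "\<exists>v. ?P (Suc k) v \<and> eventually (\<lambda>q. u q = t q * v q) (near p)" by blast
  qed
  then obtain u where u: "\<forall>k. ?P k (u k) \<and> eventually (\<lambda>q. u k q = t q * u (Suc k) q) (near p)" ..
  have ul: "u k \<in> loc p" and us: "eventually (\<lambda>q. u k q = t q * u (Suc k) q) (near p)" for k
    using u by auto
  have upow: "eventually (\<lambda>q. u i q = t q ^ k * u (i + k) q) (near p)" for i k
  proof (induction k)
    case (Suc k)
    from Suc us[of "i + k"] show ?case by eventually_elim simp
  qed simp
  obtain b where b: "b \<le> n" "rep p b \<noteq> 0" using rep_coord_nonzero[OF X_proj[OF p]] .
  have "\<exists>x. (\<exists>d. hom_poly n d (fst x) \<and> hom_poly n d (snd x)) \<and> snd x (rep p) \<noteq> 0 \<and>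
      eventually (\<lambda>q. u k q = fst x (rep q) / snd x (rep q)) (near p)" for k
    using ul[of k] by (rule locE) auto
  then have "\<forall>k. \<exists>x. (\<exists>d. hom_poly n d (fst x) \<and> hom_poly n d (snd x)) \<and> snd x (rep p) \<noteq> 0 \<and>
      eventually (\<lambda>q. u k q = fst x (rep q) / snd x (rep q)) (near p)" ..
  from choice[OF this] obtain x where x: "\<forall>k. (\<exists>d. hom_poly n d (fst (x k)) \<and> hom_poly n d (snd (x k))) \<and>
      snd (x k) (rep p) \<noteq> 0 \<and> eventually (\<lambda>q. u k q = fst (x k) (rep q) / snd (x k) (rep q)) (near p)" ..
  define A where "A k = fst (x k)" for k
  define B where "B k = snd (x k)" for k
  have AB: "\<exists>d. hom_poly n d (A k) \<and> hom_poly n d (B k)" "B k (rep p) \<noteq> 0"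
      "eventually (\<lambda>q. u k q = A k (rep q) / B k (rep q)) (near p)" for k
    using x unfolding A_def B_def by blast+
  have Bl: "(\<lambda>q. B k (nrm b q)) \<in> loc p" "B k (nrm b p) \<noteq> 0" for k
    using AB(1)[of k] AB(2)[of k] loc_hom_nrm[OF p _ b] b(2) by (auto simp: hom_poly_nrm)
  have ABn: "eventually (\<lambda>q. A k (nrm b q) = u k q * B k (nrm b q)) (near p)" for k
  proof -
    obtain d where d: "hom_poly n d (A k)" "hom_poly n d (B k)" using AB(1) by blast
    from AB(3)[of k] eventually_near_basic[OF d(2) p AB(2)] show ?thesis
      by eventually_elim (simp add: hom_poly_nrm[OF d(1)] hom_poly_nrm[OF d(2)])
  qed
  have "\<exists>d. hom_poly n d (A k)" for k using AB(1) by blast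
  from hom_poly_noetherian_seq[of n A, OF this]
  obtain K where K: "A K \<in> rspan (polys (Suc n)) (A ` {..<K})" .
  \<comment> \<open>An earlier numerator \<open>A i\<close> is \<open>u i * B i\<close>, and
    \<open>u i\<close> is \<open>u K\<close> times a positive power of \<open>t\<close>. So
    everything in the ideal they generate is \<open>t * u K\<close> times a regular
    function.\<close>
  have "\<exists>w\<in>loc p. eventually (\<lambda>q. y (nrm b q) = t q * u K q * w q) (near p)"
    if "y \<in> rspan (polys (Suc n)) (A ` {..<K})" for y
    using that
  proof induction
    case zero
    show ?case by (rule bexI[of _ "\<lambda>_. 0"]) auto
  next
    case (step r a y)
    then obtain i w where i: "a = A i" "i < K" and w: "w \<in> loc p"
      "eventually (\<lambda>q. y (nrm b q) = t q * u K q * w q) (near p)" by blast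
    have ui: "eventually (\<lambda>q. u i q = t q ^ (K - i) * u K q) (near p)"
      using upow[of i "K - i"] i(2) by simp
    have "eventually (\<lambda>q. (r * a + y) (nrm b q) =
          t q * u K q * (r (nrm b q) * (t q ^ (K - i - 1) * B i (nrm b q)) + w q)) (near p)"
      using w(2) ui ABn[of i]
    proof eventually_elim
      case (elim q)
      have "t q ^ (K - i) = t q * t q ^ (K - i - 1)" using i(2) by (metis Suc_diff_Suc diff_Suc_1 diff_diff_left plus_1_eq_Suc add.commute power_Suc)
      with elim show ?case by (simp add: i(1) algebra_simps)
    qed
    moreover have "(\<lambda>q. r (nrm b q) * (t q ^ (K - i - 1) * B i (nrm b q)) + w q) \<in> loc p"
      by (intro loc_add loc_mult loc_power loc_polys_nrm[OF p b order_refl step(1)] p tl Bl w(1))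
    ultimately show ?case by (intro bexI)
  qed
  from this[OF K] obtain w where w: "w \<in> loc p" "eventually (\<lambda>q. A K (nrm b q) = t q * u K q * w q) (near p)" ..
  \<comment> \<open>Also \<open>A K\<close> is \<open>u K * B K\<close>, so \<open>u K\<close> is
    annihilated by \<open>B K - t * w\<close>, which is a unit at \<open>p\<close>. Hence
    \<open>u K\<close>, and with it \<open>f\<close>, vanishes near \<open>p\<close>.\<close>
  have "(\<lambda>q. B K (nrm b q) - t q * w q) \<in> loc p" by (intro loc_diff loc_mult Bl w(1) tl p)
  moreover have "B K (nrm b p) - t p * w p \<noteq> 0" using Bl(2) uniformizerD(2)[OF t] by simp
  ultimately have "eventually (\<lambda>q. B K (nrm b q) - t q * w q \<noteq> 0) (near p)" by (rule loc_nonzero_near[OF p])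
  with w(2) ABn[of K] have "eventually (\<lambda>q. u K q = 0) (near p)"
    by eventually_elim (auto simp: algebra_simps)
  moreover have "eventually (\<lambda>q. f q = t q ^ K * u K q) (near p)" using u by blast
  ultimately have "eventually (\<lambda>q. f q = 0) (near p)" by eventually_elim simp
  with f(2) show False ..
qed

section \<open>Zeros are isolated and finite in number\<close>

lemma zeros_isolated:
  assumes p: "p \<in> X" and f: "f \<in> loc p" "\<not> eventually (\<lambda>q. f q = 0) (near p)"
  shows "eventually (\<lambda>q. q \<noteq> p \<longrightarrow> f q \<noteq> 0) (near p)"
proof -
  obtain b where b: "b \<le> n" "rep p b \<noteq> 0" using rep_coord_nonzero[OF X_proj[OF p]] .
  obtain k where t: "uniformizer p (dif b p k)" using uniformizer_exists[OF p b] .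
  from local_factorization[OF p t f] obtain e u where
    u: "u \<in> loc p" "u p \<noteq> 0" "eventually (\<lambda>q. f q = dif b p k q ^ e * u q) (near p)" .
  from uniformizer_near_nonzero[OF p t] loc_nonzero_near[OF p u(1,2)] u(3)
  show ?thesis by eventually_elim auto
qed

text \<open>Each zero \<open>s k\<close> is isolated, so some form \<open>H k\<close> is nonzero at
  \<open>s k\<close> and kills all other zeros of \<open>F\<close>. Every form in the ideal of the
  earlier \<open>H i\<close> then vanishes at \<open>s K\<close>, while \<open>H K\<close> does not;
  an infinite sequence of zeros contradicts Noetherianity.\<close>

lemma finite_zeros:
  assumes F: "hom_poly n d F" and q0: "q0 \<in> X" "F (rep q0) \<noteq> 0"
  shows "finite {q \<in> X. F (rep q) = 0}"
proof (rule ccontr)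
  assume "infinite {q \<in> X. F (rep q) = 0}"
  then obtain s :: "nat \<Rightarrow> ppoint" where s: "inj s" "range s \<subseteq> {q \<in> X. F (rep q) = 0}"
    using infinite_countable_subset by blast
  have sX: "s k \<in> X" and Fs: "F (rep (s k)) = 0" for k using s(2) by auto
  have "\<exists>H. (\<exists>d. hom_poly n d H) \<and> H (rep (s k)) \<noteq> 0 \<and>
      (\<forall>q\<in>X. H (rep q) \<noteq> 0 \<longrightarrow> q \<noteq> s k \<longrightarrow> F (rep q) \<noteq> 0)" for k
  proof -
    obtain b where b: "b \<le> n" "rep (s k) b \<noteq> 0" using rep_coord_nonzero[OF X_proj[OF sX]] .
    have "eventually (\<lambda>q. F (rep q) \<noteq> 0) gen" by (rule hom_poly_gen_nonzero[OF F q0])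
    have bg: "eventually (\<lambda>q. rep q b \<noteq> 0) (near (s k))"
      by (rule eventually_near_basic[OF hom_poly.var[OF b(1)] sX b(2)])
    have "\<not> eventually (\<lambda>q. F (nrm b q) = 0) (near (s k))"
    proof
      assume "eventually (\<lambda>q. F (nrm b q) = 0) (near (s k))"
      with bg have "eventually (\<lambda>q. F (rep q) = 0) (near (s k))"
        by eventually_elim (simp add: hom_poly_nrm[OF F])
      from near_gen[OF sX this] hom_poly_gen_zero[OF F _ q0(1)] q0(2) show False by blast
    qed
    from zeros_isolated[OF sX loc_hom_nrm[OF sX F b] this] bg
    have "eventually (\<lambda>q. q \<noteq> s k \<longrightarrow> F (rep q) \<noteq> 0) (near (s k))"
      by eventually_elim (simp add: hom_poly_nrm[OF F])
    then obtain U where U: "openin zar U" "s k \<in> U" "\<forall>q\<in>U. q \<noteq> s k \<longrightarrow> F (rep q) \<noteq> 0"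
      using eventually_near[OF sX] by auto
    from openin_zar_obtain_basic[OF U(1,2)] obtain d H where
      "hom_poly n d H" "H (rep (s k)) \<noteq> 0" "\<And>q. q \<in> X \<Longrightarrow> H (rep q) \<noteq> 0 \<Longrightarrow> q \<in> U" by blast
    then show ?thesis using U(3) by (intro exI[of _ H]) blast
  qed
  then have "\<forall>k. \<exists>H. (\<exists>d. hom_poly n d H) \<and> H (rep (s k)) \<noteq> 0 \<and>
      (\<forall>q\<in>X. H (rep q) \<noteq> 0 \<longrightarrow> q \<noteq> s k \<longrightarrow> F (rep q) \<noteq> 0)" ..
  from choice[OF this] obtain H where H: "\<forall>k. (\<exists>d. hom_poly n d (H k)) \<and> H k (rep (s k)) \<noteq> 0 \<and>
      (\<forall>q\<in>X. H k (rep q) \<noteq> 0 \<longrightarrow> q \<noteq> s k \<longrightarrow> F (rep q) \<noteq> 0)" ..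
  have "\<exists>d. hom_poly n d (H k)" for k using H by blast
  from hom_poly_noetherian_seq[of n H, OF this]
  obtain K where K: "H K \<in> rspan (polys (Suc n)) (H ` {..<K})" .
  have "y (rep (s K)) = 0" if "y \<in> rspan (polys (Suc n)) (H ` {..<K})" for y
    using that
  proof induction
    case (step r a y)
    then obtain i where i: "a = H i" "i < K" by blast
    have "s K \<noteq> s i" using i(2) s(1) by (auto dest: injD)
    then have "H i (rep (s K)) = 0" using H sX Fs by blast
    with step i show ?case by simp
  qed simp
  from this[OF K] H show False by blast
qed

lemma finite_Diff_open:
  assumes "openin zar U" "U \<noteq> {}" shows "finite (X - U)"
proof -
  obtain p where p: "p \<in> U" using assms(2) by blast
  from openin_zar_obtain_basic[OF assms(1) p] obtain d H where
    H: "hom_poly n d H" "H (rep p) \<noteq> 0" "\<And>q. q \<in> X \<Longrightarrow> H (rep q) \<noteq> 0 \<Longrightarrow> q \<in> U" by blast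
  have "p \<in> X" using p assms(1) openin_subset_X by blast
  from finite_zeros[OF H(1) this H(2)] show ?thesis
    by (rule finite_subset[rotated]) (use H(3) in blast)
qed

section \<open>Fixed charts and uniformizers; poles of rational functions\<close>

definition bco :: "ppoint \<Rightarrow> nat" where
  "bco p = (SOME b. b \<le> n \<and> rep p b \<noteq> 0)"

lemma bco: assumes "p \<in> X" shows "bco p \<le> n" "rep p (bco p) \<noteq> 0"
proof -
  obtain b where "b \<le> n \<and> rep p b \<noteq> 0" using rep_coord_nonzero[OF X_proj[OF assms]] by blast
  then have "bco p \<le> n \<and> rep p (bco p) \<noteq> 0" unfolding bco_def by (rule someI)
  then show "bco p \<le> n" "rep p (bco p) \<noteq> 0" by auto
qed

text \<open>The uniformizer is picked among the coordinate differences instead of arbitrary germs: a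
  difference is the dehomogenisation of a linear form, which interpolation by forms relies
  on.\<close>

definition kco :: "ppoint \<Rightarrow> nat" where
  "kco p = (SOME k. k \<le> n \<and> uniformizer p (dif (bco p) p k))"

definition unif :: "ppoint \<Rightarrow> ppoint \<Rightarrow> complex" where
  "unif p = dif (bco p) p (kco p)"

lemma unif: assumes "p \<in> X" shows "kco p \<le> n" "uniformizer p (unif p)"
proof -
  obtain k where "k \<le> n" "uniformizer p (dif (bco p) p k)" using uniformizer_exists[OF assms bco[OF assms]] .
  then have "\<exists>k. k \<le> n \<and> uniformizer p (dif (bco p) p k)" by (intro exI conjI)
  from someI_ex[OF this] have "kco p \<le> n \<and> uniformizer p (dif (bco p) p (kco p))" unfolding kco_def .
  then show "kco p \<le> n" "uniformizer p (unif p)" by (auto simp: unif_def)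
qed

lemma loc_unif: "p \<in> X \<Longrightarrow> unif p \<in> loc p"
  using uniformizerD(1)[OF unif(2)] .

lemma loc_gen_fraction:
  assumes "q0 \<in> X" "f \<in> loc q0"
  obtains d F G where "hom_poly n d F" "hom_poly n d G" "G (rep q0) \<noteq> 0"
    "eventually (\<lambda>q. f q = F (rep q) / G (rep q)) gen" "eventually (\<lambda>q. G (rep q) \<noteq> 0) gen"
proof -
  obtain d F G where F: "hom_poly n d F" "hom_poly n d G" "G (rep q0) \<noteq> 0"
    "eventually (\<lambda>q. f q = F (rep q) / G (rep q)) (near q0)" using assms(2) by (rule locE)
  from that[OF F(1-3) near_gen[OF assms(1) F(4)] hom_poly_gen_nonzero[OF F(2) assms(1) F(3)]]
  show thesis .
qed

text \<open>A germ at one point is generically a fraction of two forms. At \<open>z\<close> the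
  denominator is a power of the uniformizer times a unit, and this power clears the pole.\<close>

lemma clear_pole:
  assumes q0: "q0 \<in> X" "f \<in> loc q0" and z: "z \<in> X"
  obtains N w where "w \<in> loc z" "eventually (\<lambda>q. w q = unif z q ^ N * f q) gen"
proof -
  from loc_gen_fraction[OF q0] obtain d F G where
    F: "hom_poly n d F" "hom_poly n d G" "G (rep q0) \<noteq> 0"
    "eventually (\<lambda>q. f q = F (rep q) / G (rep q)) gen" "eventually (\<lambda>q. G (rep q) \<noteq> 0) gen" .
  let ?b = "bco z"
  note b = bco[OF z]
  have bg: "eventually (\<lambda>q. rep q ?b \<noteq> 0) gen" using hom_poly_gen_nonzero[OF hom_poly.var[OF b(1)] z b(2)] .
  have "\<not> eventually (\<lambda>q. G (nrm ?b q) = 0) (near z)"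
  proof
    assume "eventually (\<lambda>q. G (nrm ?b q) = 0) (near z)"
    from near_gen[OF z this] bg F(5) have "eventually (\<lambda>q. False) gen"
      by eventually_elim (simp add: hom_poly_nrm[OF F(2)])
    with gen_not_bot show False by (simp add: trivial_limit_def)
  qed
  from local_factorization[OF z unif(2)[OF z] loc_hom_nrm[OF z F(2) b] this]
  obtain e u where u: "u \<in> loc z" "u z \<noteq> 0" "eventually (\<lambda>q. G (nrm ?b q) = unif z q ^ e * u q) (near z)" .
  have "eventually (\<lambda>q. F (nrm ?b q) / u q = unif z q ^ e * f q) gen"
    using near_gen[OF z u(3)] near_gen[OF z loc_nonzero_near[OF z u(1,2)]] bg F(4,5)
  proof eventually_elim
    case (elim q)
    have f: "f q = F (nrm ?b q) / G (nrm ?b q)"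
      using elim(3-5) by (simp add: hom_poly_nrm[OF F(1)] hom_poly_nrm[OF F(2)])
    have "G (nrm ?b q) \<noteq> 0" using elim(3-5) by (simp add: hom_poly_nrm[OF F(2)])
    then have "unif z q ^ e \<noteq> 0" using elim(1) by auto
    then show ?case unfolding f elim(1) using elim(2) by (simp add: field_simps)
  qed
  moreover have "(\<lambda>q. F (nrm ?b q) / u q) \<in> loc z"
    by (intro loc_divide loc_hom_nrm[OF z F(1) b] u z)
  ultimately show thesis by (rule that[rotated])
qed

text \<open>If \<open>f - c\<close> is not the zero germ, it is generically nonzero; excluding all
  \<open>c\<close> in \<open>R\<close> in this way would leave \<open>f\<close> no generic value.
  With the roots of a polynomial as \<open>R\<close>, a function algebraic over the constants is
  constant.\<close>

lemma loc_finite_values_constant: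
  assumes p: "p \<in> X" and f: "f \<in> loc p" and R: "finite R" and ev: "eventually (\<lambda>q. f q \<in> R) gen"
  obtains c where "c \<in> R" "eventually (\<lambda>q. f q = c) (near p)"
proof (rule ccontr)
  assume "\<not> thesis"
  with that have no: "\<not> eventually (\<lambda>q. f q = c) (near p)" if "c \<in> R" for c using that by blast
  have "eventually (\<lambda>q. f q \<noteq> c) gen" if "c \<in> R" for c
    using loc_zero_or_gen_nonzero[OF p loc_diff[OF p f loc_const[of c]]] no[OF that] by simp
  then have "eventually (\<lambda>q. \<forall>c\<in>R. f q \<noteq> c) gen" using R by (subst eventually_ball_finite_distrib) auto
  with ev have "eventually (\<lambda>q. False) gen" by eventually_elim auto
  with gen_not_bot show False by (simp add: trivial_limit_def)
qed

end

section \<open>Linear algebra modulo a subspace\<close>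

lemma cscale_sum_apply: "(\<Sum>i\<in>I. cscale (c i) (x i)) q = (\<Sum>i\<in>I. c i * x i q)"
  by (induction I rule: infinite_finite_induct) (auto simp: cscale_def)

text \<open>Exchange argument modulo \<open>W\<close>: one vector of \<open>B\<close> is eliminated
  with a pivot \<open>x j\<close>. Counting indices instead of vectors allows repetitions in the
  family.\<close>

lemma linear_relation_mod:
  fixes x :: "'i \<Rightarrow> 'a \<Rightarrow> complex"
  assumes "finite B" and W: "cfun.subspace W" and "finite I" "card B < card I"
    and "\<And>i. i \<in> I \<Longrightarrow> x i \<in> cfun.span (W \<union> B)"
  obtains c where "\<exists>i\<in>I. c i \<noteq> 0" "(\<Sum>i\<in>I. cscale (c i) (x i)) \<in> W"
proof -
  have "\<exists>c. (\<exists>i\<in>I. c i \<noteq> 0) \<and> (\<Sum>i\<in>I. cscale (c i) (x i)) \<in> W"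
    using assms(1,3,4,5)
  proof (induction B arbitrary: I x)
    case empty
    then obtain j where j: "j \<in> I" by (metis card_gt_0_iff card.empty ex_in_conv)
    have sp: "cfun.span W = W" using cfun.span_eq_iff[of W] W by blast
    have "x j \<in> W" using empty(3)[OF j] unfolding Un_empty_right sp .
    moreover have "(\<Sum>i\<in>I. cscale (if i = j then 1 else 0) (x i)) = x j"
      using j empty(1) by (auto simp: fun_eq_iff cscale_sum_apply if_distrib[of "\<lambda>c. c * _"] sum.delta cong: if_cong)
    ultimately show ?case using j by (intro exI[of _ "\<lambda>i. if i = j then 1 else 0"]) auto
  next
    case (insert b B)
    have "\<exists>k. x i - cscale k b \<in> cfun.span (W \<union> B)" if "i \<in> I" for i
      using insert.prems(3)[OF that] cfun.span_breakdown_eq[of "x i" b "W \<union> B"] by simp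
    then obtain a where a: "\<And>i. i \<in> I \<Longrightarrow> x i - cscale (a i) b \<in> cfun.span (W \<union> B)" by metis
    show ?case
    proof (cases "\<forall>i\<in>I. a i = 0")
      case True
      then have "x i \<in> cfun.span (W \<union> B)" if "i \<in> I" for i using a[OF that] that by simp
      then show ?thesis using insert.IH[of I x] insert.prems insert.hyps by simp
    next
      case False
      then obtain j where j: "j \<in> I" "a j \<noteq> 0" by blast
      define y where "y i = x i - cscale (a i / a j) (x j)" for i
      have y: "y i \<in> cfun.span (W \<union> B)" if "i \<in> I" for i
      proof -
        have "(x i - cscale (a i) b) - cscale (a i / a j) (x j - cscale (a j) b) \<in> cfun.span (W \<union> B)"
          by (intro cfun.span_diff cfun.span_scale a that j(1))
        also have "(x i - cscale (a i) b) - cscale (a i / a j) (x j - cscale (a j) b) = y i"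
          using j(2) by (auto simp: fun_eq_iff y_def cscale_def algebra_simps)
        finally show ?thesis .
      qed
      have "card B < card (I - {j})" using insert j(1) by simp
      from insert.IH[of "I - {j}" y, OF _ this] y insert.prems(1) obtain c where
        c: "\<exists>i\<in>I - {j}. c i \<noteq> 0" "(\<Sum>i\<in>I - {j}. cscale (c i) (y i)) \<in> W" by auto
      define s where "s = (\<Sum>i\<in>I - {j}. c i * (a i / a j))"
      define d where "d = (\<lambda>i. if i = j then - s else c i)"
      have "(\<Sum>i\<in>I. cscale (d i) (x i)) = (\<Sum>i\<in>I - {j}. cscale (c i) (y i))"
      proof
        fix q
        have "(\<Sum>i\<in>I. d i * x i q) = d j * x j q + (\<Sum>i\<in>I - {j}. d i * x i q)"
          using insert.prems(1) j(1) by (rule sum.remove)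
        also have "(\<Sum>i\<in>I - {j}. d i * x i q) = (\<Sum>i\<in>I - {j}. c i * x i q)"
          by (rule sum.cong) (auto simp: d_def)
        also have "d j * x j q + (\<Sum>i\<in>I - {j}. c i * x i q) = (\<Sum>i\<in>I - {j}. c i * y i q)"
          by (simp add: d_def s_def y_def cscale_def right_diff_distrib sum_subtractf sum_distrib_right mult.assoc)
        finally show "(\<Sum>i\<in>I. cscale (d i) (x i)) q = (\<Sum>i\<in>I - {j}. cscale (c i) (y i)) q"
          by (simp add: cscale_sum_apply)
      qed
      with c(2) have "(\<Sum>i\<in>I. cscale (d i) (x i)) \<in> W" by simp
      moreover have "\<exists>i\<in>I. d i \<noteq> 0" using c(1) by (auto simp: d_def)
      ultimately show ?thesis by blast
    qed
  qed
  then show thesis using that by blast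
qed

text \<open>Only finiteness, spanning and factorisation of monomials matter, so exponents are not
  recorded.\<close>

fun mons :: "nat \<Rightarrow> nat \<Rightarrow> (cvec \<Rightarrow> complex) set" where
  "mons n 0 = {\<lambda>_. 1}"
| "mons n (Suc d) = (\<Union>i\<le>n. (\<lambda>m v. v i * m v) ` mons n d)"

lemma finite_mons: "finite (mons n d)"
  by (induction d) auto

lemma mons_hom_poly: "m \<in> mons n d \<Longrightarrow> hom_poly n d m"
proof (induction d arbitrary: m)
  case (Suc d)
  then obtain i m' where "i \<le> n" "m' \<in> mons n d" "m = (\<lambda>v. v i * m' v)" by auto
  then show ?case using hom_poly_mult'[OF hom_poly.var[of i n] Suc.IH[of m'], of "Suc d"] by simp
qed (auto intro: hom_poly.const)

lemma mons_mult: "m \<in> mons n d \<Longrightarrow> m' \<in> mons n e \<Longrightarrow> (\<lambda>v. m v * m' v) \<in> mons n (d + e)"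
proof (induction d arbitrary: m)
  case (Suc d)
  then obtain i m0 where m: "i \<le> n" "m0 \<in> mons n d" "m = (\<lambda>v. v i * m0 v)" by auto
  from Suc.IH[OF m(2) Suc.prems(2)] have "(\<lambda>v. v i * (m0 v * m' v)) \<in> mons n (Suc d + e)"
    using m(1) by auto
  then show ?case by (simp add: m(3) mult.assoc)
qed simp

lemma mons_split: "m \<in> mons n (d + e) \<Longrightarrow> \<exists>m1\<in>mons n d. \<exists>m2\<in>mons n e. m = (\<lambda>v. m1 v * m2 v)"
proof (induction d arbitrary: m)
  case (Suc d)
  then obtain i m0 where m: "i \<le> n" "m0 \<in> mons n (d + e)" "m = (\<lambda>v. v i * m0 v)" by auto
  from Suc.IH[OF m(2)] obtain m1 m2 where "m1 \<in> mons n d" "m2 \<in> mons n e" "m0 = (\<lambda>v. m1 v * m2 v)" by blast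
  with m show ?case by (intro bexI[of _ "\<lambda>v. v i * m1 v"] bexI[of _ m2]) (auto simp: mult.assoc)
qed auto

text \<open>The inductive definition of forms multiplies across degrees, which a property linear in
  one fixed degree cannot follow. Such a property is checked on monomials.\<close>

lemma hom_poly_subspace_induct [consumes 1, case_names mon zero add scale]:
  assumes "hom_poly n d F" "\<And>m. m \<in> mons n d \<Longrightarrow> P m" "P (\<lambda>_. 0)"
    "\<And>F G. hom_poly n d F \<Longrightarrow> hom_poly n d G \<Longrightarrow> P F \<Longrightarrow> P G \<Longrightarrow> P (\<lambda>v. F v + G v)"
    "\<And>c F. hom_poly n d F \<Longrightarrow> P F \<Longrightarrow> P (\<lambda>v. c * F v)"
  shows "P F"
proof -
  let ?Q = "\<lambda>d F. F \<in> cfun.span (mons n d)"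
  have "?Q d F" using assms(1)
  proof (induction rule: hom_poly.induct)
    case (const c)
    have "cscale c (\<lambda>_. 1) \<in> cfun.span (mons n 0)" by (intro cfun.span_scale cfun.span_base) auto
    moreover have "cscale c (\<lambda>_. 1) = (\<lambda>_::cvec. c)" by (simp add: cscale_def)
    ultimately show ?case by simp
  next
    case (var i)
    then show ?case by (intro cfun.span_base) auto
  next
    case (add d F G)
    then show ?case using cfun.span_add[of F _ G] by (simp add: plus_fun_def)
  next
    case (mult d F e G)
    have 1: "(\<lambda>v. m v * G v) \<in> cfun.span (mons n (d + e))" if m: "m \<in> mons n d" for m
      using mult(4)
    proof (induction rule: cfun.span_induct_alt)
      case base
      show ?case using cfun.span_zero by (simp add: zero_fun_def)
    next
      case (step c x y)
      have "cscale c (\<lambda>v. m v * x v) + (\<lambda>v. m v * y v) \<in> cfun.span (mons n (d + e))"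
        by (intro cfun.span_add cfun.span_scale cfun.span_base mons_mult m step)
      also have "cscale c (\<lambda>v. m v * x v) + (\<lambda>v. m v * y v) = (\<lambda>v. m v * (cscale c x + y) v)"
        by (simp add: fun_eq_iff cscale_def algebra_simps)
      finally show ?case .
    qed
    show ?case using mult(3)
    proof (induction rule: cfun.span_induct_alt)
      case base
      show ?case using cfun.span_zero by (simp add: zero_fun_def)
    next
      case (step c x y)
      have "cscale c (\<lambda>v. x v * G v) + (\<lambda>v. y v * G v) \<in> cfun.span (mons n (d + e))"
        by (intro cfun.span_add cfun.span_scale 1 step)
      also have "cscale c (\<lambda>v. x v * G v) + (\<lambda>v. y v * G v) = (\<lambda>v. (cscale c x + y) v * G v)"
        by (simp add: fun_eq_iff cscale_def algebra_simps)
      finally show ?case .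
    qed
  qed
  then have "hom_poly n d F \<and> P F"
  proof (induction rule: cfun.span_induct_alt)
    case base
    show ?case using assms(3) hom_poly_zero by (simp add: zero_fun_def)
  next
    case (step c x y)
    note x = mons_hom_poly[OF step(1)] assms(2)[OF step(1)]
    from assms(4)[OF hom_poly_cmult[OF x(1)] conjunct1[OF step(2)] assms(5)[OF x] conjunct2[OF step(2)]]
      hom_poly.add[OF hom_poly_cmult[OF x(1)] conjunct1[OF step(2)]]
    show ?case by (simp add: plus_fun_def cscale_def)
  qed
  then show ?thesis ..
qed

section \<open>The projective Nullstellensatz\<close>

text \<open>A homogeneous ideal, stored by its graded pieces. The degree is carried along because
  the zero function has every degree.\<close>

definition graded_ideal :: "nat \<Rightarrow> (nat \<times> (cvec \<Rightarrow> complex)) set \<Rightarrow> bool" where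
  "graded_ideal n J \<longleftrightarrow>
     (\<forall>d F. (d, F) \<in> J \<longrightarrow> hom_poly n d F) \<and> (\<forall>d. (d, \<lambda>_. 0) \<in> J) \<and>
     (\<forall>d F G. (d, F) \<in> J \<longrightarrow> (d, G) \<in> J \<longrightarrow> (d, \<lambda>v. F v + G v) \<in> J) \<and>
     (\<forall>d e F G. (d, F) \<in> J \<longrightarrow> hom_poly n e G \<longrightarrow> (d + e, \<lambda>v. F v * G v) \<in> J)"

text \<open>An ideal with all forms of one degree has no zero besides the origin. Excluding this
  plays the part that properness plays for affine ideals.\<close>

definition relevant :: "nat \<Rightarrow> (nat \<times> (cvec \<Rightarrow> complex)) set \<Rightarrow> bool" where
  "relevant n J \<longleftrightarrow> (\<forall>N. \<exists>F. hom_poly n N F \<and> (N, F) \<notin> J)"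

lemma not_relevantE:
  assumes "\<not> relevant n J" obtains N where "\<forall>F. hom_poly n N F \<longrightarrow> (N, F) \<in> J"
  using assms unfolding relevant_def by blast

lemma graded_idealD:
  assumes "graded_ideal n J"
  shows "(d, F) \<in> J \<Longrightarrow> hom_poly n d F" "(d, \<lambda>_. 0) \<in> J"
    "(d, F) \<in> J \<Longrightarrow> (d, G) \<in> J \<Longrightarrow> (d, \<lambda>v. F v + G v) \<in> J"
    "(d, F) \<in> J \<Longrightarrow> hom_poly n e G \<Longrightarrow> (d + e, \<lambda>v. F v * G v) \<in> J"
    "(d, F) \<in> J \<Longrightarrow> (d, \<lambda>v. c * F v) \<in> J"
    "(d, F) \<in> J \<Longrightarrow> hom_poly n e G \<Longrightarrow> (e + d, \<lambda>v. G v * F v) \<in> J"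
proof -
  show *: "(d, F) \<in> J \<Longrightarrow> hom_poly n d F" "(d, \<lambda>_. 0) \<in> J"
    "(d, F) \<in> J \<Longrightarrow> (d, G) \<in> J \<Longrightarrow> (d, \<lambda>v. F v + G v) \<in> J"
    "(d, F) \<in> J \<Longrightarrow> hom_poly n e G \<Longrightarrow> (d + e, \<lambda>v. F v * G v) \<in> J" for d e F G
    using assms unfolding graded_ideal_def by simp_all
  show "(d, F) \<in> J \<Longrightarrow> (d, \<lambda>v. c * F v) \<in> J"
    using *(4)[OF _ hom_poly.const[of n c], of d F] by (simp add: mult.commute)
  show "(d, F) \<in> J \<Longrightarrow> hom_poly n e G \<Longrightarrow> (e + d, \<lambda>v. G v * F v) \<in> J"
    using *(4)[of d F e G] by (simp add: mult.commute add.commute)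
qed

lemma graded_ideal_mons:
  assumes "graded_ideal n J" "\<And>m. m \<in> mons n N \<Longrightarrow> (N, m) \<in> J" "hom_poly n N F"
  shows "(N, F) \<in> J"
  using assms(3)
  by (induction rule: hom_poly_subspace_induct) (use graded_idealD[OF assms(1)] assms(2) in auto)

text \<open>Zorn's lemma applies because a degree is spanned by finitely many monomials: if the
  union of a chain contained a whole degree, one of its members would.\<close>

lemma graded_ideal_relevant_maximal:
  assumes "graded_ideal n J" "relevant n J"
  obtains M where "J \<subseteq> M" "graded_ideal n M" "relevant n M"
    "\<And>K. M \<subseteq> K \<Longrightarrow> graded_ideal n K \<Longrightarrow> relevant n K \<Longrightarrow> K = M"
proof -
  let ?A = "{K. J \<subseteq> K \<and> graded_ideal n K \<and> relevant n K}"
  have "\<exists>M\<in>?A. \<forall>K\<in>?A. M \<subseteq> K \<longrightarrow> K = M"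
  proof (rule subset_Zorn_nonempty)
    show "?A \<noteq> {}" using assms by blast
    fix C assume C: "C \<noteq> {}" "subset.chain ?A C"
    have CA: "K \<in> C \<Longrightarrow> J \<subseteq> K \<and> graded_ideal n K \<and> relevant n K" for K
      using C(2) by (auto simp: subset.chain_def)
    note D = graded_idealD[OF CA[THEN conjunct2, THEN conjunct1]]
    have two: "\<exists>K\<in>C. x \<in> K \<and> y \<in> K" if xy: "x \<in> \<Union>C" "y \<in> \<Union>C" for x y
    proof -
      obtain K K' where "K \<in> C" "x \<in> K" "K' \<in> C" "y \<in> K'" using xy by blast
      then show ?thesis using C(2) unfolding subset.chain_def by blast
    qed
    have "graded_ideal n (\<Union>C)"
      unfolding graded_ideal_def
    proof (intro conjI allI impI)
      fix d e F G
      show "(d, F) \<in> \<Union>C \<Longrightarrow> hom_poly n d F" using D(1) by blast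
      show "(d, \<lambda>_. 0) \<in> \<Union>C" using C(1) D(2) by blast
      show "(d, \<lambda>v. F v + G v) \<in> \<Union>C" if "(d, F) \<in> \<Union>C" "(d, G) \<in> \<Union>C"
        using two[OF that] D(3) by blast
      show "(d + e, \<lambda>v. F v * G v) \<in> \<Union>C" if "(d, F) \<in> \<Union>C" "hom_poly n e G"
        using that D(4) by blast
    qed
    moreover have "relevant n (\<Union>C)"
    proof (rule ccontr)
      assume "\<not> relevant n (\<Union>C)"
      then obtain N where N: "\<forall>F. hom_poly n N F \<longrightarrow> (N, F) \<in> \<Union>C" by (rule not_relevantE)
      have sub: "Pair N ` mons n N \<subseteq> \<Union>C" using N mons_hom_poly by blast
      obtain K where K: "K \<in> C" "Pair N ` mons n N \<subseteq> K"
        by (rule finite_subset_Union_chain[OF finite_imageI[OF finite_mons] sub C])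
      have "graded_ideal n K" using CA[OF K(1)] by blast
      from graded_ideal_mons[OF this, of N] K(2) have "(N, F) \<in> K" if "hom_poly n N F" for F
        using that by blast
      with CA[OF K(1)] show False unfolding relevant_def by blast
    qed
    moreover have "J \<subseteq> \<Union>C" using C(1) CA by blast
    ultimately show "\<Union>C \<in> ?A" by blast
  qed
  then obtain M where "M \<in> ?A" "\<forall>K\<in>?A. M \<subseteq> K \<longrightarrow> K = M" ..
  then show thesis using that[of M] by blast
qed

text \<open>This is \<open>l ^ R * p (x / l)\<close> when \<open>l\<close> is nonzero and
  \<open>R\<close> is at least the degree of \<open>p\<close>. \<open>R\<close> is a separate
  argument because the relations below live in one prescribed degree.\<close>

definition homogenization :: "complex poly \<Rightarrow> nat \<Rightarrow> complex \<Rightarrow> complex \<Rightarrow> complex" where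
  "homogenization p R x l = (\<Sum>k\<le>R. coeff p k * (x ^ k * l ^ (R - k)))"

lemma homogenization_mult_linear:
  assumes "degree q \<le> R"
  shows "homogenization ([:-c, 1:] * q) (Suc R) x l = (x - c * l) * homogenization q R x l"
proof -
  have "homogenization ([:-c, 1:] * q) (Suc R) x l =
     (\<Sum>k\<le>Suc R. coeff (pCons 0 q) k * (x ^ k * l ^ (Suc R - k))) - c * (\<Sum>k\<le>Suc R. coeff q k * (x ^ k * l ^ (Suc R - k)))"
    by (simp add: homogenization_def sum_subtractf sum_distrib_left algebra_simps del: sum.atMost_Suc)
  also have "(\<Sum>k\<le>Suc R. coeff (pCons 0 q) k * (x ^ k * l ^ (Suc R - k))) = x * homogenization q R x l"
    unfolding sum.atMost_Suc_shift homogenization_def by (simp add: sum_distrib_left mult.left_commute mult.assoc)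
  also have "(\<Sum>k\<le>Suc R. coeff q k * (x ^ k * l ^ (Suc R - k))) = l * homogenization q R x l"
    using assms by (simp add: homogenization_def coeff_eq_0 sum_distrib_left Suc_diff_le mult.left_commute)
  finally show ?thesis by (simp add: algebra_simps)
qed

text \<open>
  For a maximal relevant ideal \<open>M\<close> and a variable \<open>l\<close> outside \<open>M\<close>, multiplication by \<open>l\<close> is eventually onto
  modulo \<open>M\<close>, so the graded pieces of the quotient have bounded dimension.  Hence every variable \<open>x\<close>
  satisfies a homogeneous polynomial relation with \<open>l\<close>, and one of its linear factors \<open>x - c l\<close> lies in \<open>M\<close>.
\<close>

theorem projective_nullstellensatz:
  assumes "graded_ideal n J" "relevant n J"
  obtains c where "\<exists>i\<le>n. c i \<noteq> 0" "\<And>i. i > n \<Longrightarrow> c i = 0" "\<And>d F. (d, F) \<in> J \<Longrightarrow> F c = 0"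
proof -
  obtain M where JM: "J \<subseteq> M" and M: "graded_ideal n M" "relevant n M"
    and max: "\<And>K. M \<subseteq> K \<Longrightarrow> graded_ideal n K \<Longrightarrow> relevant n K \<Longrightarrow> K = M"
    using graded_ideal_relevant_maximal[OF assms] by blast
  note D = graded_idealD[OF M(1)]
  \<comment> \<open>Adding \<open>a\<close> to \<open>M\<close> gives a strictly larger graded ideal
    \<open>K\<close>. By maximality it is not relevant, so in some degree it contains every
    form.\<close>
  have absorb: "\<exists>j. \<forall>F. hom_poly n (d + j) F \<longrightarrow>
      (\<exists>m g. (d + j, m) \<in> M \<and> hom_poly n j g \<and> F = (\<lambda>v. m v + a v * g v))"
    if a: "hom_poly n d a" "(d, a) \<notin> M" for d a
  proof -
    define K where "K = M \<union> {(d + j, \<lambda>v. m v + a v * g v) | j m g. (d + j, m) \<in> M \<and> hom_poly n j g}"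
    have KI: "(d + j, \<lambda>v. m v + a v * g v) \<in> K" if "(d + j, m) \<in> M" "hom_poly n j g" for j m g
      using that unfolding K_def by blast
    have "graded_ideal n K"
      unfolding graded_ideal_def
    proof (intro conjI allI impI)
      fix k e F G
      show "hom_poly n k F" if "(k, F) \<in> K"
        using that D(1) unfolding K_def by (auto intro!: hom_poly.add hom_poly_mult' a(1))
      show "(k, \<lambda>_. 0) \<in> K" using D(2) by (simp add: K_def)
      show "(k, \<lambda>v. F v + G v) \<in> K" if FG: "(k, F) \<in> K" "(k, G) \<in> K"
      proof (cases "(k, F) \<in> M \<and> (k, G) \<in> M")
        case False
        have *: "\<exists>m g. (k, m) \<in> M \<and> hom_poly n (k - d) g \<and> F = (\<lambda>v. m v + a v * g v)" if "(k, F) \<in> K" for F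
        proof (cases "(k, F) \<in> M")
          case True
          then show ?thesis by (intro exI[of _ F] exI[of _ "\<lambda>_. 0"]) (auto intro: hom_poly_zero)
        next
          case F: False
          with that obtain j m g where "k = d + j" "(d + j, m) \<in> M" "hom_poly n j g" "F = (\<lambda>v. m v + a v * g v)"
            by (auto simp: K_def)
          then show ?thesis by (intro exI[of _ m] exI[of _ g]) simp
        qed
        have k: "k = d + (k - d)" using False FG unfolding K_def by auto
        obtain m g where 1: "(k, m) \<in> M" "hom_poly n (k - d) g" "F = (\<lambda>v. m v + a v * g v)"
          using *[OF FG(1)] by blast
        obtain m' g' where 2: "(k, m') \<in> M" "hom_poly n (k - d) g'" "G = (\<lambda>v. m' v + a v * g' v)"
          using *[OF FG(2)] by blast
        have "(\<lambda>v. F v + G v) = (\<lambda>v. (m v + m' v) + a v * (g v + g' v))"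
          by (simp add: 1(3) 2(3) algebra_simps)
        moreover have "(d + (k - d), \<lambda>v. (m v + m' v) + a v * (g v + g' v)) \<in> K"
          by (rule KI[OF _ hom_poly.add[OF 1(2) 2(2)]]) (use D(3)[OF 1(1) 2(1)] k in simp)
        ultimately show ?thesis using k by simp
      qed (use D(3) in \<open>auto simp: K_def\<close>)
      show "(k + e, \<lambda>v. F v * G v) \<in> K" if F: "(k, F) \<in> K" and G: "hom_poly n e G"
      proof (cases "(k, F) \<in> M")
        case True
        then show ?thesis using D(4) G by (auto simp: K_def)
      next
        case False
        with F obtain j m g where j: "k = d + j" "(d + j, m) \<in> M" "hom_poly n j g" "F = (\<lambda>v. m v + a v * g v)"
          by (auto simp: K_def)
        have "(d + (j + e), \<lambda>v. m v * G v + a v * (g v * G v)) \<in> K"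
          by (rule KI[OF _ hom_poly.mult[OF j(3) G]]) (use D(4)[OF j(2) G] in \<open>simp add: add.assoc\<close>)
        then show ?thesis by (simp add: j(1,4) add.assoc algebra_simps)
      qed
    qed
    moreover have "K \<noteq> M"
    proof -
      have "(d + 0, \<lambda>v. 0 + a v * 1) \<in> K"
        by (rule KI[OF _ hom_poly.const[of n 1]]) (use D(2) in simp)
      then show ?thesis using a(2) by auto
    qed
    moreover have "M \<subseteq> K" by (auto simp: K_def)
    ultimately have "\<not> relevant n K" using max by blast
    then obtain N where N': "\<forall>F. hom_poly n N F \<longrightarrow> (N, F) \<in> K" by (rule not_relevantE)
    note N = N'[rule_format]
    \<comment> \<open>A form of degree \<open>N\<close> outside \<open>M\<close> must come from the
      new part of \<open>K\<close>, which shows that \<open>N\<close> is at least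
      \<open>d\<close>.\<close>
    obtain F0 where F0: "hom_poly n N F0" "(N, F0) \<notin> M" using M(2) unfolding relevant_def by blast
    from N[OF F0(1)] F0(2) obtain j where j: "N = d + j" by (auto simp: K_def)
    have "\<exists>m g. (d + j, m) \<in> M \<and> hom_poly n j g \<and> F = (\<lambda>v. m v + a v * g v)" if F: "hom_poly n (d + j) F" for F
    proof (cases "(N, F) \<in> M")
      case True
      then show ?thesis using j by (intro exI[of _ F] exI[of _ "\<lambda>_. 0"]) (auto intro: hom_poly_zero)
    next
      case False
      with N[of F] F j obtain j' m g where *: "N = d + j'" "(d + j', m) \<in> M" "hom_poly n j' g" "F = (\<lambda>v. m v + a v * g v)"
        by (auto simp: K_def)
      then have "j' = j" using j by simp
      with * show ?thesis by (intro exI[of _ m] exI[of _ g]) simp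
    qed
    then show ?thesis by blast
  qed
  \<comment> \<open>With both factors outside \<open>M\<close>, every monomial of the sum of the two
    absorbing degrees splits into factors whose product lies in \<open>M\<close>; then
    \<open>M\<close> would not be relevant.\<close>
  have prime: "(d, a) \<in> M \<or> (e, b) \<in> M" if ab: "hom_poly n d a" "hom_poly n e b" "(d + e, \<lambda>v. a v * b v) \<in> M" for d e a b
  proof (rule ccontr)
    assume *: "\<not> ((d, a) \<in> M \<or> (e, b) \<in> M)"
    from absorb[OF ab(1)] * obtain i where i: "\<And>F. hom_poly n (d + i) F \<Longrightarrow>
      (\<exists>m g. (d + i, m) \<in> M \<and> hom_poly n i g \<and> F = (\<lambda>v. m v + a v * g v))" by blast
    from absorb[OF ab(2)] * obtain j where j: "\<And>F. hom_poly n (e + j) F \<Longrightarrow>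
      (\<exists>m g. (e + j, m) \<in> M \<and> hom_poly n j g \<and> F = (\<lambda>v. m v + b v * g v))" by blast
    let ?N = "(d + i) + (e + j)"
    have "(?N, x) \<in> M" if xm: "x \<in> mons n ?N" for x
    proof -
      obtain m1 m2 where m: "m1 \<in> mons n (d + i)" "m2 \<in> mons n (e + j)" "x = (\<lambda>v. m1 v * m2 v)"
        using mons_split[OF xm] by blast
      obtain y g where y: "(d + i, y) \<in> M" "hom_poly n i g" "m1 = (\<lambda>v. y v + a v * g v)"
        using i[OF mons_hom_poly[OF m(1)]] by blast
      obtain z h where z: "(e + j, z) \<in> M" "hom_poly n j h" "m2 = (\<lambda>v. z v + b v * h v)"
        using j[OF mons_hom_poly[OF m(2)]] by blast
      have 1: "(?N, \<lambda>v. y v * m2 v) \<in> M" using D(4)[OF y(1) mons_hom_poly[OF m(2)]] .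
      have "hom_poly n (d + i) (\<lambda>v. a v * g v)" using hom_poly.mult[OF ab(1) y(2)] .
      from D(6)[OF z(1) this] have 2: "(?N, \<lambda>v. a v * g v * z v) \<in> M" .
      from D(4)[OF ab(3) hom_poly.mult[OF y(2) z(2)]]
      have 3: "(?N, \<lambda>v. a v * b v * (g v * h v)) \<in> M" by (simp add: add_ac)
      have "x = (\<lambda>v. y v * m2 v + (a v * g v * z v + a v * b v * (g v * h v)))"
        by (simp add: m(3) y(3) z(3) algebra_simps)
      then show ?thesis using D(3)[OF 1 D(3)[OF 2 3]] by simp
    qed
    then have "(?N, F) \<in> M" if "hom_poly n ?N F" for F
      using graded_ideal_mons[OF M(1) _ that] by blast
    then show False using M(2) unfolding relevant_def by blast
  qed
  have one: "(0, \<lambda>_. c) \<notin> M" if "c \<noteq> 0" for c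
  proof
    assume "(0, \<lambda>_. c) \<in> M"
    from D(5)[OF this, of "1/c"] that have "(0, \<lambda>_. 1) \<in> M" by simp
    from D(4)[OF this] have "(N, F) \<in> M" if "hom_poly n N F" for N F using that by simp
    then show False using M(2) unfolding relevant_def by blast
  qed
  have "\<exists>a\<le>n. (1, \<lambda>v. v a) \<notin> M"
  proof (rule ccontr)
    assume "\<not> ?thesis"
    then have "(1, m) \<in> M" if "m \<in> mons n 1" for m using that by auto
    from graded_ideal_mons[OF M(1) this] show False using M(2) unfolding relevant_def by blast
  qed
  then obtain a where a: "a \<le> n" "(1, \<lambda>v. v a) \<notin> M" by blast
  note va = hom_poly.var[OF a(1)]
  from absorb[OF va a(2)] obtain N where N: "\<And>F. hom_poly n (1 + N) F \<Longrightarrow>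
      (\<exists>m g. (1 + N, m) \<in> M \<and> hom_poly n N g \<and> F = (\<lambda>v. m v + v a * g v))" by blast
  \<comment> \<open>Absorption by \<open>v a\<close>, iterated: modulo \<open>M\<close> every form
    of degree \<open>N + k\<close> is \<open>v a ^ k\<close> times a form of degree
    \<open>N\<close>, so the graded pieces of the quotient have dimension at most
    \<open>card (mons n N)\<close> from degree \<open>N\<close> on.\<close>
  have red: "\<exists>m g. (N + k, m) \<in> M \<and> hom_poly n N g \<and> F = (\<lambda>v. m v + v a ^ k * g v)"
    if "hom_poly n (N + k) F" for k F
    using that
  proof (induction k arbitrary: F)
    case 0
    then show ?case using D(2) by (intro exI[of _ "\<lambda>_. 0"] exI[of _ F]) auto
  next
    case (Suc k)
    from Suc.prems show ?case
    proof (induction rule: hom_poly_subspace_induct)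
      case (mon m)
      then obtain i m' where m: "i \<le> n" "m' \<in> mons n (N + k)" "m = (\<lambda>v. v i * m' v)" by auto
      from Suc.IH[OF mons_hom_poly[OF m(2)]] obtain y g where
        y: "(N + k, y) \<in> M" "hom_poly n N g" "m' = (\<lambda>v. y v + v a ^ k * g v)" by blast
      from N[OF hom_poly.mult[OF hom_poly.var[OF m(1)] y(2)]] obtain z h where
        z: "(1 + N, z) \<in> M" "hom_poly n N h" "(\<lambda>v. v i * g v) = (\<lambda>v. z v + v a * h v)" by blast
      from D(6)[OF y(1) hom_poly.var[OF m(1)]] have 1: "(N + Suc k, \<lambda>v. v i * y v) \<in> M" by simp
      from D(6)[OF z(1) hom_poly_var_power[OF a(1)], of k] have 2: "(N + Suc k, \<lambda>v. v a ^ k * z v) \<in> M"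
        by (simp add: add_ac)
      have "m v = (v i * y v + v a ^ k * z v) + v a ^ Suc k * h v" for v
      proof -
        have "m v = v i * y v + v a ^ k * (v i * g v)" by (simp add: m(3) y(3) algebra_simps)
        also have "v i * g v = z v + v a * h v" using fun_cong[OF z(3)] .
        finally show ?thesis by (simp add: algebra_simps)
      qed
      then show ?case using D(3)[OF 1 2] z(2) by (intro exI conjI) (assumption, assumption, blast)
    next
      case zero
      show ?case using D(2) hom_poly_zero[of n N] by (intro exI[of _ "\<lambda>_. 0"]) auto
    next
      case (add F G)
      then obtain m g m' g' where 1: "(N + Suc k, m) \<in> M" "hom_poly n N g" "F = (\<lambda>v. m v + v a ^ Suc k * g v)"
         "(N + Suc k, m') \<in> M" "hom_poly n N g'" "G = (\<lambda>v. m' v + v a ^ Suc k * g' v)" by blast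
      then show ?case using D(3)[OF 1(1,4)] hom_poly.add[OF 1(2,5)]
        by (intro exI[of _ "\<lambda>v. m v + m' v"] exI[of _ "\<lambda>v. g v + g' v"]) (auto simp: algebra_simps)
    next
      case (scale c F)
      then obtain m g where 1: "(N + Suc k, m) \<in> M" "hom_poly n N g" "F = (\<lambda>v. m v + v a ^ Suc k * g v)" by blast
      then show ?case using D(5)[OF 1(1)] hom_poly_cmult[OF 1(2)]
        by (intro exI[of _ "\<lambda>v. c * m v"] exI[of _ "\<lambda>v. c * g v"]) (auto simp: algebra_simps)
    qed
  qed
  \<comment> \<open>Over the complex numbers the binary form splits into linear factors. Primeness
    puts one of them into \<open>M\<close>, unless only a power of \<open>v a\<close> is left, which
    cannot lie in \<open>M\<close>.\<close>
  have root: "\<exists>c. (1, \<lambda>v. v i - c * v a) \<in> M"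
    if "i \<le> n" "p \<noteq> 0" "degree p \<le> R" "(R, \<lambda>v. homogenization p R (v i) (v a)) \<in> M" for i p R
    using that(2-4)
  proof (induction "degree p" arbitrary: p R)
    case 0
    have eq: "(\<lambda>v. homogenization p R (v i) (v a)) = (\<lambda>v. coeff p 0 * v a ^ R)"
      unfolding homogenization_def fun_eq_iff
      using 0 by (auto simp: coeff_eq_0 intro!: sum.neutral simp: sum.atMost_shift)
    have c0: "coeff p 0 \<noteq> 0" using 0 by (metis leading_coeff_0_iff)
    have np: "(k, \<lambda>v. v a ^ k) \<notin> M" for k
    proof (induction k)
      case 0
      then show ?case using one[of 1] by simp
    next
      case (Suc k)
      then show ?case using prime[OF va hom_poly_var_power[OF a(1), of k]] a(2) by auto
    qed
    from D(5)[OF 0(4)[unfolded eq], of "1 / coeff p 0"] c0 np show ?case by simp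
  next
    case (Suc r)
    have "\<not> constant (poly p)" using Suc(2) by (simp add: constant_degree)
    from fundamental_theorem_of_algebra[OF this] obtain c where "poly p c = 0" ..
    then obtain q where q: "p = [:-c, 1:] * q" by (auto simp: poly_eq_0_iff_dvd)
    have q0: "q \<noteq> 0" using Suc(3) q by auto
    then have dq: "degree p = Suc (degree q)" unfolding q by (subst degree_mult_eq) auto
    obtain R' where R': "R = Suc R'" using Suc(4) dq by (cases R) auto
    have dq': "degree q \<le> R'" using Suc(4) dq R' by simp
    have h1: "hom_poly n 1 (\<lambda>v. v i - c * v a)"
      by (intro hom_poly_diff hom_poly_cmult hom_poly.var that(1) a(1))
    have h2: "hom_poly n R' (\<lambda>v. homogenization q R' (v i) (v a))"
      unfolding homogenization_def
    proof (intro hom_poly_sum hom_poly_cmult)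
      fix k assume "k \<in> {..R'}"
      then show "hom_poly n R' (\<lambda>v. v i ^ k * v a ^ (R' - k))"
        by (intro hom_poly_mult'[OF hom_poly_var_power[OF that(1)] hom_poly_var_power[OF a(1)]]) auto
    qed
    have "(1 + R', \<lambda>v. (v i - c * v a) * homogenization q R' (v i) (v a)) \<in> M"
      using Suc(5) unfolding q R' homogenization_mult_linear[OF dq'] by simp
    from prime[OF h1 h2 this] show ?case
    proof
      assume "(R', \<lambda>v. homogenization q R' (v i) (v a)) \<in> M"
      from Suc(1)[OF _ q0 dq' this] Suc(2) dq show ?thesis by simp
    qed blast
  qed
  have "\<exists>c. (1, \<lambda>v. v i - c * v a) \<in> M" if i: "i \<le> n" for i
  proof -
    \<comment> \<open>In degree \<open>R\<close> the quotient has dimension at most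
      \<open>r\<close>, so the \<open>r + 1\<close> monomials \<open>v i ^ k * v a ^ (R - k)\<close>
      with \<open>k \<le> r\<close> are dependent modulo \<open>M\<close>.\<close>
    define r where "r = card (mons n N)"
    define R where "R = N + Suc r"
    let ?W = "{F. (R, F) \<in> M}"
    let ?B = "(\<lambda>m v. v a ^ Suc r * m v) ` mons n N"
    have W: "cfun.subspace ?W"
      unfolding cfun.subspace_def using D(2,3,5)[of R] by (auto simp: cscale_def zero_fun_def plus_fun_def)
    have cB: "card ?B < card {..r}"
      using card_image_le[OF finite_mons[of n N], of "\<lambda>m v. v a ^ Suc r * m v"] by (simp add: r_def)
    have mem: "(\<lambda>v. v i ^ k * v a ^ (R - k)) \<in> cfun.span (?W \<union> ?B)" if k: "k \<in> {..r}" for k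
    proof -
      have "hom_poly n (N + Suc r) (\<lambda>v. v i ^ k * v a ^ (R - k))"
        using k by (intro hom_poly_mult'[OF hom_poly_var_power[OF i] hom_poly_var_power[OF a(1)]]) (auto simp: R_def)
      from red[OF this] obtain m g where m: "(R, m) \<in> M" "hom_poly n N g"
        "(\<lambda>v. v i ^ k * v a ^ (R - k)) = (\<lambda>v. m v + v a ^ Suc r * g v)" by (auto simp: R_def)
      have g: "(\<lambda>v. v a ^ Suc r * g v) \<in> cfun.span (?W \<union> ?B)"
        using m(2)
      proof (induction rule: hom_poly_subspace_induct)
        case (mon m)
        then show ?case by (intro cfun.span_base) blast
      next
        case zero
        show ?case using cfun.span_zero by (simp add: zero_fun_def)
      next
        case (add F G)
        from cfun.span_add[OF add(3,4)] show ?case by (simp add: plus_fun_def distrib_left)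
      next
        case (scale c F)
        have "cscale c (\<lambda>v. v a ^ Suc r * F v) = (\<lambda>v. v a ^ Suc r * (c * F v))"
          by (simp add: cscale_def mult.left_commute)
        with cfun.span_scale[OF scale(2), of c] show ?case by simp
      qed
      have "m \<in> cfun.span (?W \<union> ?B)" using m(1) by (intro cfun.span_base) simp
      from cfun.span_add[OF this g] show ?thesis unfolding m(3) by (simp add: plus_fun_def)
    qed
    from linear_relation_mod[OF finite_imageI[OF finite_mons] W finite_atMost cB mem]
    obtain c where c: "\<exists>k\<in>{..r}. c k \<noteq> 0" "(\<Sum>k\<le>r. cscale (c k) (\<lambda>v. v i ^ k * v a ^ (R - k))) \<in> ?W" .
    define p where "p = (\<Sum>k\<le>r. monom (c k) k)"
    have cp: "coeff p k = (if k \<le> r then c k else 0)" for k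
      by (simp add: p_def coeff_sum if_distrib sum.delta cong: if_cong)
    have p0: "p \<noteq> 0" using c(1) cp by (metis atMost_iff coeff_0)
    have dp: "degree p \<le> R" using cp by (intro degree_le) (auto simp: R_def)
    have "homogenization p R x l = (\<Sum>k\<le>r. c k * (x ^ k * l ^ (R - k)))" for x l
      unfolding homogenization_def using cp by (intro sum.mono_neutral_cong_right) (auto simp: R_def)
    then have "(\<Sum>k\<le>r. cscale (c k) (\<lambda>v. v i ^ k * v a ^ (R - k))) = (\<lambda>v. homogenization p R (v i) (v a))"
      by (simp add: fun_eq_iff cscale_sum_apply)
    with c(2) have "(R, \<lambda>v. homogenization p R (v i) (v a)) \<in> M" by simp
    from root[OF i p0 dp this] show ?thesis .
  qed
  then have "\<forall>i. \<exists>c. i \<le> n \<longrightarrow> (1, \<lambda>v. v i - c * v a) \<in> M" by blast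
  from choice[OF this] obtain g where g: "\<forall>i. i \<le> n \<longrightarrow> (1, \<lambda>v. v i - g i * v a) \<in> M" ..
  define c where "c = (\<lambda>i. if i \<le> n then g i else 0)"
  have ca: "c a = 1"
  proof (rule ccontr)
    assume *: "c a \<noteq> 1"
    have "(1, \<lambda>v. v a - c a * v a) \<in> M" using g a(1) by (simp add: c_def)
    from D(5)[OF this, of "1 / (1 - c a)"] have "(1, \<lambda>v. 1 / (1 - c a) * (v a - c a * v a)) \<in> M" .
    also have "(\<lambda>v::cvec. 1 / (1 - c a) * (v a - c a * v a)) = (\<lambda>v. v a)"
      using * by (simp add: fun_eq_iff field_simps)
    finally show False using a(2) by simp
  qed
  \<comment> \<open>Each coordinate is a multiple of \<open>v a\<close> modulo \<open>M\<close>,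
    hence each form is its value at \<open>c\<close> times a power of \<open>v a\<close>. A form of
    \<open>J\<close> with nonzero value at \<open>c\<close> would put that power into
    \<open>M\<close>.\<close>
  have ev: "(d, \<lambda>v. F v - F c * v a ^ d) \<in> M" if "hom_poly n d F" for d F
    using that
  proof (induction rule: hom_poly.induct)
    case (const x)
    show ?case using D(2) by simp
  next
    case (var i)
    then show ?case using g by (simp add: c_def)
  next
    case (add d F G)
    from D(3)[OF add(3,4)] show ?case by (simp add: algebra_simps)
  next
    case (mult d F e G)
    have "hom_poly n d (\<lambda>v. F c * v a ^ d)" by (intro hom_poly_cmult hom_poly_var_power a(1))
    from D(3)[OF D(4)[OF mult(3,2)] D(6)[OF mult(4) this]]
    show ?case by (simp add: algebra_simps power_add)
  qed
  have np: "(k, \<lambda>v. v a ^ k) \<notin> M" for k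
  proof (induction k)
    case 0
    then show ?case using one[of 1] by simp
  next
    case (Suc k)
    then show ?case using prime[OF va hom_poly_var_power[OF a(1), of k]] a(2) by auto
  qed
  show thesis
  proof (rule that)
    show "\<exists>i\<le>n. c i \<noteq> 0" using ca a(1) by (intro exI[of _ a]) auto
    show "c i = 0" if "i > n" for i using that by (simp add: c_def)
    show "F c = 0" if "(d, F) \<in> J" for d F
    proof (rule ccontr)
      assume *: "F c \<noteq> 0"
      have F: "(d, F) \<in> M" using that JM by blast
      from D(5)[OF D(3)[OF F D(5)[OF ev[OF D(1)[OF F]], of "-1"]], of "1 / F c"] *
      have "(d, \<lambda>v. v a ^ d) \<in> M" by simp
      with np show False by blast
    qed
  qed
qed

section \<open>Global regular functions are constant\<close>

context curve
begin

text \<open>By the Nullstellensatz, \<open>f\<close> maps the finite-dimensional space of forms of some degree \<open>N\<close> to itself.\<close>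

lemma global_regular_constant:
  assumes f: "\<And>p. p \<in> X \<Longrightarrow> f \<in> loc p"
  obtains c where "\<forall>p\<in>X. f p = c"
proof -
  \<comment> \<open>The ideal of denominators of \<open>f\<close>: forms whose product with
    \<open>f\<close> is again a form of the same degree on the curve.\<close>
  define J where "J = {(d, A). hom_poly n d A \<and> (\<exists>B. hom_poly n d B \<and> (\<forall>q\<in>X. A (rep q) * f q = B (rep q)))}"
  have J: "(d, A) \<in> J \<longleftrightarrow> hom_poly n d A \<and> (\<exists>B. hom_poly n d B \<and> (\<forall>q\<in>X. A (rep q) * f q = B (rep q)))" for d A
    by (simp add: J_def)
  have gr: "graded_ideal n J"
    unfolding graded_ideal_def
  proof (intro conjI allI impI)
    fix d e F G
    show "(d, F) \<in> J \<Longrightarrow> hom_poly n d F" by (simp add: J)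
    show "(d, \<lambda>_. 0) \<in> J" unfolding J by (intro conjI exI[of _ "\<lambda>_. 0"]) (auto intro: hom_poly_zero)
    show "(d, \<lambda>v. F v + G v) \<in> J" if FG: "(d, F) \<in> J" "(d, G) \<in> J"
    proof -
      obtain A where A: "hom_poly n d A" "\<forall>q\<in>X. F (rep q) * f q = A (rep q)" using FG(1) unfolding J by blast
      obtain B where B: "hom_poly n d B" "\<forall>q\<in>X. G (rep q) * f q = B (rep q)" using FG(2) unfolding J by blast
      show ?thesis unfolding J using A B FG
        by (intro conjI exI[of _ "\<lambda>v. A v + B v"]) (auto simp: J distrib_right intro: hom_poly.add)
    qed
    show "(d + e, \<lambda>v. F v * G v) \<in> J" if FG: "(d, F) \<in> J" "hom_poly n e G"
    proof -
      obtain A where A: "hom_poly n d A" "\<forall>q\<in>X. F (rep q) * f q = A (rep q)" using FG(1) unfolding J by blast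
      then have "F (rep q) * G (rep q) * f q = A (rep q) * G (rep q)" if "q \<in> X" for q
        using that by (metis mult.assoc mult.commute)
      then show ?thesis unfolding J using A(1) FG
        by (intro conjI exI[of _ "\<lambda>v. A v * G v"]) (auto simp: J intro: hom_poly.mult)
    qed
  qed
  \<comment> \<open>The denominators have no common zero. Off the curve some equation of
    \<open>X\<close> is one, with product 0; on the curve a local denominator of \<open>f\<close> is
    one, as the local identity spreads over \<open>X\<close>.\<close>
  have nz: "\<exists>d A. (d, A) \<in> J \<and> A c \<noteq> 0" if c: "\<exists>i\<le>n. c i \<noteq> 0" "\<And>i. i > n \<Longrightarrow> c i = 0" for c
  proof -
    have c0: "c \<noteq> 0" using c(1) by auto
    have q: "line c \<in> proj_space n" unfolding proj_space_def using c(2) c0 by blast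
    show ?thesis
    proof (cases "line c \<in> X")
      case False
      have "openin (zariski n) (proj_space n - X)"
        using closed_X unfolding closedin_def topspace_zariski by blast
      then have "zariski_open n (proj_space n - X)" by (simp only: openin_zariski)
      then obtain S where S: "\<forall>F\<in>S. \<exists>d. hom_poly n d F"
        "proj_space n - X = {p \<in> proj_space n. \<exists>F\<in>S. \<exists>v\<in>p. F v \<noteq> 0}"
        unfolding zariski_open_def by (elim exE conjE)
      have "line c \<in> proj_space n - X" using False q by blast
      then obtain F v where F: "F \<in> S" "v \<in> line c" "F v \<noteq> 0" unfolding S(2) by blast
      obtain d where d: "hom_poly n d F" using S(1) F(1) by blast
      have "F (rep q) * f q = 0" if "q \<in> X" for q
      proof -
        have "q \<notin> proj_space n - X" using that by blast
        then have "F (rep q) = 0" unfolding S(2) using F(1) rep(1) X_proj[OF that] by blast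
        then show ?thesis by simp
      qed
      then have "(d, F) \<in> J" unfolding J using d by (intro conjI exI[of _ "\<lambda>_. 0"]) (auto intro: hom_poly_zero)
      moreover have "F c \<noteq> 0" using hom_poly_line_nz[OF d F(2,3)] .
      ultimately show ?thesis by blast
    next
      case True
      obtain d F G where F: "hom_poly n d F" "hom_poly n d G" "G (rep (line c)) \<noteq> 0"
        "eventually (\<lambda>q. f q = F (rep q) / G (rep q)) (near (line c))" using f[OF True] by (rule locE)
      from near_gen[OF True F(4)] hom_poly_gen_nonzero[OF F(2) True F(3)]
      have g: "eventually (\<lambda>q. G (rep q) * f q = F (rep q)) gen" by eventually_elim simp
      have "G (rep q) * f q = F (rep q)" if q: "q \<in> X" for q
      proof -
        note b = bco[OF q]
        have 1: "(\<lambda>x. G (nrm (bco q) x) * f x) \<in> loc q" by (intro loc_mult loc_hom_nrm[OF q F(2) b] f q)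
        have 2: "(\<lambda>x. F (nrm (bco q) x)) \<in> loc q" by (rule loc_hom_nrm[OF q F(1) b])
        from g have 3: "eventually (\<lambda>x. G (nrm (bco q) x) * f x = F (nrm (bco q) x)) gen"
          by eventually_elim (simp add: hom_poly_nrm[OF F(1)] hom_poly_nrm[OF F(2)])
        from loc_gen_eq(2)[OF q 1 2 3] have "G (nrm (bco q) q) * f q = F (nrm (bco q) q)" .
        then show ?thesis using b(2) by (simp add: hom_poly_nrm[OF F(1)] hom_poly_nrm[OF F(2)])
      qed
      then have "(d, G) \<in> J" unfolding J using F(1,2) by blast
      moreover have "G c \<noteq> 0" using F(3) hom_poly_rep_eq_0[OF F(2) q line_self c0] by simp
      ultimately show ?thesis by blast
    qed
  qed
  have "\<not> relevant n J"
  proof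
    assume "relevant n J"
    from projective_nullstellensatz[OF gr this] obtain c where
      "\<exists>i\<le>n. c i \<noteq> 0" "\<And>i. i > n \<Longrightarrow> c i = 0" "\<And>d F. (d, F) \<in> J \<Longrightarrow> F c = 0" by blast
    then show False using nz[of c] by blast
  qed
  then obtain N where N: "\<forall>F. hom_poly n N F \<longrightarrow> (N, F) \<in> J" by (rule not_relevantE)
  obtain p where p: "p \<in> X" using X_nonempty by blast
  note b = bco[OF p]
  let ?x = "\<lambda>q. rep q (bco p)"
  \<comment> \<open>Since all forms of degree \<open>N\<close> are denominators, multiplication by
    \<open>f\<close> can be repeated without leaving degree \<open>N\<close>. The trailing
    \<open>True\<close> is the relation between successive choices that dependent choice asks
    for.\<close>
  have "\<exists>B. \<forall>k. (hom_poly n N (B k) \<and> (\<forall>q\<in>X. ?x q ^ N * f q ^ k = B k (rep q))) \<and> True"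
  proof (rule dependent_nat_choice)
    show "\<exists>B. hom_poly n N B \<and> (\<forall>q\<in>X. ?x q ^ N * f q ^ 0 = B (rep q))"
      using hom_poly_var_power[OF b(1)] by (intro exI[of _ "\<lambda>v. v (bco p) ^ N"]) simp
    fix B k assume B: "hom_poly n N B \<and> (\<forall>q\<in>X. ?x q ^ N * f q ^ k = B (rep q))"
    then have "(N, B) \<in> J" using N by blast
    then obtain C where C: "hom_poly n N C" "\<forall>q\<in>X. B (rep q) * f q = C (rep q)" unfolding J by blast
    have "?x q ^ N * f q ^ Suc k = C (rep q)" if "q \<in> X" for q
    proof -
      have "?x q ^ N * f q ^ Suc k = (?x q ^ N * f q ^ k) * f q" by simp
      then show ?thesis using B C that by simp
    qed
    with C(1) show "\<exists>C. (hom_poly n N C \<and> (\<forall>q\<in>X. ?x q ^ N * f q ^ Suc k = C (rep q))) \<and> True" by blast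
  qed
  then obtain B where B: "\<And>k. hom_poly n N (B k)" "\<And>k q. q \<in> X \<Longrightarrow> ?x q ^ N * f q ^ k = B k (rep q)" by blast
  define r where "r = card (mons n N)"
  have sp: "B k \<in> cfun.span ({0} \<union> mons n N)" for k
    using B(1)
  proof (induction rule: hom_poly_subspace_induct)
    case (mon m)
    then show ?case by (intro cfun.span_base) blast
  next
    case zero
    show ?case using cfun.span_zero by (simp add: zero_fun_def)
  next
    case (add F G)
    from cfun.span_add[OF add(3,4)] show ?case by (simp add: plus_fun_def)
  next
    case (scale c F)
    have "cscale c F = (\<lambda>v. c * F v)" by (simp add: cscale_def)
    with cfun.span_scale[OF scale(2), of c] show ?case by simp
  qed
  have "card (mons n N) < card {..r}" by (simp add: r_def)
  from linear_relation_mod[OF finite_mons cfun.subspace_single_0 finite_atMost this sp] obtain c where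
    c: "\<exists>k\<in>{..r}. c k \<noteq> 0" "(\<Sum>k\<le>r. cscale (c k) (B k)) \<in> {0}" .
  define P where "P = (\<Sum>k\<le>r. monom (c k) k)"
  have cP: "coeff P k = (if k \<le> r then c k else 0)" for k
    by (simp add: P_def coeff_sum if_distrib sum.delta cong: if_cong)
  have P0: "P \<noteq> 0" using c(1) cP by (metis atMost_iff coeff_0)
  have "eventually (\<lambda>q. f q \<in> {x. poly P x = 0}) gen"
    using hom_poly_gen_nonzero[OF hom_poly.var[OF b(1)] p b(2)] gen_in_X
  proof eventually_elim
    case (elim q)
    have "0 = (\<Sum>k\<le>r. c k * B k (rep q))" using c(2) by (metis cscale_sum_apply singletonD zero_fun_apply)
    also have "\<dots> = ?x q ^ N * poly P (f q)"
      by (simp add: P_def poly_sum poly_monom B(2)[OF elim(2), symmetric] sum_distrib_left mult.left_commute)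
    finally show ?case using elim(1) by simp
  qed
  from loc_finite_values_constant[OF p f[OF p] poly_roots_finite[OF P0] this]
  obtain y where "eventually (\<lambda>q. f q = y) (near p)" by blast
  from near_gen[OF p this] have "f q = y" if "q \<in> X" for q
    using loc_gen_eq(2)[OF that f[OF that] loc_const[of y]] by blast
  then show thesis using that[of y] by blast
qed

end

section \<open>Codimension\<close>

text \<open>A relative dimension bound that presupposes neither inclusion nor finite dimension; with
  \<open>A' = {0}\<close> it bounds the dimension of \<open>A\<close>.\<close>

definition codim_le :: "('a \<Rightarrow> complex) set \<Rightarrow> ('a \<Rightarrow> complex) set \<Rightarrow> nat \<Rightarrow> bool" where
  "codim_le A A' m \<longleftrightarrow> (\<exists>B. finite B \<and> card B \<le> m \<and> A \<subseteq> cfun.span (A' \<union> B))"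

lemma codim_le_refl: "codim_le A A 0"
  unfolding codim_le_def by (intro exI[of _ "{}"]) (auto intro: cfun.span_base)

lemma codim_le_trans:
  assumes "codim_le A A' m" "codim_le A' A'' k" shows "codim_le A A'' (m + k)"
proof -
  obtain B where B: "finite B" "card B \<le> m" "A \<subseteq> cfun.span (A' \<union> B)" using assms(1) unfolding codim_le_def by blast
  obtain C where C: "finite C" "card C \<le> k" "A' \<subseteq> cfun.span (A'' \<union> C)" using assms(2) unfolding codim_le_def by blast
  have "A' \<union> B \<subseteq> cfun.span (A'' \<union> (B \<union> C))"
    using C(3) cfun.span_mono[of "A'' \<union> C" "A'' \<union> (B \<union> C)"] cfun.span_superset[of "A'' \<union> (B \<union> C)"] by blast
  from cfun.span_minimal[OF this cfun.subspace_span] B(3) have "A \<subseteq> cfun.span (A'' \<union> (B \<union> C))" by blast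
  moreover have "card (B \<union> C) \<le> m + k" using card_Un_le[of B C] B(2) C(2) by linarith
  ultimately show ?thesis unfolding codim_le_def using B(1) C(1) by (intro exI[of _ "B \<union> C"]) auto
qed

text \<open>One \<open>y\<close> outside \<open>A'\<close> suffices to span: its relation with any
  \<open>x\<close> must involve \<open>x\<close>, as no nonzero multiple of \<open>y\<close> lies in
  \<open>A'\<close>.\<close>

lemma codim_le_1I:
  assumes A': "cfun.subspace A'"
    and *: "\<And>x y. x \<in> A \<Longrightarrow> y \<in> A \<Longrightarrow> \<exists>a b. (a \<noteq> 0 \<or> b \<noteq> 0) \<and> cscale a x + cscale b y \<in> A'"
  shows "codim_le A A' 1"
proof (cases "A \<subseteq> A'")
  case True
  then show ?thesis unfolding codim_le_def by (intro exI[of _ "{}"]) (auto intro: cfun.span_base)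
next
  case False
  then obtain y where y: "y \<in> A" "y \<notin> A'" by blast
  have "A \<subseteq> cfun.span (A' \<union> {y})"
  proof
    fix x assume "x \<in> A"
    from *[OF this y(1)] obtain a b where ab: "a \<noteq> 0 \<or> b \<noteq> 0" "cscale a x + cscale b y \<in> A'" by blast
    have "a \<noteq> 0"
    proof
      assume a: "a = 0"
      then have "cscale b y \<in> A'" using ab by simp
      from cfun.subspace_scale[OF A' this, of "1 / b"] ab(1) a y(2) show False by simp
    qed
    have 1: "cscale a x + cscale b y \<in> cfun.span (A' \<union> {y})" and 2: "y \<in> cfun.span (A' \<union> {y})"
      using ab by (auto intro: cfun.span_base)
    have "cscale (1 / a) (cscale a x + cscale b y) + cscale (- b / a) y \<in> cfun.span (A' \<union> {y})"
      using cfun.span_add[OF cfun.span_scale[OF 1] cfun.span_scale[OF 2]] .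
    also have "cscale (1 / a) (cscale a x + cscale b y) + cscale (- b / a) y = x"
      using \<open>a \<noteq> 0\<close> by (auto simp: fun_eq_iff cscale_def field_simps)
    finally show "x \<in> cfun.span (A' \<union> {y})" .
  qed
  then show ?thesis unfolding codim_le_def by (intro exI[of _ "{y}"]) auto
qed

lemma codim_le_obtain_relation:
  assumes "codim_le A A' m" "cfun.subspace A'" "finite I" "m < card I" "\<And>i. i \<in> I \<Longrightarrow> x i \<in> A"
  obtains c where "\<exists>i\<in>I. c i \<noteq> 0" "(\<Sum>i\<in>I. cscale (c i) (x i)) \<in> A'"
proof -
  obtain B where B: "finite B" "card B \<le> m" "A \<subseteq> cfun.span (A' \<union> B)" using assms(1) unfolding codim_le_def by blast
  have "card B < card I" using B(2) assms(4) by linarith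
  from linear_relation_mod[OF B(1) assms(2,3) this] B(3) assms(5) that show thesis by blast
qed

section \<open>Sections of line bundles\<close>

lemma tensor_power_simps [simp]:
  "index (tensor_power L d) = index L" "chart (tensor_power L d) = chart L"
  "trans_fun (tensor_power L d) i j x = trans_fun L i j x powi d"
  by (simp_all add: tensor_power_def)

context curve
begin

section \<open>Orders of vanishing and the number of conditions they impose\<close>

lemma loc_powi:
  assumes "p \<in> X" "f \<in> loc p" "f p \<noteq> 0" shows "(\<lambda>x. f x powi d) \<in> loc p"
proof (cases "0 \<le> d")
  case True
  then show ?thesis using assms by (auto simp: power_int_def)
next
  case False
  have "(\<lambda>x. inverse (f x) ^ nat (- d)) \<in> loc p" by (intro loc_power loc_inverse assms)
  then show ?thesis using False by (simp add: power_int_def)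
qed

text \<open>The comparison is generic, so the notion also covers sections with poles or arbitrary
  values at \<open>z\<close>; for \<open>N = 0\<close> it says that \<open>f\<close> extends
  regularly over \<open>z\<close>.\<close>

definition vanishes :: "ppoint \<Rightarrow> nat \<Rightarrow> (ppoint \<Rightarrow> complex) \<Rightarrow> bool" where
  "vanishes z N f \<longleftrightarrow> (\<exists>a\<in>loc z. eventually (\<lambda>q. f q = unif z q ^ N * a q) gen)"

lemma vanishes_mult_loc:
  assumes "z \<in> X" "vanishes z N f" "g \<in> loc z" "eventually (\<lambda>q. h q = g q * f q) gen"
  shows "vanishes z N h"
proof -
  obtain a where a: "a \<in> loc z" "eventually (\<lambda>q. f q = unif z q ^ N * a q) gen"
    using assms(2) unfolding vanishes_def by blast
  have "eventually (\<lambda>q. h q = unif z q ^ N * (g q * a q)) gen"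
    using a(2) assms(4) by eventually_elim simp
  then show ?thesis unfolding vanishes_def using a(1) assms(1,3) by (intro bexI[of _ "\<lambda>q. g q * a q"] loc_mult)
qed

lemma vanishes_1:
  assumes "z \<in> X" "f \<in> loc z" "vanishes z 1 f" shows "f z = 0"
proof -
  obtain a where a: "a \<in> loc z" "eventually (\<lambda>q. f q = unif z q ^ 1 * a q) gen"
    using assms(3) unfolding vanishes_def by blast
  have "(\<lambda>q. unif z q ^ 1 * a q) \<in> loc z" by (intro loc_mult loc_power loc_unif a(1) assms(1))
  from loc_gen_eq(2)[OF assms(1,2) this a(2)] uniformizerD(2)[OF unif(2)[OF assms(1)]] show ?thesis by simp
qed

lemma subspace_vanishes:
  assumes V: "cfun.subspace V" and z: "z \<in> X"
  shows "cfun.subspace {s \<in> V. vanishes z N (\<lambda>x. s (i, x))}"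
  unfolding cfun.subspace_def
proof (intro conjI ballI allI)
  show "0 \<in> {s \<in> V. vanishes z N (\<lambda>x. s (i, x))}"
    using cfun.subspace_0[OF V] by (auto simp: vanishes_def intro!: bexI[of _ "\<lambda>_. 0"])
  fix s assume s: "s \<in> {s \<in> V. vanishes z N (\<lambda>x. s (i, x))}"
  fix c show "cscale c s \<in> {s \<in> V. vanishes z N (\<lambda>x. s (i, x))}"
    using s cfun.subspace_scale[OF V, of s c] vanishes_mult_loc[OF z _ loc_const[of c], of N "\<lambda>x. s (i, x)"]
    by (auto simp: cscale_def)
  fix s' assume s': "s' \<in> {s \<in> V. vanishes z N (\<lambda>x. s (i, x))}"
  from s obtain a where a: "a \<in> loc z" "eventually (\<lambda>x. s (i, x) = unif z x ^ N * a x) gen" by (auto simp: vanishes_def)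
  from s' obtain a' where a': "a' \<in> loc z" "eventually (\<lambda>x. s' (i, x) = unif z x ^ N * a' x) gen" by (auto simp: vanishes_def)
  have "eventually (\<lambda>x. (s + s') (i, x) = unif z x ^ N * (a x + a' x)) gen"
    using a(2) a'(2) by eventually_elim (simp add: distrib_left)
  then have "vanishes z N (\<lambda>x. (s + s') (i, x))"
    unfolding vanishes_def using a(1) a'(1) z by (intro bexI[of _ "\<lambda>x. a x + a' x"] loc_add)
  then show "s + s' \<in> {s \<in> V. vanishes z N (\<lambda>x. s (i, x))}"
    using s s' cfun.subspace_add[OF V] by blast
qed

text \<open>Raising the order from \<open>N\<close> to \<open>N + 1\<close> is one linear condition,
  on the leading coefficient: two functions of order \<open>N\<close> have a combination in which it
  cancels, and what remains is divisible by the uniformizer once more.\<close>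

lemma codim_vanishes:
  assumes V: "cfun.subspace V" and z: "z \<in> X" and Vl: "\<And>s. s \<in> V \<Longrightarrow> (\<lambda>x. s (i, x)) \<in> loc z"
  shows "codim_le V {s \<in> V. vanishes z N (\<lambda>x. s (i, x))} N"
proof (induction N)
  case 0
  have "vanishes z 0 (\<lambda>x. s (i, x))" if "s \<in> V" for s
    unfolding vanishes_def using Vl[OF that] by (intro bexI[of _ "\<lambda>x. s (i, x)"]) auto
  then have "{s \<in> V. vanishes z 0 (\<lambda>x. s (i, x))} = V" by blast
  then show ?case using codim_le_refl[of V] by simp
next
  case (Suc N)
  let ?V = "\<lambda>N. {s \<in> V. vanishes z N (\<lambda>x. s (i, x))}"
  have "codim_le (?V N) (?V (Suc N)) 1"
  proof (rule codim_le_1I[OF subspace_vanishes[OF V z]])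
    fix s s' assume s: "s \<in> ?V N" and s': "s' \<in> ?V N"
    from s obtain a where a: "a \<in> loc z" "eventually (\<lambda>x. s (i, x) = unif z x ^ N * a x) gen" by (auto simp: vanishes_def)
    from s' obtain a' where a': "a' \<in> loc z" "eventually (\<lambda>x. s' (i, x) = unif z x ^ N * a' x) gen" by (auto simp: vanishes_def)
    \<comment> \<open>Coefficients, not both 0, that cancel \<open>a z\<close> against
      \<open>a' z\<close>; the case distinction covers \<open>a z = a' z = 0\<close>.\<close>
    define \<alpha> where "\<alpha> = (if a z = 0 then 1 else a' z)"
    define \<beta> where "\<beta> = (if a z = 0 then 0 else - a z)"
    have nz: "\<alpha> \<noteq> 0 \<or> \<beta> \<noteq> 0" by (simp add: \<alpha>_def \<beta>_def)
    have l: "(\<lambda>x. \<alpha> * a x + \<beta> * a' x) \<in> loc z" by (intro loc_add loc_mult loc_const a(1) a'(1) z)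
    have "\<alpha> * a z + \<beta> * a' z = 0" by (simp add: \<alpha>_def \<beta>_def)
    from uniformizerD(4)[OF unif(2)[OF z] l this] obtain c where
      c: "c \<in> loc z" "eventually (\<lambda>x. \<alpha> * a x + \<beta> * a' x = unif z x * c x) (near z)" by blast
    have "eventually (\<lambda>x. (cscale \<alpha> s + cscale \<beta> s') (i, x) = unif z x ^ Suc N * c x) gen"
      using a(2) a'(2) near_gen[OF z c(2)]
    proof eventually_elim
      case (elim x)
      have "(cscale \<alpha> s + cscale \<beta> s') (i, x) = unif z x ^ N * (\<alpha> * a x + \<beta> * a' x)"
        using elim(1,2) by (simp add: cscale_def algebra_simps)
      then show ?case using elim(3) by simp
    qed
    then have "vanishes z (Suc N) (\<lambda>x. (cscale \<alpha> s + cscale \<beta> s') (i, x))"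
      unfolding vanishes_def using c(1) by blast
    moreover have "cscale \<alpha> s + cscale \<beta> s' \<in> V"
      using s s' by (intro cfun.subspace_add[OF V] cfun.subspace_scale[OF V]) auto
    ultimately show "\<exists>a b. (a \<noteq> 0 \<or> b \<noteq> 0) \<and> cscale a s + cscale b s' \<in> ?V (Suc N)"
      using nz by blast
  qed
  from codim_le_trans[OF Suc this] show ?case by simp
qed

lemma codim_vanishes_finite:
  assumes V: "cfun.subspace V" and Z: "finite Z" "Z \<subseteq> X"
    and Vl: "\<And>s z. s \<in> V \<Longrightarrow> z \<in> Z \<Longrightarrow> (\<lambda>x. s (i z, x)) \<in> loc z"
  shows "cfun.subspace {s \<in> V. \<forall>z\<in>Z. vanishes z (N z) (\<lambda>x. s (i z, x))} \<and>
    codim_le V {s \<in> V. \<forall>z\<in>Z. vanishes z (N z) (\<lambda>x. s (i z, x))} (\<Sum>z\<in>Z. N z)"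
  using Z Vl
proof (induction Z rule: finite_induct)
  case empty
  then show ?case using V codim_le_refl[of V] by simp
next
  case (insert z Z)
  let ?V = "\<lambda>Z. {s \<in> V. \<forall>z\<in>Z. vanishes z (N z) (\<lambda>x. s (i z, x))}"
  have IH: "cfun.subspace (?V Z)" "codim_le V (?V Z) (\<Sum>z\<in>Z. N z)" using insert by auto
  have z: "z \<in> X" using insert.prems(1) by blast
  have eq: "{s \<in> ?V Z. vanishes z (N z) (\<lambda>x. s (i z, x))} = ?V (insert z Z)" by blast
  have l: "(\<lambda>x. s (i z, x)) \<in> loc z" if "s \<in> ?V Z" for s using insert.prems(2) that by blast
  from subspace_vanishes[OF IH(1) z, of "N z" "i z"] codim_le_trans[OF IH(2) codim_vanishes[OF IH(1) z l, of "N z"]]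
  show ?case unfolding eq using insert.hyps by (simp add: add.commute)
qed

text \<open>Each exceptional point receives the value of its own germ. The result is regular because
  this germ and \<open>f\<close> agree generically, hence at all nearby points, where both are
  regular.\<close>

lemma extend_function:
  assumes W: "openin zar W" and F: "finite F" and f: "\<And>x. x \<in> W - F \<Longrightarrow> f \<in> loc x"
    and ext: "\<And>z. z \<in> F \<inter> W \<Longrightarrow> \<exists>b\<in>loc z. eventually (\<lambda>x. f x = b x) gen"
  obtains f' where "\<forall>x\<in>W. f' \<in> loc x" "\<forall>x\<in>W - F. f' x = f x"
proof -
  have WX: "W \<subseteq> X" using openin_subset_X[OF W] .
  have "\<forall>z. \<exists>b. z \<in> F \<inter> W \<longrightarrow> b \<in> loc z \<and> eventually (\<lambda>x. f x = b x) gen" using ext by blast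
  from choice[OF this] obtain b where b: "\<forall>z. z \<in> F \<inter> W \<longrightarrow> b z \<in> loc z \<and> eventually (\<lambda>x. f x = b z x) gen" ..
  define f' where "f' x = (if x \<in> F \<inter> W then b x x else f x)" for x
  show thesis
  proof (rule that)
    show "\<forall>x\<in>W - F. f' x = f x" by (simp add: f'_def)
    show "\<forall>z\<in>W. f' \<in> loc z"
    proof
      fix z assume z: "z \<in> W"
      have zX: "z \<in> X" using z WX by blast
      note ev = eventually_near_finite[OF F zX] eventually_near_open[OF W z]
      show "f' \<in> loc z"
      proof (cases "z \<in> F")
        case False
        have "eventually (\<lambda>x. f x = f' x) (near z)"
          using ev by eventually_elim (use False in \<open>auto simp: f'_def\<close>)
        from loc_cong[OF this] f[of z] False z show ?thesis by simp
      next
        case True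
        with b z have bz: "b z \<in> loc z" "eventually (\<lambda>x. f x = b z x) gen" by auto
        have "eventually (\<lambda>x. b z x = f' x) (near z)"
          using ev loc_near[OF zX bz(1)]
        proof eventually_elim
          case (elim x)
          show ?case
          proof (cases "x = z")
            case True
            then show ?thesis using \<open>z \<in> F\<close> z by (simp add: f'_def)
          next
            case False
            with elim have x: "x \<in> W - F" by blast
            from loc_gen_eq(2)[OF _ f[OF x] elim(3) bz(2)] x WX show ?thesis by (auto simp: f'_def)
          qed
        qed
        from loc_cong[OF this] bz(1) show ?thesis by simp
      qed
    qed
  qed
qed

section \<open>Sections of a line bundle through their local functions\<close>

lemma line_bundleD:
  assumes "is_line_bundle n X M"
  shows "i \<in> index M \<Longrightarrow> openin zar (chart M i)"
    "x \<in> X \<Longrightarrow> \<exists>i\<in>index M. x \<in> chart M i"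
    "i \<in> index M \<Longrightarrow> j \<in> index M \<Longrightarrow> x \<in> chart M i \<Longrightarrow> x \<in> chart M j \<Longrightarrow> trans_fun M i j \<in> loc x"
    "i \<in> index M \<Longrightarrow> x \<in> chart M i \<Longrightarrow> trans_fun M i i x = 1"
    "i \<in> index M \<Longrightarrow> j \<in> index M \<Longrightarrow> k \<in> index M \<Longrightarrow> x \<in> chart M i \<Longrightarrow> x \<in> chart M j \<Longrightarrow> x \<in> chart M k \<Longrightarrow>
        trans_fun M i j x * trans_fun M j k x = trans_fun M i k x"
    "i \<in> index M \<Longrightarrow> j \<in> index M \<Longrightarrow> x \<in> chart M i \<Longrightarrow> x \<in> chart M j \<Longrightarrow> trans_fun M i j x \<noteq> 0"
    "i \<in> index M \<Longrightarrow> x \<in> chart M i \<Longrightarrow> x \<in> X"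
proof -
  have M: "\<forall>i\<in>index M. openin zar (chart M i)" "(\<Union>i\<in>index M. chart M i) = X"
    "\<forall>i\<in>index M. \<forall>j\<in>index M. regular_on n X (chart M i \<inter> chart M j) (trans_fun M i j)"
    "\<forall>i\<in>index M. \<forall>x\<in>chart M i. trans_fun M i i x = 1"
    "\<forall>i\<in>index M. \<forall>j\<in>index M. \<forall>k\<in>index M. \<forall>x\<in>chart M i \<inter> chart M j \<inter> chart M k.
        trans_fun M i j x * trans_fun M j k x = trans_fun M i k x"
    using assms unfolding is_line_bundle_def by blast+
  show "i \<in> index M \<Longrightarrow> openin zar (chart M i)" using M(1) by blast
  show "x \<in> X \<Longrightarrow> \<exists>i\<in>index M. x \<in> chart M i" using M(2) by blast
  show "i \<in> index M \<Longrightarrow> x \<in> chart M i \<Longrightarrow> x \<in> X" using M(2) by blast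
  show "trans_fun M i j \<in> loc x" if "i \<in> index M" "j \<in> index M" "x \<in> chart M i" "x \<in> chart M j"
  proof -
    have "openin zar (chart M i \<inter> chart M j)" using M(1) that by blast
    from regular_on_iff[OF this] M(3) that show ?thesis by blast
  qed
  show 4: "i \<in> index M \<Longrightarrow> x \<in> chart M i \<Longrightarrow> trans_fun M i i x = 1" for i x using M(4) by blast
  show 5: "i \<in> index M \<Longrightarrow> j \<in> index M \<Longrightarrow> k \<in> index M \<Longrightarrow> x \<in> chart M i \<Longrightarrow> x \<in> chart M j \<Longrightarrow> x \<in> chart M k \<Longrightarrow>
        trans_fun M i j x * trans_fun M j k x = trans_fun M i k x" for i j k x using M(5) by blast
  show "trans_fun M i j x \<noteq> 0" if "i \<in> index M" "j \<in> index M" "x \<in> chart M i" "x \<in> chart M j"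
    using 5[of i j i x] 4[of i x] that by auto
qed

lemma is_line_bundle_tensor_power:
  assumes L: "is_line_bundle n X L" shows "is_line_bundle n X (tensor_power L d)"
proof -
  note D = line_bundleD[OF L]
  have "regular_on n X (chart L i \<inter> chart L j) (trans_fun (tensor_power L d) i j)"
    if "i \<in> index L" "j \<in> index L" for i j
  proof -
    have "openin zar (chart L i \<inter> chart L j)" using D(1) that by blast
    moreover have "trans_fun (tensor_power L d) i j \<in> loc x" if x: "x \<in> chart L i \<inter> chart L j" for x
    proof -
      have "(\<lambda>x. trans_fun L i j x powi d) \<in> loc x"
        by (intro loc_powi D(3) D(6) D(7)[of i]) (use x \<open>i \<in> index L\<close> \<open>j \<in> index L\<close> in auto)
      then show ?thesis by (simp add: tensor_power_def)
    qed
    ultimately show ?thesis by (simp add: regular_on_iff)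
  qed
  moreover have "(\<Union>i\<in>index L. chart L i) = X" using L by (simp add: is_line_bundle_def)
  moreover have "trans_fun L i j x powi d * trans_fun L j k x powi d = trans_fun L i k x powi d"
    if "i \<in> index L" "j \<in> index L" "k \<in> index L" "x \<in> chart L i \<inter> chart L j \<inter> chart L k" for i j k x
    using D(5)[of i j k x] that by (simp add: power_int_mult_distrib[symmetric])
  ultimately show ?thesis
    unfolding is_line_bundle_def using D(1,4) by simp
qed

lemma sections_iff:
  assumes M: "is_line_bundle n X M" and W: "openin zar W"
  shows "s \<in> sections n X M W \<longleftrightarrow>
    (\<forall>i\<in>index M. \<forall>x\<in>W \<inter> chart M i. (\<lambda>x. s (i, x)) \<in> loc x) \<and>
    (\<forall>i\<in>index M. \<forall>j\<in>index M. \<forall>x\<in>W \<inter> chart M i \<inter> chart M j. s (i, x) = trans_fun M i j x * s (j, x)) \<and>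
    (\<forall>i x. \<not> (i \<in> index M \<and> x \<in> W \<inter> chart M i) \<longrightarrow> s (i, x) = 0)"
proof -
  have "regular_on n X (W \<inter> chart M i) (\<lambda>x. s (i, x)) \<longleftrightarrow> (\<forall>x\<in>W \<inter> chart M i. (\<lambda>x. s (i, x)) \<in> loc x)"
    if "i \<in> index M" for i
    by (rule regular_on_iff) (use W line_bundleD(1)[OF M that] in blast)
  then show ?thesis unfolding sections_def by simp
qed

lemma sectionsD:
  assumes M: "is_line_bundle n X M" and W: "openin zar W" and s: "s \<in> sections n X M W"
  shows "i \<in> index M \<Longrightarrow> x \<in> W \<Longrightarrow> x \<in> chart M i \<Longrightarrow> (\<lambda>x. s (i, x)) \<in> loc x"
    "i \<in> index M \<Longrightarrow> j \<in> index M \<Longrightarrow> x \<in> W \<Longrightarrow> x \<in> chart M i \<Longrightarrow> x \<in> chart M j \<Longrightarrow>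
       s (i, x) = trans_fun M i j x * s (j, x)"
    "\<not> (i \<in> index M \<and> x \<in> W \<and> x \<in> chart M i) \<Longrightarrow> s (i, x) = 0"
  using s unfolding sections_iff[OF M W] by blast+

lemma subspace_sections:
  assumes M: "is_line_bundle n X M" and W: "openin zar W"
  shows "cfun.subspace (sections n X M W)"
  unfolding cfun.subspace_def
proof (intro conjI ballI allI)
  note D = sectionsD[OF M W]
  show "0 \<in> sections n X M W" unfolding sections_iff[OF M W] by auto
  fix s assume s: "s \<in> sections n X M W"
  show "cscale c s \<in> sections n X M W" for c
    unfolding sections_iff[OF M W]
  proof (intro conjI ballI allI impI)
    fix i x assume "i \<in> index M" "x \<in> W \<inter> chart M i"
    then show "(\<lambda>x. cscale c s (i, x)) \<in> loc x"
      unfolding cscale_def using D(1)[OF s] line_bundleD(7)[OF M] by (intro loc_mult loc_const) auto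
  next
    fix i j x assume "i \<in> index M" "j \<in> index M" "x \<in> W \<inter> chart M i \<inter> chart M j"
    then show "cscale c s (i, x) = trans_fun M i j x * cscale c s (j, x)"
      using D(2)[OF s, of i j x] by (simp add: cscale_def)
  next
    fix i x assume "\<not> (i \<in> index M \<and> x \<in> W \<inter> chart M i)"
    then show "cscale c s (i, x) = 0" using D(3)[OF s, of i x] by (simp add: cscale_def)
  qed
  fix s' assume s': "s' \<in> sections n X M W"
  show "s + s' \<in> sections n X M W"
    unfolding sections_iff[OF M W]
  proof (intro conjI ballI allI impI)
    fix i x assume "i \<in> index M" "x \<in> W \<inter> chart M i"
    then show "(\<lambda>x. (s + s') (i, x)) \<in> loc x"
      unfolding plus_fun_apply using D(1)[OF s] D(1)[OF s'] line_bundleD(7)[OF M] by (intro loc_add) auto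
  next
    fix i j x assume "i \<in> index M" "j \<in> index M" "x \<in> W \<inter> chart M i \<inter> chart M j"
    then show "(s + s') (i, x) = trans_fun M i j x * (s + s') (j, x)"
      using D(2)[OF s, of i j x] D(2)[OF s', of i j x] by (simp add: distrib_left)
  next
    fix i x assume "\<not> (i \<in> index M \<and> x \<in> W \<inter> chart M i)"
    then show "(s + s') (i, x) = 0" using D(3)[OF s, of i x] D(3)[OF s', of i x] by simp
  qed
qed

text \<open>Generic vanishing passes from one chart to all others through the transition functions,
  and from there to every point by the identity principle.\<close>

lemma section_eq_0:
  assumes M: "is_line_bundle n X M" and W: "openin zar W" and s: "s \<in> sections n X M W"
    and i: "i \<in> index M" "chart M i \<noteq> {}" and ev: "eventually (\<lambda>x. s (i, x) = 0) gen"
  shows "s = 0"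
proof
  fix y :: "'a \<times> ppoint"
  obtain j x where y: "y = (j, x)" by (cases y)
  note D = sectionsD[OF M W s]
  show "s y = 0 y"
  proof (cases "j \<in> index M \<and> x \<in> W \<and> x \<in> chart M j")
    case True
    then have xX: "x \<in> X" and jI: "j \<in> index M" using line_bundleD(7)[OF M] by blast+
    have ne: "W \<noteq> {}" "chart M j \<noteq> {}" using True by auto
    from ev gen_open[OF line_bundleD(1)[OF M i(1)] i(2)] gen_open[OF W ne(1)]
       gen_open[OF line_bundleD(1)[OF M jI] ne(2)]
    have "eventually (\<lambda>x. s (j, x) = 0) gen"
    proof eventually_elim
      case (elim x)
      then show ?case using D(2)[OF jI i(1), of x] by simp
    qed
    from loc_gen_eq(2)[OF xX D(1) loc_const this] True show ?thesis by (simp add: y)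
  qed (use D(3) in \<open>auto simp: y\<close>)
qed

text \<open>At an exceptional point one chart is enough: regular transition functions carry the germ
  to the other charts, and compatibility there follows from generic compatibility.\<close>

lemma extend_section:
  assumes M: "is_line_bundle n X M" and W: "openin zar W" and F: "finite F"
    and s1: "\<And>i x. i \<in> index M \<Longrightarrow> x \<in> W \<Longrightarrow> x \<in> chart M i \<Longrightarrow> x \<notin> F \<Longrightarrow> (\<lambda>x. s (i, x)) \<in> loc x"
    and s2: "\<And>i j x. i \<in> index M \<Longrightarrow> j \<in> index M \<Longrightarrow> x \<in> W \<Longrightarrow> x \<in> chart M i \<Longrightarrow> x \<in> chart M j \<Longrightarrow> x \<notin> F \<Longrightarrow>
        s (i, x) = trans_fun M i j x * s (j, x)"
    and ext: "\<And>z. z \<in> F \<inter> W \<Longrightarrow> \<exists>i\<in>index M. z \<in> chart M i \<and> (\<exists>b\<in>loc z. eventually (\<lambda>x. s (i, x) = b x) gen)"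
  obtains s' where "s' \<in> sections n X M W"
    "\<forall>i\<in>index M. \<forall>x\<in>W \<inter> chart M i - F. s' (i, x) = s (i, x)"
proof -
  note D = line_bundleD[OF M]
  have WX: "W \<subseteq> X" using openin_subset_X[OF W] .
  have gW: "eventually (\<lambda>x. x \<in> W \<and> x \<in> chart M i \<and> x \<in> chart M j \<and> x \<notin> F) gen"
    if "z \<in> W" "i \<in> index M" "j \<in> index M" "z \<in> chart M i" "z \<in> chart M j" for z i j
    using gen_open[OF W] gen_open[OF D(1)[OF that(2)]] gen_open[OF D(1)[OF that(3)]] gen_not_finite[OF F] that
    by (auto intro!: eventually_conj)
  have "\<exists>f'. (\<forall>x. x \<in> W \<inter> chart M i \<longrightarrow> f' \<in> loc x) \<and> (\<forall>x. x \<in> (W \<inter> chart M i) - F \<longrightarrow> f' x = s (i, x))"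
    if i: "i \<in> index M" for i
  proof -
    have o: "openin zar (W \<inter> chart M i)" using W D(1)[OF i] by blast
    have r: "(\<lambda>x. s (i, x)) \<in> loc x" if "x \<in> (W \<inter> chart M i) - F" for x using s1[OF i] that by blast
    have e: "\<exists>b\<in>loc z. eventually (\<lambda>x. s (i, x) = b x) gen" if z: "z \<in> F \<inter> (W \<inter> chart M i)" for z
    proof -
      obtain j b where j: "j \<in> index M" "z \<in> chart M j" "b \<in> loc z" "eventually (\<lambda>x. s (j, x) = b x) gen"
        using ext[of z] z by blast
      have zX: "z \<in> X" using z WX by blast
      have "(\<lambda>x. trans_fun M i j x * b x) \<in> loc z" using D(3)[OF i j(1) _ j(2)] j(3) z zX by (intro loc_mult) auto
      moreover have "eventually (\<lambda>x. s (i, x) = trans_fun M i j x * b x) gen"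
      proof -
        have "eventually (\<lambda>x. x \<in> W \<and> x \<in> chart M i \<and> x \<in> chart M j \<and> x \<notin> F) gen"
          using gW[OF _ i j(1) _ j(2)] z by blast
        with j(4) show ?thesis
        proof eventually_elim
          case (elim x)
          then show ?case using s2[OF i j(1), of x] by simp
        qed
      qed
      ultimately show ?thesis by (intro bexI[of _ "\<lambda>x. trans_fun M i j x * b x"])
    qed
    from extend_function[OF o F r e] obtain f' where "\<forall>x\<in>W \<inter> chart M i. f' \<in> loc x"
      "\<forall>x\<in>(W \<inter> chart M i) - F. f' x = s (i, x)" .
    then show ?thesis by (intro exI[of _ f'] conjI allI impI) auto
  qed
  then have "\<forall>i. \<exists>f'. i \<in> index M \<longrightarrow> (\<forall>x. x \<in> W \<inter> chart M i \<longrightarrow> f' \<in> loc x) \<and> (\<forall>x. x \<in> (W \<inter> chart M i) - F \<longrightarrow> f' x = s (i, x))"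
    by blast
  from choice[OF this] obtain f where f: "\<forall>i. i \<in> index M \<longrightarrow> (\<forall>x. x \<in> W \<inter> chart M i \<longrightarrow> f i \<in> loc x) \<and>
     (\<forall>x. x \<in> (W \<inter> chart M i) - F \<longrightarrow> f i x = s (i, x))" ..
  define s' where "s' = (\<lambda>(i, x). if i \<in> index M \<and> x \<in> W \<inter> chart M i then f i x else 0)"
  have s'f: "s' (i, x) = f i x" if "i \<in> index M" "x \<in> W" "x \<in> chart M i" for i x
    using that by (simp add: s'_def)
  have l: "(\<lambda>x. s' (i, x)) \<in> loc x" if i: "i \<in> index M" "x \<in> W" "x \<in> chart M i" for i x
  proof -
    have "eventually (\<lambda>x. f i x = s' (i, x)) (near x)"
      using eventually_near_open[OF W i(2)] eventually_near_open[OF D(1)[OF i(1)] i(3)]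
      by eventually_elim (simp add: s'f i)
    from loc_cong[OF this] f i show ?thesis by blast
  qed
  have s's: "s' (i, x) = s (i, x)" if "i \<in> index M" "x \<in> W" "x \<in> chart M i" "x \<notin> F" for i x
    using f that s'f by auto
  have tr: "s' (i, x) = trans_fun M i j x * s' (j, x)"
    if i: "i \<in> index M" "j \<in> index M" "x \<in> W" "x \<in> chart M i" "x \<in> chart M j" for i j x
  proof -
    have xX: "x \<in> X" using WX i by blast
    have r: "(\<lambda>x. trans_fun M i j x * s' (j, x)) \<in> loc x"
      by (intro loc_mult l D(3) i xX)
    have "eventually (\<lambda>x. s' (i, x) = trans_fun M i j x * s' (j, x)) gen"
      using gW[OF i(3,1,2,4,5)] 
    proof eventually_elim
      case (elim x)
      then show ?case using s2[OF i(1,2), of x] s's[OF i(1), of x] s's[OF i(2), of x] by simp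
    qed
    from loc_gen_eq(2)[OF xX l[OF i(1,3,4)] r this] show ?thesis .
  qed
  have "s' \<in> sections n X M W"
    unfolding sections_iff[OF M W]
  proof (intro conjI ballI allI impI)
    show "s' (i, x) = 0" if "\<not> (i \<in> index M \<and> x \<in> W \<inter> chart M i)" for i x
      unfolding s'_def using that by auto
  qed (use l tr in blast)+
  then show thesis using s's by (intro that[of s']) auto
qed

definition fin_dim :: "('b \<Rightarrow> complex) set \<Rightarrow> bool" where
  "fin_dim V \<longleftrightarrow> (\<exists>B. finite B \<and> V \<subseteq> cfun.span B)"

text \<open>In one chart a section is a function whose poles at the finitely many points outside are
  bounded by those of the transition functions. Enough zeros imposed there leave a global regular
  function, hence a constant, and a zero at \<open>x0\<close> makes it 0. So finitely many linear
  conditions kill all sections.\<close>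

lemma fin_dim_sections:
  assumes M: "is_line_bundle n X M" shows "fin_dim (sections n X M X)"
proof -
  note D = line_bundleD[OF M] and S = sectionsD[OF M openin_X]
  obtain x0 where x0: "x0 \<in> X" using X_nonempty by blast
  obtain i0 where i0: "i0 \<in> index M" "x0 \<in> chart M i0" using D(2)[OF x0] by blast
  let ?U = "chart M i0"
  have U: "openin zar ?U" "?U \<noteq> {}" using D(1) i0 by auto
  define Y where "Y = X - ?U"
  have Y: "finite Y" unfolding Y_def by (rule finite_Diff_open[OF U])
  have "\<exists>k. fst k \<in> index M \<and> y \<in> chart M (fst k) \<and>
     (\<exists>w\<in>loc y. eventually (\<lambda>x. w x = unif y x ^ snd k * trans_fun M i0 (fst k) x) gen)" if y: "y \<in> X" for y
  proof -
    obtain j where j: "j \<in> index M" "y \<in> chart M j" using D(2)[OF y] by blast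
    obtain x1 where x1: "x1 \<in> ?U" "x1 \<in> chart M j"
      using open_inter_nonempty[OF U(1) D(1)[OF j(1)] U(2)] j(2) by blast
    from clear_pole[OF D(7)[OF i0(1) x1(1)] D(3)[OF i0(1) j(1) x1] y]
    obtain N w where "w \<in> loc y" "eventually (\<lambda>x. w x = unif y x ^ N * trans_fun M i0 j x) gen" .
    then show ?thesis using j by (intro exI[of _ "(j, N)"]) auto
  qed
  then have "\<forall>y. \<exists>k. y \<in> X \<longrightarrow> fst k \<in> index M \<and> y \<in> chart M (fst k) \<and>
     (\<exists>w\<in>loc y. eventually (\<lambda>x. w x = unif y x ^ snd k * trans_fun M i0 (fst k) x) gen)" by blast
  from choice[OF this] obtain k where k: "\<forall>y. y \<in> X \<longrightarrow> fst (k y) \<in> index M \<and> y \<in> chart M (fst (k y)) \<and>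
     (\<exists>w\<in>loc y. eventually (\<lambda>x. w x = unif y x ^ snd (k y) * trans_fun M i0 (fst (k y)) x) gen)" ..
  \<comment> \<open>At points outside the chart the imposed order is the pole order of the
    transition function; at \<open>x0\<close> it is 1, measured in the chart \<open>i0\<close>
    itself.\<close>
  define j where "j y = (if y \<in> Y then fst (k y) else i0)" for y
  define N where "N y = (if y \<in> Y then snd (k y) else 1)" for y
  let ?Z = "insert x0 Y"
  have Zj: "j z \<in> index M" "z \<in> chart M (j z)" "z \<in> X" if "z \<in> ?Z" for z
    using that k i0 x0 by (auto simp: j_def Y_def)
  let ?V = "sections n X M X"
  let ?V' = "{s \<in> ?V. \<forall>z\<in>?Z. vanishes z (N z) (\<lambda>x. s (j z, x))}"
  have sub: "?Z \<subseteq> X" using Zj(3) by blast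
  have fZ: "finite ?Z" using Y by simp
  have Vl: "(\<lambda>x. s (j z, x)) \<in> loc z" if "s \<in> ?V" "z \<in> ?Z" for s z
    using S(1)[OF that(1) Zj(1)[OF that(2)] Zj(3)[OF that(2)] Zj(2)[OF that(2)]] .
  from codim_vanishes_finite[OF subspace_sections[OF M openin_X] fZ sub Vl]
  have cod: "codim_le ?V ?V' (\<Sum>z\<in>?Z. N z)" by (rule conjunct2)
  have "s = 0" if s: "s \<in> ?V'" for s
  proof -
    have sV: "s \<in> ?V" using s by blast
    have f1: "(\<lambda>x. s (i0, x)) \<in> loc x" if "x \<in> X - Y" for x
      using S(1)[OF sV i0(1), of x] that by (auto simp: Y_def)
    have f2: "\<exists>b\<in>loc y. eventually (\<lambda>x. s (i0, x) = b x) gen" if y: "y \<in> Y \<inter> X" for y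
    proof -
      have yX: "y \<in> X" and jy: "j y \<in> index M" "y \<in> chart M (j y)" "j y = fst (k y)" "N y = snd (k y)"
        using y k by (auto simp: j_def N_def)
      obtain w where w: "w \<in> loc y" "eventually (\<lambda>x. w x = unif y x ^ N y * trans_fun M i0 (j y) x) gen"
        using k yX jy(3,4) by auto
      have "vanishes y (N y) (\<lambda>x. s (j y, x))" using s y by blast
      then obtain a where a: "a \<in> loc y" "eventually (\<lambda>x. s (j y, x) = unif y x ^ N y * a x) gen"
        unfolding vanishes_def by blast
      have ne: "chart M (j y) \<noteq> {}" using jy by blast
      have "eventually (\<lambda>x. s (i0, x) = w x * a x) gen"
        using w(2) a(2) gen_open[OF U] gen_open[OF D(1)[OF jy(1)] ne]
      proof eventually_elim
        case (elim x)
        then show ?case using S(2)[OF sV i0(1) jy(1), of x] D(7)[OF i0(1)] by (simp add: mult.assoc mult.left_commute)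
      qed
      moreover have "(\<lambda>x. w x * a x) \<in> loc y" by (intro loc_mult w(1) a(1) yX)
      ultimately show ?thesis by (intro bexI[of _ "\<lambda>x. w x * a x"])
    qed
    from extend_function[OF openin_X Y f1 f2] obtain f where
      f: "\<forall>x\<in>X. f \<in> loc x" "\<forall>x\<in>X - Y. f x = s (i0, x)" .
    from global_regular_constant[OF f(1)[rule_format]] obtain c where c: "\<forall>p\<in>X. f p = c" .
    have x0Y: "x0 \<notin> Y" using i0 by (simp add: Y_def)
    have "vanishes x0 1 (\<lambda>x. s (i0, x))" using s x0Y by (auto simp: j_def N_def)
    from vanishes_1[OF x0 S(1)[OF sV i0(1) x0 i0(2)] this] have "c = 0"
      using f(2) c x0 x0Y by simp
    have "eventually (\<lambda>x. s (i0, x) = 0) gen"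
      using gen_open[OF U] by (rule eventually_mono) (use f(2) c \<open>c = 0\<close> D(7)[OF i0(1)] in \<open>fastforce simp: Y_def\<close>)
    from section_eq_0[OF M openin_X sV i0(1) U(2) this] show ?thesis .
  qed
  then have V0: "?V' \<subseteq> {0}" by blast
  obtain B where B: "finite B" "?V \<subseteq> cfun.span (?V' \<union> B)" using cod unfolding codim_le_def by blast
  have "cfun.span (?V' \<union> B) \<subseteq> cfun.span (insert 0 B)" using V0 by (intro cfun.span_mono) blast
  with B show ?thesis unfolding fin_dim_def by (intro exI[of _ "insert 0 B"]) auto
qed

end

section \<open>Sections of high powers of an ample line bundle\<close>

context curve
begin

text \<open>If all sections defining the embedding were multiples of one, the map would be constant;
  but it is injective and the curve has two points.\<close>

lemma very_ample_pencil:
  assumes M: "is_line_bundle n X M" and va: "very_ample n X M"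
  obtains \<sigma> \<tau> where "\<sigma> \<in> sections n X M X" "\<tau> \<in> sections n X M X" "\<sigma> \<noteq> 0" "\<forall>c. \<tau> \<noteq> cscale c \<sigma>"
proof (rule ccontr)
  assume neg: "\<not> thesis"
  note thesisI = that
  note D = line_bundleD[OF M]
  from va obtain N \<sigma> \<phi> where \<sigma>: "\<forall>a\<le>N. \<sigma> a \<in> sections n X M X"
    and \<phi>: "\<forall>i\<in>index M. \<forall>x\<in>chart M i.
           (\<exists>a\<le>N. \<sigma> a (i, x) \<noteq> 0) \<and> \<phi> x = line (\<lambda>a. if a \<le> N then \<sigma> a (i, x) else 0)"
    and ce: "closed_embedding n X N \<phi>"
    unfolding very_ample_def by (elim exE conjE)
  obtain \<psi> where \<psi>: "\<forall>x\<in>X. \<psi> (\<phi> x) = x" using ce unfolding closed_embedding_def by blast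
  obtain x where x: "x \<in> X" using X_nonempty by blast
  obtain y where y: "y \<in> X" "y \<noteq> x" using gen_ex[OF gen_neq[OF x]] by blast
  obtain i where i: "i \<in> index M" "x \<in> chart M i" using D(2)[OF x] by blast
  then obtain a where a: "a \<le> N" "\<sigma> a (i, x) \<noteq> 0" using \<phi> by blast
  then have "\<sigma> a \<noteq> 0" by auto
  then have "\<exists>c. \<sigma> b = cscale c (\<sigma> a)" if "b \<le> N" for b
    using neg thesisI[of "\<sigma> a" "\<sigma> b"] \<sigma> a(1) that by blast
  then have "\<forall>b. \<exists>c. b \<le> N \<longrightarrow> \<sigma> b = cscale c (\<sigma> a)" by blast
  from choice[OF this] obtain c where c: "\<forall>b. b \<le> N \<longrightarrow> \<sigma> b = cscale (c b) (\<sigma> a)" ..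
  have "\<phi> z = line (\<lambda>b. if b \<le> N then c b else 0)" if z: "z \<in> X" for z
  proof -
    obtain j where j: "j \<in> index M" "z \<in> chart M j" using D(2)[OF z] by blast
    then obtain b where b: "b \<le> N" "\<sigma> b (j, z) \<noteq> 0" using \<phi> by blast
    then have "c b * \<sigma> a (j, z) \<noteq> 0" using c by (auto simp: cscale_def)
    then have nz: "\<sigma> a (j, z) \<noteq> 0" by simp
    have "(\<lambda>b. if b \<le> N then \<sigma> b (j, z) else 0) = cscale (\<sigma> a (j, z)) (\<lambda>b. if b \<le> N then c b else 0)"
    proof
      fix b
      have "\<sigma> b (j, z) = c b * \<sigma> a (j, z)" if "b \<le> N"
        using fun_cong[OF c[rule_format, OF that], of "(j, z)"] by (simp add: cscale_def)
      then show "(if b \<le> N then \<sigma> b (j, z) else 0) = cscale (\<sigma> a (j, z)) (\<lambda>b. if b \<le> N then c b else 0) b"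
        by (simp add: cscale_def)
    qed
    then show ?thesis using \<phi> j line_cscale[OF nz] by simp
  qed
  then have "\<phi> x = \<phi> y" using x y by simp
  then show False using \<psi> x y by metis
qed

lemma section_gen_nonzero:
  assumes M: "is_line_bundle n X M" and s: "s \<in> sections n X M X" "s \<noteq> 0"
    and i: "i \<in> index M" "x \<in> chart M i"
  shows "eventually (\<lambda>x. s (i, x) \<noteq> 0) gen"
proof -
  have x: "x \<in> X" using line_bundleD(7)[OF M i] .
  have ne: "chart M i \<noteq> {}" using i by blast
  have "\<not> eventually (\<lambda>x. s (i, x) = 0) (near x)"
    using near_gen[OF x] section_eq_0[OF M openin_X s(1) i(1) ne] s(2) by blast
  with loc_zero_or_gen_nonzero[OF x sectionsD(1)[OF M openin_X s(1) i(1) x i(2)]] show ?thesis by blast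
qed

text \<open>Dividing a relation by \<open>\<sigma> ^ j\<close> gives a polynomial equation with
  constant coefficients for the rational function \<open>\<tau> / \<sigma>\<close>. Such a function
  is constant, which makes the two sections proportional.\<close>

lemma pencil_powers_independent:
  assumes M: "is_line_bundle n X M" and \<sigma>: "\<sigma> \<in> sections n X M X" "\<sigma> \<noteq> 0"
    and \<tau>: "\<tau> \<in> sections n X M X" "\<forall>c. \<tau> \<noteq> cscale c \<sigma>"
    and c: "\<exists>k\<in>{..j}. c k \<noteq> 0"
  shows "(\<Sum>k\<le>j. cscale (c k) (\<lambda>y. \<tau> y ^ k * \<sigma> y ^ (j - k))) \<noteq> 0"
proof
  assume eq: "(\<Sum>k\<le>j. cscale (c k) (\<lambda>y. \<tau> y ^ k * \<sigma> y ^ (j - k))) = 0"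
  have 0: "(\<Sum>k\<le>j. c k * (\<tau> y ^ k * \<sigma> y ^ (j - k))) = 0" for y
    using fun_cong[OF eq, of y] by (simp only: cscale_sum_apply zero_fun_apply)
  obtain x0 where x0: "x0 \<in> X" using X_nonempty by blast
  obtain i where i: "i \<in> index M" "x0 \<in> chart M i" using line_bundleD(2)[OF M x0] by blast
  have ne: "chart M i \<noteq> {}" using i by blast
  note nz = section_gen_nonzero[OF M \<sigma> i]
  have "eventually (\<lambda>x. \<sigma> (i, x) \<noteq> 0 \<and> x \<in> chart M i) gen"
    using nz gen_open[OF line_bundleD(1)[OF M i(1)] ne] by (rule eventually_conj)
  from gen_ex[OF this] obtain x where x: "x \<in> X" "\<sigma> (i, x) \<noteq> 0" "x \<in> chart M i" by blast
  have l: "(\<lambda>x. \<tau> (i, x) / \<sigma> (i, x)) \<in> loc x"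
    using sectionsD(1)[OF M openin_X \<sigma>(1) i(1) x(1,3)] sectionsD(1)[OF M openin_X \<tau>(1) i(1) x(1,3)] x
    by (intro loc_divide)
  define P where "P = (\<Sum>k\<le>j. monom (c k) k)"
  have cP: "coeff P k = (if k \<le> j then c k else 0)" for k
    by (simp add: P_def coeff_sum if_distrib sum.delta cong: if_cong)
  have P0: "P \<noteq> 0" using c cP by (metis atMost_iff coeff_0)
  have "eventually (\<lambda>x. \<tau> (i, x) / \<sigma> (i, x) \<in> {z. poly P z = 0}) gen"
    using nz
  proof eventually_elim
    case (elim x)
    let ?s = "\<sigma> (i, x)" and ?t = "\<tau> (i, x)"
    have "?s ^ j * poly P (?t / ?s) = (\<Sum>k\<le>j. c k * (?t ^ k * ?s ^ (j - k)))"
      unfolding P_def poly_sum poly_monom sum_distrib_left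
    proof (rule sum.cong[OF refl])
      fix k assume "k \<in> {..j}"
      then have "?s ^ j = ?s ^ k * ?s ^ (j - k)" by (simp flip: power_add)
      then show "?s ^ j * (c k * (?t / ?s) ^ k) = c k * (?t ^ k * ?s ^ (j - k))"
        using elim by (simp add: power_divide field_simps)
    qed
    with 0[of "(i, x)"] elim show ?case by simp
  qed
  from loc_finite_values_constant[OF x(1) l poly_roots_finite[OF P0] this]
  obtain r where r: "eventually (\<lambda>x. \<tau> (i, x) / \<sigma> (i, x) = r) (near x)" .
  have "eventually (\<lambda>x. (\<tau> - cscale r \<sigma>) (i, x) = 0) gen"
    using near_gen[OF x(1) r] nz by eventually_elim (auto simp: cscale_def)
  moreover have "\<tau> - cscale r \<sigma> \<in> sections n X M X"
    using subspace_sections[OF M openin_X] \<sigma>(1) \<tau>(1)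
    by (intro cfun.subspace_diff cfun.subspace_scale)
  ultimately have "\<tau> - cscale r \<sigma> = 0" using section_eq_0[OF M openin_X _ i(1) ne] by blast
  with \<tau>(2) show False by simp
qed

lemma section_power_product:
  assumes L: "is_line_bundle n X L"
    and \<sigma>: "\<sigma> \<in> sections n X (tensor_power L m) X" and \<tau>: "\<tau> \<in> sections n X (tensor_power L m) X"
    and k: "k \<le> j"  and j: "0 < j"
  shows "(\<lambda>y. \<tau> y ^ k * \<sigma> y ^ (j - k)) \<in> sections n X (tensor_power L (m * int j)) X"
proof -
  note M = is_line_bundle_tensor_power[OF L]
  note S = sectionsD[OF M openin_X \<sigma>] and T = sectionsD[OF M openin_X \<tau>]
  show ?thesis
    unfolding sections_iff[OF M openin_X]
  proof (intro conjI ballI allI impI)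
    fix i x assume "i \<in> index (tensor_power L (m * int j))" "x \<in> X \<inter> chart (tensor_power L (m * int j)) i"
    then show "(\<lambda>x. \<tau> (i, x) ^ k * \<sigma> (i, x) ^ (j - k)) \<in> loc x"
      using S(1)[of i x] T(1)[of i x] by (intro loc_mult loc_power) auto
  next
    fix i l x assume "i \<in> index (tensor_power L (m * int j))" "l \<in> index (tensor_power L (m * int j))"
      "x \<in> X \<inter> chart (tensor_power L (m * int j)) i \<inter> chart (tensor_power L (m * int j)) l"
    then have s: "\<sigma> (i, x) = trans_fun L i l x powi m * \<sigma> (l, x)" "\<tau> (i, x) = trans_fun L i l x powi m * \<tau> (l, x)"
      using S(2)[of i l x] T(2)[of i l x] by auto
    let ?g = "trans_fun L i l x"
    have "?g powi (m * int j) = (?g powi m) ^ k * (?g powi m) ^ (j - k)"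
      using k by (simp add: power_int_mult flip: power_add)
    then show "\<tau> (i, x) ^ k * \<sigma> (i, x) ^ (j - k) =
      trans_fun (tensor_power L (m * int j)) i l x * (\<tau> (l, x) ^ k * \<sigma> (l, x) ^ (j - k))"
      unfolding s by (simp add: power_mult_distrib)
  next
    fix i x assume "\<not> (i \<in> index (tensor_power L (m * int j)) \<and> x \<in> X \<inter> chart (tensor_power L (m * int j)) i)"
    then have "\<sigma> (i, x) = 0" "\<tau> (i, x) = 0" using S(3)[of i x] T(3)[of i x] by auto
    \<comment> \<open>Here \<open>0 < j\<close> matters: for \<open>j = 0\<close> the product would
      be 1 and not 0 outside the charts.\<close>
    then show "\<tau> (i, x) ^ k * \<sigma> (i, x) ^ (j - k) = 0" using j k by (cases "k = 0") auto
  qed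
qed

text \<open>The section is a form in two independent sections of \<open>L\<^sup>m\<close> which vanishes to high order at
  \<open>Z\<close> and outside a chart \<open>i0\<close>, multiplied by the rational section of \<open>L\<^sup>e\<close> equal to 1 on the chart.\<close>

lemma vanishing_section_exists:
  assumes L: "is_line_bundle n X L" and am: "ample n X L" and Z: "finite Z" "Z \<subseteq> X"
  obtains d0 :: int where "\<forall>d\<ge>d0. \<exists>s\<in>sections n X (tensor_power L d) X. s \<noteq> 0 \<and>
    (\<forall>z\<in>Z. \<forall>i\<in>index L. z \<in> chart L i \<longrightarrow> vanishes z (N z) (\<lambda>x. s (i, x)))"
proof -
  note D = line_bundleD[OF L]
  note LB = is_line_bundle_tensor_power[OF L]
  obtain m :: int where m: "m > 0" "very_ample n X (tensor_power L m)" using am unfolding ample_def by blast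
  from very_ample_pencil[OF LB m(2)] obtain \<sigma> \<tau> where
    \<sigma>: "\<sigma> \<in> sections n X (tensor_power L m) X" "\<sigma> \<noteq> 0" and
    \<tau>: "\<tau> \<in> sections n X (tensor_power L m) X" "\<forall>c. \<tau> \<noteq> cscale c \<sigma>" by metis
  obtain x0 where x0: "x0 \<in> X" using X_nonempty by blast
  obtain i0 where i0: "i0 \<in> index L" "x0 \<in> chart L i0" using D(2)[OF x0] by blast
  let ?U = "chart L i0"
  have U: "openin zar ?U" "?U \<noteq> {}" using D(1) i0 by auto
  define Y where "Y = X - ?U"
  have Y: "finite Y" unfolding Y_def by (rule finite_Diff_open[OF U])
  define Z' where "Z' = Z \<union> Y"
  have Z': "finite Z'" "Z' \<subseteq> X" using Z Y by (auto simp: Z'_def Y_def)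
  have "\<forall>z. \<exists>j. z \<in> X \<longrightarrow> j \<in> index L \<and> z \<in> chart L j" using D(2) by blast
  from choice[OF this] obtain j where j: "\<forall>z. z \<in> X \<longrightarrow> j z \<in> index L \<and> z \<in> chart L (j z)" ..
  have gj: "eventually (\<lambda>x. x \<in> chart L (j z) \<and> x \<in> ?U) gen" if "z \<in> X" for z
    using gen_open[OF U] gen_open[OF D(1), of "j z"] j that by (intro eventually_conj) blast+
  have "\<exists>P. \<exists>w\<in>loc z. eventually (\<lambda>x. w x = unif z x ^ P * trans_fun L (j z) i0 x powi e) gen" if z: "z \<in> X" for z e
  proof -
    obtain x1 where x1: "x1 \<in> chart L (j z)" "x1 \<in> ?U" "x1 \<in> X" using gen_ex[OF gj[OF z]] by blast
    have jz: "j z \<in> index L" using j z by blast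
    have "(\<lambda>x. trans_fun L (j z) i0 x powi e) \<in> loc x1"
      by (intro loc_powi D(3,6) jz i0(1) x1)
    from clear_pole[OF x1(3) this z] show ?thesis by metis
  qed
  then have "\<forall>y. \<exists>P. fst y \<in> X \<longrightarrow> (\<exists>w\<in>loc (fst y). eventually (\<lambda>x. w x = unif (fst y) x ^ P * trans_fun L (j (fst y)) i0 x powi snd y) gen)"
    by blast
  from choice[OF this] obtain P' where P': "\<forall>y. fst y \<in> X \<longrightarrow> (\<exists>w\<in>loc (fst y).
    eventually (\<lambda>x. w x = unif (fst y) x ^ P' y * trans_fun L (j (fst y)) i0 x powi snd y) gen)" ..
  define P where "P z e = P' (z, e)" for z e
  have P: "\<exists>w\<in>loc z. eventually (\<lambda>x. w x = unif z x ^ P z e * trans_fun L (j z) i0 x powi e) gen" if "z \<in> X" for z e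
    using P'[rule_format, of "(z, e)"] that by (simp add: P_def)
  \<comment> \<open>Summing over all residues \<open>e\<close> bounds the number of conditions for
    each of them. The added 1 makes \<open>k\<close> positive, and the \<open>k + 1\<close> products
    of powers of the pencil outnumber the conditions.\<close>
  define C where "C = (\<Sum>e\<in>{0..<m}. \<Sum>z\<in>Z'. P z e + N z) + 1"
  show thesis
  proof (rule that, intro allI impI)
    fix d :: int assume d: "int C * m \<le> d"
    define e where "e = d mod m"
    define k where "k = nat (d div m)"
    have "int C \<le> d div m" using d m(1) by (metis nonzero_mult_div_cancel_right zdiv_mono1 less_irrefl)
    then have k: "C \<le> k" "int k = d div m" by (auto simp: k_def)
    have dk: "d = e + m * int k" by (simp add: e_def k(2))
    have "(\<Sum>z\<in>Z'. P z e + N z) \<le> (\<Sum>e\<in>{0..<m}. \<Sum>z\<in>Z'. P z e + N z)"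
      by (rule member_le_sum) (use m(1) in \<open>auto simp: e_def\<close>)
    then have k1: "(\<Sum>z\<in>Z'. P z e + N z) < card {..k}" and k0: "0 < k" using k(1) by (auto simp: C_def)
    let ?V = "sections n X (tensor_power L (m * int k)) X"
    let ?V' = "{s \<in> ?V. \<forall>z\<in>Z'. vanishes z (P z e + N z) (\<lambda>x. s (j z, x))}"
    have Vl: "(\<lambda>x. s (j z, x)) \<in> loc z" if "s \<in> ?V" "z \<in> Z'" for s z
    proof -
      have "z \<in> X" using that(2) Z'(2) by blast
      then show ?thesis using sectionsD(1)[OF LB openin_X that(1), of "j z" z] j by simp
    qed
    note cod = codim_vanishes_finite[OF subspace_sections[OF LB openin_X] Z' Vl, where N = "\<lambda>z. P z e + N z"]
    have mem: "(\<lambda>y. \<tau> y ^ l * \<sigma> y ^ (k - l)) \<in> ?V" if "l \<in> {..k}" for l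
      using section_power_product[OF L \<sigma>(1) \<tau>(1) _ k0, of l] that by simp
    from codim_le_obtain_relation[OF conjunct2[OF cod] conjunct1[OF cod] finite_atMost k1 mem]
    obtain c where c: "\<exists>l\<in>{..k}. c l \<noteq> 0" "(\<Sum>l\<le>k. cscale (c l) (\<lambda>y. \<tau> y ^ l * \<sigma> y ^ (k - l))) \<in> ?V'" .
    define s' where "s' = (\<Sum>l\<le>k. cscale (c l) (\<lambda>y. \<tau> y ^ l * \<sigma> y ^ (k - l)))"
    have s'0: "s' \<noteq> 0" unfolding s'_def by (rule pencil_powers_independent[OF LB \<sigma> \<tau> c(1)])
    have s'V: "s' \<in> ?V" and s'v: "\<And>z. z \<in> Z' \<Longrightarrow> vanishes z (P z e + N z) (\<lambda>x. s' (j z, x))"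
      using c(2) unfolding s'_def by blast+
    note S = sectionsD[OF LB openin_X s'V, simplified]
    \<comment> \<open>In chart \<open>i\<close> the rational section of \<open>L\<^sup>e\<close>
      that is 1 on the chart \<open>i0\<close> is this power of the transition function. At
      \<open>z\<close> its pole has order at most \<open>P z e\<close>, which the extra order of
      \<open>s'\<close> absorbs.\<close>
    define s0 where "s0 = (\<lambda>(i, x). trans_fun L i i0 x powi e * s' (i, x))"
    have s0: "s0 (i, x) = trans_fun L i i0 x powi e * s' (i, x)" for i x by (simp add: s0_def)
    have pole: "vanishes z (N z) (\<lambda>x. s0 (j z, x))" if z: "z \<in> Z'" for z
    proof -
      have zX: "z \<in> X" using z Z' by blast
      obtain w where w: "w \<in> loc z" "eventually (\<lambda>x. w x = unif z x ^ P z e * trans_fun L (j z) i0 x powi e) gen"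
        using P[OF zX] by blast
      obtain a where a: "a \<in> loc z" "eventually (\<lambda>x. s' (j z, x) = unif z x ^ (P z e + N z) * a x) gen"
        using s'v[OF z] unfolding vanishes_def by blast
      have "eventually (\<lambda>x. s0 (j z, x) = unif z x ^ N z * (w x * a x)) gen"
        using w(2) a(2) by eventually_elim (simp add: s0 power_add)
      moreover have "(\<lambda>x. w x * a x) \<in> loc z" using w(1) a(1) zX by (intro loc_mult)
      ultimately show ?thesis unfolding vanishes_def by (intro bexI[of _ "\<lambda>x. w x * a x"])
    qed
    have e1: "(\<lambda>x. s0 (i, x)) \<in> loc x"
      if "i \<in> index (tensor_power L d)" "x \<in> X" "x \<in> chart (tensor_power L d) i" "x \<notin> Y" for i x
    proof -
      have "x \<in> ?U" using that by (simp add: Y_def)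
      then show ?thesis unfolding s0 using that i0(1)
        by (intro loc_mult loc_powi D(3,6) S(1)) auto
    qed
    have e2: "s0 (i, x) = trans_fun (tensor_power L d) i l x * s0 (l, x)"
      if "i \<in> index (tensor_power L d)" "l \<in> index (tensor_power L d)" "x \<in> X"
        "x \<in> chart (tensor_power L d) i" "x \<in> chart (tensor_power L d) l" "x \<notin> Y" for i l x
    proof -
      have "x \<in> ?U" using that by (simp add: Y_def)
      then have g: "trans_fun L i i0 x = trans_fun L i l x * trans_fun L l i0 x" "trans_fun L i l x \<noteq> 0"
        using D(5)[of i l i0 x] D(6)[of i l x] that i0(1) by auto
      have s': "s' (i, x) = trans_fun L i l x powi (m * int k) * s' (l, x)" using S(2)[of i l x] that by simp
      have "trans_fun L i l x powi d = trans_fun L i l x powi e * trans_fun L i l x powi (m * int k)"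
        unfolding dk using g(2) by (simp add: power_int_add)
      then show ?thesis unfolding s0 g(1) s' by (simp add: power_int_mult_distrib)
    qed
    have e3: "\<exists>i\<in>index (tensor_power L d). z \<in> chart (tensor_power L d) i \<and> (\<exists>b\<in>loc z. eventually (\<lambda>x. s0 (i, x) = b x) gen)"
      if z: "z \<in> Y \<inter> X" for z
    proof -
      have zX: "z \<in> X" and zZ: "z \<in> Z'" using z by (auto simp: Z'_def)
      obtain a where "a \<in> loc z" "eventually (\<lambda>x. s0 (j z, x) = unif z x ^ N z * a x) gen"
        using pole[OF zZ] unfolding vanishes_def by blast
      then show ?thesis using j zX
        by (intro bexI[of _ "j z"] conjI bexI[of _ "\<lambda>x. unif z x ^ N z * a x"] loc_mult loc_power loc_unif) auto
    qed
    from extend_section[OF LB openin_X Y e1 e2 e3] obtain s where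
      s: "s \<in> sections n X (tensor_power L d) X"
      "\<forall>i\<in>index (tensor_power L d). \<forall>x\<in>X \<inter> chart (tensor_power L d) i - Y. s (i, x) = s0 (i, x)" .
    have ss0: "eventually (\<lambda>x. s (i, x) = s0 (i, x)) gen" if "i \<in> index L" "x \<in> chart L i" for i x
    proof -
      have "chart L i \<noteq> {}" using that by blast
      from gen_open[OF D(1)[OF that(1)] this] gen_not_finite[OF Y] gen_in_X show ?thesis
        by eventually_elim (use s(2) that(1) in auto)
    qed
    have "s \<noteq> 0"
    proof
      assume "s = 0"
      have "eventually (\<lambda>x. s' (i0, x) = 0) gen"
        using ss0[OF i0] gen_open[OF U]
        by eventually_elim (use \<open>s = 0\<close> D(4)[OF i0(1)] in \<open>simp add: s0\<close>)
      from section_eq_0[OF LB openin_X s'V _ _ this] i0 U s'0 show False by simp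
    qed
    moreover have "vanishes z (N z) (\<lambda>x. s (i, x))" if z: "z \<in> Z" and i: "i \<in> index L" "z \<in> chart L i" for z i
    proof -
      have zX: "z \<in> X" and zZ: "z \<in> Z'" using z Z by (auto simp: Z'_def)
      have jz: "j z \<in> index L" "z \<in> chart L (j z)" using j zX by auto
      have ne: "chart L i \<noteq> {}" "chart L (j z) \<noteq> {}" using i jz by auto
      have "(\<lambda>x. trans_fun L i (j z) x powi d) \<in> loc z" by (intro loc_powi D(3,6) i jz zX)
      moreover have "eventually (\<lambda>x. s (i, x) = trans_fun L i (j z) x powi d * s0 (j z, x)) gen"
        using gen_open[OF D(1)[OF i(1)] ne(1)] gen_open[OF D(1)[OF jz(1)] ne(2)] ss0[OF jz]
      proof eventually_elim
        case (elim x)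
        then show ?case using sectionsD(2)[OF LB openin_X s(1), of i "j z" x] i jz D(7)[OF i(1) elim(1)] by simp
      qed
      ultimately show ?thesis by (rule vanishes_mult_loc[OF zX pole[OF zZ]])
    qed
    ultimately show "\<exists>s\<in>sections n X (tensor_power L d) X. s \<noteq> 0 \<and>
        (\<forall>z\<in>Z. \<forall>i\<in>index L. z \<in> chart L i \<longrightarrow> vanishes z (N z) (\<lambda>x. s (i, x)))"
      using s(1) by blast
  qed
qed

end

section \<open>Interpolation by forms of large degree\<close>

context curve
begin

lemma vanishes_add:
  assumes "z \<in> X" "vanishes z N f" "vanishes z N g"
  shows "vanishes z N (\<lambda>q. f q + g q)"
proof -
  obtain a where a: "a \<in> loc z" "eventually (\<lambda>q. f q = unif z q ^ N * a q) gen" using assms(2) unfolding vanishes_def by blast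
  obtain b where b: "b \<in> loc z" "eventually (\<lambda>q. g q = unif z q ^ N * b q) gen" using assms(3) unfolding vanishes_def by blast
  have "eventually (\<lambda>q. f q + g q = unif z q ^ N * (a q + b q)) gen"
    using a(2) b(2) by eventually_elim (simp add: distrib_left)
  then show ?thesis unfolding vanishes_def using a(1) b(1) assms(1)
    by (intro bexI[of _ "\<lambda>q. a q + b q"] loc_add)
qed

lemma vanishes_sum:
  assumes "z \<in> X" "\<And>i. i \<in> I \<Longrightarrow> vanishes z N (f i)"
  shows "vanishes z N (\<lambda>q. \<Sum>i\<in>I. f i q)"
proof -
  have 0: "vanishes z N (\<lambda>_. 0)" unfolding vanishes_def by (intro bexI[of _ "\<lambda>_. 0"]) auto
  show ?thesis using assms(2)
    by (induction I rule: infinite_finite_induct) (auto intro: 0 vanishes_add[OF assms(1)])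
qed

text \<open>Repeatedly subtract the value at \<open>z\<close> from the current quotient and divide
  by the uniformizer.\<close>

lemma taylor_expansion:
  assumes z: "z \<in> X" and f: "f \<in> loc z"
  shows "\<exists>c. vanishes z N (\<lambda>q. f q - (\<Sum>k<N. c k * unif z q ^ k))"
proof (induction N)
  case 0
  show ?case unfolding vanishes_def using f by (intro exI[of _ "\<lambda>_. 0"] bexI[of _ f]) auto
next
  case (Suc N)
  then obtain c a where a: "a \<in> loc z" "eventually (\<lambda>q. f q - (\<Sum>k<N. c k * unif z q ^ k) = unif z q ^ N * a q) gen"
    unfolding vanishes_def by blast
  have l: "(\<lambda>q. a q - a z) \<in> loc z" by (intro loc_diff loc_const a(1) z)
  obtain b where b: "b \<in> loc z" "eventually (\<lambda>q. a q - a z = unif z q * b q) (near z)"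
    using uniformizerD(4)[OF unif(2)[OF z] l] by auto
  define c' where "c' = c(N := a z)"
  have s: "(\<Sum>k<N. c' k * unif z q ^ k) = (\<Sum>k<N. c k * unif z q ^ k)" for q
    by (rule sum.cong) (auto simp: c'_def)
  have "eventually (\<lambda>q. f q - (\<Sum>k<Suc N. c' k * unif z q ^ k) = unif z q ^ Suc N * b q) gen"
    using a(2) near_gen[OF z b(2)]
  proof eventually_elim
    case (elim q)
    have "f q - (\<Sum>k<Suc N. c' k * unif z q ^ k) = unif z q ^ N * (a q - a z)"
      using elim(1) by (simp add: s c'_def algebra_simps)
    then show ?case using elim(2) by simp
  qed
  then show ?case unfolding vanishes_def using b(1) by blast
qed

lemma gen_coord: "z \<in> X \<Longrightarrow> eventually (\<lambda>q. rep q (bco z) \<noteq> 0) gen"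
  using hom_poly_gen_nonzero[OF hom_poly.var[OF bco(1)] _ bco(2)] by blast

text \<open>A product of \<open>N\<close>-th powers of linear forms, one through each point of
  \<open>S\<close> and none through \<open>z\<close>.\<close>

lemma form_vanishing_elsewhere:
  assumes "finite S" "S \<subseteq> X" "z \<in> X" "z \<notin> S"
  shows "\<exists>d Q. hom_poly n d Q \<and> Q (rep z) \<noteq> 0 \<and> (\<forall>y\<in>S. vanishes y N (\<lambda>q. Q (nrm (bco y) q)))"
  using assms(1,2,4)
proof (induction S rule: finite_induct)
  case empty
  show ?case using hom_poly.const[of n 1] by (intro exI[of _ 0] exI[of _ "\<lambda>_. 1"]) auto
next
  case (insert x S)
  then obtain d Q where Q: "hom_poly n d Q" "Q (rep z) \<noteq> 0" "\<forall>y\<in>S. vanishes y N (\<lambda>q. Q (nrm (bco y) q))" by auto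
  have x: "x \<in> X" "x \<noteq> z" using insert.prems by auto
  obtain l where l: "hom_poly n 1 l" "l (rep x) = 0" "l (rep z) \<noteq> 0"
    using separating_form[OF X_proj[OF x(1)] X_proj[OF assms(3)] x(2)] .
  let ?Q = "\<lambda>v. Q v * l v ^ N"
  have h: "hom_poly n (d + N) ?Q"
    using hom_poly_mult'[OF Q(1) hom_poly_power[OF l(1), of N]] by simp
  have lp: "(\<lambda>q. l (nrm (bco y) q)) \<in> loc y" if "y \<in> X" for y by (rule loc_hom_nrm[OF that l(1) bco[OF that]])
  have "vanishes y N (\<lambda>q. ?Q (nrm (bco y) q))" if y: "y \<in> insert x S" for y
  proof (cases "y = x")
    case True
    have "l (nrm (bco x) x) = 0" using l(2) by (simp add: hom_poly_nrm[OF l(1)])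
    from uniformizerD(4)[OF unif(2)[OF x(1)] lp[OF x(1)] this] obtain a where
      a: "a \<in> loc x" "eventually (\<lambda>q. l (nrm (bco x) q) = unif x q * a q) (near x)" by blast
    have "eventually (\<lambda>q. ?Q (nrm (bco x) q) = unif x q ^ N * (Q (nrm (bco x) q) * a q ^ N)) gen"
      using near_gen[OF x(1) a(2)] by eventually_elim (simp add: power_mult_distrib)
    moreover have "(\<lambda>q. Q (nrm (bco x) q) * a q ^ N) \<in> loc x"
      by (intro loc_mult loc_power a(1) x(1) loc_hom_nrm[OF x(1) Q(1) bco[OF x(1)]])
    ultimately show ?thesis unfolding vanishes_def True by (intro bexI[of _ "\<lambda>q. Q (nrm (bco x) q) * a q ^ N"])
  next
    case False
    then have yS: "y \<in> S" "y \<in> X" using y insert.prems by auto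
    show ?thesis
      by (rule vanishes_mult_loc[OF yS(2) Q(3)[rule_format, OF yS(1)] loc_power[OF yS(2) lp[OF yS(2)], of N]])
         (simp add: mult.commute)
  qed
  moreover have "?Q (rep z) \<noteq> 0" using Q(2) l(3) by simp
  ultimately show ?case using h by blast
qed

lemma interpolation_one_point:
  assumes Z: "finite Z" "Z \<subseteq> X" "z \<in> Z"
  shows "\<exists>r0. \<forall>r\<ge>r0. \<forall>w\<in>loc z. \<exists>A. hom_poly n r A \<and> vanishes z N (\<lambda>q. A (nrm (bco z) q) - w q) \<and>
    (\<forall>y\<in>Z - {z}. vanishes y N (\<lambda>q. A (nrm (bco y) q)))"
proof -
  have zX: "z \<in> X" using Z by blast
  note b = bco[OF zX]
  let ?b = "bco z"
  obtain d Q where Q: "hom_poly n d Q" "Q (rep z) \<noteq> 0" "\<forall>y\<in>Z - {z}. vanishes y N (\<lambda>q. Q (nrm (bco y) q))"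
    using form_vanishing_elsewhere[of "Z - {z}" z N] Z zX by blast
  have Ql: "(\<lambda>q. Q (nrm ?b q)) \<in> loc z" "Q (nrm ?b z) \<noteq> 0"
    using loc_hom_nrm[OF zX Q(1) b] Q(2) b(2) by (auto simp: hom_poly_nrm[OF Q(1)])
  \<comment> \<open>A linear form whose dehomogenisation in the chart of \<open>z\<close> is the
    uniformizer, so that polynomials in \<open>unif z\<close> come from forms.\<close>
  define \<Lambda> where "\<Lambda> = (\<lambda>v::cvec. v (kco z) - nrm ?b z (kco z) * v ?b)"
  have \<Lambda>: "hom_poly n 1 \<Lambda>" unfolding \<Lambda>_def
    by (intro hom_poly_diff hom_poly_cmult hom_poly.var b unif(1)[OF zX])
  show ?thesis
  proof (intro exI[of _ "d + N"] allI impI ballI)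
    fix r w assume r: "d + N \<le> r" and w: "w \<in> loc z"
    \<comment> \<open>\<open>Q\<close> makes the form vanish at the other points; as it is a unit at
      \<open>z\<close>, its effect there is divided out beforehand.\<close>
    have "(\<lambda>q. w q / Q (nrm ?b q)) \<in> loc z" by (intro loc_divide w Ql zX)
    from taylor_expansion[OF zX this, of N] obtain c where
      c: "vanishes z N (\<lambda>q. w q / Q (nrm ?b q) - (\<Sum>k<N. c k * unif z q ^ k))" by blast
    \<comment> \<open>Each power of \<open>\<Lambda>\<close> is filled up to degree
      \<open>r - d\<close> with the coordinate that is 1 in the chart; \<open>d + N \<le> r\<close>
      leaves room for all \<open>k < N\<close>.\<close>
    define G where "G = (\<lambda>v::cvec. \<Sum>k<N. c k * (\<Lambda> v ^ k * v ?b ^ (r - d - k)))"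
    have G: "hom_poly n (r - d) G" unfolding G_def
    proof (intro hom_poly_sum hom_poly_cmult)
      fix k assume "k \<in> {..<N}"
      then show "hom_poly n (r - d) (\<lambda>v. \<Lambda> v ^ k * v ?b ^ (r - d - k))"
        using r by (intro hom_poly_mult'[OF hom_poly_power[OF \<Lambda>, of k] hom_poly_var_power[OF b(1)]]) auto
    qed
    let ?A = "\<lambda>v. Q v * G v"
    have "hom_poly n r ?A" using r by (intro hom_poly_mult'[OF Q(1) G]) auto
    moreover have "vanishes z N (\<lambda>q. ?A (nrm ?b q) - w q)"
    proof (rule vanishes_mult_loc[OF zX c])
      show "(\<lambda>q. - Q (nrm ?b q)) \<in> loc z" by (intro loc_uminus Ql zX)
      show "eventually (\<lambda>q. ?A (nrm ?b q) - w q =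
          - Q (nrm ?b q) * (w q / Q (nrm ?b q) - (\<Sum>k<N. c k * unif z q ^ k))) gen"
        using near_gen[OF zX loc_nonzero_near[OF zX Ql]] gen_coord[OF zX]
      proof eventually_elim
        case (elim q)
        have "\<Lambda> (nrm ?b q) = unif z q" using nrm_self[OF elim(2)] by (simp add: \<Lambda>_def unif_def dif_def)
        then have "G (nrm ?b q) = (\<Sum>k<N. c k * unif z q ^ k)" using nrm_self[OF elim(2)] by (simp add: G_def)
        then show ?case using elim(1) by (simp add: algebra_simps)
      qed
    qed
    moreover have "vanishes y N (\<lambda>q. ?A (nrm (bco y) q))" if y: "y \<in> Z - {z}" for y
    proof -
      have yX: "y \<in> X" using y Z by blast
      show ?thesis
        by (rule vanishes_mult_loc[OF yX Q(3)[rule_format, OF y] loc_hom_nrm[OF yX G bco[OF yX]]])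
           (simp add: mult.commute)
    qed
    ultimately show "\<exists>A. hom_poly n r A \<and> vanishes z N (\<lambda>q. A (nrm ?b q) - w q) \<and>
        (\<forall>y\<in>Z - {z}. vanishes y N (\<lambda>q. A (nrm (bco y) q)))" by (intro exI[of _ ?A]) blast
  qed
qed

lemma interpolation:
  assumes Z: "finite Z" "Z \<subseteq> X"
  obtains r0 where "\<forall>r\<ge>r0. \<forall>w. (\<forall>z\<in>Z. w z \<in> loc z) \<longrightarrow>
    (\<exists>A. hom_poly n r A \<and> (\<forall>z\<in>Z. vanishes z N (\<lambda>q. A (nrm (bco z) q) - w z q)))"
proof -
  have "\<forall>z. \<exists>r0. z \<in> Z \<longrightarrow> (\<forall>r\<ge>r0. \<forall>w\<in>loc z. \<exists>A. hom_poly n r A \<and> vanishes z N (\<lambda>q. A (nrm (bco z) q) - w q) \<and>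
    (\<forall>y\<in>Z - {z}. vanishes y N (\<lambda>q. A (nrm (bco y) q))))"
    using interpolation_one_point[OF Z] by blast
  from choice[OF this] obtain r0 where r0: "\<forall>z. z \<in> Z \<longrightarrow> (\<forall>r\<ge>r0 z. \<forall>w\<in>loc z. \<exists>A. hom_poly n r A \<and>
    vanishes z N (\<lambda>q. A (nrm (bco z) q) - w q) \<and> (\<forall>y\<in>Z - {z}. vanishes y N (\<lambda>q. A (nrm (bco y) q))))" ..
  show thesis
  proof (rule that, intro allI impI)
    fix r w assume r: "(\<Sum>z\<in>Z. r0 z) \<le> r" and w: "\<forall>z\<in>Z. w z \<in> loc z"
    have r0r: "r0 z \<le> r" if "z \<in> Z" for z using member_le_sum[OF that, of r0] Z(1) r by simp
    have "\<forall>z. \<exists>A. z \<in> Z \<longrightarrow> hom_poly n r A \<and>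
      vanishes z N (\<lambda>q. A (nrm (bco z) q) - w z q) \<and> (\<forall>y\<in>Z - {z}. vanishes y N (\<lambda>q. A (nrm (bco y) q)))"
      using r0 r0r w by meson
    from choice[OF this] obtain A where A: "\<forall>z. z \<in> Z \<longrightarrow> hom_poly n r (A z) \<and>
      vanishes z N (\<lambda>q. A z (nrm (bco z) q) - w z q) \<and> (\<forall>y\<in>Z - {z}. vanishes y N (\<lambda>q. A z (nrm (bco y) q)))" ..
    have "hom_poly n r (\<lambda>v. \<Sum>z\<in>Z. A z v)" using A by (intro hom_poly_sum) blast
    moreover have "vanishes z N (\<lambda>q. (\<Sum>y\<in>Z. A y (nrm (bco z) q)) - w z q)" if z: "z \<in> Z" for z
    proof -
      have zX: "z \<in> X" using z Z by blast
      have 1: "vanishes z N (\<lambda>q. A z (nrm (bco z) q) - w z q)" using A z by blast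
      have 2: "vanishes z N (\<lambda>q. \<Sum>y\<in>Z - {z}. A y (nrm (bco z) q))"
        using A z by (intro vanishes_sum[OF zX]) blast
      have "(\<Sum>y\<in>Z. A y (nrm (bco z) q)) - w z q =
          (A z (nrm (bco z) q) - w z q) + (\<Sum>y\<in>Z - {z}. A y (nrm (bco z) q))" for q
        using sum.remove[OF Z(1) z, of "\<lambda>y. A y (nrm (bco z) q)"] by simp
      then show ?thesis using vanishes_add[OF zX 1 2] by (simp only:)
    qed
    ultimately show "\<exists>A. hom_poly n r A \<and> (\<forall>z\<in>Z. vanishes z N (\<lambda>q. A (nrm (bco z) q) - w z q))"
      by (intro exI[of _ "\<lambda>v. \<Sum>z\<in>Z. A z v"]) blast
  qed
qed

section \<open>Vanishing of the first cohomology\<close>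

lemma std_chart_iff: "std_chart n X a = {p \<in> X. rep p a \<noteq> 0}" if "a \<le> n"
proof -
  have "(\<exists>v\<in>p. v a \<noteq> 0) \<longleftrightarrow> rep p a \<noteq> 0" if p: "p \<in> X" for p
  proof
    assume "\<exists>v\<in>p. v a \<noteq> 0"
    then obtain v where v: "v \<in> p" "v a \<noteq> 0" by blast
    then have "v \<noteq> 0" by auto
    from hom_poly_rep_eq_0[OF hom_poly.var[OF \<open>a \<le> n\<close>] X_proj[OF p] v(1) this] v(2) show "rep p a \<noteq> 0" by simp
  qed (use rep(1)[OF X_proj[OF p]] in blast)
  then show ?thesis unfolding std_chart_def by blast
qed

lemma openin_std_chart: "a \<le> n \<Longrightarrow> openin zar (std_chart n X a)"
  using openin_basic[OF hom_poly.var] std_chart_iff by simp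

section \<open>Cocycles and coboundaries of the Cech complex\<close>

lemma subspace_cech_Z1:
  assumes M: "is_line_bundle n X M" shows "cfun.subspace (cech_Z1 n X M)"
proof -
  have o: "openin zar (std_chart n X a \<inter> std_chart n X b)" if "a \<le> n" "b \<le> n" for a b
    using openin_std_chart that by blast
  note sub = subspace_sections[OF M o]
  show ?thesis
    unfolding cfun.subspace_def
  proof (intro conjI ballI allI)
    show "0 \<in> cech_Z1 n X M"
      unfolding cech_Z1_def using cfun.subspace_0[OF sub] by (simp add: zero_fun_def)
    fix c assume c: "c \<in> cech_Z1 n X M"
    have e1: "(\<lambda>y. cscale k c (a, b, y)) = cscale k (\<lambda>y. c (a, b, y))" for k a b by (simp add: cscale_def)
    show "cscale k c \<in> cech_Z1 n X M" for k
      unfolding cech_Z1_def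
    proof (intro CollectI conjI allI impI ballI)
      show "(\<lambda>y. cscale k c (a, b, y)) \<in> sections n X M (std_chart n X a \<inter> std_chart n X b)" if "a \<le> n" "b \<le> n" for a b
        unfolding e1 using c that by (intro cfun.subspace_scale[OF sub]) (auto simp: cech_Z1_def)
      show "cscale k c (b, e, i, x) - cscale k c (a, e, i, x) + cscale k c (a, b, i, x) = 0"
        if "a \<le> n" "b \<le> n" "e \<le> n" "i \<in> index M"
          "x \<in> std_chart n X a \<inter> std_chart n X b \<inter> std_chart n X e \<inter> chart M i" for a b e i x
      proof -
        have "c (b, e, i, x) - c (a, e, i, x) + c (a, b, i, x) = 0" using c that unfolding cech_Z1_def by blast
        then have "k * (c (b, e, i, x) - c (a, e, i, x) + c (a, b, i, x)) = 0" by simp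
        then show ?thesis by (simp add: cscale_def algebra_simps)
      qed
    qed (use c in \<open>auto simp: cech_Z1_def cscale_def\<close>)
    fix c' assume c': "c' \<in> cech_Z1 n X M"
    have e2: "(\<lambda>y. (c + c') (a, b, y)) = (\<lambda>y. c (a, b, y)) + (\<lambda>y. c' (a, b, y))" for a b by (simp add: plus_fun_def)
    show "c + c' \<in> cech_Z1 n X M"
      unfolding cech_Z1_def
    proof (intro CollectI conjI allI impI ballI)
      show "(\<lambda>y. (c + c') (a, b, y)) \<in> sections n X M (std_chart n X a \<inter> std_chart n X b)" if "a \<le> n" "b \<le> n" for a b
        unfolding e2 using c c' that by (intro cfun.subspace_add[OF sub]) (auto simp: cech_Z1_def)
      show "(c + c') (b, e, i, x) - (c + c') (a, e, i, x) + (c + c') (a, b, i, x) = 0"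
        if "a \<le> n" "b \<le> n" "e \<le> n" "i \<in> index M"
          "x \<in> std_chart n X a \<inter> std_chart n X b \<inter> std_chart n X e \<inter> chart M i" for a b e i x
      proof -
        have "c (b, e, i, x) - c (a, e, i, x) + c (a, b, i, x) = 0" using c that unfolding cech_Z1_def by blast
        moreover have "c' (b, e, i, x) - c' (a, e, i, x) + c' (a, b, i, x) = 0" using c' that unfolding cech_Z1_def by blast
        ultimately show ?thesis unfolding plus_fun_apply by (simp add: algebra_simps)
      qed
    qed (use c c' in \<open>auto simp: cech_Z1_def\<close>)
  qed
qed

lemma cech_B1_subset_Z1:
  assumes M: "is_line_bundle n X M" shows "cech_B1 n X M \<subseteq> cech_Z1 n X M"
proof
  fix c assume "c \<in> cech_B1 n X M"
  then obtain h where h: "\<forall>a\<le>n. h a \<in> sections n X M (std_chart n X a)"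
    and c: "c = (\<lambda>(a, b, i, x). if a \<le> n \<and> b \<le> n \<and> x \<in> std_chart n X a \<inter> std_chart n X b
                             then h b (i, x) - h a (i, x) else 0)" unfolding cech_B1_def by blast
  have o: "openin zar (std_chart n X a \<inter> std_chart n X b)" if "a \<le> n" "b \<le> n" for a b
    using openin_std_chart that by blast
  show "c \<in> cech_Z1 n X M"
    unfolding cech_Z1_def
  proof (intro CollectI conjI allI impI ballI)
    show "(\<lambda>y. c (a, b, y)) \<in> sections n X M (std_chart n X a \<inter> std_chart n X b)" if ab: "a \<le> n" "b \<le> n" for a b
    proof -
      let ?W = "std_chart n X a \<inter> std_chart n X b"
      note A = sectionsD[OF M openin_std_chart[OF ab(1)] h[rule_format, OF ab(1)]]
      note B = sectionsD[OF M openin_std_chart[OF ab(2)] h[rule_format, OF ab(2)]]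
      have cW: "c (a, b, i, x) = h b (i, x) - h a (i, x)" if "x \<in> ?W" for i x using that ab by (simp add: c)
      show ?thesis
        unfolding sections_iff[OF M o[OF ab]]
      proof (intro conjI ballI allI impI)
        fix i x assume ix: "i \<in> index M" "x \<in> ?W \<inter> chart M i"
        have x: "x \<in> X" using line_bundleD(7)[OF M] ix by blast
        have ev: "eventually (\<lambda>x. h b (i, x) - h a (i, x) = c (a, b, i, x)) (near x)"
          using eventually_near_open[OF o[OF ab], of x] ix by (auto elim!: eventually_mono simp: cW)
        have "(\<lambda>x. h b (i, x) - h a (i, x)) \<in> loc x" using ix A(1) B(1) x by (intro loc_diff) auto
        with loc_cong[OF ev] show "(\<lambda>x. c (a, b, i, x)) \<in> loc x" by blast
      next
        fix i j x assume "i \<in> index M" "j \<in> index M" "x \<in> ?W \<inter> chart M i \<inter> chart M j"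
        then show "c (a, b, i, x) = trans_fun M i j x * c (a, b, j, x)"
          using A(2)[of i j x] B(2)[of i j x] by (simp add: cW right_diff_distrib)
      next
        fix i x assume "\<not> (i \<in> index M \<and> x \<in> ?W \<inter> chart M i)"
        then show "c (a, b, i, x) = 0" using A(3)[of i x] B(3)[of i x] by (auto simp: c)
      qed
    qed
  qed (auto simp: c)
qed

text \<open>Take \<open>h b\<close> to be \<open>c (a0, b)\<close> plus a section \<open>T\<close>
  regular off \<open>Z\<close> that is the same for all \<open>b\<close>; the cocycle identity gives
  \<open>h b - h a = c (a, b)\<close>, once \<open>h b\<close> extends over \<open>Z\<close>. At
  \<open>z\<close> the sections \<open>c (a0, b)\<close> and \<open>c (a0, bco z)\<close> differ by
  something regular, so only one principal part per point has to be matched. The quotient of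
  \<open>s * A\<close> by a power of the coordinate \<open>a0\<close> does this.\<close>

lemma cech_Z1_subset_B1:
  assumes M: "is_line_bundle n X M" and a0: "a0 \<le> n" and Z: "Z = {q \<in> X. rep q a0 = 0}"
    and Zf: "finite Z" and ne: "std_chart n X a0 \<noteq> {}"
    and s: "s \<in> sections n X M X" "s \<noteq> 0"
    and sdiv: "\<And>z i. z \<in> Z \<Longrightarrow> i \<in> index M \<Longrightarrow> z \<in> chart M i \<Longrightarrow>
      \<exists>g\<in>loc z. eventually (\<lambda>q. s (i, q) = nrm (bco z) q a0 ^ r * g q) gen"
    and ip: "\<And>m w. (\<forall>z\<in>Z. w z \<in> loc z) \<Longrightarrow> \<exists>A. hom_poly n (r + m) A \<and>
      (\<forall>z\<in>Z. \<exists>g\<in>loc z. eventually (\<lambda>q. A (nrm (bco z) q) - w z q = nrm (bco z) q a0 ^ m * g q) gen)"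
  shows "cech_Z1 n X M \<subseteq> cech_B1 n X M"
proof
  fix c assume c: "c \<in> cech_Z1 n X M"
  note D = line_bundleD[OF M]
  let ?V = "std_chart n X"
  have Vi: "?V a = {q \<in> X. rep q a \<noteq> 0}" if "a \<le> n" for a using std_chart_iff[OF that] .
  note Vo = openin_std_chart
  have VVo: "openin zar (?V a \<inter> ?V b)" if "a \<le> n" "b \<le> n" for a b using Vo that by blast
  have cs: "(\<lambda>y. c (a, b, y)) \<in> sections n X M (?V a \<inter> ?V b)" if "a \<le> n" "b \<le> n" for a b
    using c that unfolding cech_Z1_def by blast
  note cS = sectionsD[OF M VVo cs]
  have coc: "c (b, e, i, x) - c (a, e, i, x) + c (a, b, i, x) = 0"
    if "a \<le> n" "b \<le> n" "e \<le> n" "i \<in> index M" "x \<in> ?V a" "x \<in> ?V b" "x \<in> ?V e" "x \<in> chart M i" for a b e i x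
    using c that unfolding cech_Z1_def by blast
  have ZX: "Z \<subseteq> X" using Z by blast
  have "\<forall>z. \<exists>i. z \<in> X \<longrightarrow> i \<in> index M \<and> z \<in> chart M i" using D(2) by blast
  from choice[OF this] obtain i where i: "\<forall>z. z \<in> X \<longrightarrow> i z \<in> index M \<and> z \<in> chart M (i z)" ..
  let ?b = bco and ?\<xi> = "\<lambda>z q. nrm (bco z) q a0"
  have "\<exists>g. g \<in> loc z \<and> eventually (\<lambda>q. s (i z, q) = ?\<xi> z q ^ r * g q) gen" if "z \<in> Z" for z
    using sdiv[OF that, of "i z"] i ZX that by blast
  then have "\<forall>z. \<exists>g. z \<in> Z \<longrightarrow> g \<in> loc z \<and> eventually (\<lambda>q. s (i z, q) = ?\<xi> z q ^ r * g q) gen" by blast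
  from choice[OF this] obtain \<sigma> where \<sigma>: "\<forall>z. z \<in> Z \<longrightarrow> \<sigma> z \<in> loc z \<and> eventually (\<lambda>q. s (i z, q) = ?\<xi> z q ^ r * \<sigma> z q) gen" ..
  have g\<xi>: "eventually (\<lambda>q. ?\<xi> z q \<noteq> 0 \<and> rep q (?b z) \<noteq> 0 \<and> rep q a0 \<noteq> 0) gen" if "z \<in> Z" for z
  proof -
    have zX: "z \<in> X" using that ZX by blast
    from gen_open[OF Vo[OF a0] ne] gen_coord[OF zX] show ?thesis
      unfolding Vi[OF a0] by eventually_elim (auto simp: nrm_def)
  qed
  \<comment> \<open>The principal part is expressed through the cofactor \<open>\<sigma> z\<close>
    of \<open>s\<close>. The exponent has to cover the pole order \<open>P\<close> of the cocycle
    and the order \<open>e\<close> of \<open>\<sigma> z\<close>; larger ones work too because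
    \<open>?\<xi> z\<close> vanishes at \<open>z\<close>. The sign lets the poles of
    \<open>c\<close> and \<open>T\<close> cancel.\<close>
  have "\<exists>m. \<forall>k\<ge>m. \<exists>w\<in>loc z. eventually (\<lambda>q. ?\<xi> z q ^ k * c (a0, ?b z, i z, q) = - (\<sigma> z q * w q)) gen" if z: "z \<in> Z" for z
  proof -
    have zX: "z \<in> X" using z ZX by blast
    note b = bco[OF zX]
    have iz: "i z \<in> index M" "z \<in> chart M (i z)" using i zX by auto
    have "?V (?b z) \<noteq> {}" using zX b Vi by blast
    moreover have "chart M (i z) \<noteq> {}" using iz by blast
    ultimately have "eventually (\<lambda>q. q \<in> ?V a0 \<and> q \<in> ?V (?b z) \<and> q \<in> chart M (i z)) gen"
      using gen_open[OF Vo[OF a0] ne] gen_open[OF Vo[OF b(1)]] gen_open[OF D(1)[OF iz(1)]] by (intro eventually_conj)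
    from gen_ex[OF this] obtain x1 where x1: "x1 \<in> X" "x1 \<in> ?V a0 \<inter> ?V (?b z)" "x1 \<in> chart M (i z)" by blast
    from clear_pole[OF x1(1) cS(1)[OF a0 b(1) a0 b(1) iz(1) x1(2,3)] zX] obtain P w0 where
      w0: "w0 \<in> loc z" "eventually (\<lambda>q. w0 q = unif z q ^ P * c (a0, ?b z, i z, q)) gen" .
    have \<xi>l: "?\<xi> z \<in> loc z" using loc_nrm[OF zX a0 b] .
    have "\<not> eventually (\<lambda>q. ?\<xi> z q = 0) (near z)"
    proof
      assume "eventually (\<lambda>q. ?\<xi> z q = 0) (near z)"
      from near_gen[OF zX this] g\<xi>[OF z] have "eventually (\<lambda>q. False) gen" by eventually_elim simp
      then show False using gen_not_bot by (simp add: trivial_limit_def)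
    qed
    moreover have "?\<xi> z z = 0" using z Z by (simp add: nrm_def)
    ultimately obtain a where a: "a \<in> loc z" "eventually (\<lambda>q. ?\<xi> z q = unif z q * a q) (near z)"
      using uniformizerD(4)[OF unif(2)[OF zX] \<xi>l] by blast
    have \<sigma>z: "\<sigma> z \<in> loc z" "eventually (\<lambda>q. s (i z, q) = ?\<xi> z q ^ r * \<sigma> z q) gen" using \<sigma> z by auto
    have "\<not> eventually (\<lambda>q. \<sigma> z q = 0) (near z)"
    proof
      assume "eventually (\<lambda>q. \<sigma> z q = 0) (near z)"
      from near_gen[OF zX this] \<sigma>z(2) section_gen_nonzero[OF M s iz]
      have "eventually (\<lambda>q. False) gen" by eventually_elim simp
      then show False using gen_not_bot by (simp add: trivial_limit_def)
    qed
    from local_factorization[OF zX unif(2)[OF zX] \<sigma>z(1) this] obtain e u where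
      u: "u \<in> loc z" "u z \<noteq> 0" "eventually (\<lambda>q. \<sigma> z q = unif z q ^ e * u q) (near z)" .
    show ?thesis
    proof (intro exI[of _ "P + e"] allI impI)
      fix k assume k: "P + e \<le> k"
      let ?w = "\<lambda>q. - (unif z q ^ (k - (P + e)) * a q ^ k * w0 q / u q)"
      have "?w \<in> loc z" by (intro loc_uminus loc_divide loc_mult loc_power loc_unif a(1) w0(1) u(1,2) zX)
      moreover have "eventually (\<lambda>q. ?\<xi> z q ^ k * c (a0, ?b z, i z, q) = - (\<sigma> z q * ?w q)) gen"
        using near_gen[OF zX a(2)] near_gen[OF zX u(3)] near_gen[OF zX loc_nonzero_near[OF zX u(1,2)]] w0(2)
      proof eventually_elim
        case (elim q)
        have "unif z q ^ k = unif z q ^ e * unif z q ^ (k - (P + e)) * unif z q ^ P"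
          using k by (simp flip: power_add)
        then show ?case using elim by (simp add: power_mult_distrib)
      qed
      ultimately show "\<exists>w\<in>loc z. eventually (\<lambda>q. ?\<xi> z q ^ k * c (a0, ?b z, i z, q) = - (\<sigma> z q * w q)) gen"
        by (intro bexI[of _ ?w])
    qed
  qed
  then have "\<forall>z. \<exists>m. z \<in> Z \<longrightarrow> (\<forall>k\<ge>m. \<exists>w\<in>loc z. eventually (\<lambda>q. ?\<xi> z q ^ k * c (a0, ?b z, i z, q) = - (\<sigma> z q * w q)) gen)"
    by blast
  from choice[OF this] obtain m where m: "\<forall>z. z \<in> Z \<longrightarrow> (\<forall>k\<ge>m z. \<exists>w\<in>loc z. eventually (\<lambda>q. ?\<xi> z q ^ k * c (a0, ?b z, i z, q) = - (\<sigma> z q * w q)) gen)" ..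
  \<comment> \<open>One exponent for all points of \<open>Z\<close>, as a single form
    \<open>A\<close> has to serve them all.\<close>
  define k where "k = (\<Sum>z\<in>Z. m z)"
  have mk: "m z \<le> k" if "z \<in> Z" for z using member_le_sum[OF that, of m] Zf by (simp add: k_def)
  have "\<forall>z. \<exists>w. z \<in> Z \<longrightarrow> w \<in> loc z \<and> eventually (\<lambda>q. ?\<xi> z q ^ k * c (a0, ?b z, i z, q) = - (\<sigma> z q * w q)) gen"
    using m mk by blast
  from choice[OF this] obtain w where w: "\<forall>z. z \<in> Z \<longrightarrow> w z \<in> loc z \<and> eventually (\<lambda>q. ?\<xi> z q ^ k * c (a0, ?b z, i z, q) = - (\<sigma> z q * w z q)) gen" ..
  have "\<forall>z\<in>Z. w z \<in> loc z" using w by blast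
  from ip[OF this, of k] obtain A where A: "hom_poly n (r + k) A"
    "\<forall>z\<in>Z. \<exists>g\<in>loc z. eventually (\<lambda>q. A (nrm (?b z) q) - w z q = ?\<xi> z q ^ k * g q) gen" by blast
  define T where "T = (\<lambda>j x. s (j, x) * (A (rep x) / rep x a0 ^ (r + k)))"
  note sS = sectionsD[OF M openin_X s(1)]
  have T1: "(\<lambda>x. T j x) \<in> loc x" if "j \<in> index M" "x \<in> chart M j" "x \<in> ?V a0" for j x
  proof -
    have "x \<in> X" "rep x a0 \<noteq> 0" using that(3) Vi[OF a0] by auto
    then show ?thesis unfolding T_def using that
      by (intro loc_mult sS(1) loc_frac[OF _ A(1) hom_poly_var_power[OF a0]]) auto
  qed
  have T2: "T j x = trans_fun M j l x * T l x" if "j \<in> index M" "l \<in> index M" "x \<in> chart M j" "x \<in> chart M l" for j l x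
    unfolding T_def using sS(2)[OF that(1,2) D(7)[OF that(1,3)] that(3,4)] by simp
  have Tz: "\<exists>g\<in>loc z. eventually (\<lambda>q. c (a0, ?b z, i z, q) + T (i z) q = g q) gen" if z: "z \<in> Z" for z
  proof -
    have zX: "z \<in> X" using z ZX by blast
    obtain g where g: "g \<in> loc z" "eventually (\<lambda>q. A (nrm (?b z) q) - w z q = ?\<xi> z q ^ k * g q) gen" using A(2) z by blast
    have ev1: "eventually (\<lambda>q. ?\<xi> z q ^ k * c (a0, ?b z, i z, q) = - (\<sigma> z q * w z q)) gen"
      and ev2: "eventually (\<lambda>q. s (i z, q) = ?\<xi> z q ^ r * \<sigma> z q) gen" and sl: "\<sigma> z \<in> loc z" using w \<sigma> z by blast+
    from g(2) g\<xi>[OF z] ev1 ev2 have "eventually (\<lambda>q. c (a0, ?b z, i z, q) + T (i z) q = \<sigma> z q * g q) gen"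
    proof eventually_elim
      case (elim q)
      let ?x = "rep q (?b z)" and ?y = "rep q a0" and ?X = "?\<xi> z q"
      have X0: "?X \<noteq> 0" "?x \<noteq> 0" "?y \<noteq> 0" using elim(2) by auto
      have "A (rep q) / ?y ^ (r + k) = (A (rep q) / ?x ^ (r + k)) / (?y / ?x) ^ (r + k)"
        using X0 by (simp add: power_divide)
      also have "\<dots> = A (nrm (?b z) q) / ?X ^ (r + k)"
        unfolding hom_poly_nrm[OF A(1)] by (simp add: nrm_def)
      finally have "T (i z) q = ?X ^ r * \<sigma> z q * (A (nrm (?b z) q) / ?X ^ (r + k))"
        unfolding T_def elim(4) by simp
      then have "?X ^ k * T (i z) q = \<sigma> z q * A (nrm (?b z) q)"
        using X0(1) by (simp add: power_add)
      then have "?X ^ k * (c (a0, ?b z, i z, q) + T (i z) q) = \<sigma> z q * (A (nrm (?b z) q) - w z q)"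
        using elim(3) by (simp add: algebra_simps)
      then have "?X ^ k * (c (a0, ?b z, i z, q) + T (i z) q) = ?X ^ k * (\<sigma> z q * g q)"
        unfolding elim(1) by (simp add: algebra_simps)
      then show ?case using X0(1) by simp
    qed
    moreover have "(\<lambda>q. \<sigma> z q * g q) \<in> loc z" by (intro loc_mult sl g(1) zX)
    ultimately show ?thesis by (intro bexI[of _ "\<lambda>q. \<sigma> z q * g q"])
  qed
  have "\<exists>h. h \<in> sections n X M (?V b) \<and> (\<forall>j\<in>index M. \<forall>x\<in>?V b \<inter> chart M j - Z. h (j, x) = c (a0, b, j, x) + T j x)"
    if b: "b \<le> n" for b
  proof -
    let ?s = "\<lambda>y. c (a0, b, y) + T (fst y) (snd y)"
    have nZ: "x \<in> ?V a0" if "x \<in> ?V b" "x \<notin> Z" for x using that Vi[OF a0] Vi[OF b] Z by blast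
    have 1: "(\<lambda>x. ?s (j, x)) \<in> loc x" if "j \<in> index M" "x \<in> ?V b" "x \<in> chart M j" "x \<notin> Z" for j x
      using cS(1)[OF a0 b a0 b that(1) _ that(3)] T1[OF that(1,3)] nZ[OF that(2,4)] that(2) D(7)[OF that(1,3)]
      by auto
    have 2: "?s (j, x) = trans_fun M j l x * ?s (l, x)"
      if "j \<in> index M" "l \<in> index M" "x \<in> ?V b" "x \<in> chart M j" "x \<in> chart M l" "x \<notin> Z" for j l x
      using cS(2)[OF a0 b a0 b that(1,2) _ that(4,5)] T2[OF that(1,2,4,5)] nZ[OF that(3,6)] that(3)
      by (simp add: distrib_left)
    have 3: "\<exists>j\<in>index M. z \<in> chart M j \<and> (\<exists>g\<in>loc z. eventually (\<lambda>x. ?s (j, x) = g x) gen)" if z: "z \<in> Z \<inter> ?V b" for z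
    proof -
      have zX: "z \<in> X" using z ZX by blast
      note bz = bco[OF zX]
      have iz: "i z \<in> index M" "z \<in> chart M (i z)" using i zX by auto
      have zV: "z \<in> ?V (?b z) \<inter> ?V b" using z bz zX Vi by blast
      obtain g where g: "g \<in> loc z" "eventually (\<lambda>q. c (a0, ?b z, i z, q) + T (i z) q = g q) gen" using Tz z by blast
      \<comment> \<open>The part of \<open>c (a0, b)\<close> that \<open>T\<close> does not have to
        match: \<open>z\<close> lies in both charts, so it is regular there.\<close>
      have l: "(\<lambda>q. c (?b z, b, i z, q)) \<in> loc z" by (rule cS(1)[OF bz(1) b bz(1) b iz(1) zV iz(2)])
      have ne': "?V (?b z) \<noteq> {}" "?V b \<noteq> {}" "chart M (i z) \<noteq> {}" using zV iz by auto
      from g(2) gen_open[OF Vo[OF a0] ne] gen_open[OF Vo[OF bz(1)] ne'(1)] gen_open[OF Vo[OF b] ne'(2)]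
        gen_open[OF D(1)[OF iz(1)] ne'(3)]
      have "eventually (\<lambda>x. ?s (i z, x) = g x + c (?b z, b, i z, x)) gen"
      proof eventually_elim
        case (elim x)
        have "c (a0, b, i z, x) = c (?b z, b, i z, x) + c (a0, ?b z, i z, x)"
          using coc[OF a0 bz(1) b iz(1) elim(2,3,4,5)] by (simp add: algebra_simps)
        then show ?case unfolding elim(1)[symmetric] by simp
      qed
      then show ?thesis using iz g(1) l zX
        by (intro bexI[of _ "i z"] conjI bexI[of _ "\<lambda>x. g x + c (?b z, b, i z, x)"] loc_add)
    qed
    from extend_section[OF M Vo[OF b] Zf 1 2 3] obtain h where "h \<in> sections n X M (?V b)"
      "\<forall>j\<in>index M. \<forall>x\<in>?V b \<inter> chart M j - Z. h (j, x) = ?s (j, x)" .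
    then show ?thesis by auto
  qed
  then have "\<forall>b. \<exists>h. b \<le> n \<longrightarrow> h \<in> sections n X M (?V b) \<and> (\<forall>j\<in>index M. \<forall>x\<in>?V b \<inter> chart M j - Z. h (j, x) = c (a0, b, j, x) + T j x)"
    by blast
  from choice[OF this] obtain h where h: "\<forall>b. b \<le> n \<longrightarrow> h b \<in> sections n X M (?V b) \<and> (\<forall>j\<in>index M. \<forall>x\<in>?V b \<inter> chart M j - Z. h b (j, x) = c (a0, b, j, x) + T j x)" ..
  have hs: "h b \<in> sections n X M (?V b)" if "b \<le> n" for b using h that by blast
  note hS = sectionsD[OF M Vo hs]
  have "c (a, b, j, x) = (if a \<le> n \<and> b \<le> n \<and> x \<in> ?V a \<inter> ?V b then h b (j, x) - h a (j, x) else 0)" for a b j x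
  proof (cases "a \<le> n \<and> b \<le> n")
    case False
    then show ?thesis using c by (auto simp: cech_Z1_def)
  next
    case True
    then have ab: "a \<le> n" "b \<le> n" by auto
    show ?thesis
    proof (cases "x \<in> ?V a \<inter> ?V b \<and> j \<in> index M \<and> x \<in> chart M j")
      case False
      then have "c (a, b, j, x) = 0" using cS(3)[OF ab ab] by blast
      moreover have "h b (j, x) - h a (j, x) = 0" if "x \<in> ?V a \<inter> ?V b"
        using False that hS(3)[OF ab(1) ab(1), of j x] hS(3)[OF ab(2) ab(2), of j x] by auto
      ultimately show ?thesis by auto
    next
      case x: True
      then have xX: "x \<in> X" and jx: "j \<in> index M" "x \<in> chart M j" "x \<in> ?V a" "x \<in> ?V b" using D(7) by auto
      have l1: "(\<lambda>x. c (a, b, j, x)) \<in> loc x" using cS(1)[OF ab ab jx(1) _ jx(2)] jx by blast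
      have l2: "(\<lambda>x. h b (j, x) - h a (j, x)) \<in> loc x"
        by (intro loc_diff xX hS(1)[OF ab(1) ab(1) jx(1,3,2)] hS(1)[OF ab(2) ab(2) jx(1,4,2)])
      have ne': "?V a \<noteq> {}" "?V b \<noteq> {}" "chart M j \<noteq> {}" using jx by auto
      from gen_open[OF Vo[OF a0] ne] gen_open[OF Vo[OF ab(1)] ne'(1)] gen_open[OF Vo[OF ab(2)] ne'(2)]
        gen_open[OF D(1)[OF jx(1)] ne'(3)] gen_not_finite[OF Zf]
      have "eventually (\<lambda>x. c (a, b, j, x) = h b (j, x) - h a (j, x)) gen"
      proof eventually_elim
        case (elim y)
        have "h b (j, y) = c (a0, b, j, y) + T j y" "h a (j, y) = c (a0, a, j, y) + T j y"
          using h ab jx(1) elim by blast+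
        then show ?case using coc[OF a0 ab jx(1) elim(1-4)] by (simp add: algebra_simps)
      qed
      from loc_gen_eq(2)[OF xX l1 l2 this] show ?thesis using ab jx by simp
    qed
  qed
  then have "c = (\<lambda>(a, b, i, x). if a \<le> n \<and> b \<le> n \<and> x \<in> ?V a \<inter> ?V b then h b (i, x) - h a (i, x) else 0)"
    by (auto simp: fun_eq_iff)
  then show "c \<in> cech_B1 n X M" unfolding cech_B1_def using hs by blast
qed

theorem h1_eventually_zero:
  assumes L: "is_line_bundle n X L" and am: "ample n X L"
  obtains d0 :: int where "\<forall>d\<ge>d0. h1 n X (tensor_power L d) = 0"
proof -
  obtain x0 where x0: "x0 \<in> X" using X_nonempty by blast
  obtain a0 where a0: "a0 \<le> n" "rep x0 a0 \<noteq> 0" using rep_coord_nonzero[OF X_proj[OF x0]] .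
  define Z where "Z = {q \<in> X. rep q a0 = 0}"
  have Zf: "finite Z" unfolding Z_def using finite_zeros[OF hom_poly.var[OF a0(1)] x0 a0(2)] .
  have ZX: "Z \<subseteq> X" by (auto simp: Z_def)
  have ne: "std_chart n X a0 \<noteq> {}" using x0 a0 std_chart_iff[OF a0(1)] by blast
  let ?b = bco and ?\<xi> = "\<lambda>z q. nrm (bco z) q a0"
  have "\<exists>x. fst x \<in> loc z \<and> fst x z \<noteq> 0 \<and> eventually (\<lambda>q. ?\<xi> z q = unif z q ^ snd x * fst x q) gen" if z: "z \<in> X" for z
  proof -
    note b = bco[OF z]
    have "\<not> eventually (\<lambda>q. ?\<xi> z q = 0) (near z)"
    proof
      assume "eventually (\<lambda>q. ?\<xi> z q = 0) (near z)"
      from near_gen[OF z this] hom_poly_gen_nonzero[OF hom_poly.var[OF a0(1)] x0 a0(2)] gen_coord[OF z]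
      have "eventually (\<lambda>q. False) gen" by eventually_elim (simp add: nrm_def)
      then show False using gen_not_bot by (simp add: trivial_limit_def)
    qed
    from local_factorization[OF z unif(2)[OF z] loc_nrm[OF z a0(1) b] this] obtain e u where
      "u \<in> loc z" "u z \<noteq> 0" "eventually (\<lambda>q. ?\<xi> z q = unif z q ^ e * u q) (near z)" .
    then show ?thesis using near_gen[OF z] by (intro exI[of _ "(u, e)"]) auto
  qed
  then have "\<forall>z. \<exists>x. z \<in> X \<longrightarrow> fst x \<in> loc z \<and> fst x z \<noteq> 0 \<and> eventually (\<lambda>q. ?\<xi> z q = unif z q ^ snd x * fst x q) gen" by blast
  from choice[OF this] obtain x where x: "\<forall>z. z \<in> X \<longrightarrow> fst (x z) \<in> loc z \<and> fst (x z) z \<noteq> 0 \<and>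
    eventually (\<lambda>q. ?\<xi> z q = unif z q ^ snd (x z) * fst (x z) q) gen" ..
  define u where "u z = fst (x z)" for z
  \<comment> \<open>The order at \<open>z\<close> of the coordinate \<open>a0\<close>, which
    converts orders in the uniformizer into powers of \<open>?\<xi> z\<close>.\<close>
  define e where "e z = snd (x z)" for z
  have u: "u z \<in> loc z" "u z z \<noteq> 0" "eventually (\<lambda>q. ?\<xi> z q = unif z q ^ e z * u z q) gen" if "z \<in> X" for z
    using x that by (auto simp: u_def e_def)
  have div: "\<exists>g\<in>loc z. eventually (\<lambda>q. f q = ?\<xi> z q ^ k * g q) gen" if z: "z \<in> X" and v: "vanishes z N f" and k: "k * e z \<le> N" for z N f k
  proof -
    obtain a where a: "a \<in> loc z" "eventually (\<lambda>q. f q = unif z q ^ N * a q) gen" using v unfolding vanishes_def by blast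
    let ?g = "\<lambda>q. unif z q ^ (N - k * e z) * a q / u z q ^ k"
    have "?g \<in> loc z" by (intro loc_divide loc_mult loc_power loc_unif a(1) u z) (use u(2)[OF z] in simp)
    moreover have "eventually (\<lambda>q. f q = ?\<xi> z q ^ k * ?g q) gen"
      using a(2) u(3)[OF z] near_gen[OF z loc_nonzero_near[OF z u(1,2)[OF z]]]
    proof eventually_elim
      case (elim q)
      have "unif z q ^ N = (unif z q ^ e z) ^ k * unif z q ^ (N - k * e z)"
        using k by (simp add: mult.commute flip: power_add power_mult)
      then show ?case using elim by (simp add: power_mult_distrib)
    qed
    ultimately show ?thesis by (intro bexI[of _ ?g])
  qed
  \<comment> \<open>The sum is at least each single \<open>e z\<close>, so interpolation to this
    order is interpolation modulo \<open>?\<xi> z\<close> at every point.\<close>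
  from interpolation[OF Zf ZX, of "\<Sum>z\<in>Z. e z"] obtain r where r: "\<forall>r'\<ge>r. \<forall>w. (\<forall>z\<in>Z. w z \<in> loc z) \<longrightarrow>
    (\<exists>A. hom_poly n r' A \<and> (\<forall>z\<in>Z. vanishes z (\<Sum>z\<in>Z. e z) (\<lambda>q. A (nrm (bco z) q) - w z q)))" .
  have base: "\<exists>A. hom_poly n r' A \<and> (\<forall>z\<in>Z. \<exists>g\<in>loc z. eventually (\<lambda>q. A (nrm (bco z) q) - w z q = ?\<xi> z q * g q) gen)"
    if r': "r \<le> r'" and w: "\<forall>z\<in>Z. w z \<in> loc z" for r' w
  proof -
    obtain A where A: "hom_poly n r' A" "\<forall>z\<in>Z. vanishes z (\<Sum>z\<in>Z. e z) (\<lambda>q. A (nrm (bco z) q) - w z q)" using r r' w by blast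
    have "\<exists>g\<in>loc z. eventually (\<lambda>q. A (nrm (bco z) q) - w z q = ?\<xi> z q * g q) gen" if z: "z \<in> Z" for z
    proof -
      have "1 * e z \<le> (\<Sum>z\<in>Z. e z)" using member_le_sum[OF z, of e] Zf by simp
      from div[OF subsetD[OF ZX z] A(2)[rule_format, OF z] this] show ?thesis by simp
    qed
    with A(1) show ?thesis by blast
  qed
  \<comment> \<open>Induction on \<open>m\<close> keeps \<open>r\<close> fixed: the error that
    \<open>A0\<close> leaves modulo \<open>?\<xi>\<close> is corrected by the coordinate
    \<open>a0\<close> times a form of one degree less. For \<open>m = 0\<close> the form 0 will
    do.\<close>
  have ip: "\<exists>A. hom_poly n (r + m) A \<and> (\<forall>z\<in>Z. \<exists>g\<in>loc z. eventually (\<lambda>q. A (nrm (bco z) q) - w z q = ?\<xi> z q ^ m * g q) gen)"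
    if "\<forall>z\<in>Z. w z \<in> loc z" for m w
    using that
  proof (induction m arbitrary: w)
    case 0
    have "\<exists>g\<in>loc z. eventually (\<lambda>q. 0 - w z q = ?\<xi> z q ^ 0 * g q) gen" if "z \<in> Z" for z
      using 0 that ZX by (intro bexI[of _ "\<lambda>q. - w z q"]) auto
    then show ?case using hom_poly_zero[of n "r + 0"] by blast
  next
    case (Suc m)
    from base[of "r + Suc m", OF _ Suc.prems] obtain A0 where A0: "hom_poly n (r + Suc m) A0"
      "\<forall>z\<in>Z. \<exists>g\<in>loc z. eventually (\<lambda>q. A0 (nrm (bco z) q) - w z q = ?\<xi> z q * g q) gen" by auto
    then have "\<forall>z. \<exists>g. z \<in> Z \<longrightarrow> g \<in> loc z \<and> eventually (\<lambda>q. A0 (nrm (bco z) q) - w z q = ?\<xi> z q * g q) gen" by blast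
    from choice[OF this] obtain g where g: "\<forall>z. z \<in> Z \<longrightarrow> g z \<in> loc z \<and> eventually (\<lambda>q. A0 (nrm (bco z) q) - w z q = ?\<xi> z q * g z q) gen" ..
    have "\<forall>z\<in>Z. (\<lambda>q. - g z q) \<in> loc z" using g ZX by blast
    from Suc.IH[OF this] obtain A1 where A1: "hom_poly n (r + m) A1"
      "\<forall>z\<in>Z. \<exists>g'\<in>loc z. eventually (\<lambda>q. A1 (nrm (bco z) q) - - g z q = ?\<xi> z q ^ m * g' q) gen" by blast
    let ?A = "\<lambda>v. A0 v + v a0 * A1 v"
    have "hom_poly n (r + Suc m) ?A"
      by (intro hom_poly.add A0(1) hom_poly_mult'[OF hom_poly.var[OF a0(1)] A1(1)]) simp
    moreover have "\<exists>g'\<in>loc z. eventually (\<lambda>q. ?A (nrm (bco z) q) - w z q = ?\<xi> z q ^ Suc m * g' q) gen" if z: "z \<in> Z" for z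
    proof -
      obtain g' where g': "g' \<in> loc z" "eventually (\<lambda>q. A1 (nrm (bco z) q) - - g z q = ?\<xi> z q ^ m * g' q) gen" using A1(2) z by blast
      have gz: "eventually (\<lambda>q. A0 (nrm (bco z) q) - w z q = ?\<xi> z q * g z q) gen" using g z by blast
      have "eventually (\<lambda>q. ?A (nrm (bco z) q) - w z q = ?\<xi> z q ^ Suc m * g' q) gen"
        using g'(2) gz
      proof eventually_elim
        case (elim q)
        have "?A (nrm (bco z) q) - w z q = (A0 (nrm (bco z) q) - w z q) + ?\<xi> z q * A1 (nrm (bco z) q)" by simp
        also have "\<dots> = ?\<xi> z q * (A1 (nrm (bco z) q) - - g z q)" unfolding elim(2) by (simp add: algebra_simps)
        finally show ?case unfolding elim(1) by simp
      qed
      then show ?thesis using g'(1) by blast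
    qed
    ultimately show ?case by (intro exI[of _ ?A]) blast
  qed
  \<comment> \<open>Order \<open>r * e z\<close> amounts to divisibility by the \<open>r\<close>-th
    power of \<open>?\<xi> z\<close>.\<close>
  from vanishing_section_exists[OF L am Zf ZX, of "\<lambda>z. r * e z"] obtain d0 :: int where
    d0: "\<forall>d\<ge>d0. \<exists>s\<in>sections n X (tensor_power L d) X. s \<noteq> 0 \<and>
    (\<forall>z\<in>Z. \<forall>i\<in>index L. z \<in> chart L i \<longrightarrow> vanishes z (r * e z) (\<lambda>x. s (i, x)))" .
  show thesis
  proof (rule that, intro allI impI)
    fix d assume "d0 \<le> d"
    then obtain s where s: "s \<in> sections n X (tensor_power L d) X" "s \<noteq> 0"
      and sv: "\<forall>z\<in>Z. \<forall>i\<in>index L. z \<in> chart L i \<longrightarrow> vanishes z (r * e z) (\<lambda>x. s (i, x))" using d0 by blast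
    let ?M = "tensor_power L d"
    note M = is_line_bundle_tensor_power[OF L, of d]
    have sdiv: "\<exists>g\<in>loc z. eventually (\<lambda>q. s (i, q) = ?\<xi> z q ^ r * g q) gen"
      if "z \<in> Z" "i \<in> index ?M" "z \<in> chart ?M i" for z i
      using div[OF subsetD[OF ZX that(1)], of "r * e z" "\<lambda>x. s (i, x)" r] sv that by simp
    have "cech_B1 n X ?M = cech_Z1 n X ?M"
      using cech_B1_subset_Z1[OF M] cech_Z1_subset_B1[OF M a0(1) Z_def Zf ne s sdiv ip] by blast
    moreover have "cfun.span (cech_Z1 n X ?M) = cech_Z1 n X ?M"
      using subspace_cech_Z1[OF M] cfun.span_eq_iff[of "cech_Z1 n X ?M"] by blast
    ultimately have "\<exists>B. B \<subseteq> cech_Z1 n X ?M \<and> finite B \<and> card B = 0 \<and> cfun.span (cech_B1 n X ?M \<union> B) = cech_Z1 n X ?M"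
      by (intro exI[of _ "{}"]) auto
    then have "h1 n X ?M \<le> 0" unfolding h1_def quot_dim_def by (rule Least_le)
    then show "h1 n X ?M = 0" by simp
  qed
qed

end

section \<open>Partial derivatives of forms\<close>

text \<open>Forms are functions here, so the derivative is the complex one along a coordinate line
  and cannot depend on a polynomial expression for the form.\<close>

definition pd :: "nat \<Rightarrow> (cvec \<Rightarrow> complex) \<Rightarrow> cvec \<Rightarrow> complex" where
  "pd i F v = deriv (\<lambda>t. F (v(i := v i + t))) 0"

lemma hom_poly_differentiable:
  "hom_poly n d F \<Longrightarrow> (\<lambda>t. F (v(i := v i + t))) field_differentiable (at t)"
proof (induction rule: hom_poly.induct)
  case (var j)
  then show ?case by (cases "i = j") (auto intro!: derivative_intros)
qed (auto intro!: derivative_intros)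

lemma pd_const: "pd i (\<lambda>_. c) = (\<lambda>_. 0)"
  by (simp add: pd_def fun_eq_iff)

lemma pd_var: "pd i (\<lambda>v. v j) = (\<lambda>_. if i = j then 1 else 0)"
proof
  fix v :: cvec
  show "pd i (\<lambda>v. v j) v = (if i = j then 1 else 0)"
    unfolding pd_def by (cases "i = j") auto
qed

lemma pd_add:
  assumes "hom_poly n d F" "hom_poly n e G"
  shows "pd i (\<lambda>v. F v + G v) v = pd i F v + pd i G v"
  unfolding pd_def by (rule deriv_add) (use hom_poly_differentiable assms in blast)+

lemma pd_mult:
  assumes "hom_poly n d F" "hom_poly n e G"
  shows "pd i (\<lambda>v. F v * G v) v = pd i F v * G v + F v * pd i G v"
proof -
  have "(\<lambda>t. F (v(i := v i + t))) field_differentiable at 0" "(\<lambda>t. G (v(i := v i + t))) field_differentiable at 0"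
    using hom_poly_differentiable assms by blast+
  from deriv_mult[OF this] show ?thesis unfolding pd_def by simp
qed

text \<open>The second conjunct repairs truncated subtraction in the product case: for
  \<open>d = 0\<close> the degree \<open>d - 1 + e\<close> is too large, but then that summand is
  zero.\<close>

lemma hom_poly_pd_aux:
  "hom_poly n d F \<Longrightarrow> hom_poly n (d - 1) (pd i F) \<and> (d = 0 \<longrightarrow> pd i F = (\<lambda>_. 0))"
proof (induction rule: hom_poly.induct)
  case (const c)
  then show ?case by (auto simp: pd_const intro: hom_poly.const)
next
  case (var j)
  then show ?case by (auto simp: pd_var intro: hom_poly.const)
next
  case (add d F G)
  have "pd i (\<lambda>v. F v + G v) = (\<lambda>v. pd i F v + pd i G v)" using pd_add[OF add(1,2)] by blast
  then show ?case using add by (auto intro: hom_poly.add)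
next
  case (mult d F e G)
  have eq: "pd i (\<lambda>v. F v * G v) = (\<lambda>v. pd i F v * G v + F v * pd i G v)" using pd_mult[OF mult(1,2)] by blast
  have "hom_poly n (d + e - 1) (\<lambda>v. pd i F v * G v)"
  proof (cases "d = 0")
    case True
    then show ?thesis using mult(3) by (auto intro: hom_poly_zero)
  next
    case False
    then show ?thesis using mult(2,3) by (intro hom_poly_mult'[of n "d - 1" _ e]) auto
  qed
  moreover have "hom_poly n (d + e - 1) (\<lambda>v. F v * pd i G v)"
  proof (cases "e = 0")
    case True
    then show ?thesis using mult(4) by (auto intro: hom_poly_zero)
  next
    case False
    then show ?thesis using mult(1,4) by (intro hom_poly_mult'[of n d _ "e - 1"]) auto
  qed
  ultimately show ?case unfolding eq using mult(3,4) by (auto intro: hom_poly.add)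
qed

lemma hom_poly_pd: "hom_poly n d F \<Longrightarrow> hom_poly n (d - 1) (pd i F)"
  using hom_poly_pd_aux by blast

section \<open>A tangent vector field\<close>

context curve
begin

text \<open>First-order expansion along the curve in the parameter \<open>t\<close>. The
  \<open>w i\<close> are difference quotients of the affine coordinates, so their values at
  \<open>p\<close> are the velocity.\<close>

lemma taylor_second_order:
  assumes p: "p \<in> X" and b: "b \<le> n" "rep p b \<noteq> 0" and t: "t \<in> loc p"
    and w: "\<And>i. i \<le> n \<Longrightarrow> w i \<in> loc p" "\<And>i. i \<le> n \<Longrightarrow> eventually (\<lambda>q. dif b p i q = t q * w i q) (near p)"
    and F: "hom_poly n d F"
  shows "\<exists>r\<in>loc p. eventually (\<lambda>q. F (nrm b q) =
    F (nrm b p) + t q * (\<Sum>i\<le>n. pd i F (nrm b p) * w i q) + t q ^ 2 * r q) (near p)"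
  using F
proof (induction rule: hom_poly.induct)
  case (const c)
  show ?case by (rule bexI[of _ "\<lambda>_. 0"]) (auto simp: pd_const)
next
  case (var j)
  have "(\<Sum>i\<le>n. pd i (\<lambda>v. v j) (nrm b p) * w i q) = w j q" for q
    using var by (simp add: pd_var if_distrib[of "\<lambda>c. c * _"] sum.delta cong: if_cong)
  then show ?case using w(2)[OF var]
    by (intro bexI[of _ "\<lambda>_. 0"]) (auto simp: dif_def algebra_simps elim!: eventually_mono)
next
  case (add d F G)
  then obtain r r' where r: "r \<in> loc p" "eventually (\<lambda>q. F (nrm b q) =
    F (nrm b p) + t q * (\<Sum>i\<le>n. pd i F (nrm b p) * w i q) + t q ^ 2 * r q) (near p)"
    "r' \<in> loc p" "eventually (\<lambda>q. G (nrm b q) =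
    G (nrm b p) + t q * (\<Sum>i\<le>n. pd i G (nrm b p) * w i q) + t q ^ 2 * r' q) (near p)" by blast
  show ?case
  proof (intro bexI[of _ "\<lambda>q. r q + r' q"] loc_add r(1,3) p)
    show "eventually (\<lambda>q. F (nrm b q) + G (nrm b q) = F (nrm b p) + G (nrm b p) +
        t q * (\<Sum>i\<le>n. pd i (\<lambda>v. F v + G v) (nrm b p) * w i q) + t q ^ 2 * (r q + r' q)) (near p)"
      using r(2,4)
    proof eventually_elim
      case (elim q)
      have "(\<Sum>i\<le>n. pd i (\<lambda>v. F v + G v) (nrm b p) * w i q) =
         (\<Sum>i\<le>n. pd i F (nrm b p) * w i q) + (\<Sum>i\<le>n. pd i G (nrm b p) * w i q)"
        by (simp add: pd_add[OF add(1,2)] distrib_right sum.distrib)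
      then show ?case unfolding elim by (simp add: algebra_simps)
    qed
  qed
next
  case (mult d F e G)
  let ?f = "\<lambda>q. \<Sum>i\<le>n. pd i F (nrm b p) * w i q" and ?g = "\<lambda>q. \<Sum>i\<le>n. pd i G (nrm b p) * w i q"
  let ?F = "F (nrm b p)" and ?G = "G (nrm b p)"
  obtain r r' where r: "r \<in> loc p" "eventually (\<lambda>q. F (nrm b q) = ?F + t q * ?f q + t q ^ 2 * r q) (near p)"
    "r' \<in> loc p" "eventually (\<lambda>q. G (nrm b q) = ?G + t q * ?g q + t q ^ 2 * r' q) (near p)" using mult by blast
  let ?r = "\<lambda>q. ?F * r' q + ?f q * ?g q + ?f q * (t q * r' q) + r q * (?G + t q * ?g q + t q ^ 2 * r' q)"
  have fg: "?f \<in> loc p" "?g \<in> loc p" using w(1) p by (auto intro!: loc_sum loc_mult)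
  show ?case
  proof (intro bexI[of _ ?r])
    show "?r \<in> loc p" by (intro loc_add loc_mult loc_const loc_power r(1,3) t fg p)
    show "eventually (\<lambda>q. F (nrm b q) * G (nrm b q) = ?F * ?G +
        t q * (\<Sum>i\<le>n. pd i (\<lambda>v. F v * G v) (nrm b p) * w i q) + t q ^ 2 * ?r q) (near p)"
      using r(2,4)
    proof eventually_elim
      case (elim q)
      have "(\<Sum>i\<le>n. pd i (\<lambda>v. F v * G v) (nrm b p) * w i q) = ?f q * ?G + ?F * ?g q"
        by (simp add: pd_mult[OF mult(1,2)] sum.distrib sum_distrib_left algebra_simps)
      then show ?case unfolding elim by (simp add: algebra_simps power2_eq_square)
    qed
  qed
qed

text \<open>The velocity of the affine coordinates in the parameter \<open>t\<close> is tangent: for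
  \<open>F\<close> vanishing on the curve, dividing its expansion by \<open>t\<close> and evaluating
  at \<open>p\<close> leaves just the linear term. It is nonzero since \<open>t\<close> is itself a
  coordinate difference.\<close>

lemma tangent_vector_exists:
  assumes p: "p \<in> X" and b: "b \<le> n" "rep p b \<noteq> 0"
  shows "\<exists>\<tau>. (\<exists>i\<in>{..n} - {b}. \<tau> i \<noteq> 0) \<and>
    (\<forall>F d. hom_poly n d F \<and> (\<forall>q\<in>X. F (rep q) = 0) \<longrightarrow> (\<Sum>i\<in>{..n} - {b}. pd i F (rep p) * \<tau> i) = 0)"
proof -
  obtain k where k: "k \<le> n" "uniformizer p (dif b p k)" using uniformizer_exists[OF p b] .
  define t where "t = dif b p k"
  note t = k(2)[folded t_def]
  have tl: "t \<in> loc p" using uniformizerD(1)[OF t] .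
  have "\<forall>i. \<exists>a. i \<le> n \<longrightarrow> a \<in> loc p \<and> eventually (\<lambda>q. dif b p i q = t q * a q) (near p)"
    using uniformizerD(4)[OF t loc_dif[OF p _ b]] dif_self by blast
  from choice[OF this] obtain w where w': "\<forall>i. i \<le> n \<longrightarrow> w i \<in> loc p \<and> eventually (\<lambda>q. dif b p i q = t q * w i q) (near p)" ..
  then have w: "\<And>i. i \<le> n \<Longrightarrow> w i \<in> loc p" "\<And>i. i \<le> n \<Longrightarrow> eventually (\<lambda>q. dif b p i q = t q * w i q) (near p)" by auto
  note t0 = uniformizer_gen_nonzero[OF p t]
  \<comment> \<open>Coordinate \<open>b\<close> is constantly 1 in the chart, so index
    \<open>b\<close> drops out of the sums.\<close>
  have wb: "w b p = 0"
  proof -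
    have "eventually (\<lambda>q. w b q = 0) gen"
      using t0 near_gen[OF p w(2)[OF b(1)]] near_gen[OF p eventually_near_basic[OF hom_poly.var[OF b(1)] p b(2)]]
      by eventually_elim (use b(2) in \<open>auto simp: dif_def nrm_self\<close>)
    from loc_gen_eq(2)[OF p w(1)[OF b(1)] loc_const this] show ?thesis .
  qed
  have wk: "w k p = 1"
  proof -
    have "eventually (\<lambda>q. w k q = 1) gen"
      using t0 near_gen[OF p w(2)[OF k(1)]] unfolding t_def[symmetric] by eventually_elim simp
    from loc_gen_eq(2)[OF p w(1)[OF k(1)] loc_const this] show ?thesis .
  qed
  show ?thesis
  proof (intro exI[of _ "\<lambda>i. w i p"] conjI allI impI)
    show "\<exists>i\<in>{..n} - {b}. w i p \<noteq> 0" using wk wb k(1) by (intro bexI[of _ k]) auto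
    fix F d assume F: "hom_poly n d F \<and> (\<forall>q\<in>X. F (rep q) = 0)"
    then have hF: "hom_poly n d F" by blast
    have F0: "F (nrm b q) = 0" if "q \<in> X" for q using F that by (simp add: hom_poly_nrm[OF hF])
    from taylor_second_order[OF p b tl w hF] obtain r where r: "r \<in> loc p" "eventually (\<lambda>q. F (nrm b q) =
      F (nrm b p) + t q * (\<Sum>i\<le>n. pd i F (nrm b p) * w i q) + t q ^ 2 * r q) (near p)" by blast
    let ?h = "\<lambda>q. (\<Sum>i\<le>n. pd i F (nrm b p) * w i q) + t q * r q"
    have "eventually (\<lambda>q. ?h q = 0) gen"
      using t0 near_gen[OF p r(2)] gen_in_X
    proof eventually_elim
      case (elim q)
      have "t q * ?h q = 0" using elim(2) F0[OF elim(3)] F0[OF p] by (simp add: algebra_simps power2_eq_square)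
      then show ?case using elim(1) by simp
    qed
    moreover have "?h \<in> loc p" using w(1) by (intro loc_add loc_sum loc_mult loc_const tl r(1) p) auto
    ultimately have "?h p = 0" using loc_gen_eq(2)[OF p _ loc_const] by blast
    then have "0 = (\<Sum>i\<le>n. pd i F (nrm b p) * w i p)" using uniformizerD(2)[OF t] by simp
    also have "\<dots> = (\<Sum>i\<in>{..n} - {b}. pd i F (nrm b p) * w i p)"
      using sum.remove[of "{..n}" b "\<lambda>i. pd i F (nrm b p) * w i p"] b(1) wb by simp
    also have "\<dots> = (\<Sum>i\<in>{..n} - {b}. pd i F (rep p) * w i p) / rep p b ^ (d - 1)"
      by (simp add: hom_poly_nrm[OF hom_poly_pd[OF hF]] sum_divide_distrib)
    finally show "(\<Sum>i\<in>{..n} - {b}. pd i F (rep p) * w i p) = 0" using b(2) by simp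
  qed
qed

text \<open>Fraction-free Gaussian elimination over the function field.\<close>

lemma linear_system_solution:
  fixes I :: "nat set" and S :: "(nat \<Rightarrow> cvec \<Rightarrow> complex) set"
  assumes "finite I"
    and "\<And>J. J \<in> S \<Longrightarrow> \<exists>d. \<forall>i\<in>I. hom_poly n d (J i)"
    and "eventually (\<lambda>q. \<exists>\<tau>. (\<exists>i\<in>I. \<tau> i \<noteq> 0) \<and> (\<forall>J\<in>S. (\<Sum>i\<in>I. J i (rep q) * \<tau> i) = 0)) gen"
  shows "\<exists>V e. (\<forall>i\<in>I. hom_poly n e (V i)) \<and> (\<exists>i\<in>I. \<exists>q\<in>X. V i (rep q) \<noteq> 0) \<and>
    (\<forall>J\<in>S. \<forall>q\<in>X. (\<Sum>i\<in>I. J i (rep q) * V i (rep q)) = 0)"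
  using assms
proof (induction "card I" arbitrary: I S rule: less_induct)
  case less
  note fin = less.prems(1) and hom = less.prems(2) and sol = less.prems(3)
  show ?case
  proof (cases "\<forall>J\<in>S. \<forall>i\<in>I. \<forall>q\<in>X. J i (rep q) = 0")
    case True
    \<comment> \<open>Nonzero pointwise solutions keep the elimination from using up all unknowns.
      With only trivial equations left, the constant vector 1 is a solution.\<close>
    from gen_ex[OF sol] have "I \<noteq> {}" by blast
    then show ?thesis using True X_nonempty
      by (intro exI[of _ "\<lambda>_ _. 1"] exI[of _ 0]) (auto intro: hom_poly.const)
  next
    case False
    then obtain K k q0 where K: "K \<in> S" "k \<in> I" "q0 \<in> X" "K k (rep q0) \<noteq> 0" by blast
    obtain dK where dK: "\<And>i. i \<in> I \<Longrightarrow> hom_poly n dK (K i)" using hom[OF K(1)] by blast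
    note Kk = hom_poly_gen_nonzero[OF dK[OF K(2)] K(3,4)]
    \<comment> \<open>Row \<open>J\<close> with the unknown \<open>k\<close> eliminated by the pivot
      row \<open>K\<close>; cross-multiplication keeps the entries forms.\<close>
    define R where "R J = (\<lambda>i v. K k v * J i v - J k v * K i v)" for J :: "nat \<Rightarrow> cvec \<Rightarrow> complex"
    let ?I = "I - {k}"
    have split: "(\<Sum>i\<in>I. f i) = f k + (\<Sum>i\<in>?I. f i)" for f :: "nat \<Rightarrow> complex"
      using sum.remove[OF fin K(2)] .
    have card: "card ?I < card I" using fin K(2) by (meson card_Diff1_less)
    have homR: "\<exists>d. \<forall>i\<in>?I. hom_poly n d (J' i)" if J': "J' \<in> R ` S" for J'
    proof -
      obtain J where J: "J \<in> S" "J' = R J" using J' by blast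
      obtain d where d: "\<And>i. i \<in> I \<Longrightarrow> hom_poly n d (J i)" using hom[OF J(1)] by blast
      have "hom_poly n (dK + d) (R J i)" if "i \<in> ?I" for i
        unfolding R_def using that K(2)
        by (intro hom_poly_diff hom_poly_mult'[OF dK d] hom_poly_mult'[OF d dK]) auto
      then show ?thesis using J(2) by blast
    qed
    have solR: "eventually (\<lambda>q. \<exists>\<tau>. (\<exists>i\<in>?I. \<tau> i \<noteq> 0) \<and> (\<forall>J\<in>R ` S. (\<Sum>i\<in>?I. J i (rep q) * \<tau> i) = 0)) gen"
      using sol Kk
    proof eventually_elim
      case (elim q)
      then obtain \<tau> where \<tau>: "\<exists>i\<in>I. \<tau> i \<noteq> 0" "\<And>J. J \<in> S \<Longrightarrow> (\<Sum>i\<in>I. J i (rep q) * \<tau> i) = 0" by blast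
      have S: "(\<Sum>i\<in>?I. J i (rep q) * \<tau> i) = - (J k (rep q) * \<tau> k)" if "J \<in> S" for J
        using \<tau>(2)[OF that] split[of "\<lambda>i. J i (rep q) * \<tau> i"] by (simp add: eq_neg_iff_add_eq_0 add.commute)
      have "\<exists>i\<in>?I. \<tau> i \<noteq> 0"
      proof (rule ccontr)
        assume *: "\<not> ?thesis"
        then have "(\<Sum>i\<in>?I. K i (rep q) * \<tau> i) = 0" by (intro sum.neutral) auto
        with S[OF K(1)] elim(2) have "\<tau> k = 0" by simp
        with * \<tau>(1) show False by auto
      qed
      moreover have "(\<Sum>i\<in>?I. R J i (rep q) * \<tau> i) = 0" if "J \<in> S" for J
      proof -
        have "(\<Sum>i\<in>?I. R J i (rep q) * \<tau> i) =
           K k (rep q) * (\<Sum>i\<in>?I. J i (rep q) * \<tau> i) - J k (rep q) * (\<Sum>i\<in>?I. K i (rep q) * \<tau> i)"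
          by (simp add: R_def left_diff_distrib sum_subtractf sum_distrib_left mult.assoc)
        then show ?thesis unfolding S[OF that] S[OF K(1)] by (simp add: algebra_simps)
      qed
      ultimately show ?case by blast
    qed
    have fin': "finite ?I" using fin by simp
    have "\<exists>V e. (\<forall>i\<in>?I. hom_poly n e (V i)) \<and> (\<exists>i\<in>?I. \<exists>q\<in>X. V i (rep q) \<noteq> 0) \<and>
        (\<forall>J\<in>R ` S. \<forall>q\<in>X. (\<Sum>i\<in>?I. J i (rep q) * V i (rep q)) = 0)"
      using less.hyps[OF card fin' homR solR] by blast
    then obtain V e where
      V1: "\<forall>i\<in>?I. hom_poly n e (V i)" and V2: "\<exists>i\<in>?I. \<exists>q\<in>X. V i (rep q) \<noteq> 0"
        and V3: "\<forall>J\<in>R ` S. \<forall>q\<in>X. (\<Sum>i\<in>?I. J i (rep q) * V i (rep q)) = 0" by (elim exE conjE)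
    note V = V1[rule_format] V2 V3
    \<comment> \<open>Back substitution, multiplied through by the pivot \<open>K k\<close>.\<close>
    define U where "U i = (if i = k then (\<lambda>v. - 1 * (\<Sum>i\<in>?I. K i v * V i v)) else (\<lambda>v. K k v * V i v))" for i
    have "hom_poly n (dK + e) (U i)" if "i \<in> I" for i
    proof (cases "i = k")
      case True
      have "hom_poly n (dK + e) (\<lambda>v. \<Sum>i\<in>?I. K i v * V i v)" using dK V(1) by (intro hom_poly_sum hom_poly.mult) auto
      then show ?thesis using True hom_poly_cmult[of n "dK + e" _ "-1"] by (simp add: U_def)
    next
      case False
      then show ?thesis using that dK[OF K(2)] V(1)[of i] by (auto simp: U_def intro: hom_poly.mult)
    qed
    moreover have "\<exists>i\<in>I. \<exists>q\<in>X. U i (rep q) \<noteq> 0"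
    proof -
      obtain i q where i: "i \<in> ?I" "q \<in> X" "V i (rep q) \<noteq> 0" using V(2) by blast
      have "eventually (\<lambda>q. U i (rep q) \<noteq> 0) gen"
        using Kk hom_poly_gen_nonzero[OF V(1)[OF i(1)] i(2,3)] by eventually_elim (use i(1) in \<open>simp add: U_def\<close>)
      from gen_ex[OF this] i(1) show ?thesis by blast
    qed
    moreover have "(\<Sum>i\<in>I. J i (rep q) * U i (rep q)) = 0" if "J \<in> S" "q \<in> X" for J q
    proof -
      have "(\<Sum>i\<in>?I. J i (rep q) * U i (rep q)) = (\<Sum>i\<in>?I. K k (rep q) * (J i (rep q) * V i (rep q)))"
        by (rule sum.cong) (auto simp: U_def)
      then have "(\<Sum>i\<in>I. J i (rep q) * U i (rep q)) = (\<Sum>i\<in>?I. R J i (rep q) * V i (rep q))"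
        unfolding split[of "\<lambda>i. J i (rep q) * U i (rep q)"]
        by (simp add: U_def R_def algebra_simps sum_subtractf sum_distrib_left sum_negf)
      also have "\<dots> = 0" using V(3) that by blast
      finally show ?thesis .
    qed
    ultimately show ?thesis by blast
  qed
qed

end

text \<open>A vector field with forms as coefficients, tangent to the curve in the chart of
  coordinate \<open>a0\<close>. It has no component along \<open>a0\<close>, so its derivation
  treats the normalising coordinate as a constant.\<close>

locale tangent_field = curve +
  fixes a0 :: nat and e :: nat and V :: "nat \<Rightarrow> cvec \<Rightarrow> complex"
  assumes a0: "a0 \<le> n" "\<exists>q\<in>X. rep q a0 \<noteq> 0"
    and V: "\<And>i. i \<le> n \<Longrightarrow> i \<noteq> a0 \<Longrightarrow> hom_poly n e (V i)"
    and V_nonzero: "\<exists>i\<le>n. i \<noteq> a0 \<and> (\<exists>q\<in>X. V i (rep q) \<noteq> 0)"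
    and V_tangent: "\<And>F d q. hom_poly n d F \<Longrightarrow> (\<forall>q\<in>X. F (rep q) = 0) \<Longrightarrow> q \<in> X \<Longrightarrow>
      (\<Sum>i\<in>{..n} - {a0}. pd i F (rep q) * V i (rep q)) = 0"

text \<open>Tangent vectors at general points solve the linear system given by all equations of the
  curve; elimination turns these pointwise solutions into one solution by forms.\<close>

lemma (in curve) tangent_field_exists: "\<exists>a0 e V. tangent_field n X a0 e V"
proof -
  obtain x0 where x0: "x0 \<in> X" using X_nonempty by blast
  obtain a0 where a0: "a0 \<le> n" "rep x0 a0 \<noteq> 0" using rep_coord_nonzero[OF X_proj[OF x0]] .
  define S where "S = {(\<lambda>i. pd i F) | F. \<exists>d. hom_poly n d F \<and> (\<forall>q\<in>X. F (rep q) = 0)}"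
  let ?I = "{..n} - {a0}"
  have "\<exists>d. \<forall>i\<in>?I. hom_poly n d (J i)" if "J \<in> S" for J
    using that hom_poly_pd by (fastforce simp: S_def)
  moreover have "eventually (\<lambda>q. \<exists>\<tau>. (\<exists>i\<in>?I. \<tau> i \<noteq> 0) \<and> (\<forall>J\<in>S. (\<Sum>i\<in>?I. J i (rep q) * \<tau> i) = 0)) gen"
    using hom_poly_gen_nonzero[OF hom_poly.var[OF a0(1)] x0 a0(2)] gen_in_X
  proof eventually_elim
    case (elim q)
    from tangent_vector_exists[OF elim(2) a0(1) elim(1)] obtain \<tau> where
      \<tau>: "\<exists>i\<in>?I. \<tau> i \<noteq> 0" "\<forall>F d. hom_poly n d F \<and> (\<forall>q\<in>X. F (rep q) = 0) \<longrightarrow> (\<Sum>i\<in>?I. pd i F (rep q) * \<tau> i) = 0"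
      by blast
    then show ?case by (intro exI[of _ \<tau>]) (auto simp: S_def)
  qed
  ultimately obtain V e where V: "\<forall>i\<in>?I. hom_poly n e (V i)" "\<exists>i\<in>?I. \<exists>q\<in>X. V i (rep q) \<noteq> 0"
    "\<forall>J\<in>S. \<forall>q\<in>X. (\<Sum>i\<in>?I. J i (rep q) * V i (rep q)) = 0"
    using linear_system_solution[of ?I S] by blast
  have "tangent_field n X a0 e V"
  proof unfold_locales
    show "a0 \<le> n" "\<exists>q\<in>X. rep q a0 \<noteq> 0" using a0 x0 by auto
    show "i \<le> n \<Longrightarrow> i \<noteq> a0 \<Longrightarrow> hom_poly n e (V i)" for i using V(1) by simp
    show "\<exists>i\<le>n. i \<noteq> a0 \<and> (\<exists>q\<in>X. V i (rep q) \<noteq> 0)" using V(2) by auto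
    fix F d q assume F: "hom_poly n d F" "\<forall>q\<in>X. F (rep q) = 0" "q \<in> X"
    then have "(\<lambda>i. pd i F) \<in> S" by (auto simp: S_def)
    from V(3)[rule_format, OF this F(3)] show "(\<Sum>i\<in>?I. pd i F (rep q) * V i (rep q)) = 0" .
  qed
  then show ?thesis by blast
qed

context tangent_field
begin

definition Dr :: "(cvec \<Rightarrow> complex) \<Rightarrow> cvec \<Rightarrow> complex" where
  "Dr F v = (\<Sum>i\<in>{..n} - {a0}. pd i F v * V i v)"

lemma hom_poly_Dr: "hom_poly n d F \<Longrightarrow> hom_poly n (d - 1 + e) (Dr F)"
  unfolding Dr_def[abs_def] using V by (intro hom_poly_sum hom_poly.mult hom_poly_pd) auto

lemma Dr_add: "hom_poly n d F \<Longrightarrow> hom_poly n e' G \<Longrightarrow> Dr (\<lambda>v. F v + G v) v = Dr F v + Dr G v"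
  by (simp add: Dr_def pd_add distrib_right sum.distrib)

lemma Dr_mult: "hom_poly n d F \<Longrightarrow> hom_poly n e' G \<Longrightarrow> Dr (\<lambda>v. F v * G v) v = Dr F v * G v + F v * Dr G v"
  by (simp add: Dr_def pd_mult sum.distrib sum_distrib_left algebra_simps)

lemma Dr_const: "Dr (\<lambda>_. c) v = 0"
  by (simp add: Dr_def pd_const)

lemma Dr_cmult: "hom_poly n d F \<Longrightarrow> Dr (\<lambda>v. c * F v) v = c * Dr F v"
  using Dr_mult[OF hom_poly.const[of n c], of d F v] by (simp add: Dr_const)

lemma Dr_diff: "hom_poly n d F \<Longrightarrow> hom_poly n e' G \<Longrightarrow> Dr (\<lambda>v. F v - G v) v = Dr F v - Dr G v"
  using Dr_add[OF _ hom_poly_cmult[of n e' G "-1"], of d F v] Dr_cmult[of e' G "-1" v] by simp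

lemma Dr_sum:
  assumes "\<And>i. i \<in> I \<Longrightarrow> hom_poly n d (F i)"
  shows "Dr (\<lambda>v. \<Sum>i\<in>I. c i * F i v) v = (\<Sum>i\<in>I. c i * Dr (F i) v)"
  using assms
proof (induction I rule: infinite_finite_induct)
  case (insert i I)
  have "hom_poly n d (\<lambda>v. \<Sum>i\<in>I. c i * F i v)" using insert by (intro hom_poly_sum hom_poly_cmult) auto
  moreover have "hom_poly n d (F i)" using insert by simp
  ultimately show ?case
    using Dr_add[OF hom_poly_cmult[of n d "F i" "c i"], of d "\<lambda>v. \<Sum>i\<in>I. c i * F i v" v] insert
    by (simp add: Dr_cmult[of d])
qed (auto simp: Dr_const)

lemma Dr_power:
  assumes "hom_poly n d F"
  shows "Dr (\<lambda>v. F v ^ Suc k) v = of_nat (Suc k) * F v ^ k * Dr F v"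
proof (induction k)
  case (Suc k)
  have "Dr (\<lambda>v. F v * F v ^ Suc k) v = Dr F v * F v ^ Suc k + F v * Dr (\<lambda>v. F v ^ Suc k) v"
    by (rule Dr_mult[OF assms hom_poly_power[OF assms]])
  then show ?case unfolding Suc by (simp add: algebra_simps)
qed simp

lemma Dr_var: "j \<le> n \<Longrightarrow> Dr (\<lambda>v. v j) v = (if j = a0 then 0 else V j v)"
proof -
  assume j: "j \<le> n"
  have "Dr (\<lambda>v. v j) v = (\<Sum>i\<in>{..n} - {a0}. if i = j then V i v else 0)"
    unfolding Dr_def by (rule sum.cong) (auto simp: pd_var)
  then show ?thesis using j by simp
qed

text \<open>Tangency makes the derivation well defined on forms restricted to the curve, so
  identities valid only on \<open>X\<close> may be differentiated.\<close>

lemma Dr_vanishing: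
  assumes "hom_poly n d F" "\<And>q. q \<in> X \<Longrightarrow> F (rep q) = 0" "q \<in> X"
  shows "Dr F (rep q) = 0" "Dr F (nrm b q) = 0"
proof -
  show *: "Dr F (rep q) = 0" unfolding Dr_def using V_tangent[OF assms(1) _ assms(3)] assms(2) by blast
  show "Dr F (nrm b q) = 0" using * hom_poly_nrm[OF hom_poly_Dr[OF assms(1)]] by simp
qed

lemma Dr_eq_on_X:
  assumes "hom_poly n d F" "hom_poly n d G" "\<And>q. q \<in> X \<Longrightarrow> F (rep q) = G (rep q)" "q \<in> X"
  shows "Dr F (nrm b q) = Dr G (nrm b q)"
  using Dr_vanishing(2)[OF hom_poly_diff[OF assms(1,2)] _ assms(4)] assms(3) Dr_diff[OF assms(1,2)] by simp

lemma forms_eq_on_X: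
  assumes "hom_poly n d F" "hom_poly n d G" "eventually (\<lambda>q. F (rep q) = G (rep q)) gen" "q \<in> X"
  shows "F (rep q) = G (rep q)"
  using hom_poly_gen_zero[OF hom_poly_diff[OF assms(1,2)] _ assms(4)] assms(3) by simp

text \<open>With denominators cleared, \<open>F\<close> times something nonzero at \<open>p\<close>
  equals \<open>T ^ 2\<close> times a form on the curve, and \<open>T\<close> vanishes at
  \<open>p\<close>; so the derivative vanishes there too. This turns singularity at \<open>p\<close>
  into two linear equations.\<close>

lemma Dr_max_ideal_sq:
  assumes p: "p \<in> X" and f: "f \<in> max_ideal_sq n X p"
    and F: "hom_poly n d F" "hom_poly n d G" "G (rep p) \<noteq> 0"
    and ev: "eventually (\<lambda>q. f q = F (rep q) / G (rep q)) (near p)"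
  shows "F (rep p) = 0" "Dr F (rep p) = 0"
proof -
  note t = unif(2)[OF p]
  note tl = uniformizerD(1)[OF t]
  from f obtain w where w: "w \<in> loc p" "eventually (\<lambda>q. f q = unif p q ^ 2 * w q) (near p)"
    unfolding max_ideal_sq_uniformizer[OF p t] by blast
  from tl obtain c T S where T: "hom_poly n c T" "hom_poly n c S" "S (rep p) \<noteq> 0"
    "eventually (\<lambda>q. unif p q = T (rep q) / S (rep q)) (near p)" by (rule locE)
  from w(1) obtain a A B where A: "hom_poly n a A" "hom_poly n a B" "B (rep p) \<noteq> 0"
    "eventually (\<lambda>q. w q = A (rep q) / B (rep q)) (near p)" by (rule locE)
  have T0: "T (rep p) = 0" using eventually_near_self[OF p T(4)] uniformizerD(2)[OF t] T(3) by simp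
  have "f p = 0" using eventually_near_self[OF p w(2)] uniformizerD(2)[OF t] by simp
  then show F0: "F (rep p) = 0" using eventually_near_self[OF p ev] F(3) by simp
  let ?P = "\<lambda>v. S v * (S v * B v)" and ?Q = "\<lambda>v. T v * (A v * G v)"
  have P: "hom_poly n (c + (c + a)) ?P" by (intro hom_poly.mult T A)
  have Q: "hom_poly n (c + (a + d)) ?Q" by (intro hom_poly.mult T A F)
  have h1: "hom_poly n (d + (c + (c + a))) (\<lambda>v. F v * ?P v)" by (rule hom_poly.mult[OF F(1) P])
  have h2: "hom_poly n (d + (c + (c + a))) (\<lambda>v. T v * ?Q v)" by (rule hom_poly_mult'[OF T(1) Q]) simp
  have "eventually (\<lambda>q. F (rep q) * ?P (rep q) = T (rep q) * ?Q (rep q)) (near p)"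
    using ev w(2) T(4) A(4) eventually_near_basic[OF F(2) p F(3)] eventually_near_basic[OF T(2) p T(3)]
      eventually_near_basic[OF A(2) p A(3)]
  proof eventually_elim
    case (elim q)
    then have "F (rep q) / G (rep q) = (T (rep q) / S (rep q)) ^ 2 * (A (rep q) / B (rep q))" by simp
    then show ?case using elim(5-7) by (simp add: field_simps power2_eq_square)
  qed
  from forms_eq_on_X[OF h1 h2 near_gen[OF p this]] have eq: "F (rep q) * ?P (rep q) = T (rep q) * ?Q (rep q)" if "q \<in> X" for q
    using that by blast
  have "Dr (\<lambda>v. F v * ?P v - T v * ?Q v) (rep p) = 0"
    using Dr_vanishing(1)[OF hom_poly_diff[OF h1 h2] _ p] eq by simp
  then have "Dr (\<lambda>v. F v * ?P v) (rep p) = Dr (\<lambda>v. T v * ?Q v) (rep p)"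
    using Dr_diff[OF h1 h2] by simp
  moreover have "Dr (\<lambda>v. F v * ?P v) (rep p) = Dr F (rep p) * ?P (rep p)"
    unfolding Dr_mult[OF F(1) P] using F0 by simp
  moreover have "Dr (\<lambda>v. T v * ?Q v) (rep p) = 0"
    unfolding Dr_mult[OF T(1) Q] using T0 by simp
  ultimately show "Dr F (rep p) = 0" using T(3) A(3) by simp
qed

text \<open>Characteristic 0 enters here: if \<open>F\<close> is not a multiple of \<open>G\<close>, subtract a multiple of \<open>G\<close> to
  obtain a form vanishing to order \<open>k > 0\<close> at a general point; its derivative vanishes to order
  exactly \<open>k - 1\<close>, so the Wronskian does not vanish.\<close>

lemma wronskian_zero_imp_proportional:
  assumes F: "hom_poly n d F" and G: "hom_poly n d G" and q0: "q0 \<in> X" "G (rep q0) \<noteq> 0"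
    and W: "\<And>q. q \<in> X \<Longrightarrow> F (rep q) * Dr G (rep q) = G (rep q) * Dr F (rep q)"
  shows "\<exists>c. \<forall>q\<in>X. F (rep q) = c * G (rep q)"
proof -
  obtain q1 where q1: "q1 \<in> X" "rep q1 a0 \<noteq> 0" using a0(2) by blast
  obtain i q2 where i: "i \<le> n" "i \<noteq> a0" "q2 \<in> X" "V i (rep q2) \<noteq> 0" using V_nonzero by blast
  from hom_poly_gen_nonzero[OF G q0] hom_poly_gen_nonzero[OF hom_poly.var[OF a0(1)] q1]
    hom_poly_gen_nonzero[OF V[OF i(1,2)] i(3,4)]
  have "eventually (\<lambda>q. G (rep q) \<noteq> 0 \<and> rep q a0 \<noteq> 0 \<and> V i (rep q) \<noteq> 0) gen" by eventually_elim simp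
  from gen_ex[OF this] obtain p where p: "p \<in> X" and Gp: "G (rep p) \<noteq> 0" and b: "rep p a0 \<noteq> 0"
    and Vp: "V i (rep p) \<noteq> 0" by blast
  let ?N = "nrm a0"
  have ga: "eventually (\<lambda>q. rep q a0 \<noteq> 0) (near p)" by (rule eventually_near_basic[OF hom_poly.var[OF a0(1)] p b])
  define c where "c = F (rep p) / G (rep p)"
  define H where "H = (\<lambda>v. F v - c * G v)"
  have H: "hom_poly n d H" unfolding H_def by (intro hom_poly_diff hom_poly_cmult F G)
  have Hp: "H (rep p) = 0" using Gp by (simp add: H_def c_def)
  have "H (rep q) = 0" if q: "q \<in> X" for q
  proof (rule ccontr)
    assume Hq: "H (rep q) \<noteq> 0"
    note hl = loc_hom_nrm[OF p H a0(1) b]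
    note t = unif(2)[OF p]
    have "\<not> eventually (\<lambda>q. H (?N q) = 0) (near p)"
    proof
      assume "eventually (\<lambda>q. H (?N q) = 0) (near p)"
      with ga have "eventually (\<lambda>q. H (rep q) = 0) (near p)" by eventually_elim (simp add: hom_poly_nrm[OF H])
      from hom_poly_gen_zero[OF H near_gen[OF p this] q] Hq show False by contradiction
    qed
    from local_factorization[OF p t hl this] obtain k' u where
      u: "u \<in> loc p" "u p \<noteq> 0" "eventually (\<lambda>q. H (?N q) = unif p q ^ k' * u q) (near p)" .
    have "k' \<noteq> 0"
    proof
      assume "k' = 0"
      with eventually_near_self[OF p u(3)] u(2) Hp show False by (simp add: hom_poly_nrm[OF H])
    qed
    then obtain k where k: "k' = Suc k" by (cases k') auto
    from uniformizerD(1)[OF t] obtain c' T S where T: "hom_poly n c' T" "hom_poly n c' S" "S (rep p) \<noteq> 0"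
      "eventually (\<lambda>q. unif p q = T (rep q) / S (rep q)) (near p)" by (rule locE)
    from u(1) obtain a A B where A: "hom_poly n a A" "hom_poly n a B" "B (rep p) \<noteq> 0"
      "eventually (\<lambda>q. u q = A (rep q) / B (rep q)) (near p)" by (rule locE)
    have T0: "T (rep p) = 0" using eventually_near_self[OF p T(4)] uniformizerD(2)[OF t] T(3) by simp
    have Ap: "A (rep p) \<noteq> 0" using eventually_near_self[OF p A(4)] u(2) by auto
    \<comment> \<open>After clearing denominators \<open>H * P = T ^ Suc k * R\<close> on the curve,
      with \<open>P\<close> and \<open>R\<close> nonzero at \<open>p\<close> and \<open>T\<close>
      the numerator of the uniformizer.\<close>
    define P where "P = (\<lambda>v. S v ^ Suc k * B v)"
    define R where "R = (\<lambda>v::cvec. v a0 ^ d * A v)"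
    have P: "hom_poly n (Suc k * c' + a) P" unfolding P_def by (intro hom_poly.mult hom_poly_power T A)
    have R: "hom_poly n (d + a) R" unfolding R_def by (intro hom_poly.mult hom_poly_var_power A a0)
    note Tk = hom_poly_power[OF T(1), of "Suc k"]
    have h1: "hom_poly n (d + (Suc k * c' + a)) (\<lambda>v. H v * P v)" by (rule hom_poly.mult[OF H P])
    have h2: "hom_poly n (d + (Suc k * c' + a)) (\<lambda>v. T v ^ Suc k * R v)" by (rule hom_poly_mult'[OF Tk R]) simp
    have "eventually (\<lambda>q. H (rep q) * P (rep q) = T (rep q) ^ Suc k * R (rep q)) (near p)"
      using u(3) T(4) A(4) ga eventually_near_basic[OF T(2) p T(3)] eventually_near_basic[OF A(2) p A(3)]
    proof eventually_elim
      case (elim q)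
      then have "H (rep q) / rep q a0 ^ d = (T (rep q) / S (rep q)) ^ Suc k * (A (rep q) / B (rep q))"
        by (simp add: hom_poly_nrm[OF H] k)
      then show ?case using elim(4-6) unfolding P_def R_def
        by (simp add: power_divide divide_simps mult_ac del: power_Suc)
    qed
    from forms_eq_on_X[OF h1 h2 near_gen[OF p this]]
    have eq: "H (rep q) * P (rep q) = T (rep q) ^ Suc k * R (rep q)" if "q \<in> X" for q using that by blast
    have eqN: "H (?N q) * P (?N q) = T (?N q) ^ Suc k * R (?N q)" if "q \<in> X" for q
      using eq[OF that] hom_poly_nrm[OF h1, of a0 q] hom_poly_nrm[OF h2, of a0 q] by simp
    have D1: "Dr H (?N q) * P (?N q) + H (?N q) * Dr P (?N q) =
        of_nat (Suc k) * T (?N q) ^ k * Dr T (?N q) * R (?N q) + T (?N q) ^ Suc k * Dr R (?N q)" if "q \<in> X" for q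
      using Dr_eq_on_X[OF h1 h2 eq that, of a0] unfolding Dr_mult[OF H P] Dr_mult[OF Tk R] Dr_power[OF T(1)] .
    have W1: "H (rep q) * Dr G (rep q) = G (rep q) * Dr H (rep q)" if "q \<in> X" for q
    proof -
      have DH: "Dr H (rep q) = Dr F (rep q) - c * Dr G (rep q)"
        unfolding H_def by (simp add: Dr_diff[OF F hom_poly_cmult[OF G]] Dr_cmult[OF G])
      have Hq: "H (rep q) = F (rep q) - c * G (rep q)" by (simp add: H_def)
      show ?thesis unfolding DH Hq using W[OF that] by (simp add: algebra_simps)
    qed
    have W2: "H (?N q) * Dr G (?N q) = G (?N q) * Dr H (?N q)" if "q \<in> X" for q
      using W1[OF that] hom_poly_nrm[OF H, of a0 q] hom_poly_nrm[OF G, of a0 q]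
        hom_poly_nrm[OF hom_poly_Dr[OF H], of a0 q] hom_poly_nrm[OF hom_poly_Dr[OF G], of a0 q] by simp
    \<comment> \<open>The Wronskian identity with the factor \<open>T ^ k\<close> removed. At
      \<open>p\<close>, where \<open>T\<close> vanishes, only the term with \<open>Suc k\<close>
      times \<open>Dr T\<close> survives, so \<open>Dr T\<close> vanishes at
      \<open>p\<close>.\<close>
    define E where "E = (\<lambda>q. T (?N q) * R (?N q) * (P (?N q) * Dr G (?N q) + G (?N q) * Dr P (?N q)) -
        G (?N q) * P (?N q) * (of_nat (Suc k) * Dr T (?N q) * R (?N q) + T (?N q) * Dr R (?N q)))"
    have El: "E \<in> loc p"
    proof -
      note l = loc_hom_nrm[OF p _ a0(1) b]
      show ?thesis unfolding E_def
        by (intro loc_diff loc_mult loc_add loc_const p l[OF T(1)] l[OF R] l[OF P] l[OF G]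
            l[OF hom_poly_Dr[OF G]] l[OF hom_poly_Dr[OF P]] l[OF hom_poly_Dr[OF T(1)]] l[OF hom_poly_Dr[OF R]])
    qed
    have "eventually (\<lambda>q. E q = 0) gen"
      using near_gen[OF p T(4)] uniformizer_gen_nonzero[OF p t] gen_in_X near_gen[OF p ga]
    proof eventually_elim
      case (elim q)
      have "T (rep q) \<noteq> 0" using elim(1,2) by auto
      then have Tn: "T (?N q) \<noteq> 0" using elim(4) by (simp add: hom_poly_nrm[OF T(1)])
      let ?v = "?N q"
      have "T ?v ^ k * E q = (T ?v ^ Suc k * R ?v) * (P ?v * Dr G ?v + G ?v * Dr P ?v) -
          G ?v * P ?v * (of_nat (Suc k) * T ?v ^ k * Dr T ?v * R ?v + T ?v ^ Suc k * Dr R ?v)"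
        by (simp add: E_def algebra_simps)
      also have "\<dots> = (H ?v * P ?v) * (P ?v * Dr G ?v + G ?v * Dr P ?v) - G ?v * P ?v * (Dr H ?v * P ?v + H ?v * Dr P ?v)"
        unfolding eqN[OF elim(3)] D1[OF elim(3)] ..
      also have "\<dots> = P ?v * P ?v * (H ?v * Dr G ?v - G ?v * Dr H ?v)" by (simp add: algebra_simps)
      also have "\<dots> = 0" unfolding W2[OF elim(3)] by simp
      finally show ?case using Tn by simp
    qed
    from loc_gen_eq(2)[OF p El loc_const this] have "E p = 0" .
    moreover have "T (?N p) = 0" using T0 by (simp add: hom_poly_nrm[OF T(1)])
    moreover have "P (rep p) \<noteq> 0" "R (rep p) \<noteq> 0" using b T(3) A(3) Ap by (auto simp: P_def R_def)
    then have "G (?N p) \<noteq> 0" "P (?N p) \<noteq> 0" "R (?N p) \<noteq> 0"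
      using Gp b by (auto simp: hom_poly_nrm[OF G] hom_poly_nrm[OF P] hom_poly_nrm[OF R])
    ultimately have DT: "Dr T (?N p) = 0" by (simp add: E_def del: of_nat_Suc)
    have difl: "dif a0 p i \<in> loc p" by (rule loc_dif[OF p i(1) a0(1) b])
    from uniformizerD(4)[OF t difl dif_self] obtain w where w: "w \<in> loc p" "eventually (\<lambda>q. dif a0 p i q = unif p q * w q) (near p)" by blast
    from w(1) obtain a' A' B' where A': "hom_poly n a' A'" "hom_poly n a' B'" "B' (rep p) \<noteq> 0"
      "eventually (\<lambda>q. w q = A' (rep q) / B' (rep q)) (near p)" by (rule locE)
    \<comment> \<open>Coordinate \<open>i\<close> minus its value at \<open>p\<close> is a multiple
      of the uniformizer, so \<open>Dr T = 0\<close> at \<open>p\<close> forces its derivative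
      \<open>V i\<close> to vanish there, against the choice of \<open>p\<close>.\<close>
    define \<mu> where "\<mu> = (\<lambda>v::cvec. v i - ?N p i * v a0)"
    have \<mu>: "hom_poly n 1 \<mu>" unfolding \<mu>_def by (intro hom_poly_diff hom_poly_cmult hom_poly.var i a0)
    have \<mu>p: "\<mu> (?N p) = 0" using nrm_self[OF b] by (simp add: \<mu>_def)
    have SB: "hom_poly n (c' + a') (\<lambda>v. S v * B' v)" by (intro hom_poly.mult T A')
    have xA: "hom_poly n (1 + a') (\<lambda>v. v a0 * A' v)" by (intro hom_poly.mult hom_poly.var a0 A')
    have h3: "hom_poly n (1 + (c' + a')) (\<lambda>v. \<mu> v * (S v * B' v))" by (rule hom_poly.mult[OF \<mu> SB])
    have h4: "hom_poly n (1 + (c' + a')) (\<lambda>v. T v * (v a0 * A' v))" by (rule hom_poly_mult'[OF T(1) xA]) simp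
    have "eventually (\<lambda>q. \<mu> (rep q) * (S (rep q) * B' (rep q)) = T (rep q) * (rep q a0 * A' (rep q))) (near p)"
      using w(2) T(4) A'(4) ga eventually_near_basic[OF T(2) p T(3)] eventually_near_basic[OF A'(2) p A'(3)]
    proof eventually_elim
      case (elim q)
      have "\<mu> (rep q) = rep q a0 * dif a0 p i q"
        using elim(4) by (simp add: \<mu>_def dif_def nrm_def right_diff_distrib)
      then show ?case using elim by simp
    qed
    from forms_eq_on_X[OF h3 h4 near_gen[OF p this]]
    have eq2: "\<mu> (rep q) * (S (rep q) * B' (rep q)) = T (rep q) * (rep q a0 * A' (rep q))" if "q \<in> X" for q using that by blast
    have "Dr \<mu> (?N p) * (S (?N p) * B' (?N p)) = 0"
      using Dr_eq_on_X[OF h3 h4 eq2 p, of a0] \<mu>p DT T0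
      unfolding Dr_mult[OF \<mu> SB] Dr_mult[OF T(1) xA] by (simp add: hom_poly_nrm[OF T(1)])
    moreover have "S (?N p) \<noteq> 0" "B' (?N p) \<noteq> 0"
      using T(3) A'(3) b by (auto simp: hom_poly_nrm[OF T(2)] hom_poly_nrm[OF A'(2)])
    ultimately have "Dr \<mu> (?N p) = 0" by simp
    moreover have "Dr \<mu> (?N p) = V i (?N p)"
      unfolding \<mu>_def using i a0(1)
      by (simp add: Dr_diff[OF hom_poly.var[OF i(1)] hom_poly_cmult[OF hom_poly.var[OF a0(1)]]]
          Dr_cmult[OF hom_poly.var[OF a0(1)]] Dr_var)
    ultimately show False using Vp b by (simp add: hom_poly_nrm[OF V[OF i(1,2)]])
  qed
  then show ?thesis unfolding H_def by (intro exI[of _ c]) simp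
qed

end

section \<open>Semicontinuity of kernels\<close>

lemma multihom_poly_mult':
  "multihom_poly k n d F \<Longrightarrow> multihom_poly k n e G \<Longrightarrow> f = (\<lambda>l. d l + e l) \<Longrightarrow> multihom_poly k n f (\<lambda>v. F v * G v)"
  using multihom_poly.mult by blast

lemma multihom_poly_cmult: "multihom_poly k n d F \<Longrightarrow> multihom_poly k n d (\<lambda>v. c * F v)"
  using multihom_poly_mult'[OF multihom_poly.const[of k n c], of d F d] by simp

lemma multihom_poly_diff:
  "multihom_poly k n d F \<Longrightarrow> multihom_poly k n d G \<Longrightarrow> multihom_poly k n d (\<lambda>v. F v - G v)"
  using multihom_poly.add[OF _ multihom_poly_cmult[of k n d G "-1"]] by simp

lemma hom_poly_imp_multihom_poly:
  assumes "hom_poly n d F" "j < k"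
  shows "multihom_poly k n (\<lambda>l. if l = j then d else 0) (\<lambda>v. F (v j))"
  using assms(1)
proof (induction rule: hom_poly.induct)
  case (const c)
  show ?case using multihom_poly.const[of k n c] by (simp add: if_cancel)
next
  case (var i)
  then show ?case using multihom_poly.var[OF assms(2)] by simp
next
  case (add d F G)
  from multihom_poly.add[OF add(3,4)] show ?case .
next
  case (mult d F e G)
  show ?case by (rule multihom_poly_mult'[OF mult(3,4)]) auto
qed

lemma multihom_poly_prod:
  assumes "hom_poly n d H" "finite J" "J \<subseteq> {..<k}"
  shows "\<exists>e. multihom_poly k n e (\<lambda>v. \<Prod>j\<in>J. H (v j))"
  using assms(2,3)
proof (induction J rule: finite_induct)
  case empty
  show ?case using multihom_poly.const[of k n 1] by auto
next
  case (insert j J)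
  then obtain e where "multihom_poly k n e (\<lambda>v. \<Prod>j\<in>J. H (v j))" by auto
  from multihom_poly.mult[OF hom_poly_imp_multihom_poly[OF assms(1), of j k] this] insert show ?case by auto
qed

lemma codim_le_mono: "codim_le A' C m \<Longrightarrow> A \<subseteq> A' \<Longrightarrow> m \<le> m' \<Longrightarrow> codim_le A C m'"
  unfolding codim_le_def by (meson order_trans)

lemma codim_le_linear_image:
  fixes f :: "('a \<Rightarrow> complex) \<Rightarrow> ('b \<Rightarrow> complex)"
  assumes add: "\<And>x y. f (x + y) = f x + f y" and scale: "\<And>c x. f (cscale c x) = cscale c (f x)"
    and A: "codim_le A {0} m" "A' \<subseteq> f ` A"
  shows "codim_le A' {0} m"
proof -
  obtain B where B: "finite B" "card B \<le> m" "A \<subseteq> cfun.span ({0} \<union> B)" using A(1) unfolding codim_le_def by blast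
  have f0: "f 0 = 0" using scale[of 0 0] by simp
  have "f x \<in> cfun.span ({0} \<union> f ` B)" if "x \<in> cfun.span ({0} \<union> B)" for x
    using that
  proof (induction rule: cfun.span_induct_alt)
    case base
    show ?case using cfun.span_zero f0 by (simp add: zero_fun_def)
  next
    case (step c x y)
    have "f x \<in> {0} \<union> f ` B" using step(1) f0 by auto
    from cfun.span_add[OF cfun.span_scale[OF cfun.span_base[OF this]] step(2)] show ?case unfolding add scale .
  qed
  then have "A' \<subseteq> cfun.span ({0} \<union> f ` B)" using A(2) B(3) by blast
  then show ?thesis unfolding codim_le_def using B card_image_le[OF B(1), of f]
    by (intro exI[of _ "f ` B"]) auto
qed

text \<open>Kernel of a matrix with rows below \<open>m\<close> and columns \<open>C\<close>, whose
  entries depend on \<open>v\<close>. Vectors are extended by 0 outside \<open>C\<close>, so that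
  columns can be deleted.\<close>

definition lker :: "nat \<Rightarrow> nat set \<Rightarrow> (nat \<Rightarrow> nat \<Rightarrow> 'v \<Rightarrow> complex) \<Rightarrow> 'v \<Rightarrow> (nat \<Rightarrow> complex) set" where
  "lker m C R v = {c. (\<forall>a. a \<notin> C \<longrightarrow> c a = 0) \<and> (\<forall>r<m. (\<Sum>a\<in>C. c a * R r a v) = 0)}"

text \<open>Solving row \<open>m\<close> for the pivot unknown identifies the two kernels by
  mutually inverse linear maps \<open>f\<close> and \<open>g\<close>.\<close>

lemma lker_eliminate:
  fixes R :: "nat \<Rightarrow> nat \<Rightarrow> 'v \<Rightarrow> complex"
  assumes C: "finite C" "a0 \<in> C" and x: "R m a0 v \<noteq> 0"
  defines "R' \<equiv> \<lambda>r a v. R m a0 v * R r a v - R r a0 v * R m a v"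
  shows "codim_le (lker (Suc m) C R v) {0} K \<longleftrightarrow> codim_le (lker m (C - {a0}) R' v) {0} K"
proof -
  let ?C = "C - {a0}" and ?x = "R m a0 v"
  define f where "f c = c(a0 := 0)" for c :: "nat \<Rightarrow> complex"
  define g where "g c = c(a0 := - (\<Sum>a\<in>?C. c a * R m a v) / ?x)" for c :: "nat \<Rightarrow> complex"
  have split: "(\<Sum>a\<in>C. h a) = h a0 + (\<Sum>a\<in>?C. h a)" for h :: "nat \<Rightarrow> complex"
    using sum.remove[OF C] .
  have sR': "(\<Sum>a\<in>?C. c a * R' r a v) = ?x * (\<Sum>a\<in>?C. c a * R r a v) - R r a0 v * (\<Sum>a\<in>?C. c a * R m a v)" for c r
    by (simp add: R'_def right_diff_distrib sum_subtractf sum_distrib_left mult_ac)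
  have gs: "(\<Sum>a\<in>?C. g c a * h a) = (\<Sum>a\<in>?C. c a * h a)" for c h
    by (rule sum.cong) (auto simp: g_def)
  have fs: "(\<Sum>a\<in>?C. f c a * h a) = (\<Sum>a\<in>?C. c a * h a)" for c h
    by (rule sum.cong) (auto simp: f_def)
  have fK: "f c \<in> lker m ?C R' v" "g (f c) = c" if c: "c \<in> lker (Suc m) C R v" for c
  proof -
    have row: "(\<Sum>a\<in>?C. c a * R r a v) = - (c a0 * R r a0 v)" if "r < Suc m" for r
      using c that split[of "\<lambda>a. c a * R r a v"] by (simp add: lker_def eq_neg_iff_add_eq_0 add.commute)
    have "(\<Sum>a\<in>?C. f c a * R' r a v) = 0" if "r < m" for r
      unfolding fs sR' using row[of r] row[of m] that by simp
    then show "f c \<in> lker m ?C R' v" using c by (auto simp: lker_def f_def)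
    have "- (\<Sum>a\<in>?C. f c a * R m a v) / ?x = c a0" unfolding fs using row[of m] x by simp
    then show "g (f c) = c" unfolding g_def by (auto simp: f_def)
  qed
  have gK: "g c \<in> lker (Suc m) C R v" "f (g c) = c" if c: "c \<in> lker m ?C R' v" for c
  proof -
    have "(\<Sum>a\<in>C. g c a * R r a v) = 0" if "r < Suc m" for r
    proof -
      have "?x * (\<Sum>a\<in>C. g c a * R r a v) = ?x * (\<Sum>a\<in>?C. c a * R r a v) - R r a0 v * (\<Sum>a\<in>?C. c a * R m a v)"
        unfolding split[of "\<lambda>a. g c a * R r a v"] gs using x by (simp add: g_def field_simps)
      also have "\<dots> = 0"
      proof (cases "r = m")
        case False
        then have "(\<Sum>a\<in>?C. c a * R' r a v) = 0" using c that by (simp add: lker_def)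
        then show ?thesis unfolding sR' .
      qed simp
      finally show ?thesis using x by simp
    qed
    then show "g c \<in> lker (Suc m) C R v" using c C(2) by (auto simp: lker_def g_def)
    have "c a0 = 0" using c by (auto simp: lker_def)
    then show "f (g c) = c" by (auto simp: f_def g_def)
  qed
  have f1: "f (c + d) = f c + f d" "f (cscale k c) = cscale k (f c)" for c d k
    by (auto simp: f_def fun_eq_iff cscale_def)
  have g1: "g (c + d) = g c + g d" "g (cscale k c) = cscale k (g c)" for c d k
    by (auto simp: g_def fun_eq_iff cscale_def distrib_right sum.distrib add_divide_distrib diff_divide_distrib
        sum_distrib_left mult.assoc)
  show ?thesis
  proof
    assume "codim_le (lker (Suc m) C R v) {0} K"
    from codim_le_linear_image[of f, OF f1 this] gK show "codim_le (lker m ?C R' v) {0} K"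
      by (metis (no_types, lifting) image_eqI subsetI)
  next
    assume "codim_le (lker m ?C R' v) {0} K"
    from codim_le_linear_image[of g, OF g1 this] fK show "codim_le (lker (Suc m) C R v) {0} K"
      by (metis (no_types, lifting) image_eqI subsetI)
  qed
qed

text \<open>The elimination that succeeds at \<open>v0\<close> succeeds wherever its pivots are
  nonzero, and \<open>\<Phi>\<close> is their product. The degree \<open>\<delta> r\<close> depends
  on the row alone, so cross-multiplied rows are multihomogeneous again.\<close>

lemma kernel_semicontinuous:
  assumes "finite C" "\<And>r a. r < m \<Longrightarrow> a \<in> C \<Longrightarrow> multihom_poly k n (\<delta> r) (R r a)"
    and "codim_le (lker m C R v0) {0} K"
  shows "\<exists>\<Phi> d. multihom_poly k n d \<Phi> \<and> \<Phi> v0 \<noteq> 0 \<and> (\<forall>v. \<Phi> v \<noteq> 0 \<longrightarrow> codim_le (lker m C R v) {0} K)"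
  using assms
proof (induction m arbitrary: C R \<delta>)
  case 0
  have "lker 0 C R v = lker 0 C R v0" for v unfolding lker_def by simp
  then have "\<forall>v. codim_le (lker 0 C R v) {0} K" using 0(3) by metis
  with multihom_poly.const[of k n 1] zero_neq_one[where ?'a = complex] show ?case by metis
next
  case (Suc m)
  show ?case
  proof (cases "\<forall>a\<in>C. R m a v0 = 0")
    case True
    \<comment> \<open>A row that is zero at \<open>v0\<close> is dropped. The kernel at
      \<open>v0\<close> stays the same, and elsewhere a bound for the larger kernel is bound
      enough.\<close>
    have "lker m C R v0 \<subseteq> lker (Suc m) C R v0" using True by (auto simp: lker_def less_Suc_eq)
    then have "codim_le (lker m C R v0) {0} K" using codim_le_mono[OF Suc.prems(3)] by blast
    moreover have "multihom_poly k n (\<delta> r) (R r a)" if "r < m" "a \<in> C" for r a using Suc.prems(2) that by simp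
    ultimately obtain \<Phi> d where
      \<Phi>: "multihom_poly k n d \<Phi>" "\<Phi> v0 \<noteq> 0" "\<forall>v. \<Phi> v \<noteq> 0 \<longrightarrow> codim_le (lker m C R v) {0} K"
      using Suc.IH[OF Suc.prems(1)] by blast
    have "lker (Suc m) C R v \<subseteq> lker m C R v" for v by (auto simp: lker_def)
    then have "\<forall>v. \<Phi> v \<noteq> 0 \<longrightarrow> codim_le (lker (Suc m) C R v) {0} K" using \<Phi>(3) codim_le_mono by blast
    then show ?thesis using \<Phi>(1,2) by blast
  next
    case False
    then obtain a0 where a0: "a0 \<in> C" "R m a0 v0 \<noteq> 0" by blast
    define R' where "R' = (\<lambda>r a v. R m a0 v * R r a v - R r a0 v * R m a v)"
    have mh: "multihom_poly k n (\<lambda>l. \<delta> m l + \<delta> r l) (R' r a)" if "r < m" "a \<in> C - {a0}" for r a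
    proof -
      have 1: "multihom_poly k n (\<delta> m) (R m a0)" "multihom_poly k n (\<delta> r) (R r a)"
        "multihom_poly k n (\<delta> r) (R r a0)" "multihom_poly k n (\<delta> m) (R m a)"
        using Suc.prems(2) that a0(1) by auto
      show ?thesis unfolding R'_def
        by (intro multihom_poly_diff multihom_poly_mult'[OF 1(1,2)] multihom_poly_mult'[OF 1(3,4)]) auto
    qed
    note el = lker_eliminate[OF Suc.prems(1) a0(1), of R m, folded R'_def]
    have fin: "finite (C - {a0})" using Suc.prems(1) by simp
    have "codim_le (lker m (C - {a0}) R' v0) {0} K" using el[OF a0(2)] Suc.prems(3) by blast
    from Suc.IH[OF fin mh this] obtain \<Phi> d where
      \<Phi>: "multihom_poly k n d \<Phi>" "\<Phi> v0 \<noteq> 0" "\<forall>v. \<Phi> v \<noteq> 0 \<longrightarrow> codim_le (lker m (C - {a0}) R' v) {0} K" by blast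
    have "multihom_poly k n (\<lambda>l. \<delta> m l + d l) (\<lambda>v. R m a0 v * \<Phi> v)"
      using Suc.prems(2) a0(1) \<Phi>(1) by (intro multihom_poly.mult) auto
    moreover have "R m a0 v0 * \<Phi> v0 \<noteq> 0" using a0(2) \<Phi>(2) by simp
    moreover have "codim_le (lker (Suc m) C R v) {0} K" if "R m a0 v * \<Phi> v \<noteq> 0" for v
      using el[of v] \<Phi>(3) that by fastforce
    ultimately show ?thesis by blast
  qed
qed

section \<open>General points impose independent conditions\<close>

text \<open>A basis of \<open>S'\<close> stays independent after adding \<open>c\<close> and
  \<open>c'\<close>, so it has at most \<open>m - 2\<close> elements, where the subtraction is a
  genuine one.\<close>

lemma codim_le_drop_2:
  assumes S': "cfun.subspace S'" "S' \<subseteq> S" and S: "codim_le S {0} m" and c: "c \<in> S" "c' \<in> S"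
    and ind: "\<And>\<alpha> \<beta>. cscale \<alpha> c + cscale \<beta> c' \<in> S' \<Longrightarrow> \<alpha> = 0 \<and> \<beta> = 0"
  shows "codim_le S' {0} (m - 2)"
proof -
  obtain B where B: "finite B" "card B \<le> m" "S \<subseteq> cfun.span ({0} \<union> B)" using S unfolding codim_le_def by blast
  have B0: "S \<subseteq> cfun.span B" using B(3) cfun.span_insert_0 by simp
  obtain B' where B': "B' \<subseteq> S'" "cfun.independent B'" "S' \<subseteq> cfun.span B'"
    using cfun.maximal_independent_subset by blast
  have sp: "cfun.span B' \<subseteq> S'" using cfun.span_minimal[OF B'(1) S'(1)] .
  have c1: "c \<notin> cfun.span B'"
  proof
    assume "c \<in> cfun.span B'"
    then have "cscale 1 c + cscale 0 c' \<in> S'" using sp by auto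
    from ind[OF this] show False by simp
  qed
  have c2: "c' \<notin> cfun.span (insert c B')"
  proof
    assume "c' \<in> cfun.span (insert c B')"
    then obtain k where "c' - cscale k c \<in> cfun.span B'" using cfun.span_breakdown_eq by blast
    then have "cscale (- k) c + cscale 1 c' \<in> S'" using sp by (auto simp: cfun.scale_minus_left)
    from ind[OF this] show False by simp
  qed
  have "cfun.independent (insert c' (insert c B'))"
    using B'(2) c1 c2 by (intro cfun.independent_insertI)
  moreover have "insert c' (insert c B') \<subseteq> cfun.span B" using B'(1) S'(2) c B0 by blast
  ultimately have "finite (insert c' (insert c B')) \<and> card (insert c' (insert c B')) \<le> card B"
    by (rule cfun.independent_span_bound[OF B(1)])
  then have fin: "finite (insert c' (insert c B'))" and le: "card (insert c' (insert c B')) \<le> card B" by simp_all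
  have "c \<notin> B'" "c' \<notin> insert c B'" using c1 c2 cfun.span_base by blast+
  then have "card B' \<le> m - 2" using fin le B(2) by simp
  then show ?thesis unfolding codim_le_def using B'(3) fin cfun.span_insert_0[of B'] by (intro exI[of _ B']) auto
qed

context tangent_field
begin

text \<open>For two independent vectors of \<open>S\<close>, a nonzero Wronskian at \<open>q\<close>
  makes value and derivative independent conditions. If \<open>S\<close> has dimension at most 1, a
  point where a generator does not vanish leaves only 0, within any truncated bound.\<close>

lemma choose_point:
  assumes F: "\<And>a. a < h \<Longrightarrow> hom_poly n d (F a)"
    and ind: "\<And>c. (\<forall>a. a \<notin> {..<h} \<longrightarrow> c a = 0) \<Longrightarrow> (\<forall>q\<in>X. (\<Sum>a<h. c a * F a (rep q)) = 0) \<Longrightarrow> c = 0"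
    and H: "hom_poly n dH H" "q0 \<in> X" "H (rep q0) \<noteq> 0"
    and S: "cfun.subspace S" "\<And>c. c \<in> S \<Longrightarrow> \<forall>a. a \<notin> {..<h} \<longrightarrow> c a = 0" "codim_le S {0} m"
  shows "\<exists>q\<in>X. H (rep q) \<noteq> 0 \<and>
    codim_le {c \<in> S. (\<Sum>a<h. c a * F a (rep q)) = 0 \<and> (\<Sum>a<h. c a * Dr (F a) (rep q)) = 0} {0} (m - 2)"
proof -
  let ?F = "\<lambda>c v. \<Sum>a<h. c a * F a v"
  let ?S = "\<lambda>q. {c \<in> S. ?F c (rep q) = 0 \<and> (\<Sum>a<h. c a * Dr (F a) (rep q)) = 0}"
  have hF: "hom_poly n d (?F c)" for c using F by (intro hom_poly_sum hom_poly_cmult) auto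
  have DF: "Dr (?F c) v = (\<Sum>a<h. c a * Dr (F a) v)" for c v using F by (intro Dr_sum) auto
  have triv: "codim_le (?S q) {0} (m - 2)" if "?S q \<subseteq> {0}" for q
    using codim_le_mono[OF codim_le_refl[of "{0}"] that] by simp
  note Hg = hom_poly_gen_nonzero[OF H]
  show ?thesis
  proof (cases "S \<subseteq> {0}")
    case True
    then have "?S q0 \<subseteq> {0}" by blast
    from triv[OF this] H(2,3) show ?thesis by (intro bexI[of _ q0] conjI)
  next
    case False
    then obtain c where c: "c \<in> S" "c \<noteq> 0" by blast
    then obtain q1 where q1: "q1 \<in> X" "?F c (rep q1) \<noteq> 0" using ind[of c] S(2) by blast
    show ?thesis
    proof (cases "\<forall>c'\<in>S. \<exists>k. c' = cscale k c")
      case True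
      from Hg hom_poly_gen_nonzero[OF hF q1] have "eventually (\<lambda>q. H (rep q) \<noteq> 0 \<and> ?F c (rep q) \<noteq> 0) gen"
        by (rule eventually_conj)
      from gen_ex[OF this] obtain q where q: "q \<in> X" "H (rep q) \<noteq> 0" "?F c (rep q) \<noteq> 0" by blast
      have "?S q \<subseteq> {0}"
      proof
        fix c' assume c': "c' \<in> ?S q"
        then obtain k where k: "c' = cscale k c" using True by blast
        have "?F c' (rep q) = k * ?F c (rep q)" by (simp add: k cscale_def sum_distrib_left mult.assoc)
        then have "k = 0" using c' q(3) by simp
        then show "c' \<in> {0}" by (simp add: k)
      qed
      from triv[OF this] q(1,2) show ?thesis by (intro bexI[of _ q] conjI)
    next
      case False
      then obtain c' where c': "c' \<in> S" "\<forall>k. c' \<noteq> cscale k c" by blast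
      let ?W = "\<lambda>v. ?F c' v * Dr (?F c) v - ?F c v * Dr (?F c') v"
      have hW: "hom_poly n (d + (d - 1 + e)) ?W"
        by (intro hom_poly_diff hom_poly.mult hF hom_poly_Dr)
      have "\<exists>q\<in>X. ?W (rep q) \<noteq> 0"
      proof (rule ccontr)
        assume "\<not> ?thesis"
        then have "?F c' (rep q) * Dr (?F c) (rep q) = ?F c (rep q) * Dr (?F c') (rep q)" if "q \<in> X" for q
          using that by auto
        from wronskian_zero_imp_proportional[OF hF hF q1 this] obtain k where
          k: "\<forall>q\<in>X. ?F c' (rep q) = k * ?F c (rep q)" by blast
        have "?F (c' - cscale k c) (rep q) = 0" if "q \<in> X" for q
          using k that by (simp add: cscale_def left_diff_distrib sum_subtractf sum_distrib_left mult.assoc)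
        moreover have "\<forall>a. a \<notin> {..<h} \<longrightarrow> (c' - cscale k c) a = 0" using S(2)[OF c(1)] S(2)[OF c'(1)] by (simp add: cscale_def)
        ultimately have "c' - cscale k c = 0" using ind[of "c' - cscale k c"] by blast
        then show False using c'(2) by simp
      qed
      then obtain q2 where q2: "q2 \<in> X" "?W (rep q2) \<noteq> 0" by blast
      from Hg hom_poly_gen_nonzero[OF hW q2] have "eventually (\<lambda>q. H (rep q) \<noteq> 0 \<and> ?W (rep q) \<noteq> 0) gen"
        by (rule eventually_conj)
      from gen_ex[OF this] obtain q where q: "q \<in> X" "H (rep q) \<noteq> 0" "?W (rep q) \<noteq> 0" by blast
      have lin: "(\<Sum>a<h. (cscale \<alpha> x + cscale \<beta> y) a * g a) = \<alpha> * (\<Sum>a<h. x a * g a) + \<beta> * (\<Sum>a<h. y a * g a)" for \<alpha> \<beta> x y g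
        by (simp add: cscale_def distrib_right sum.distrib sum_distrib_left mult.assoc)
      have sub: "cfun.subspace (?S q)"
        unfolding cfun.subspace_def
      proof (intro conjI ballI allI)
        show "0 \<in> ?S q" using cfun.subspace_0[OF S(1)] by simp
        fix x assume x: "x \<in> ?S q"
        show "cscale k x \<in> ?S q" for k
          using x cfun.subspace_scale[OF S(1), of x k] lin[of k x 0 0] by simp
        fix y assume y: "y \<in> ?S q"
        show "x + y \<in> ?S q" using x y cfun.subspace_add[OF S(1), of x y] lin[of 1 x 1 y] by simp
      qed
      have "\<alpha> = 0 \<and> \<beta> = 0" if "cscale \<alpha> c + cscale \<beta> c' \<in> ?S q" for \<alpha> \<beta>
      proof -
        have 1: "\<alpha> * ?F c (rep q) + \<beta> * ?F c' (rep q) = 0"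
          and 2: "\<alpha> * Dr (?F c) (rep q) + \<beta> * Dr (?F c') (rep q) = 0"
          using that unfolding DF mem_Collect_eq lin by blast+
        have "\<alpha> * ?W (rep q) = ?F c' (rep q) * (\<alpha> * Dr (?F c) (rep q) + \<beta> * Dr (?F c') (rep q))
           - Dr (?F c') (rep q) * (\<alpha> * ?F c (rep q) + \<beta> * ?F c' (rep q))" by (simp add: algebra_simps)
        moreover have "\<beta> * ?W (rep q) = Dr (?F c) (rep q) * (\<alpha> * ?F c (rep q) + \<beta> * ?F c' (rep q))
           - ?F c (rep q) * (\<alpha> * Dr (?F c) (rep q) + \<beta> * Dr (?F c') (rep q))" by (simp add: algebra_simps)
        ultimately show ?thesis unfolding 1 2 using q(3) by simp
      qed
      from codim_le_drop_2[OF sub _ S(3) c(1) c'(1) this] q(1,2) show ?thesis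
        by (intro bexI[of _ q] conjI) auto
    qed
  qed
qed

text \<open>Greedy choice: each new point is general for the kernel left by its predecessors, while
  \<open>H\<close> keeps it in a prescribed open set.\<close>

lemma choose_points:
  assumes F: "\<And>a. a < h \<Longrightarrow> hom_poly n d (F a)"
    and ind: "\<And>c. (\<forall>a. a \<notin> {..<h} \<longrightarrow> c a = 0) \<Longrightarrow> (\<forall>q\<in>X. (\<Sum>a<h. c a * F a (rep q)) = 0) \<Longrightarrow> c = 0"
    and H: "hom_poly n dH H" "q0 \<in> X" "H (rep q0) \<noteq> 0"
  shows "\<exists>p. (\<forall>j<k. p j \<in> X \<and> H (rep (p j)) \<noteq> 0) \<and>
    codim_le {c. (\<forall>a. a \<notin> {..<h} \<longrightarrow> c a = 0) \<and>
      (\<forall>j<k. (\<Sum>a<h. c a * F a (rep (p j))) = 0 \<and> (\<Sum>a<h. c a * Dr (F a) (rep (p j))) = 0)} {0} (h - 2 * k)"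
proof (induction k)
  case 0
  let ?u = "\<lambda>b a. if a = b then 1 else 0 :: complex"
  have "c \<in> cfun.span ({0} \<union> ?u ` {..<h})" if c: "\<forall>a. a \<notin> {..<h} \<longrightarrow> c a = 0" for c
  proof -
    have "c = (\<Sum>b<h. cscale (c b) (?u b))"
    proof
      fix a show "c a = (\<Sum>b<h. cscale (c b) (?u b)) a"
        unfolding cscale_sum_apply using c by (simp add: if_distrib[of "\<lambda>x. _ * x"] sum.delta cong: if_cong)
    qed
    also have "\<dots> \<in> cfun.span ({0} \<union> ?u ` {..<h})"
      by (intro cfun.span_sum cfun.span_scale cfun.span_base) auto
    finally show ?thesis .
  qed
  then show ?case using card_image_le[of "{..<h}" ?u]
    unfolding codim_le_def by (intro exI[of _ "\<lambda>_. q0"] conjI exI[of _ "?u ` {..<h}"]) auto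
next
  case (Suc k)
  let ?S = "\<lambda>k p. {c. (\<forall>a. a \<notin> {..<h} \<longrightarrow> c a = 0) \<and>
      (\<forall>j<k. (\<Sum>a<h. c a * F a (rep (p j))) = 0 \<and> (\<Sum>a<h. c a * Dr (F a) (rep (p j))) = 0)}"
  obtain p where p: "\<forall>j<k. p j \<in> X \<and> H (rep (p j)) \<noteq> 0" "codim_le (?S k p) {0} (h - 2 * k)" using Suc by blast
  have sub: "cfun.subspace (?S k p)"
    unfolding cfun.subspace_def
    by (auto simp: cscale_def distrib_right sum.distrib sum_distrib_left[symmetric] mult.assoc)
  have supp: "\<forall>a. a \<notin> {..<h} \<longrightarrow> c a = 0" if "c \<in> ?S k p" for c using that by blast
  have "\<exists>q\<in>X. H (rep q) \<noteq> 0 \<and>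
    codim_le {c \<in> ?S k p. (\<Sum>a<h. c a * F a (rep q)) = 0 \<and> (\<Sum>a<h. c a * Dr (F a) (rep q)) = 0} {0} (h - 2 * k - 2)"
    by (rule choose_point[where F = F and h = h and d = d, OF _ _ H sub _ p(2)]) (use F ind supp in blast)+
  then obtain q where q: "q \<in> X" "H (rep q) \<noteq> 0"
    "codim_le {c \<in> ?S k p. (\<Sum>a<h. c a * F a (rep q)) = 0 \<and> (\<Sum>a<h. c a * Dr (F a) (rep q)) = 0} {0} (h - 2 * k - 2)" by blast
  define p' where "p' = p(k := q)"
  have "?S (Suc k) p' \<subseteq> {c \<in> ?S k p. (\<Sum>a<h. c a * F a (rep q)) = 0 \<and> (\<Sum>a<h. c a * Dr (F a) (rep q)) = 0}"
  proof
    fix c assume c: "c \<in> ?S (Suc k) p'"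
    have "p' k = q" "\<And>j. j < k \<Longrightarrow> p' j = p j" by (auto simp: p'_def)
    with c show "c \<in> {c \<in> ?S k p. (\<Sum>a<h. c a * F a (rep q)) = 0 \<and> (\<Sum>a<h. c a * Dr (F a) (rep q)) = 0}"
      by (auto simp: less_Suc_eq)
  qed
  from codim_le_mono[OF q(3) this] have "codim_le (?S (Suc k) p') {0} (h - 2 * Suc k)" by simp
  moreover have "\<forall>j<Suc k. p' j \<in> X \<and> H (rep (p' j)) \<noteq> 0" using p(1) q(1,2) by (auto simp: p'_def less_Suc_eq)
  ultimately show ?case by blast
qed

end

context curve
begin

lemma common_denominator:
  assumes x: "x \<in> X" and "finite I" "\<And>i. i \<in> I \<Longrightarrow> f i \<in> loc x"
  shows "\<exists>d G F. hom_poly n d G \<and> G (rep x) \<noteq> 0 \<and>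
    (\<forall>i\<in>I. hom_poly n d (F i) \<and> eventually (\<lambda>q. f i q = F i (rep q) / G (rep q)) (near x))"
  using assms(2,3)
proof (induction I rule: finite_induct)
  case empty
  show ?case using hom_poly.const[of n 1] by (intro exI[of _ 0] exI[of _ "\<lambda>_. 1"]) auto
next
  case (insert i I)
  then obtain d G F where IH: "hom_poly n d G" "G (rep x) \<noteq> 0"
    "\<forall>i\<in>I. hom_poly n d (F i) \<and> eventually (\<lambda>q. f i q = F i (rep q) / G (rep q)) (near x)" by auto
  obtain d' A B where A: "hom_poly n d' A" "hom_poly n d' B" "B (rep x) \<noteq> 0"
    "eventually (\<lambda>q. f i q = A (rep q) / B (rep q)) (near x)" using insert.prems[of i] by (auto elim: locE)
  define F' where "F' = (\<lambda>j v. if j = i then G v * A v else F j v * B v)"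
  have "hom_poly n (d + d') (\<lambda>v. G v * B v)" by (rule hom_poly.mult[OF IH(1) A(2)])
  moreover have "hom_poly n (d + d') (F' j) \<and> eventually (\<lambda>q. f j q = F' j (rep q) / (G (rep q) * B (rep q))) (near x)"
    if j: "j \<in> insert i I" for j
  proof (cases "j = i")
    case True
    have "eventually (\<lambda>q. f i q = G (rep q) * A (rep q) / (G (rep q) * B (rep q))) (near x)"
      using A(4) eventually_near_basic[OF IH(1) x IH(2)] by eventually_elim simp
    then show ?thesis using True hom_poly.mult[OF IH(1) A(1)] by (simp add: F'_def)
  next
    case False
    then have jI: "hom_poly n d (F j)" "eventually (\<lambda>q. f j q = F j (rep q) / G (rep q)) (near x)" using IH(3) j by auto
    have "eventually (\<lambda>q. f j q = F j (rep q) * B (rep q) / (G (rep q) * B (rep q))) (near x)"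
      using jI(2) eventually_near_basic[OF A(2) x A(3)] by eventually_elim simp
    then show ?thesis using False hom_poly.mult[OF jI(1) A(2)] by (simp add: F'_def)
  qed
  moreover have "G (rep x) * B (rep x) \<noteq> 0" using IH(2) A(3) by simp
  ultimately show ?case by (intro exI[of _ "d + d'"] exI[of _ "\<lambda>v. G v * B v"] exI[of _ F']) blast
qed

lemma vanishes_2_max_ideal_sq:
  assumes "z \<in> X" "f \<in> loc z" "vanishes z 2 f" shows "f \<in> max_ideal_sq n X z"
proof -
  obtain a where a: "a \<in> loc z" "eventually (\<lambda>q. f q = unif z q ^ 2 * a q) gen" using assms(3) unfolding vanishes_def by blast
  have "(\<lambda>q. unif z q ^ 2 * a q) \<in> loc z" by (intro loc_mult loc_power loc_unif a(1) assms(1))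
  from loc_gen_eq(1)[OF assms(1,2) this a(2)] a(1)
  show ?thesis unfolding max_ideal_sq_uniformizer[OF assms(1) unif(2)[OF assms(1)]] by blast
qed

text \<open>Order 2 at a point is two linear conditions in one chart, and regular transition
  functions carry it to the others. Valid for arbitrary points, this bounds the dimension from
  below.\<close>

lemma codim_singular_sections:
  assumes M: "is_line_bundle n X M" and P: "finite P" "P \<subseteq> X"
  shows "codim_le (sections n X M X) (singular_sections n X M P) (2 * card P)"
proof -
  note D = line_bundleD[OF M]
  let ?V = "sections n X M X"
  have "\<forall>z. \<exists>i. z \<in> X \<longrightarrow> i \<in> index M \<and> z \<in> chart M i" using D(2) by blast
  from choice[OF this] obtain i where i: "\<forall>z. z \<in> X \<longrightarrow> i z \<in> index M \<and> z \<in> chart M (i z)" ..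
  have Vl: "(\<lambda>x. s (i z, x)) \<in> loc z" if "s \<in> ?V" "z \<in> P" for s z
    using sectionsD(1)[OF M openin_X that(1)] i P(2) that(2) by blast
  let ?V' = "{s \<in> ?V. \<forall>z\<in>P. vanishes z 2 (\<lambda>x. s (i z, x))}"
  have "?V' \<subseteq> singular_sections n X M P"
  proof
    fix s assume s: "s \<in> ?V'"
    then have sV: "s \<in> ?V" by blast
    note S = sectionsD[OF M openin_X sV]
    have "(\<lambda>x. s (j, x)) \<in> max_ideal_sq n X z" if z: "z \<in> P" and j: "j \<in> index M" "z \<in> chart M j" for z j
    proof -
      have zX: "z \<in> X" using z P by blast
      then have iz: "i z \<in> index M" "z \<in> chart M (i z)" using i by auto
      have ne: "chart M j \<noteq> {}" "chart M (i z) \<noteq> {}" using j iz by auto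
      have "vanishes z 2 (\<lambda>x. s (i z, x))" using s z by blast
      moreover have "eventually (\<lambda>x. s (j, x) = trans_fun M j (i z) x * s (i z, x)) gen"
        using gen_open[OF D(1)[OF j(1)] ne(1)] gen_open[OF D(1)[OF iz(1)] ne(2)] gen_in_X
      proof eventually_elim
        case (elim x)
        then show ?case using S(2)[OF j(1) iz(1), of x] by blast
      qed
      ultimately have "vanishes z 2 (\<lambda>x. s (j, x))"
        by (rule vanishes_mult_loc[OF zX _ D(3)[OF j(1) iz(1) j(2) iz(2)]])
      from vanishes_2_max_ideal_sq[OF zX S(1)[OF j(1) zX j(2)] this] show ?thesis .
    qed
    then show "s \<in> singular_sections n X M P"
      unfolding singular_sections_def singular_at_def using sV by blast
  qed
  moreover from codim_vanishes_finite[OF subspace_sections[OF M openin_X] P Vl, where N = "\<lambda>_. 2"]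
  have "codim_le ?V ?V' (2 * card P)" by (simp add: mult.commute)
  ultimately show ?thesis unfolding codim_le_def by (meson Un_mono cfun.span_mono order_refl order_trans)
qed

end

context tangent_field
begin

text \<open>A singular section satisfies \<open>2 * k\<close> linear equations, for values and
  derivatives. At a greedily chosen tuple they cut down the dimension as far as possible, and
  semicontinuity extends this upper bound to an open set; the lower bound counts conditions.\<close>

lemma general_singular_sections:
  assumes M: "is_line_bundle n X M"
  shows "for_general_points n X k (\<lambda>p.
    int (cfun.dim (singular_sections n X M (p ` {..<k}))) = max 0 (int (h0 n X M) - 2 * int k))"
proof -
  note D = line_bundleD[OF M]
  let ?V = "sections n X M X"
  obtain B0 where B0: "finite B0" "?V \<subseteq> cfun.span B0" using fin_dim_sections[OF M] unfolding fin_dim_def by blast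
  obtain B where B: "B \<subseteq> ?V" "cfun.independent B" "?V \<subseteq> cfun.span B" "card B = cfun.dim ?V"
    using cfun.basis_exists by blast
  have "B \<subseteq> cfun.span B0" using B(1) B0(2) by blast
  from cfun.independent_span_bound[OF B0(1) B(2) this] have finB: "finite B" ..
  define h where "h = card B"
  obtain s where s: "bij_betw s {..<h} B" using ex_bij_betw_nat_finite[OF finB] by (auto simp: h_def atLeast0LessThan)
  have sV: "s a \<in> ?V" if "a < h" for a using bij_betwE[OF s] that B(1) by blast
  have reindex: "(\<Sum>b\<in>B. g b) = (\<Sum>a<h. g (s a))" for g :: "_ \<Rightarrow> _ \<Rightarrow> complex"
    using sum.reindex_bij_betw[OF s, of g] by simp
  obtain x0 where x0: "x0 \<in> X" using X_nonempty by blast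
  obtain i0 where i0: "i0 \<in> index M" "x0 \<in> chart M i0" using D(2)[OF x0] by blast
  have sl: "(\<lambda>x. s a (i0, x)) \<in> loc x0" if "a \<in> {..<h}" for a
    using sectionsD(1)[OF M openin_X sV i0(1) x0 i0(2)] that by blast
  \<comment> \<open>A common denominator replaces the basis by forms of one degree near
    \<open>x0\<close>, so relations between forms on the curve are relations between
    sections.\<close>
  from common_denominator[where I = "{..<h}" and f = "\<lambda>a x. s a (i0, x)", OF x0 finite_lessThan sl] obtain d G F where
    G: "hom_poly n d G" "G (rep x0) \<noteq> 0" and
    FG: "\<forall>a\<in>{..<h}. hom_poly n d (F a) \<and> eventually (\<lambda>q. s a (i0, q) = F a (rep q) / G (rep q)) (near x0)" by blast
  have F: "hom_poly n d (F a)" if "a < h" for a using FG that by blast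
  have "eventually (\<lambda>q. \<forall>a\<in>{..<h}. s a (i0, q) = F a (rep q) / G (rep q)) (near x0)"
    using FG by (subst eventually_ball_finite_distrib) auto
  with eventually_near_open[OF D(1)[OF i0(1)] i0(2)] eventually_near_basic[OF G(1) x0 G(2)]
  have "eventually (\<lambda>q. (\<forall>a<h. s a (i0, q) = F a (rep q) / G (rep q)) \<and> q \<in> chart M i0 \<and> G (rep q) \<noteq> 0) (near x0)"
    by eventually_elim auto
  then obtain U where U: "openin zar U" "x0 \<in> U"
    "\<forall>q\<in>U. (\<forall>a<h. s a (i0, q) = F a (rep q) / G (rep q)) \<and> q \<in> chart M i0 \<and> G (rep q) \<noteq> 0"
    using eventually_near[OF x0] by blast
  from openin_zar_obtain_basic[OF U(1,2)] obtain dH H where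
    H: "hom_poly n dH H" "H (rep x0) \<noteq> 0" and HU: "\<And>q. q \<in> X \<Longrightarrow> H (rep q) \<noteq> 0 \<Longrightarrow> q \<in> U" by blast
  have sF: "(\<Sum>a<h. cscale (c a) (s a)) (i0, q) = (\<Sum>a<h. c a * F a (rep q)) / G (rep q)" if "q \<in> U" for c q
    using U(3) that by (simp add: cscale_sum_apply sum_divide_distrib)
  have comb: "(\<Sum>a<h. cscale (c a) (s a)) \<in> ?V" for c
    using sV subspace_sections[OF M openin_X] by (intro cfun.subspace_sum cfun.subspace_scale) auto
  have ind: "c = 0" if c: "\<forall>a. a \<notin> {..<h} \<longrightarrow> c a = 0" "\<forall>q\<in>X. (\<Sum>a<h. c a * F a (rep q)) = 0" for c
  proof -
    have "eventually (\<lambda>q. (\<Sum>a<h. cscale (c a) (s a)) (i0, q) = 0) gen"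
    proof -
      have "U \<noteq> {}" using U(2) by blast
      from gen_open[OF U(1) this] gen_in_X show ?thesis
      proof eventually_elim
        case (elim q)
        show ?case unfolding sF[OF elim(1)] using c(2) elim(2) by simp
      qed
    qed
    from section_eq_0[OF M openin_X comb i0(1) _ this] i0(2) have 0: "(\<Sum>a<h. cscale (c a) (s a)) = 0" by blast
    let ?u = "\<lambda>b. c (inv_into {..<h} s b)"
    have inv: "inv_into {..<h} s (s a) = a" if "a < h" for a
      using s that by (simp add: bij_betw_def inv_into_f_f)
    have "(\<Sum>b\<in>B. cscale (?u b) b) = (\<Sum>a<h. cscale (c a) (s a))"
      unfolding reindex by (rule sum.cong) (auto simp: inv)
    then have "?u b = 0" if "b \<in> B" for b
      using cfun.independentD[OF B(2) finB order_refl _ that] 0 by simp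
    then have "c a = 0" if "a < h" for a using inv[OF that] bij_betwE[OF s] that by (metis lessThan_iff)
    with c(1) show ?thesis by (auto simp: fun_eq_iff)
  qed
  have "\<exists>p. (\<forall>j<k. p j \<in> X \<and> H (rep (p j)) \<noteq> 0) \<and>
    codim_le {c. (\<forall>a. a \<notin> {..<h} \<longrightarrow> c a = 0) \<and>
      (\<forall>j<k. (\<Sum>a<h. c a * F a (rep (p j))) = 0 \<and> (\<Sum>a<h. c a * Dr (F a) (rep (p j))) = 0)} {0} (h - 2 * k)"
    by (rule choose_points[where F = F and h = h and d = d, OF _ _ H(1) x0 H(2)]) (use F ind in blast)+
  then obtain p0 where
    p0: "\<forall>j<k. p0 j \<in> X \<and> H (rep (p0 j)) \<noteq> 0" and
    cod: "codim_le {c. (\<forall>a. a \<notin> {..<h} \<longrightarrow> c a = 0) \<and>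
      (\<forall>j<k. (\<Sum>a<h. c a * F a (rep (p0 j))) = 0 \<and> (\<Sum>a<h. c a * Dr (F a) (rep (p0 j))) = 0)} {0} (h - 2 * k)" by blast
  \<comment> \<open>Rows \<open>2 * j\<close> and \<open>2 * j + 1\<close> are the value and the
    derivative at the \<open>j\<close>-th point.\<close>
  define R where "R r a v = (if even r then F a (v (r div 2)) else Dr (F a) (v (r div 2)))" for r a and v :: "nat \<Rightarrow> cvec"
  define v0 where "v0 = (\<lambda>j. rep (p0 j))"
  have lker: "lker (2 * k) {..<h} R v = {c. (\<forall>a. a \<notin> {..<h} \<longrightarrow> c a = 0) \<and>
      (\<forall>j<k. (\<Sum>a<h. c a * F a (v j)) = 0 \<and> (\<Sum>a<h. c a * Dr (F a) (v j)) = 0)}" for v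
  proof -
    have "(\<forall>r<2 * k. (\<Sum>a<h. c a * R r a v) = 0) \<longleftrightarrow>
        (\<forall>j<k. (\<Sum>a<h. c a * F a (v j)) = 0 \<and> (\<Sum>a<h. c a * Dr (F a) (v j)) = 0)" (is "?A \<longleftrightarrow> ?B") for c
    proof
      assume A: ?A
      show ?B
      proof (intro allI impI conjI)
        fix j assume j: "j < k"
        show "(\<Sum>a<h. c a * F a (v j)) = 0" using A[rule_format, of "2 * j"] j by (simp add: R_def)
        show "(\<Sum>a<h. c a * Dr (F a) (v j)) = 0" using A[rule_format, of "2 * j + 1"] j by (simp add: R_def)
      qed
    next
      assume B: ?B
      show ?A
      proof (intro allI impI)
        fix r assume "r < 2 * k"
        then show "(\<Sum>a<h. c a * R r a v) = 0" using B[rule_format, of "r div 2"] by (cases "even r") (simp_all add: R_def)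
      qed
    qed
    then show ?thesis by (simp add: lker_def)
  qed
  define \<delta> where "\<delta> r = (\<lambda>l. if l = r div 2 then (if even r then d else d - 1 + e) else 0)" for r :: nat
  have mh: "multihom_poly k n (\<delta> r) (R r a)" if "r < 2 * k" "a \<in> {..<h}" for r a
  proof -
    have "r div 2 < k" "a < h" using that by auto
    then show ?thesis
      using hom_poly_imp_multihom_poly[OF F] hom_poly_imp_multihom_poly[OF hom_poly_Dr[OF F]]
      by (cases "even r") (simp_all add: \<delta>_def R_def[abs_def])
  qed
  have "codim_le (lker (2 * k) {..<h} R v0) {0} (h - 2 * k)" using cod unfolding lker v0_def .
  from kernel_semicontinuous[where C = "{..<h}" and R = R and m = "2 * k" and \<delta> = \<delta>, OF finite_lessThan mh this] obtain \<Phi> d\<Phi> where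
    \<Phi>: "multihom_poly k n d\<Phi> \<Phi>" "\<Phi> v0 \<noteq> 0" "\<forall>v. \<Phi> v \<noteq> 0 \<longrightarrow> codim_le (lker (2 * k) {..<h} R v) {0} (h - 2 * k)" by blast
  obtain d\<Pi> where \<Pi>: "multihom_poly k n d\<Pi> (\<lambda>v. \<Prod>j<k. H (v j))"
    using multihom_poly_prod[OF H(1) finite_lessThan order_refl] by blast
  \<comment> \<open>The factor \<open>\<Phi>\<close> preserves the bound on the kernel; the product
    keeps all points in \<open>U\<close>, where the fractions represent the sections.\<close>
  define \<Psi> where "\<Psi> = (\<lambda>v. \<Phi> v * (\<Prod>j<k. H (v j)))"
  have \<Psi>: "multihom_poly k n (\<lambda>l. d\<Phi> l + d\<Pi> l) \<Psi>" unfolding \<Psi>_def by (rule multihom_poly.mult[OF \<Phi>(1) \<Pi>])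
  define T where "T = {p \<in> {..<k} \<rightarrow>\<^sub>E proj_space n. \<exists>F\<in>{\<Psi>}. \<exists>v. (\<forall>j<k. v j \<in> p j) \<and> F v \<noteq> 0}"
  have "zariski_power_open k n T"
    unfolding zariski_power_open_def T_def using \<Psi> by (intro exI[of _ "{\<Psi>}"]) auto
  then have oT: "openin (zariski_power k n) T" by (simp add: openin_zariski_power)
  define W where "W = T \<inter> ({..<k} \<rightarrow>\<^sub>E X)"
  have "openin (subtopology (zariski_power k n) ({..<k} \<rightarrow>\<^sub>E X)) W"
    unfolding W_def openin_subtopology using oT by blast
  moreover have "W \<noteq> {}"
  proof -
    define p where "p = restrict p0 {..<k}"
    have pX: "p \<in> {..<k} \<rightarrow>\<^sub>E X" using p0 by (auto simp: p_def)
    have pP: "p \<in> {..<k} \<rightarrow>\<^sub>E proj_space n" using p0 X_proj by (auto simp: p_def)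
    have "\<Psi> v0 \<noteq> 0" using \<Phi>(2) p0 by (simp add: \<Psi>_def v0_def)
    moreover have "v0 j \<in> p j" if "j < k" for j
      using rep(1)[OF X_proj, of "p0 j"] p0 that by (simp add: p_def v0_def)
    ultimately have "p \<in> T" unfolding T_def using pP by blast
    with pX show ?thesis unfolding W_def by blast
  qed
  moreover have "int (cfun.dim (singular_sections n X M (p ` {..<k}))) = max 0 (int (h0 n X M) - 2 * int k)"
    if p: "p \<in> W" for p
  proof -
    have pX: "p j \<in> X" if "j < k" for j using p that by (auto simp: W_def)
    define v where "v = (\<lambda>j. rep (p j))"
    have "\<Psi> v \<noteq> 0"
    proof -
      obtain v' where v': "\<forall>j<k. v' j \<in> p j" "\<Psi> v' \<noteq> 0" using p by (auto simp: W_def T_def)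
      have "v' j \<in> line (v j)" if "j < k" for j
        using v'(1) that rep(3)[OF X_proj[OF pX[OF that]]] by (simp add: v_def)
      from multihom_poly_line_nz[OF \<Psi> this v'(2)] show ?thesis .
    qed
    then have \<Phi>v: "\<Phi> v \<noteq> 0" and Hv: "\<And>j. j < k \<Longrightarrow> H (rep (p j)) \<noteq> 0" by (auto simp: \<Psi>_def v_def)
    let ?P = "p ` {..<k}"
    let ?S = "singular_sections n X M ?P"
    let ?f = "\<lambda>c. \<Sum>a<h. cscale (c a) (s a)"
    have upper: "?S \<subseteq> ?f ` lker (2 * k) {..<h} R v"
    proof
      fix t assume t: "t \<in> ?S"
      then have "t \<in> cfun.span B" using B(3) by (auto simp: singular_sections_def)
      then obtain u where u: "t = (\<Sum>b\<in>B. cscale (u b) b)" using cfun.span_finite[OF finB] by auto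
      define c where "c a = (if a < h then u (s a) else 0)" for a
      have tc: "t = ?f c" unfolding u reindex by (rule sum.cong) (auto simp: c_def)
      have "(\<Sum>a<h. c a * F a (v j)) = 0 \<and> (\<Sum>a<h. c a * Dr (F a) (v j)) = 0" if j: "j < k" for j
      proof -
        let ?q = "p j"
        note qX = pX[OF j]
        have qU: "?q \<in> U" using HU[OF qX Hv[OF j]] .
        have "singular_at n X M t ?q" using t j by (auto simp: singular_sections_def)
        then have ms: "(\<lambda>x. t (i0, x)) \<in> max_ideal_sq n X ?q" using i0(1) U(3) qU by (auto simp: singular_at_def)
        have hF: "hom_poly n d (\<lambda>v. \<Sum>a<h. c a * F a v)" using F by (intro hom_poly_sum hom_poly_cmult) auto
        have G0: "G (rep ?q) \<noteq> 0" using U(3) qU by blast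
        have ev: "eventually (\<lambda>x. t (i0, x) = (\<Sum>a<h. c a * F a (rep x)) / G (rep x)) (near ?q)"
          using eventually_near_open[OF U(1) qU] unfolding tc by (rule eventually_mono) (rule sF)
        from Dr_max_ideal_sq[OF qX ms hF G(1) G0 ev] show ?thesis
          using Dr_sum[of "{..<h}" d F c] F by (simp add: v_def)
      qed
      then have "c \<in> lker (2 * k) {..<h} R v" unfolding lker by (simp add: c_def)
      then show "t \<in> ?f ` lker (2 * k) {..<h} R v" using tc by blast
    qed
    have "?f (c + c') = ?f c + ?f c'" "?f (cscale x c) = cscale x (?f c)" for c c' x
    proof -
      have cs: "cscale x g y = x * g y" for g and y :: 'b by (simp add: cscale_def)
      have "?f (c + c') y = (?f c + ?f c') y" for y
        by (simp add: cscale_sum_apply distrib_right sum.distrib)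
      then show "?f (c + c') = ?f c + ?f c'" by (rule ext)
      have "?f (cscale x c) y = cscale x (?f c) y" for y
        unfolding cs cscale_sum_apply by (simp add: cscale_def sum_distrib_left mult.assoc)
      then show "?f (cscale x c) = cscale x (?f c)" by (rule ext)
    qed
    from codim_le_linear_image[of ?f, OF this \<Phi>(3)[rule_format, OF \<Phi>v] upper]
    obtain C where C: "finite C" "card C \<le> h - 2 * k" "?S \<subseteq> cfun.span ({0} \<union> C)" unfolding codim_le_def by blast
    have le: "cfun.dim ?S \<le> h - 2 * k"
      using cfun.dim_le_card[of ?S C] C cfun.span_insert_0[of C] by simp
    have PX: "finite ?P" "?P \<subseteq> X" using pX by auto
    \<comment> \<open>The points may coincide, and the set then imposes fewer conditions.\<close>
    have "2 * card ?P \<le> 2 * k" using card_image_le[of "{..<k}" p] by simp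
    from codim_le_mono[OF codim_singular_sections[OF M PX] order_refl this]
    obtain E where E: "finite E" "card E \<le> 2 * k" "?V \<subseteq> cfun.span (?S \<union> E)" unfolding codim_le_def by blast
    obtain B1 where B1: "B1 \<subseteq> ?S" "cfun.independent B1" "?S \<subseteq> cfun.span B1" "card B1 = cfun.dim ?S"
      using cfun.basis_exists by blast
    have "B1 \<subseteq> cfun.span B0" using B1(1) B0(2) by (auto simp: singular_sections_def)
    from cfun.independent_span_bound[OF B0(1) B1(2) this] have finB1: "finite B1" ..
    have "?S \<union> E \<subseteq> cfun.span (B1 \<union> E)"
      using B1(3) cfun.span_mono[of B1 "B1 \<union> E"] cfun.span_superset[of "B1 \<union> E"] by blast
    from cfun.span_minimal[OF this cfun.subspace_span] E(3) B(1) have sub: "B \<subseteq> cfun.span (B1 \<union> E)" by blast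
    have "finite (B1 \<union> E)" using finB1 E(1) by simp
    from cfun.independent_span_bound[OF this B(2) sub] have "card B \<le> card (B1 \<union> E)" ..
    also have "\<dots> \<le> cfun.dim ?S + 2 * k" using card_Un_le[of B1 E] B1(4) E(2) by linarith
    finally have "h \<le> cfun.dim ?S + 2 * k" by (simp add: h_def)
    \<comment> \<open>The truncated difference \<open>h - 2 * k\<close> is the maximum with 0 in the
      claim.\<close>
    with le have "cfun.dim ?S = h - 2 * k" by linarith
    moreover have "h0 n X M = h" using B(4) by (simp add: h0_def h_def)
    ultimately show ?thesis by simp
  qed
  ultimately show ?thesis unfolding for_general_points_def by blast
qed

end

theorem proposition1p5:
  fixes n :: nat and X :: "ppoint set" and L :: "'i line_bundle"
  assumes "smooth_projective_curve n X"
    and "is_line_bundle n X L"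
    and "ample n X L"
  shows "\<exists>d0::int. \<forall>d\<ge>d0. \<forall>k::nat. k > 0 \<longrightarrow>
           for_general_points n X k (\<lambda>p.
             singular_system_dim n X (tensor_power L d) (p ` {..<k}) =
               max 0 (curve_euler_char n X (tensor_power L d) - 2 * int k) - 1)"
proof -
  interpret curve n X by unfold_locales (rule assms(1))
  obtain a0 e V where "tangent_field n X a0 e V" using tangent_field_exists by blast
  then interpret tangent_field n X a0 e V .
  \<comment> \<open>The bound comes from the vanishing of \<open>h1\<close> alone and so is
    independent of \<open>k\<close>.\<close>
  obtain d0 :: int where d0: "\<forall>d\<ge>d0. h1 n X (tensor_power L d) = 0"
    using h1_eventually_zero[OF assms(2,3)] by blast
  show ?thesis
  proof (intro exI[of _ d0] allI impI)
    fix d and k :: nat assume "d0 \<le> d"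
    then have "curve_euler_char n X (tensor_power L d) = int (h0 n X (tensor_power L d))"
      using d0 by (simp add: curve_euler_char_def)
    then show "for_general_points n X k (\<lambda>p.
        singular_system_dim n X (tensor_power L d) (p ` {..<k}) =
          max 0 (curve_euler_char n X (tensor_power L d) - 2 * int k) - 1)"
      using general_singular_sections[OF is_line_bundle_tensor_power[OF assms(2), of d], of k]
      by (simp add: singular_system_dim_def)
  qed
qed

end
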